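(* Assume the standing assumptions (A) with $F=0$. Let $(V_m)_{m\in\mathbb{N}}$ be finite-dimensional subspaces of $H^1_0(\Omega)$ such that $\lim_{m\to\infty}\inf_{v\in V_m}\|\varphi-v\|_{H^1_0(\Omega)}=0$ for all $\varphi\in H^1_0(\Omega)$. Then for each $m$ there exists $w_m\in V_m$ solving \[ \int_\Omega\rho(w_m)v+\int_\Omega\Lambda\nabla\mu(w_m)\cdot\nabla v=\int_\Omega fv\quad\forall v\in V_m, \] and, for any such choice of $(w_m)_m$, with $\bar w$ the solution of (W') below, as $m\to\infty$: $\mu(w_m)\to\mu(\bar w)$ weakly in $H^1_0(\Omega)$ and strongly in $L^2(\Omega)$; $\nu(w_m)\to\nu(\bar w)$ weakly in $H^1_0(\Omega)$ and strongly in $L^2(\Omega)$; $\rho(w_m)\to\rho(\bar w)$ weakly in $L^2(\Omega)$. If moreover the energy equality \[ \int_\Omega\rho(\bar w)\bar w+\int_\Omega\Lambda\nabla\nu(\bar w)\cdot\nabla\nu(\bar w)=\int_\Omega f\bar w \] holds, then $\nabla\nu(w_m)\to\nabla\nu(\bar w)$ strongly in $L^2(\Omega)^d$ and $w_m\to\bar w$ strongly in $L^2(\Omega)$.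
   Context: Standing assumptions (A): $\Omega$ is an open bounded connected subset of $\mathbb{R}^d$; $\zeta:\mathbb{R}\to\mathbb{R}$ is continuous, non-decreasing, $\zeta(0)=0$ and there are $M_0,M_1>0$ with $|\zeta(s)|\ge M_0|s|-M_1$ for all $s$; $\beta:\mathbb{R}\to\mathbb{R}$ is continuous, non-decreasing, $\beta(0)=0$ and there are $K_0,K_1>0$ with $|\beta(s)|\le K_0|s|+K_1$ for all $s$; $\beta+\zeta$ is strictly increasing; $\Lambda:\Omega\to M_d(\mathbb{R})$ is measurable and there are $\overline\lambda\ge\underline\lambda>0$ such that for a.e. $x$, $\Lambda(x)$ is symmetric with eigenvalues in $[\underline\lambda,\overline\lambda]$; $f\in L^2(\Omega)$, $F\in L^2(\Omega)^d$. Under (A), $\beta+\zeta:\mathbb{R}\to\mathbb{R}$ is a bijection; define $\mu(t)=\zeta((\beta+\zeta)^{-1}(t))$ and $\rho(t)=t-\mu(t)=\beta((\beta+\zeta)^{-1}(t))$ (both non-decreasing and 1-Lipschitz), and $\nu(s)=\int_0^s\sqrt{\mu'(r)}\,dr$. Problem (W'): find $\bar w\in L^2(\Omega)$ with $\mu(\bar w)\in H^1_0(\Omega)$ and $\int_\Omega\rho(\bar w)\bar v+\int_\Omega\Lambda\nabla\mu(\bar w)\cdot\nabla\bar v=\int_\Omega f\bar v$ for all $\bar v\in H^1_0(\Omega)$; it is equivalent to the weak problem $\int_\Omega\beta(\bar u)\bar v+\int_\Omega\Lambda\nabla\zeta(\bar u)\cdot\nabla\bar v=\int_\Omega f\bar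 v$ via $\bar w=(\beta+\zeta)(\bar u)$, and has a unique solution. *)

theory Defs
  imports "HOL-Analysis.Analysis"
begin

text \<open>Functions on a domain Omega of real^'n are represented by total functions
  real^'n => real; only their values on Omega matter (integrals are taken
  w.r.t. Lebesgue measure restricted to Omega).\<close>

definition L2 :: "(real^'n::finite) set \<Rightarrow> (real^'n \<Rightarrow> real) \<Rightarrow> bool" where
  "L2 \<Omega> u \<longleftrightarrow> u \<in> borel_measurable (lebesgue_on \<Omega>) \<and>
      integrable (lebesgue_on \<Omega>) (\<lambda>x. (u x)\<^sup>2)"

definition L2vec :: "(real^'n::finite) set \<Rightarrow> (real^'n \<Rightarrow> real^'n) \<Rightarrow> bool" where
  "L2vec \<Omega> g \<longleftrightarrow> (\<forall>i. L2 \<Omega> (\<lambda>x. g x $ i))"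

definition partial :: "'n::finite \<Rightarrow> (real^'n \<Rightarrow> real) \<Rightarrow> (real^'n \<Rightarrow> real)" where
  "partial i \<phi> = (\<lambda>x. frechet_derivative \<phi> (at x) (axis i 1))"

definition cgrad :: "(real^'n::finite \<Rightarrow> real) \<Rightarrow> (real^'n \<Rightarrow> real^'n)" where
  "cgrad \<phi> = (\<lambda>x. \<chi> i. partial i \<phi> x)"

definition smooth :: "(real^'n::finite \<Rightarrow> real) \<Rightarrow> bool" where
  "smooth \<phi> \<longleftrightarrow> (\<forall>is. (\<forall>x. foldr partial is \<phi> differentiable (at x)))"

definition test_fun :: "(real^'n::finite) set \<Rightarrow> (real^'n \<Rightarrow> real) \<Rightarrow> bool" where
  "test_fun \<Omega> \<phi> \<longleftrightarrow> smooth \<phi> \<and>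
     (\<exists>K. compact K \<and> K \<subseteq> \<Omega> \<and> (\<forall>x. x \<notin> K \<longrightarrow> \<phi> x = 0))"

definition weak_grad :: "(real^'n::finite) set \<Rightarrow> (real^'n \<Rightarrow> real) \<Rightarrow> (real^'n \<Rightarrow> real^'n) \<Rightarrow> bool" where
  "weak_grad \<Omega> u g \<longleftrightarrow> L2 \<Omega> u \<and> L2vec \<Omega> g \<and>
     (\<forall>\<phi> i. test_fun \<Omega> \<phi> \<longrightarrow>
        (LINT x|lebesgue_on \<Omega>. u x * partial i \<phi> x) = - (LINT x|lebesgue_on \<Omega>. g x $ i * \<phi> x))"

definition H1grad :: "(real^'n::finite) set \<Rightarrow> (real^'n \<Rightarrow> real) \<Rightarrow> (real^'n \<Rightarrow> real^'n)" where
  "H1grad \<Omega> u = (SOME g. weak_grad \<Omega> u g)"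

definition H1_inner :: "(real^'n::finite) set \<Rightarrow> (real^'n \<Rightarrow> real) \<Rightarrow> (real^'n \<Rightarrow> real) \<Rightarrow> real" where
  "H1_inner \<Omega> u v = (LINT x|lebesgue_on \<Omega>. u x * v x)
      + (LINT x|lebesgue_on \<Omega>. H1grad \<Omega> u x \<bullet> H1grad \<Omega> v x)"

definition H1_norm :: "(real^'n::finite) set \<Rightarrow> (real^'n \<Rightarrow> real) \<Rightarrow> real" where
  "H1_norm \<Omega> u = sqrt (H1_inner \<Omega> u u)"

definition H10 :: "(real^'n::finite) set \<Rightarrow> (real^'n \<Rightarrow> real) set" where
  "H10 \<Omega> = {u. \<exists>g. weak_grad \<Omega> u g \<and>
      (\<exists>\<phi>s. (\<forall>k. test_fun \<Omega> (\<phi>s k)) \<and>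
        ((\<lambda>k. (LINT x|lebesgue_on \<Omega>. (\<phi>s k x - u x)\<^sup>2)
            + (LINT x|lebesgue_on \<Omega>. (norm (cgrad (\<phi>s k) x - g x))\<^sup>2)) \<longlonglongrightarrow> 0))}"

definition fin_dim_subspace_H10 :: "(real^'n::finite) set \<Rightarrow> (real^'n \<Rightarrow> real) set \<Rightarrow> bool" where
  "fin_dim_subspace_H10 \<Omega> V \<longleftrightarrow> (\<exists>B. finite B \<and> B \<subseteq> H10 \<Omega> \<and>
      V = {(\<lambda>x. \<Sum>b\<in>B. c b * b x) | c. True})"

definition weak_conv_H10 :: "(real^'n::finite) set \<Rightarrow> (nat \<Rightarrow> real^'n \<Rightarrow> real) \<Rightarrow> (real^'n \<Rightarrow> real) \<Rightarrow> bool" where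
  "weak_conv_H10 \<Omega> us u \<longleftrightarrow> (\<forall>m. us m \<in> H10 \<Omega>) \<and> u \<in> H10 \<Omega> \<and>
     (\<forall>\<phi>\<in>H10 \<Omega>. (\<lambda>m. H1_inner \<Omega> (us m) \<phi>) \<longlonglongrightarrow> H1_inner \<Omega> u \<phi>)"

definition weak_conv_L2 :: "(real^'n::finite) set \<Rightarrow> (nat \<Rightarrow> real^'n \<Rightarrow> real) \<Rightarrow> (real^'n \<Rightarrow> real) \<Rightarrow> bool" where
  "weak_conv_L2 \<Omega> us u \<longleftrightarrow> (\<forall>m. L2 \<Omega> (us m)) \<and> L2 \<Omega> u \<and>
     (\<forall>\<phi>. L2 \<Omega> \<phi> \<longrightarrow> (\<lambda>m. LINT x|lebesgue_on \<Omega>. us m x * \<phi> x) \<longlonglongrightarrow> (LINT x|lebesgue_on \<Omega>. u x * \<phi> x))"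

definition strong_conv_L2 :: "(real^'n::finite) set \<Rightarrow> (nat \<Rightarrow> real^'n \<Rightarrow> real) \<Rightarrow> (real^'n \<Rightarrow> real) \<Rightarrow> bool" where
  "strong_conv_L2 \<Omega> us u \<longleftrightarrow> (\<forall>m. L2 \<Omega> (us m)) \<and> L2 \<Omega> u \<and>
     (\<lambda>m. LINT x|lebesgue_on \<Omega>. (us m x - u x)\<^sup>2) \<longlonglongrightarrow> 0"

definition strong_conv_L2vec :: "(real^'n::finite) set \<Rightarrow> (nat \<Rightarrow> real^'n \<Rightarrow> real^'n) \<Rightarrow> (real^'n \<Rightarrow> real^'n) \<Rightarrow> bool" where
  "strong_conv_L2vec \<Omega> gs g \<longleftrightarrow> (\<forall>m. L2vec \<Omega> (gs m)) \<and> L2vec \<Omega> g \<and>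
     (\<lambda>m. LINT x|lebesgue_on \<Omega>. (norm (gs m x - g x))\<^sup>2) \<longlonglongrightarrow> 0"

definition mu_of :: "(real \<Rightarrow> real) \<Rightarrow> (real \<Rightarrow> real) \<Rightarrow> real \<Rightarrow> real" where
  "mu_of \<beta> \<zeta> t = \<zeta> (inv (\<lambda>s. \<beta> s + \<zeta> s) t)"

definition rho_of :: "(real \<Rightarrow> real) \<Rightarrow> (real \<Rightarrow> real) \<Rightarrow> real \<Rightarrow> real" where
  "rho_of \<beta> \<zeta> t = t - mu_of \<beta> \<zeta> t"

definition nu_of :: "(real \<Rightarrow> real) \<Rightarrow> (real \<Rightarrow> real) \<Rightarrow> real \<Rightarrow> real" where
  "nu_of \<beta> \<zeta> s = interval_lebesgue_integral lborel (ereal 0) (ereal s)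
       (\<lambda>r. sqrt (deriv (mu_of \<beta> \<zeta>) r))"

definition eigenvalues_in :: "real^'n^'n \<Rightarrow> real \<Rightarrow> real \<Rightarrow> bool" where
  "eigenvalues_in A a b \<longleftrightarrow> (\<forall>c \<xi>. \<xi> \<noteq> 0 \<longrightarrow> A *v \<xi> = c *\<^sub>R \<xi> \<longrightarrow> a \<le> c \<and> c \<le> b)"

end

theory Submission
  imports Defs "HOL-Library.Diagonal_Subsequence"
begin


text \<open>Put \<open>M w = \<mu>(w)\<close> and \<open>N w = \<nu>(w)\<close>. Since \<open>\<mu>\<close> is monotone and 1-Lipschitz, \<open>M\<close> is firmly nonexpansive on \<open>L\<^sup>2\<close>, and by
  Cauchy-Schwarz \<open>|\<nu>(a) - \<nu>(b)|\<^sup>2 \<le> (a - b)(\<mu>(a) - \<mu>(b))\<close>. The chain rule turns \<open>\<Lambda>\<nabla>\<mu>(w)\<cdot>\<nabla>w\<close> into \<open>\<Lambda>\<nabla>\<nu>(w)\<cdot>\<nabla>\<nu>(w)\<close>, so testing the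
  discrete equation with \<open>w\<^sub>m\<close> bounds \<open>\<nu>(w\<^sub>m)\<close> in \<open>H\<^sup>1\<^sub>0\<close>, hence \<open>w\<^sub>m\<close> in \<open>L\<^sup>2\<close>; this also gives existence, by a zero of a
  continuous vector field. Along a subsequence \<open>w\<^sub>m\<close> converges weakly to some \<open>w\<close> and, by Rellich, \<open>\<mu>(w\<^sub>m)\<close> converges strongly.
  Then \<open>(w\<^sub>m - w, \<mu>(w\<^sub>m) - \<mu>(w))\<close> tends to zero, which by the two inequalities forces \<open>\<mu>(w\<^sub>m)\<close> and \<open>\<nu>(w\<^sub>m)\<close> to converge strongly
  to \<open>\<mu>(w)\<close> and \<open>\<nu>(w)\<close>. So \<open>w\<close> solves the limit problem, whose solution is unique, and the whole sequence converges. The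
  energy equality says that the discrete energies converge to the limit energy, which upgrades the remaining weak
  convergences to strong ones.\<close>

subsection \<open>Weak convergence in Hilbert spaces\<close>

text \<open>Two obstacles shape the proof. Since \<open>V m\<close> is not stable under composition,
  \<mu>(w) is not admissible as a test function in the discrete problem; \<open>w\<close> itself is,
  and as the slope of \<mu> may vanish this bounds the gradient of \<nu>(w) but not that of
  \<open>w\<close>. The bound on \<open>w\<close> then rests on growth: \<zeta> grows at least and
  \<beta> at most linearly, so the modulus of \<open>t\<close> is at most affine in that of
  \<mu>(t), which in turn is at most that of \<nu>(t). The other obstacle is that \<mu> is merely
  Lipschitz while \<nu> is made from its pointwise derivative. The chain rule therefore rests on
  Lebesgue's theorem for monotone functions and on the fact that a Sobolev function has zero
  gradient where its values fall in a null set; otherwise the exceptional arguments of \<mu> could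
  be hit on a set of positive measure. To separate functional analysis from measure theory, the
  Galerkin argument is run for a closed linear graph in a product of two Hilbert spaces. The
  concrete spaces consist of classes on the whole space, where translations act and functions on
  \<Omega> enter by zero extension.\<close>

lemma subspace_closure:
  fixes S :: "'a::real_normed_vector set"
  assumes "subspace S" shows "subspace (closure S)"
  unfolding subspace_def
proof (intro conjI ballI allI)
  show "0 \<in> closure S" using assms closure_subset subspace_0 by blast
  fix x y assume "x \<in> closure S" "y \<in> closure S"
  then obtain a b where "\<forall>n. a n \<in> S" "a \<longlonglongrightarrow> x" "\<forall>n. b n \<in> S" "b \<longlonglongrightarrow> y"
    unfolding closure_sequential by blast
  then show "x + y \<in> closure S"
    unfolding closure_sequential using assms
    by (intro exI[of _ "\<lambda>n. a n + b n"]) (auto intro: tendsto_add subspace_add)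
next
  fix c and x assume "x \<in> closure S"
  then obtain a where "\<forall>n. a n \<in> S" "a \<longlonglongrightarrow> x" unfolding closure_sequential by blast
  then show "c *\<^sub>R x \<in> closure S"
    unfolding closure_sequential using assms
    by (intro exI[of _ "\<lambda>n. c *\<^sub>R a n"]) (auto intro: tendsto_scaleR subspace_scale)
qed

definition wconv :: "(nat \<Rightarrow> 'a::real_inner) \<Rightarrow> 'a \<Rightarrow> bool" where
  "wconv x y \<longleftrightarrow> (\<forall>z. (\<lambda>n. x n \<bullet> z) \<longlonglongrightarrow> y \<bullet> z)"

lemma wconvD: "wconv x y \<Longrightarrow> (\<lambda>n. x n \<bullet> z) \<longlonglongrightarrow> y \<bullet> z"
  by (simp add: wconv_def)

lemma wconv_if_tendsto: "u \<longlonglongrightarrow> v \<Longrightarrow> wconv u v"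
  unfolding wconv_def by (auto intro: tendsto_inner)

lemma wconv_subseq: "wconv x y \<Longrightarrow> strict_mono r \<Longrightarrow> wconv (x \<circ> r) y"
  unfolding wconv_def comp_def
  by (intro allI) (rule LIMSEQ_subseq_LIMSEQ[of "\<lambda>n. x n \<bullet> z" for z, unfolded comp_def], auto)

lemma wconv_unique:
  assumes "wconv x y" "wconv x y'" shows "y = y'"
proof -
  have "y \<bullet> z = y' \<bullet> z" for z
    using assms LIMSEQ_unique unfolding wconv_def by blast
  then have "(y - y') \<bullet> (y - y') = 0" by (simp add: inner_diff_left)
  then show ?thesis by simp
qed

text \<open>Split \<open>z n\<close> into \<open>z n - w\<close> and \<open>w\<close>: the bound on
  \<open>x\<close> kills the first pairing, weak convergence handles the second. Products of a weak
  and a strong limit are the only nonlinear limits taken later.\<close>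

lemma tendsto_inner_wconv:
  assumes "wconv x y" "z \<longlonglongrightarrow> w" "\<And>n. norm (x n) \<le> B"
  shows "(\<lambda>n. x n \<bullet> z n) \<longlonglongrightarrow> y \<bullet> w"
proof -
  have 1: "(\<lambda>n. norm (z n - w)) \<longlonglongrightarrow> 0" using assms(2) by (simp add: LIM_zero tendsto_norm_zero)
  have 2: "(\<lambda>n. x n \<bullet> (z n - w)) \<longlonglongrightarrow> 0"
  proof (rule Lim_null_comparison[where g="\<lambda>n. B * norm (z n - w)"])
    have "norm (x n \<bullet> (z n - w)) \<le> B * norm (z n - w)" for n
      by (rule order_trans[OF Cauchy_Schwarz_ineq2[of "x n", folded real_norm_def]])
        (simp add: mult_right_mono assms(3))
    then show "\<forall>\<^sub>F n in sequentially. norm (x n \<bullet> (z n - w)) \<le> B * norm (z n - w)" by simp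
    show "(\<lambda>n. B * norm (z n - w)) \<longlonglongrightarrow> 0" using tendsto_mult_right_zero[OF 1] by simp
  qed
  have "(\<lambda>n. x n \<bullet> (z n - w) + x n \<bullet> w) \<longlonglongrightarrow> 0 + y \<bullet> w"
    by (intro tendsto_add 2 wconvD assms)
  then show ?thesis by (simp add: inner_diff_right)
qed

text \<open>The subsequence principle: limits obtained by compactness along subsequences become
  limits of the whole sequence once they are known to agree.\<close>

lemma tendsto_if_subseq_tendsto:
  fixes x :: "nat \<Rightarrow> 'a::metric_space"
  assumes "\<And>r :: nat \<Rightarrow> nat. strict_mono r \<Longrightarrow> \<exists>s :: nat \<Rightarrow> nat. strict_mono s \<and> (\<lambda>n. x (r (s n))) \<longlonglongrightarrow> L"
  shows "x \<longlonglongrightarrow> L"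
proof (rule ccontr)
  assume "\<not> x \<longlonglongrightarrow> L"
  then obtain e where e: "e > 0" "\<And>N. \<exists>n\<ge>N. \<not> dist (x n) L < e"
    unfolding lim_sequentially by blast
  let ?I = "{n. \<not> dist (x n) L < e}"
  have "infinite ?I" using e(2) by (simp add: infinite_nat_iff_unbounded_le)
  then obtain r :: "nat \<Rightarrow> nat" where r: "strict_mono r" "\<And>n. r n \<in> ?I"
    using infinite_enumerate by blast
  obtain s where "strict_mono s" "(\<lambda>n. x (r (s n))) \<longlonglongrightarrow> L" using assms[OF r(1)] by blast
  then obtain n where "dist (x (r (s n))) L < e"
    using e(1) unfolding lim_sequentially by blast
  then show False using r(2)[of "s n"] by simp
qed

lemma tendsto_if_sq_norm_le:
  fixes z :: "nat \<Rightarrow> 'a::real_normed_vector"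
  assumes "\<And>n. (norm (z n - a))\<^sup>2 \<le> e n" "e \<longlonglongrightarrow> 0"
  shows "z \<longlonglongrightarrow> a"
proof (rule LIM_zero_cancel, rule tendsto_norm_zero_cancel)
  have "(\<lambda>n. (norm (z n - a))\<^sup>2) \<longlonglongrightarrow> 0"
    by (rule Lim_null_comparison[OF _ assms(2)]) (use assms(1) in auto)
  then have "(\<lambda>n. sqrt ((norm (z n - a))\<^sup>2)) \<longlonglongrightarrow> sqrt 0" by (rule tendsto_real_sqrt)
  then show "(\<lambda>n. norm (z n - a)) \<longlonglongrightarrow> 0" by simp
qed

lemma inverse_Suc_at_0: "filterlim (\<lambda>n. 1 / real (Suc n)) (at 0) sequentially"
  unfolding filterlim_at using LIMSEQ_Suc[OF lim_1_over_n] by auto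

text \<open>Near-minimizers of the norm on the sets \<open>C n\<close> form a Cauchy sequence by the parallelogram law.\<close>

lemma nested_convex_closures_meet:
  fixes C :: "nat \<Rightarrow> 'a::{real_inner,complete_space} set"
  assumes conv: "\<And>n. convex (C n)" and ne: "\<And>n. C n \<noteq> {}" and anti: "antimono C"
    and bd: "\<And>y. y \<in> C 0 \<Longrightarrow> norm y \<le> B"
  shows "\<exists>y. \<forall>n. y \<in> closure (C n)"
proof -
  define d where "d n = (INF y\<in>C n. norm y)" for n
  have bdd: "bdd_below (norm ` C n)" for n by (auto intro!: bdd_belowI2[where m=0])
  have dle: "d n \<le> norm y" if "y \<in> C n" for n y
    unfolding d_def by (rule cINF_lower[OF bdd that])
  have sub: "C m \<subseteq> C n" if "n \<le> m" for n m using anti that by (auto simp: antimono_def)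
  have dmono: "incseq d"
    unfolding incseq_def d_def by (intro allI impI cINF_superset_mono ne bdd sub order_refl)
  have d0: "0 \<le> d n" for n unfolding d_def by (rule cINF_greatest[OF ne]) auto
  have dB: "d n \<le> B" for n
  proof -
    obtain y where "y \<in> C n" using ne by blast
    then show ?thesis using dle[of y n] bd[of y] sub[of 0 n] by force
  qed
  obtain D where D: "d \<longlonglongrightarrow> D" "\<And>n. d n \<le> D" using incseq_convergent[OF dmono, of B] dB by blast
  have "\<exists>y\<in>C n. norm y < d n + 1 / Suc n" for n
    using cINF_less_iff[OF ne bdd, of n "d n + 1 / Suc n"] unfolding d_def by (simp add: add.commute)
  then obtain y where y: "\<And>n. y n \<in> C n" "\<And>n. norm (y n) < d n + 1 / Suc n" by metis
  \<comment> \<open>For \<open>n \<le> m\<close> the midpoint of \<open>y n\<close> and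
    \<open>y m\<close> lies in \<open>C n\<close>, so its norm is at least \<open>d n\<close>, while
    both norms are at most \<open>D + 1 / Suc n\<close>; the parallelogram law turns this into the
    bound \<open>e n\<close> on the squared distance.\<close>
  define e where "e n = 4 * ((D + 1 / Suc n)\<^sup>2 - (d n)\<^sup>2)" for n
  have yD: "(norm (y n))\<^sup>2 \<le> (D + 1 / Suc n)\<^sup>2" for n
    by (rule power_mono) (use y(2)[of n] D(2)[of n] in auto)
  have est: "(norm (y n - y m))\<^sup>2 \<le> e n" if "n \<le> m" for n m
  proof -
    have mem: "(1/2) *\<^sub>R y n + (1/2) *\<^sub>R y m \<in> C n"
      using convexD[OF conv y(1)[of n], of "y m" "1/2" "1/2"] y(1)[of m] sub[OF that] by auto
    have "(d n)\<^sup>2 \<le> (norm ((1/2) *\<^sub>R y n + (1/2) *\<^sub>R y m))\<^sup>2"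
      by (rule power_mono[OF dle[OF mem] d0])
    moreover have "(norm ((1/2) *\<^sub>R y n + (1/2) *\<^sub>R y m))\<^sup>2 =
        ((norm (y n))\<^sup>2 + (norm (y m))\<^sup>2) / 2 - (norm (y n - y m))\<^sup>2 / 4"
      unfolding power2_norm_eq_inner by (simp add: inner_simps inner_commute field_simps)
    moreover have "(norm (y m))\<^sup>2 \<le> (D + 1 / Suc n)\<^sup>2"
    proof (rule order_trans[OF yD power_mono])
      show "D + 1 / real (Suc m) \<le> D + 1 / real (Suc n)"
        using that by (simp add: frac_le)
      show "0 \<le> D + 1 / real (Suc m)" using d0[of 0] D(2)[of 0] by (auto intro!: add_nonneg_nonneg)
    qed
    ultimately show ?thesis using yD[of n] unfolding e_def by (simp only: right_diff_distrib) argo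
  qed
  have "(\<lambda>n. e n) \<longlonglongrightarrow> 4 * ((D + 0)\<^sup>2 - D\<^sup>2)"
    unfolding e_def by (intro tendsto_intros D LIMSEQ_Suc[OF lim_1_over_n])
  then have e0: "e \<longlonglongrightarrow> 0" by simp
  have "Cauchy y"
  proof (rule metric_CauchyI)
    fix r :: real assume "r > 0"
    then have "\<forall>\<^sub>F n in sequentially. e n < r\<^sup>2" using order_tendstoD(2)[OF e0, of "r\<^sup>2"] by simp
    then obtain N where N: "\<And>n. n \<ge> N \<Longrightarrow> e n < r\<^sup>2" by (auto simp: eventually_sequentially)
    have aux: "dist (y n) (y m) < r" if "N \<le> n" "n \<le> m" for n m
      unfolding dist_norm
      by (rule power_less_imp_less_base[where n=2]) (use est[OF that(2)] N[OF that(1)] \<open>r>0\<close> in auto)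
    show "\<exists>M. \<forall>m\<ge>M. \<forall>n\<ge>M. dist (y m) (y n) < r"
    proof (intro exI allI impI)
      fix m n assume "N \<le> m" "N \<le> n"
      then show "dist (y m) (y n) < r"
        using aux[of m n] aux[of n m] by (cases "m \<le> n") (auto simp: dist_commute)
    qed
  qed
  then obtain z where z: "y \<longlonglongrightarrow> z" using Cauchy_convergent convergent_def by blast
  have "z \<in> closure (C n)" for n
  proof (rule closure_sequential[THEN iffD2], intro exI conjI allI)
    show "y (k + n) \<in> C n" for k using y(1)[of "k+n"] sub[of n "k+n"] by auto
    show "(\<lambda>k. y (k + n)) \<longlonglongrightarrow> z" using z by (rule LIMSEQ_ignore_initial_segment)
  qed
  then show ?thesis by blast
qed

text \<open>If the pairings with \<open>z\<close> tend to \<open>c\<close>, the slab of all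
  \<open>v\<close> with \<open>v \<bullet> z\<close> within \<open>e\<close> of \<open>c\<close> is
  closed and convex and contains a tail of \<open>x\<close>, hence it contains \<open>y\<close>.
  Directions without convergence are left open, which is why the second clause is
  conditional.\<close>

lemma ex_Mazur_limit:
  fixes x :: "nat \<Rightarrow> 'a::{real_inner,complete_space}"
  assumes bd: "\<And>n. norm (x n) \<le> B"
  shows "\<exists>y. (\<forall>n. y \<in> closure (convex hull (x ` {n..}))) \<and>
             (\<forall>z c. (\<lambda>n. x n \<bullet> z) \<longlonglongrightarrow> c \<longrightarrow> y \<bullet> z = c)"
proof -
  define C where "C n = convex hull (x ` {n..})" for n
  have "\<exists>y. \<forall>n. y \<in> closure (C n)"
  proof (rule nested_convex_closures_meet)
    show "convex (C n)" "C n \<noteq> {}" for n unfolding C_def by (auto simp: convex_convex_hull)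
    show "antimono C" unfolding C_def antimono_def by (intro allI impI hull_mono) auto
    show "norm y \<le> B" if "y \<in> C 0" for y
    proof -
      have "C 0 \<subseteq> cball 0 B" unfolding C_def by (intro hull_minimal) (auto simp: bd convex_cball)
      then show ?thesis using that by auto
    qed
  qed
  then obtain y where y: "\<And>n. y \<in> closure (C n)" by blast
  have "y \<bullet> z = c" if lim: "(\<lambda>n. x n \<bullet> z) \<longlonglongrightarrow> c" for z c
  proof -
    have "dist (y \<bullet> z) c \<le> e" if "e > 0" for e
    proof -
      obtain N where N: "\<And>n. n \<ge> N \<Longrightarrow> dist (x n \<bullet> z) c < e"
        using lim \<open>e > 0\<close> unfolding lim_sequentially by blast
      let ?S = "{v. v \<bullet> z \<in> cball c e}"
      have S: "?S = (\<lambda>v. v \<bullet> z) -` cball c e" by auto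
      have "convex ?S" unfolding S
        by (intro convex_linear_vimage convex_cball bounded_linear.linear bounded_linear_inner_left)
      moreover have "closed ?S" unfolding S
        by (intro closed_vimage closed_cball continuous_intros)
      moreover have "x ` {N..} \<subseteq> ?S" using N by (auto simp: dist_commute less_imp_le)
      ultimately have "closure (C N) \<subseteq> ?S" unfolding C_def by (intro closure_minimal hull_minimal)
      then show ?thesis using y[of N] by (auto simp: dist_commute)
    qed
    then show ?thesis by (metis (full_types) dist_le_zero_iff field_le_epsilon add_0)
  qed
  then show ?thesis using y unfolding C_def by blast
qed

text \<open>Cantor's diagonal argument. The diagonal sequence is a subsequence of the
  \<open>k\<close>-th selected one only after a shift by \<open>Suc k\<close>, which does not affect
  convergence.\<close>

lemma bounded_pointwise_imp_convergent_subseq: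
  fixes f :: "nat \<Rightarrow> nat \<Rightarrow> real"
  assumes "\<And>n k. \<bar>f n k\<bar> \<le> B"
  shows "\<exists>r. strict_mono (r :: nat \<Rightarrow> nat) \<and> (\<forall>k. \<exists>l. (\<lambda>n. f (r n) k) \<longlonglongrightarrow> l)"
proof -
  interpret subseqs "\<lambda>k r. convergent (\<lambda>n. f (r n) k)"
  proof
    fix k and s :: "nat \<Rightarrow> nat"
    have "bounded (range (\<lambda>n. f (s n) k))" using assms by (auto simp: bounded_iff)
    from bounded_imp_convergent_subsequence[OF this]
    show "\<exists>r'. strict_mono r' \<and> convergent (\<lambda>n. f ((s \<circ> r') n) k)"
      by (auto simp: convergent_def comp_def)
  qed
  have "convergent (\<lambda>n. f (diagseq n) k)" for k
  proof -
    have "convergent (\<lambda>n. f ((diagseq \<circ> (+) (Suc k)) n) k)"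
    proof (rule diagseq_holds)
      fix r s :: "nat \<Rightarrow> nat" and n
      assume "strict_mono r" "convergent (\<lambda>m. f (s m) n)"
      then show "convergent (\<lambda>m. f ((s \<circ> r) m) n)"
        using convergent_subseq_convergent[of "\<lambda>m. f (s m) n" r] by (simp add: comp_def)
    qed
    then show ?thesis
      using convergent_ignore_initial_segment[of "\<lambda>n. f (diagseq n) k" "Suc k"] by (simp add: add.commute)
  qed
  then show ?thesis using subseq_diagseq by (auto simp: convergent_def)
qed

text \<open>Instead of the Riesz theorem, the weak limit is a point in all the closed convex hulls of the tails.\<close>

theorem bounded_imp_wconv_subseq:
  fixes x :: "nat \<Rightarrow> 'a::{real_inner,complete_space}"
  assumes bd: "\<And>n. norm (x n) \<le> B"
  shows "\<exists>r y. strict_mono (r :: nat \<Rightarrow> nat) \<and> wconv (x \<circ> r) y"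
proof -
  have "\<bar>x n \<bullet> x k\<bar> \<le> B * B" for n k
    by (rule order_trans[OF Cauchy_Schwarz_ineq2[of "x n"]])
      (meson bd mult_mono norm_ge_zero order_trans)
  then obtain r :: "nat \<Rightarrow> nat" where r: "strict_mono r"
      "\<And>k. \<exists>l. (\<lambda>n. x (r n) \<bullet> x k) \<longlonglongrightarrow> l"
    using bounded_pointwise_imp_convergent_subseq[of "\<lambda>n k. x n \<bullet> x k" "B*B"] by blast
  let ?x = "x \<circ> r"
  have bdr: "norm (?x n) \<le> B" for n using bd by simp
  obtain y where y: "y \<in> closure (convex hull (?x ` {0..}))"
      "\<And>z c. (\<lambda>n. ?x n \<bullet> z) \<longlonglongrightarrow> c \<Longrightarrow> y \<bullet> z = c"
    using ex_Mazur_limit[of ?x B, OF bdr] by blast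
  define S where "S = closure (span (range x))"
  have hullS: "closure (convex hull (x ` A)) \<subseteq> S" for A
    unfolding S_def
    by (intro closure_mono hull_minimal subspace_imp_convex subspace_span)
      (meson image_mono span_superset subset_UNIV subset_trans)
  have "wconv ?x y"
    unfolding wconv_def
  proof (intro allI tendsto_if_subseq_tendsto)
    \<comment> \<open>For a general \<open>z\<close> the pairings are not yet known to converge. A
      further subsequence makes them converge, and its own Mazur point \<open>y'\<close> is shown to
      coincide with \<open>y\<close>.\<close>
    fix z and q :: "nat \<Rightarrow> nat" assume q: "strict_mono q"
    have "norm (x (r (q n)) \<bullet> z) \<le> B * norm z" for n
      by (rule order_trans[OF Cauchy_Schwarz_ineq2[of "x (r (q n))", folded real_norm_def]])
        (simp add: mult_right_mono bd)
    then have "bounded (range (\<lambda>n. x (r (q n)) \<bullet> z))" by (auto simp: bounded_iff)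
    then obtain c s where s: "strict_mono s" "(\<lambda>n. x (r (q (s n))) \<bullet> z) \<longlonglongrightarrow> c"
      using bounded_imp_convergent_subsequence[of "\<lambda>n. x (r (q n)) \<bullet> z"] by (auto simp: comp_def)
    let ?x' = "\<lambda>n. x (r (q (s n)))"
    obtain y' where y': "y' \<in> closure (convex hull (?x' ` {0..}))"
      "\<And>z c. (\<lambda>n. ?x' n \<bullet> z) \<longlonglongrightarrow> c \<Longrightarrow> y' \<bullet> z = c"
      using ex_Mazur_limit[of ?x' B] bd by blast
    have qs: "strict_mono (\<lambda>n. q (s n))" using q s(1) strict_mono_o[of q s] by (simp add: comp_def)
    \<comment> \<open>By the choice of \<open>r\<close> the pairings with each \<open>x k\<close>
      already converge, so \<open>y\<close> and \<open>y'\<close> agree on them. Their difference is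
      then orthogonal to \<open>S\<close>, to which it belongs.\<close>
    have orth: "(y - y') \<bullet> v = 0" if "v \<in> range x" for v
    proof -
      obtain k where k: "v = x k" using \<open>v \<in> range x\<close> by blast
      obtain l where l: "(\<lambda>n. x (r n) \<bullet> x k) \<longlonglongrightarrow> l" using r(2)[of k] by blast
      have "y \<bullet> v = l" using y(2)[of v l] l k by simp
      moreover have "y' \<bullet> v = l"
        using y'(2)[of v l] LIMSEQ_subseq_LIMSEQ[OF l qs] k by (simp add: comp_def)
      ultimately show ?thesis by (simp add: inner_diff_left)
    qed
    have T: "{v. (y - y') \<bullet> v = 0} = (\<lambda>v. (y - y') \<bullet> v) -` {0}" by auto
    have "S \<subseteq> {v. (y - y') \<bullet> v = 0}"
      unfolding S_def
    proof (intro closure_minimal span_minimal)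
      show "range x \<subseteq> {v. (y - y') \<bullet> v = 0}" using orth by auto
      show "subspace {v. (y - y') \<bullet> v = 0}" by (auto simp: subspace_def inner_simps)
      show "closed {v. (y - y') \<bullet> v = 0}" unfolding T by (intro closed_vimage continuous_intros)
    qed
    moreover have "y - y' \<in> S"
    proof -
      have "y \<in> S" "y' \<in> S"
        using y(1) y'(1) hullS[of "r ` {0..}"] hullS[of "(\<lambda>n. r (q (s n))) ` {0..}"]
        unfolding image_image comp_def by blast+
      then show ?thesis unfolding S_def
        by (intro subspace_diff subspace_closure subspace_span)
    qed
    ultimately have "y = y'" by auto
    then have "c = y \<bullet> z" using y'(2)[OF s(2)] by simp
    then show "\<exists>s. strict_mono s \<and> (\<lambda>n. ?x (q (s n)) \<bullet> z) \<longlonglongrightarrow> y \<bullet> z"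
      using s by auto
  qed
  with r(1) show ?thesis by (intro exI[of _ r] exI[of _ y] conjI)
qed

text \<open>Mazur's theorem: the point common to the closed convex hulls has the same pairings as
  the weak limit and therefore is that limit.\<close>

lemma closed_convex_wconv_mem:
  fixes x :: "nat \<Rightarrow> 'a::{real_inner,complete_space}"
  assumes "wconv x y" "\<And>n. norm (x n) \<le> B" "\<And>n. x n \<in> S" "closed S" "convex S"
  shows "y \<in> S"
proof -
  obtain y' where y': "y' \<in> closure (convex hull (x ` {0..}))"
      "\<And>z c. (\<lambda>n. x n \<bullet> z) \<longlonglongrightarrow> c \<Longrightarrow> y' \<bullet> z = c"
    using ex_Mazur_limit[of x B, OF assms(2)] by blast
  have "wconv x y'" unfolding wconv_def
  proof
    fix z
    have "y' \<bullet> z = y \<bullet> z" by (rule y'(2)) (rule wconvD[OF assms(1)])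
    then show "(\<lambda>n. x n \<bullet> z) \<longlonglongrightarrow> y' \<bullet> z" using wconvD[OF assms(1), of z] by simp
  qed
  then have "y' = y" using wconv_unique[OF assms(1)] by simp
  moreover have "closure (convex hull (x ` {0..})) \<subseteq> S"
    by (intro closure_minimal hull_minimal image_subsetI assms)
  ultimately show ?thesis using y'(1) by auto
qed

lemma wconv_if_subseq_wconv:
  fixes x :: "nat \<Rightarrow> 'a::real_inner"
  assumes "\<And>r :: nat \<Rightarrow> nat. strict_mono r \<Longrightarrow> \<exists>s :: nat \<Rightarrow> nat. strict_mono s \<and> wconv (\<lambda>n. x (r (s n))) L"
  shows "wconv x L"
  unfolding wconv_def
proof (intro allI tendsto_if_subseq_tendsto)
  fix z and r :: "nat \<Rightarrow> nat" assume "strict_mono r"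
  from assms[OF this] show "\<exists>s. strict_mono s \<and> (\<lambda>n. x (r (s n)) \<bullet> z) \<longlonglongrightarrow> L \<bullet> z"
    unfolding wconv_def by blast
qed


subsection \<open>A variational inequality on a box\<close>

text \<open>Kuhn's combinatorial lemma is used directly: unlike the fixed point theorem of Brouwer in the library, it allows
  a dimension that is a natural number and not a type.\<close>

lemma box_variational_inequality:
  fixes F :: "(nat \<Rightarrow> real) \<Rightarrow> nat \<Rightarrow> real"
  assumes r: "r > 0"
    and cont: "\<And>c x i. i < n \<Longrightarrow> (\<And>j. j < n \<Longrightarrow> (\<lambda>k. c k j) \<longlonglongrightarrow> x j) \<Longrightarrow>
        (\<lambda>k. F (c k) i) \<longlonglongrightarrow> F x i"
  shows "\<exists>x. \<forall>i<n. \<bar>x i\<bar> \<le> r \<and> (x i > - r \<longrightarrow> F x i \<le> 0) \<and> (x i < r \<longrightarrow> F x i \<ge> 0)"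
proof -
  define g where "g p q = (\<lambda>j. - r + 2 * r * (real (q j) / real (Suc p)))" for p :: nat and q :: "nat \<Rightarrow> nat"
  \<comment> \<open>Kuhn's lemma prescribes the labels on the two faces in direction
    \<open>i\<close>; in between, the label is the sign of \<open>F\<close>. A face label may
    contradict the sign, which is why only one inequality for \<open>F x i\<close> survives on a
    face.\<close>
  define label where "label p q i = (if q i = 0 then 0 else if q i = Suc p then 1
      else if F (g p q) i \<le> 0 then 0 else (1::nat))" for p q i
  have "\<exists>q. (\<forall>i<n. q i < Suc p) \<and> (\<forall>i<n. \<exists>a b. (\<forall>j<n. q j \<le> a j \<and> a j \<le> q j + 1) \<and>
          (\<forall>j<n. q j \<le> b j \<and> b j \<le> q j + 1) \<and> label p a i = 0 \<and> label p b i = 1)" for p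
  proof -
    obtain q where q: "\<forall>i<n. q i < Suc p"
      "\<forall>i<n. \<exists>a b. (\<forall>j<n. q j \<le> a j \<and> a j \<le> q j + 1) \<and> (\<forall>j<n. q j \<le> b j \<and> b j \<le> q j + 1) \<and> label p a i \<noteq> label p b i"
      by (rule kuhn_lemma[of "Suc p" n "label p"]) (auto simp: label_def)
    have l01: "label p a i = 0 \<or> label p a i = 1" for a i by (auto simp: label_def)
    show ?thesis using q l01 by metis
  qed
  then obtain Q where Q: "\<And>p. \<forall>i<n. Q p i < Suc p"
    "\<And>p. \<forall>i<n. \<exists>a b. (\<forall>j<n. Q p j \<le> a j \<and> a j \<le> Q p j + 1) \<and>
          (\<forall>j<n. Q p j \<le> b j \<and> b j \<le> Q p j + 1) \<and> label p a i = 0 \<and> label p b i = 1"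
    by metis
  then have "\<forall>p i. \<exists>a b. i < n \<longrightarrow> (\<forall>j<n. Q p j \<le> a j \<and> a j \<le> Q p j + 1) \<and>
          (\<forall>j<n. Q p j \<le> b j \<and> b j \<le> Q p j + 1) \<and> label p a i = 0 \<and> label p b i = 1"
    by blast
  then obtain A B where AB: "\<And>p i. i < n \<Longrightarrow> (\<forall>j<n. Q p j \<le> A p i j \<and> A p i j \<le> Q p j + 1) \<and>
          (\<forall>j<n. Q p j \<le> B p i j \<and> B p i j \<le> Q p j + 1) \<and> label p (A p i) i = 0 \<and> label p (B p i) i = 1"
    by metis
  have gb: "\<bar>g p q j\<bar> \<le> r" if "q j \<le> Suc p" for p q j
  proof -
    have "0 \<le> real (q j) / real (Suc p)" "real (q j) / real (Suc p) \<le> 1" using that by (auto simp: field_simps)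
    then have "0 \<le> 2 * r * (real (q j) / real (Suc p))" "2 * r * (real (q j) / real (Suc p)) \<le> 2 * r * 1"
      using r mult_left_mono[of "real (q j) / real (Suc p)" 1 "2*r"] by auto
    then show ?thesis unfolding g_def by simp
  qed
  have "\<bar>if j < n then g p (Q p) j else 0\<bar> \<le> r" for p j
    using gb[of "Q p" j p] Q(1)[of p] r by (auto simp: less_imp_le)
  from bounded_pointwise_imp_convergent_subseq[of "\<lambda>p j. if j < n then g p (Q p) j else 0", OF this]
  obtain k :: "nat \<Rightarrow> nat" where k: "strict_mono k"
      "\<forall>j. \<exists>l. (\<lambda>m. if j < n then g (k m) (Q (k m)) j else 0) \<longlonglongrightarrow> l" by blast
  from choice[OF k(2)] obtain x where
    x': "\<forall>j. (\<lambda>m. if j < n then g (k m) (Q (k m)) j else 0) \<longlonglongrightarrow> x j" by blast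
  have x: "(\<lambda>m. g (k m) (Q (k m)) j) \<longlonglongrightarrow> x j" if "j < n" for j using x'[rule_format, of j] that by simp
  note k = k(1)
  \<comment> \<open>The vertices selected in a cell differ from \<open>Q p\<close> by at most one
    grid step, so they share its limit \<open>x\<close>, where the signs of \<open>F\<close> at
    different vertices are compared.\<close>
  have near: "(\<lambda>m. g (k m) (C (k m)) j) \<longlonglongrightarrow> x j"
    if "j < n" and C: "\<And>p. Q p j \<le> C p j \<and> C p j \<le> Q p j + 1" for C j
  proof -
    have "(\<lambda>m. g (k m) (C (k m)) j - g (k m) (Q (k m)) j) \<longlonglongrightarrow> 0"
    proof (rule Lim_null_comparison)
      have "norm (g (k m) (C (k m)) j - g (k m) (Q (k m)) j) \<le> 2 * r * (1 / real (Suc (k m)))" for m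
      proof -
        have "g (k m) (C (k m)) j - g (k m) (Q (k m)) j = 2 * r * ((real (C (k m) j) - real (Q (k m) j)) / real (Suc (k m)))"
          unfolding g_def by (simp add: diff_divide_distrib right_diff_distrib)
        also have "norm \<dots> \<le> 2 * r * (1 / real (Suc (k m)))"
          unfolding norm_mult real_norm_def using r C[of "k m"]
          by (auto simp: abs_mult intro!: mult_left_mono divide_right_mono)
        finally show ?thesis .
      qed
      then show "\<forall>\<^sub>F m in sequentially. norm (g (k m) (C (k m)) j - g (k m) (Q (k m)) j) \<le> 2 * r * (1 / real (Suc (k m)))"
        by simp
      have "(\<lambda>m. 1 / real (Suc (k m))) \<longlonglongrightarrow> 0"
        using LIMSEQ_subseq_LIMSEQ[OF LIMSEQ_Suc[OF lim_1_over_n] k] by (simp add: comp_def)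
      from tendsto_mult_right_zero[OF this]
      show "(\<lambda>m. 2 * r * (1 / real (Suc (k m)))) \<longlonglongrightarrow> 0" .
    qed
    from tendsto_add[OF this x[OF \<open>j<n\<close>]] show ?thesis by simp
  qed
  have limA: "(\<lambda>m. g (k m) (A (k m) i) j) \<longlonglongrightarrow> x j" if "i < n" "j < n" for i j
    by (rule near[of j "\<lambda>p. A p i"]) (use AB that in auto)
  have limB: "(\<lambda>m. g (k m) (B (k m) i) j) \<longlonglongrightarrow> x j" if "i < n" "j < n" for i j
    by (rule near[of j "\<lambda>p. B p i"]) (use AB that in auto)
  have FA: "(\<lambda>m. F (g (k m) (A (k m) i)) i) \<longlonglongrightarrow> F x i" if "i < n" for i
    using cont[OF that limA[OF that]] .
  have FB: "(\<lambda>m. F (g (k m) (B (k m) i)) i) \<longlonglongrightarrow> F x i" if "i < n" for i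
    using cont[OF that limB[OF that]] .
  show ?thesis
  proof (intro exI[of _ x] allI impI conjI)
    fix i assume i: "i < n"
    have "\<bar>g (k m) (Q (k m)) i\<bar> \<le> r" for m by (rule gb) (simp add: less_imp_le Q(1) i)
    then show "\<bar>x i\<bar> \<le> r"
      by (intro tendsto_upperbound[OF tendsto_rabs[OF x[OF i]]]) auto
    \<comment> \<open>If the limit is off the lower face, so are the vertices eventually, and then
      the label 0 was given by the sign of \<open>F\<close>.\<close>
    show "F x i \<le> 0" if "x i > - r"
    proof (rule tendsto_upperbound[OF FA[OF i]])
      have "\<forall>\<^sub>F m in sequentially. g (k m) (A (k m) i) i > - r" using order_tendstoD(1)[OF limA[OF i i] that] .
      then show "\<forall>\<^sub>F m in sequentially. F (g (k m) (A (k m) i)) i \<le> 0"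
      proof eventually_elim
        case (elim m)
        then have "A (k m) i i \<noteq> 0" by (intro notI) (simp add: g_def)
        then show ?case using AB[OF i, of "k m"] by (auto simp: label_def split: if_splits)
      qed
    qed simp
    show "F x i \<ge> 0" if "x i < r"
    proof (rule tendsto_lowerbound[OF FB[OF i]])
      have "\<forall>\<^sub>F m in sequentially. g (k m) (B (k m) i) i < r" using order_tendstoD(2)[OF limB[OF i i] that] .
      then show "\<forall>\<^sub>F m in sequentially. F (g (k m) (B (k m) i)) i \<ge> 0"
      proof eventually_elim
        case (elim m)
        then have "B (k m) i i \<noteq> Suc (k m)" by (intro notI) (simp add: g_def del: of_nat_Suc)
        then show ?case using AB[OF i, of "k m"] by (auto simp: label_def split: if_splits)
      qed
    qed simp
  qed
qed


lemma tendsto_norm_bounded: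
  fixes X :: "nat \<Rightarrow> 'a::real_normed_vector"
  assumes "X \<longlonglongrightarrow> L" shows "\<exists>Z. \<forall>n. norm (X n) \<le> Z"
  using convergent_imp_Bseq[OF convergentI[OF assms]] by (auto simp: Bseq_def)

subsection \<open>Galerkin schemes for an abstract monotone problem\<close>

text \<open>The set \<open>G\<close> is the graph of the gradient on \<open>H\<^sup>1\<^sub>0\<close>, seen in a product of Hilbert spaces; \<open>M\<close> and \<open>N\<close>
  stand for composition with \<open>\<mu>\<close> and \<open>\<nu>\<close>, and \<open>T\<close> for multiplication by the diffusion matrix.\<close>

locale galerkin =
  fixes G :: "('h::{real_inner,complete_space} \<times> 'g::{real_inner,complete_space}) set"
    and K :: "'h set" and M N :: "'h \<Rightarrow> 'h" and T :: "'g \<Rightarrow> 'g" and f :: 'h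
    and CP C1 C2 lo :: real
  assumes G: "subspace G" "closed G" "\<And>g. (0, g) \<in> G \<Longrightarrow> g = 0"
    and poincare: "\<And>u g. (u, g) \<in> G \<Longrightarrow> norm u \<le> CP * norm g"
    and rellich: "\<And>u g v B. (\<And>n. (u n, g n) \<in> G) \<Longrightarrow> (\<And>n. norm (g n) \<le> B) \<Longrightarrow> wconv u v \<Longrightarrow> u \<longlonglongrightarrow> v"
    and K: "closed K" "subspace K" "fst ` G \<subseteq> K"
    and dense: "\<And>h. h \<in> K \<Longrightarrow> (\<And>v g. (v, g) \<in> G \<Longrightarrow> h \<bullet> v = 0) \<Longrightarrow> h = 0"
    and firm: "\<And>a b. (M a - M b) \<bullet> (M a - M b) \<le> (a - b) \<bullet> (M a - M b)" "M 0 = 0"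
    and N: "\<And>a b. (N a - N b) \<bullet> (N a - N b) \<le> (a - b) \<bullet> (M a - M b)"
           "\<And>a. norm (M a) \<le> norm (N a)"
    and coercive: "\<And>w. w \<in> K \<Longrightarrow> norm w \<le> C1 * norm (M w) + C2"
    and chain: "\<And>w g. (w, g) \<in> G \<Longrightarrow> \<exists>gM gN. (M w, gM) \<in> G \<and> (N w, gN) \<in> G \<and>
          T gM \<bullet> g = T gN \<bullet> gN \<and> norm gM \<le> norm gN \<and> norm gN \<le> norm g"
    and T: "bounded_linear T" "\<And>x y. T x \<bullet> y = x \<bullet> T y" "\<And>x. lo * (norm x)\<^sup>2 \<le> T x \<bullet> x"
    and pos: "CP > 0" "C1 > 0" "C2 > 0" "lo > 0"
begin

section \<open>The gradient as an operator, monotonicity, and the a priori bound\<close>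

definition dom :: "'h set" where "dom = fst ` G"
definition D :: "'h \<Rightarrow> 'g" where "D u = (THE g. (u, g) \<in> G)"

lemma D_eq: "(u, g) \<in> G \<Longrightarrow> D u = g"
  unfolding D_def
proof (rule the_equality)
  fix g' assume "(u, g) \<in> G" "(u, g') \<in> G"
  then have "(u, g') - (u, g) \<in> G" using G(1) subspace_diff by blast
  then show "g' = g" using G(3)[of "g' - g"] by simp
qed

lemma domI: "(u, g) \<in> G \<Longrightarrow> u \<in> dom"
  unfolding dom_def by force

lemma G_D: "u \<in> dom \<Longrightarrow> (u, D u) \<in> G"
  unfolding dom_def using D_eq by force

lemma dom_K: "dom \<subseteq> K" using K(3) unfolding dom_def .

lemma D_linear:
  assumes "u \<in> dom" "v \<in> dom"
  shows "u + v \<in> dom" "D (u + v) = D u + D v" "u - v \<in> dom" "D (u - v) = D u - D v"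
proof -
  have "(u, D u) + (v, D v) \<in> G" "(u, D u) - (v, D v) \<in> G"
    by (intro subspace_add subspace_diff subspace_scale G(1) G_D assms)+
  then have *: "(u + v, D u + D v) \<in> G" "(u - v, D u - D v) \<in> G" by auto
  show "u + v \<in> dom" "D (u + v) = D u + D v" "u - v \<in> dom" "D (u - v) = D u - D v"
    using *[THEN domI] *[THEN D_eq] by auto
qed

lemma D_scaleR:
  assumes "u \<in> dom" shows "c *\<^sub>R u \<in> dom" "D (c *\<^sub>R u) = c *\<^sub>R D u"
proof -
  have "c *\<^sub>R (u, D u) \<in> G" by (intro subspace_scale G(1) G_D assms)
  then have "(c *\<^sub>R u, c *\<^sub>R D u) \<in> G" by simp
  then show "c *\<^sub>R u \<in> dom" "D (c *\<^sub>R u) = c *\<^sub>R D u" using domI D_eq by auto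
qed

lemma dom_0: "0 \<in> dom" "D 0 = 0"
  using subspace_0[OF G(1)] domI[of 0 0] D_eq[of 0 0] by (auto simp: zero_prod_def)

lemma dom_sum: "finite I \<Longrightarrow> (\<And>i. i \<in> I \<Longrightarrow> e i \<in> dom) \<Longrightarrow>
    (\<Sum>i\<in>I. c i *\<^sub>R e i) \<in> dom \<and> D (\<Sum>i\<in>I. c i *\<^sub>R e i) = (\<Sum>i\<in>I. c i *\<^sub>R D (e i))"
  by (induction I rule: finite_induct) (auto simp: dom_0 D_linear D_scaleR)

lemma subspace_dom: "subspace dom"
  unfolding subspace_def by (auto simp: dom_0 D_linear D_scaleR)

lemma MN:
  assumes "w \<in> dom"
  shows "M w \<in> dom" "N w \<in> dom" "T (D (M w)) \<bullet> D w = T (D (N w)) \<bullet> D (N w)"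
    "norm (D (M w)) \<le> norm (D (N w))" "norm (D (N w)) \<le> norm (D w)"
proof -
  obtain gM gN where *: "(M w, gM) \<in> G" "(N w, gN) \<in> G" "T gM \<bullet> D w = T gN \<bullet> gN"
    "norm gM \<le> norm gN" "norm gN \<le> norm (D w)" using chain[OF G_D[OF assms]] by blast
  then show "M w \<in> dom" "N w \<in> dom" "T (D (M w)) \<bullet> D w = T (D (N w)) \<bullet> D (N w)"
    "norm (D (M w)) \<le> norm (D (N w))" "norm (D (N w)) \<le> norm (D w)"
    using D_eq[OF *(1)] D_eq[OF *(2)] domI by auto
qed

lemma firm_sq: "(norm (M a - M b))\<^sup>2 \<le> (a - b) \<bullet> (M a - M b)"
  using firm(1) by (simp add: power2_norm_eq_inner)

lemma N_sq: "(norm (N a - N b))\<^sup>2 \<le> (a - b) \<bullet> (M a - M b)"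
  using N(1) by (simp add: power2_norm_eq_inner)

lemma M_lip: "norm (M a - M b) \<le> norm (a - b)"
proof (cases "norm (M a - M b) = 0")
  case False
  have "norm (M a - M b) * norm (M a - M b) \<le> norm (a - b) * norm (M a - M b)"
    using firm_sq[of a b] norm_cauchy_schwarz[of "a - b" "M a - M b"] by (simp add: power2_eq_square)
  then show ?thesis using False by simp
qed simp

lemma M_le: "norm (M a) \<le> norm a"
  using M_lip[of a 0] firm(2) by simp

text \<open>The map \<open>a - M a\<close> stands for composition with \<rho>. It inherits firmness
  because the defect in the inequality is the same for a map and its complement; that the defect is
  nonnegative is \<open>R_mono\<close>.\<close>

lemma R_firm: "(norm (a - M a - (b - M b)))\<^sup>2 \<le> (a - b) \<bullet> (a - M a - (b - M b))"
proof -
  have "(a - b) \<bullet> (a - M a - (b - M b)) - (norm (a - M a - (b - M b)))\<^sup>2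
      = (a - b) \<bullet> (M a - M b) - (norm (M a - M b))\<^sup>2"
    unfolding power2_norm_eq_inner by (simp add: inner_simps inner_commute algebra_simps)
  then show ?thesis using firm_sq[of a b] by linarith
qed

lemma R_mono: "0 \<le> (a - M a - (b - M b)) \<bullet> (M a - M b)"
proof -
  have "(a - M a - (b - M b)) \<bullet> (M a - M b) = (a - b) \<bullet> (M a - M b) - (norm (M a - M b))\<^sup>2"
    unfolding power2_norm_eq_inner by (simp add: inner_simps inner_commute algebra_simps)
  then show ?thesis using firm_sq[of a b] by linarith
qed

lemma R_pos: "0 \<le> (a - M a) \<bullet> a"
  using R_firm[of a 0] firm(2) by (simp add: inner_commute) (smt (verit) zero_le_power2)

text \<open>With \<open>t = C1 * CP * norm (D (N w))\<close> and \<open>A\<close> the first summand,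
  the estimates read \<open>norm w \<le> t + C2\<close> and \<open>2 * t \<le> A + norm w\<close>.
  Eliminating \<open>t\<close> gives \<open>A + 2 * C2\<close>.\<close>

definition bd :: real where "bd = (C1 * CP)\<^sup>2 * norm f / lo + 2 * C2"

lemma bd_nonneg: "bd \<ge> 0" unfolding bd_def using pos by (auto intro!: add_nonneg_nonneg)

text \<open>Testing with \<open>w\<close> controls the gradient of \<open>N w\<close>, since the
  \<rho>-term is nonnegative. Poincare and coercivity carry the control to \<open>w\<close>; the
  right-hand side is linear in \<open>norm w\<close> while a squared gradient is bounded, so it can
  be absorbed. An inequality is assumed because in the existence proof only a sign is known at
  first.\<close>

lemma a_priori:
  assumes w: "w \<in> dom" and le: "(w - M w) \<bullet> w + T (D (M w)) \<bullet> D w \<le> f \<bullet> w"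
  shows "norm w \<le> bd" "(norm (D (N w)))\<^sup>2 \<le> norm f * bd / lo"
proof -
  have fw: "f \<bullet> w \<le> norm f * norm w" by (rule norm_cauchy_schwarz)
  have "lo * (norm (D (N w)))\<^sup>2 \<le> norm f * norm w"
    using le R_pos[of w] MN(3)[OF w] T(3)[of "D (N w)"] fw by linarith
  then have *: "(norm (D (N w)))\<^sup>2 \<le> norm f * norm w / lo" using pos by (simp add: field_simps)
  define t where "t = C1 * CP * norm (D (N w))"
  have "norm w \<le> C1 * norm (M w) + C2" using coercive w dom_K by blast
  also have "norm (M w) \<le> CP * norm (D (N w))"
    using N(2)[of w] poincare[OF G_D[OF MN(2)[OF w]]] by linarith
  finally have 1: "norm w \<le> t + C2" unfolding t_def using pos by (simp add: mult.assoc)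
  have "t\<^sup>2 \<le> (C1 * CP)\<^sup>2 * (norm f * norm w / lo)"
    unfolding t_def power_mult_distrib[of _ "norm _"] using * by (intro mult_left_mono) auto
  then have t2: "t\<^sup>2 \<le> ((C1 * CP)\<^sup>2 * norm f / lo) * norm w" by (simp add: field_simps)
  define A where "A = (C1 * CP)\<^sup>2 * norm f / lo"
  have A0: "A \<ge> 0" unfolding A_def using pos by auto
  have "2 * t \<le> A + norm w"
  proof (rule power2_le_imp_le)
    have "(2 * t)\<^sup>2 \<le> 4 * (A * norm w)" using t2 unfolding A_def by (simp add: power_mult_distrib)
    also have "\<dots> \<le> (A + norm w)\<^sup>2" using zero_le_power2[of "A - norm w"]
      by (simp add: power2_sum power2_diff)
    finally show "(2 * t)\<^sup>2 \<le> (A + norm w)\<^sup>2" .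
  qed (use A0 in simp)
  then show b: "norm w \<le> bd" using 1 unfolding bd_def A_def by linarith
  show "(norm (D (N w)))\<^sup>2 \<le> norm f * bd / lo"
    by (rule order_trans[OF *]) (use b pos in \<open>auto intro!: divide_right_mono mult_left_mono\<close>)
qed

text \<open>The graph \<open>G\<close> is closed and convex, hence weakly closed in the product
  space. Bounded gradients have weakly convergent subsequences, and each of their limits must be the
  gradient of \<open>v\<close>, since \<open>G\<close> is single-valued.\<close>

lemma wconv_D:
  assumes u: "\<And>n. u n \<in> dom" "wconv u v" "\<And>n. norm (u n) \<le> B" "\<And>n. norm (D (u n)) \<le> C"
  shows "v \<in> dom" "wconv (\<lambda>n. D (u n)) (D v)"
proof -
  have *: "\<exists>s. strict_mono s \<and> wconv (\<lambda>n. D (u (r (s n)))) (D v) \<and> v \<in> dom" if r: "strict_mono r" for r :: "nat \<Rightarrow> nat"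
  proof -
    obtain s h where s: "strict_mono s" "wconv ((\<lambda>n. D (u (r n))) \<circ> s) h"
      using bounded_imp_wconv_subseq[of "\<lambda>n. D (u (r n))" C] u(4) by auto
    have rs: "strict_mono (r \<circ> s)" using r s by (simp add: strict_mono_o)
    have 1: "wconv (\<lambda>n. u (r (s n))) v" using wconv_subseq[OF u(2) rs] by (simp add: comp_def)
    have "(v, h) \<in> G"
    proof (rule closed_convex_wconv_mem[where B="B + C"])
      show "(u (r (s n)), D (u (r (s n)))) \<in> G" for n using G_D u(1) by blast
      show "wconv (\<lambda>n. (u (r (s n)), D (u (r (s n))))) (v, h)"
        using 1 s(2) unfolding wconv_def by (auto simp: inner_prod_def intro!: tendsto_add)
      show "norm (u (r (s n)), D (u (r (s n)))) \<le> B + C" for n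
        by (rule order_trans[OF norm_Pair_le add_mono]) (use u in auto)
      show "closed G" "convex G" using G subspace_imp_convex by auto
    qed
    then show ?thesis using s D_eq[of v h] domI by (auto simp: comp_def)
  qed
  show "v \<in> dom" using *[of id] by (auto simp: strict_mono_def)
  show "wconv (\<lambda>n. D (u n)) (D v)" by (rule wconv_if_subseq_wconv) (use * in blast)
qed

text \<open>The residuals \<open>F\<close> against an orthogonal basis form a continuous vector
  field on the coefficients. The variational inequality on a box gives a point that obeys the a
  priori bound; the box is so large that this bound keeps the point off the faces, where alone a
  residual could be nonzero.\<close>

lemma exists_galerkin:
  assumes B: "finite B" "B \<subseteq> dom"
  shows "\<exists>w\<in>span B. \<forall>v\<in>span B. (w - M w) \<bullet> v + T (D (M w)) \<bullet> D v = f \<bullet> v"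
proof -
  obtain C where C: "finite C" "span C = span B" "pairwise orthogonal C"
    using basis_orthogonal[OF B(1)] by blast
  have spdom: "span B \<subseteq> dom" by (rule span_minimal[OF B(2) subspace_dom])
  define E where "E = C - {0}"
  have E: "finite E" "span E = span B" "E \<subseteq> dom" "pairwise orthogonal E"
    using C spdom span_superset[of C] unfolding E_def by (auto simp: pairwise_def)
  obtain e where e: "bij_betw e {..<card E} E" using ex_bij_betw_nat_finite[OF E(1)] by (auto simp: lessThan_atLeast0)
  define n where "n = card E"
  have eE: "e i \<in> E" if "i < n" for i using e that unfolding n_def bij_betw_def by auto
  have edom: "e i \<in> dom" if "i < n" for i using eE[OF that] E(3) by blast
  have enz: "norm (e i) > 0" if "i < n" for i using eE[OF that] unfolding E_def by auto
  have eorth: "e i \<bullet> e j = 0" if "i < n" "j < n" "i \<noteq> j" for i j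
  proof -
    have "e i \<noteq> e j" using e that unfolding n_def bij_betw_def by (auto simp: inj_on_def)
    then show ?thesis using E(4) eE that unfolding pairwise_def orthogonal_def by blast
  qed
  define W where "W c = (\<Sum>i<n. c i *\<^sub>R e i)" for c :: "nat \<Rightarrow> real"
  have Wdom: "W c \<in> dom" "D (W c) = (\<Sum>i<n. c i *\<^sub>R D (e i))" for c
    unfolding W_def using dom_sum[of "{..<n}" e c] edom by auto
  have Wspan: "W c \<in> span B" for c
    unfolding W_def E(2)[symmetric] using eE by (intro span_sum span_scale span_base) auto
  define F where "F c i = (W c - M (W c)) \<bullet> e i + T (D (M (W c))) \<bullet> D (e i) - f \<bullet> e i" for c i
  \<comment> \<open>By orthogonality \<open>bd / norm (e i)\<close> bounds the \<open>i\<close>-th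
    coefficient of every vector of norm at most \<open>bd\<close>; \<open>r\<close> exceeds all
    these numbers.\<close>
  define r where "r = 1 + (\<Sum>i<n. bd / norm (e i))"
  have r_gt: "bd / norm (e i) < r" if "i < n" for i
    using member_le_sum[of i "{..<n}" "\<lambda>i. bd / norm (e i)"] that bd_nonneg unfolding r_def by auto
  have "r > 0" unfolding r_def using bd_nonneg by (auto intro!: add_pos_nonneg sum_nonneg)
  moreover have "(\<lambda>k. F (c k) i) \<longlonglongrightarrow> F x i" if i: "i < n" and lim: "\<And>j. j < n \<Longrightarrow> (\<lambda>k. c k j) \<longlonglongrightarrow> x j" for c x i
  proof -
    have W: "(\<lambda>k. W (c k)) \<longlonglongrightarrow> W x" unfolding W_def by (intro tendsto_intros lim) auto
    have MW: "(\<lambda>k. M (W (c k))) \<longlonglongrightarrow> M (W x)"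
      by (rule LIM_zero_cancel, rule Lim_null_comparison[OF _ tendsto_norm_zero[OF LIM_zero[OF W]]])
         (use M_lip in auto)
    have "(\<lambda>k. D (W (c k))) \<longlonglongrightarrow> D (W x)" unfolding Wdom by (intro tendsto_intros lim) auto
    note bD = this
    obtain Z where Z: "\<And>k. norm (D (W (c k))) \<le> Z" using tendsto_norm_bounded[OF bD] by auto
    obtain Z' where Z': "\<And>k. norm (M (W (c k))) \<le> Z'" using tendsto_norm_bounded[OF MW] by auto
    \<comment> \<open>The gradient of \<open>M w\<close> depends on the coefficients only in a
      weakly continuous way. This is enough, because in \<open>F\<close> it is paired with the fixed
      vector \<open>T (D (e i))\<close>.\<close>
    have "wconv (\<lambda>k. D (M (W (c k)))) (D (M (W x)))"
    proof (rule wconv_D(2))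
      show "M (W (c k)) \<in> dom" for k using MN Wdom by blast
      show "wconv (\<lambda>k. M (W (c k))) (M (W x))" using wconv_if_tendsto[OF MW] .
      show "norm (M (W (c k))) \<le> Z'" for k using Z' .
      show "norm (D (M (W (c k)))) \<le> Z" for k
        using MN(4,5)[OF Wdom(1), of "c k"] Z[of k] by linarith
    qed
    from wconvD[OF this, of "T (D (e i))"]
    have "(\<lambda>k. T (D (M (W (c k)))) \<bullet> D (e i)) \<longlonglongrightarrow> T (D (M (W x))) \<bullet> D (e i)" by (simp add: T(2))
    then show ?thesis unfolding F_def
      by (intro tendsto_add tendsto_diff tendsto_inner[OF tendsto_diff[OF W MW]] tendsto_const)
  qed
  ultimately obtain x where x: "\<And>i. i < n \<Longrightarrow> \<bar>x i\<bar> \<le> r \<and> (x i > - r \<longrightarrow> F x i \<le> 0) \<and> (x i < r \<longrightarrow> F x i \<ge> 0)"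
    using box_variational_inequality[of r n F] by blast
  define w where "w = W x"
  have wdom: "w \<in> dom" unfolding w_def using Wdom by blast
  \<comment> \<open>A nonzero residual occurs only on a face, where its sign is opposite to that of
    the coordinate. The sum is the equation tested with \<open>w\<close>, so \<open>a_priori\<close>
    applies.\<close>
  have "(\<Sum>i<n. x i * F x i) \<le> 0"
  proof (rule sum_nonpos)
    fix i assume "i \<in> {..<n}"
    then have i: "x i > - r \<Longrightarrow> F x i \<le> 0" "x i < r \<Longrightarrow> F x i \<ge> 0" using x[of i] by auto
    consider "x i \<le> - r" | "x i \<ge> r" | "x i > - r" "x i < r" by linarith
    then show "x i * F x i \<le> 0"
    proof cases
      case 1
      then show ?thesis using i(2) \<open>r > 0\<close> by (intro mult_nonpos_nonneg) auto
    next
      case 2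
      then show ?thesis using i(1) \<open>r > 0\<close> by (intro mult_nonneg_nonpos) auto
    next
      case 3
      then show ?thesis using i by simp
    qed
  qed
  also have "(\<Sum>i<n. x i * F x i) = (w - M w) \<bullet> W x + T (D (M w)) \<bullet> D (W x) - f \<bullet> W x"
  proof -
    have "a \<bullet> W x = (\<Sum>i<n. x i * (a \<bullet> e i))" "b \<bullet> D (W x) = (\<Sum>i<n. x i * (b \<bullet> D (e i)))" for a b
      unfolding Wdom unfolding W_def by (simp_all add: inner_sum_right)
    then show ?thesis
      unfolding F_def w_def[symmetric] by (simp add: sum.distrib sum_subtractf right_diff_distrib distrib_left)
  qed
  finally have "norm w \<le> bd" using a_priori(1)[OF wdom] unfolding w_def by linarith
  have F0: "F x i = 0" if i: "i < n" for i
  proof -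
    have "w \<bullet> e i = (\<Sum>j<n. if j = i then x i * (e i \<bullet> e i) else 0)"
      unfolding w_def W_def inner_sum_left using eorth i by (intro sum.cong) auto
    then have "w \<bullet> e i = x i * (norm (e i))\<^sup>2" using i by (simp add: power2_norm_eq_inner)
    then have "\<bar>x i\<bar> * norm (e i) * norm (e i) \<le> norm w * norm (e i)"
      using Cauchy_Schwarz_ineq2[of w "e i"] by (simp add: abs_mult power2_eq_square)
    then have "\<bar>x i\<bar> * norm (e i) \<le> bd" using enz[OF i] \<open>norm w \<le> bd\<close> by (simp only: mult_le_cancel_right_pos)
    then have "\<bar>x i\<bar> \<le> bd / norm (e i)" using enz[OF i] by (simp add: field_simps)
    then have "\<bar>x i\<bar> < r" using r_gt[OF i] by linarith
    then show ?thesis using x[OF i] by (auto simp: abs_less_iff)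
  qed
  show ?thesis
  proof (intro bexI[of _ w] ballI)
    show "w \<in> span B" unfolding w_def by (rule Wspan)
    fix v assume "v \<in> span B"
    have "E \<subseteq> {v \<in> dom. (w - M w) \<bullet> v + T (D (M w)) \<bullet> D v = f \<bullet> v}"
    proof
      fix v assume v: "v \<in> E"
      then obtain i where "i < n" "v = e i" using e unfolding bij_betw_def n_def by auto
      then show "v \<in> {v \<in> dom. (w - M w) \<bullet> v + T (D (M w)) \<bullet> D v = f \<bullet> v}"
        using F0[of i] edom[of i] unfolding F_def w_def by auto
    qed
    moreover have "subspace {v \<in> dom. (w - M w) \<bullet> v + T (D (M w)) \<bullet> D v = f \<bullet> v}"
      unfolding subspace_def using dom_0 by (auto simp: D_linear D_scaleR inner_add_right algebra_simps)
        (simp add: distrib_left[symmetric])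
    ultimately have "span E \<subseteq> {v \<in> dom. (w - M w) \<bullet> v + T (D (M w)) \<bullet> D v = f \<bullet> v}"
      by (rule span_minimal)
    then show "(w - M w) \<bullet> v + T (D (M w)) \<bullet> D v = f \<bullet> v" using E(2) \<open>v \<in> span B\<close> by blast
  qed
qed

text \<open>Test the difference of the equations with \<open>M a - M b\<close>:
  \<open>R_mono\<close> gives the zero-order term a sign, so ellipticity and Poincare yield
  \<open>M a = M b\<close>. What remains says that \<open>a - b\<close> is orthogonal to
  \<open>dom\<close>, and density finishes.\<close>

lemma solution_unique:
  assumes "a \<in> K" "M a \<in> dom" and a: "\<And>v. v \<in> dom \<Longrightarrow> (a - M a) \<bullet> v + T (D (M a)) \<bullet> D v = f \<bullet> v"
    and "b \<in> K" "M b \<in> dom" and b: "\<And>v. v \<in> dom \<Longrightarrow> (b - M b) \<bullet> v + T (D (M b)) \<bullet> D v = f \<bullet> v"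
  shows "a = b"
proof -
  interpret T: bounded_linear T by (rule T(1))
  have diff: "(a - M a - (b - M b)) \<bullet> v + T (D (M a) - D (M b)) \<bullet> D v = 0" if "v \<in> dom" for v
    using a[OF that] b[OF that] by (simp add: T.diff inner_diff_left)
  have d: "M a - M b \<in> dom" "D (M a - M b) = D (M a) - D (M b)" using D_linear assms by auto
  have "lo * (norm (D (M a) - D (M b)))\<^sup>2 \<le> 0"
    using diff[OF d(1)] R_mono[of a b] T(3)[of "D (M a) - D (M b)"] d(2) by simp
  then have D0: "D (M a) - D (M b) = 0" using pos(4) by (simp add: mult_le_0_iff)
  have "norm (M a - M b) \<le> CP * norm (D (M a - M b))" by (rule poincare[OF G_D[OF d(1)]])
  then have MM: "M a = M b" using d(2) D0 by simp
  have "a - b = 0"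
  proof (rule dense)
    show "a - b \<in> K" using K assms subspace_diff by blast
    fix v g assume "(v, g) \<in> G"
    then have "v \<in> dom" by (rule domI)
    from diff[OF this] show "(a - b) \<bullet> v = 0" unfolding D0 MM by (simp add: T.zero)
  qed
  then show ?thesis by simp
qed

section \<open>Convergence of the discrete solutions\<close>

context
  fixes V :: "nat \<Rightarrow> 'h set" and w :: "nat \<Rightarrow> 'h" and wb :: 'h
  assumes Vd: "\<And>m. V m \<subseteq> dom"
    and dense_V: "\<And>\<phi>. \<phi> \<in> dom \<Longrightarrow> \<exists>v. (\<forall>m. v m \<in> V m) \<and> v \<longlonglongrightarrow> \<phi> \<and> (\<lambda>m. D (v m)) \<longlonglongrightarrow> D \<phi>"
    and w: "\<And>m. w m \<in> V m"
    and eq: "\<And>m v. v \<in> V m \<Longrightarrow> (w m - M (w m)) \<bullet> v + T (D (M (w m))) \<bullet> D v = f \<bullet> v"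
    and wb: "wb \<in> K" "M wb \<in> dom"
    and eqb: "\<And>v. v \<in> dom \<Longrightarrow> (wb - M wb) \<bullet> v + T (D (M wb)) \<bullet> D v = f \<bullet> v"
begin

lemma w_dom: "w m \<in> dom" using w Vd by blast

lemma w_bd: "norm (w m) \<le> bd" "norm (M (w m)) \<le> bd"
  "norm (D (N (w m))) \<le> sqrt (norm f * bd / lo)" "norm (D (M (w m))) \<le> sqrt (norm f * bd / lo)"
proof -
  have le: "(w m - M (w m)) \<bullet> w m + T (D (M (w m))) \<bullet> D (w m) \<le> f \<bullet> w m" using eq[OF w] by simp
  show 1: "norm (w m) \<le> bd" "norm (D (N (w m))) \<le> sqrt (norm f * bd / lo)"
    using a_priori[OF w_dom le] by (auto intro: real_le_rsqrt)
  show "norm (M (w m)) \<le> bd" using 1 M_le[of "w m"] by linarith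
  show "norm (D (M (w m))) \<le> sqrt (norm f * bd / lo)" using 1(2) MN(4)[OF w_dom, of m] by linarith
qed

lemma subseq_limits:
  assumes r: "strict_mono (r :: nat \<Rightarrow> nat)"
  shows "\<exists>s :: nat \<Rightarrow> nat. strict_mono s \<and> wconv (\<lambda>n. w (r (s n))) wb \<and> (\<lambda>n. M (w (r (s n)))) \<longlonglongrightarrow> M wb \<and>
    (\<lambda>n. N (w (r (s n)))) \<longlonglongrightarrow> N wb \<and> wconv (\<lambda>n. D (M (w (r (s n))))) (D (M wb)) \<and>
    N wb \<in> dom \<and> wconv (\<lambda>n. D (N (w (r (s n))))) (D (N wb))"
proof -
  obtain s1 w' where s1: "strict_mono s1" "wconv ((\<lambda>n. w (r n)) \<circ> s1) w'"
    using bounded_imp_wconv_subseq[of "\<lambda>n. w (r n)" bd] w_bd by auto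
  obtain s2 ch where s2: "strict_mono s2" "wconv ((\<lambda>n. M (w (r (s1 n)))) \<circ> s2) ch"
    using bounded_imp_wconv_subseq[of "\<lambda>n. M (w (r (s1 n)))" bd] w_bd by auto
  define q where "q n = r (s1 (s2 n))" for n
  have s12: "strict_mono (s1 \<circ> s2)" using s1 s2 strict_mono_o by blast
  have q: "strict_mono q" using strict_mono_o[OF r s12] by (simp add: q_def[abs_def] comp_def)
  have wq: "wconv (\<lambda>n. w (q n)) w'" using wconv_subseq[OF s1(2) s2(1)] by (simp add: comp_def q_def)
  have Mq: "wconv (\<lambda>n. M (w (q n))) ch" using s2(2) by (simp add: comp_def q_def)
  have Mlim: "(\<lambda>n. M (w (q n))) \<longlonglongrightarrow> ch"
    by (rule rellich[of _ "\<lambda>n. D (M (w (q n)))", OF G_D[OF MN(1)[OF w_dom]] w_bd(4) Mq])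
  have wq0: "wconv (\<lambda>n. w (q n) - w') 0"
    using wq unfolding wconv_def by (auto simp: inner_diff_left intro: LIM_zero)
  have wq0_bd: "norm (w (q n) - w') \<le> bd + norm w'" for n
    by (rule order_trans[OF norm_triangle_ineq4]) (use w_bd in auto)
  \<comment> \<open>The strong limit \<open>ch\<close> is not yet identified with
    \<open>M w'\<close>. The pairing vanishes in the limit all the same, because its weakly
    convergent factor tends to 0.\<close>
  have inner0: "(\<lambda>n. (w (q n) - w') \<bullet> (M (w (q n)) - M w')) \<longlonglongrightarrow> 0"
    using tendsto_inner_wconv[OF wq0 tendsto_diff[OF Mlim tendsto_const[of "M w'"]] wq0_bd] by simp
  have MM: "(\<lambda>n. M (w (q n))) \<longlonglongrightarrow> M w'" by (rule tendsto_if_sq_norm_le[OF firm_sq inner0])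
  have NN: "(\<lambda>n. N (w (q n))) \<longlonglongrightarrow> N w'" by (rule tendsto_if_sq_norm_le[OF N_sq inner0])
  have DM: "M w' \<in> dom" "wconv (\<lambda>n. D (M (w (q n)))) (D (M w'))"
    using wconv_D[OF MN(1)[OF w_dom] wconv_if_tendsto[OF MM] w_bd(2) w_bd(4)] by blast+
  obtain Z where Z: "\<And>k. norm (N (w (q k))) \<le> Z" using tendsto_norm_bounded[OF NN] by auto
  have DN: "N w' \<in> dom" "wconv (\<lambda>n. D (N (w (q n)))) (D (N w'))"
    using wconv_D[OF MN(2)[OF w_dom] wconv_if_tendsto[OF NN] Z w_bd(3)] by blast+
  have "w' = wb"
  proof (rule solution_unique)
    show "w' \<in> K"
      by (rule closed_convex_wconv_mem[OF wq w_bd(1) _ K(1) subspace_imp_convex[OF K(2)]])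
        (use w_dom dom_K in blast)
    fix v assume "v \<in> dom"
    then obtain vm where vm: "\<And>m. vm m \<in> V m" "vm \<longlonglongrightarrow> v" "(\<lambda>m. D (vm m)) \<longlonglongrightarrow> D v"
      using dense_V by blast
    have vq: "(\<lambda>n. vm (q n)) \<longlonglongrightarrow> v" "(\<lambda>n. D (vm (q n))) \<longlonglongrightarrow> D v"
      using LIMSEQ_subseq_LIMSEQ[OF vm(2) q] LIMSEQ_subseq_LIMSEQ[OF vm(3) q] by (auto simp: comp_def)
    interpret T: bounded_linear T by (rule T(1))
    \<comment> \<open>The test functions vary with \<open>n\<close>, as they must lie in
      \<open>V (q n)\<close>; they converge strongly together with their gradients, so weak
      convergence of the other factors suffices.\<close>
    have "(\<lambda>n. (w (q n)) \<bullet> vm (q n) - M (w (q n)) \<bullet> vm (q n) + D (M (w (q n))) \<bullet> T (D (vm (q n)))) \<longlonglongrightarrow>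
      w' \<bullet> v - M w' \<bullet> v + D (M w') \<bullet> T (D v)"
      by (intro tendsto_add tendsto_diff tendsto_inner_wconv[OF wq _ w_bd(1)] tendsto_inner MM vq
           tendsto_inner_wconv[OF DM(2) _ w_bd(4)] T.tendsto)
    moreover have "(w (q n)) \<bullet> vm (q n) - M (w (q n)) \<bullet> vm (q n) + D (M (w (q n))) \<bullet> T (D (vm (q n))) = f \<bullet> vm (q n)" for n
      using eq[OF vm(1), of "q n"] by (simp add: inner_diff_left T(2))
    ultimately have "(\<lambda>n. f \<bullet> vm (q n)) \<longlonglongrightarrow> w' \<bullet> v - M w' \<bullet> v + D (M w') \<bullet> T (D v)" by simp
    moreover have "(\<lambda>n. f \<bullet> vm (q n)) \<longlonglongrightarrow> f \<bullet> v" by (intro tendsto_intros vq)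
    ultimately have "w' \<bullet> v - M w' \<bullet> v + D (M w') \<bullet> T (D v) = f \<bullet> v" by (rule LIMSEQ_unique)
    then show "(w' - M w') \<bullet> v + T (D (M w')) \<bullet> D v = f \<bullet> v" by (simp add: inner_diff_left T(2))
  qed (use DM wb eqb in auto)
  then show ?thesis
    using s12 wq MM NN DM DN by (intro exI[of _ "s1 \<circ> s2"]) (simp add: q_def comp_def)
qed

text \<open>The chain rule says nothing about \<open>wb\<close>, of which only \<open>M wb\<close>
  is known to have a gradient. Membership is inherited from the bounded gradients of
  \<open>N (w n)\<close>.\<close>

lemma N_wb_dom: "N wb \<in> dom" using subseq_limits[of id] by (auto simp: strict_mono_def)

lemma galerkin_limits: "wconv w wb" "(\<lambda>n. M (w n)) \<longlonglongrightarrow> M wb" "(\<lambda>n. N (w n)) \<longlonglongrightarrow> N wb"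
  "wconv (\<lambda>n. D (M (w n))) (D (M wb))" "wconv (\<lambda>n. D (N (w n))) (D (N wb))"
  by (rule wconv_if_subseq_wconv tendsto_if_subseq_tendsto, use subseq_limits in blast)+

text \<open>\<open>X\<close> adds the monotone pairing of the \<rho>-terms and the elliptic energy
  of the gradient error. When expanded, its quadratic part is the discrete energy, equal to
  \<open>f \<bullet> w n\<close>, and the rest is linear in weakly convergent quantities; the energy
  equality makes the limit 0. Each summand dominates a square, and \<open>w\<close> is the sum of
  its \<rho>-part and \<open>M w\<close>.\<close>

lemma galerkin_strong_limits:
  assumes energy: "(wb - M wb) \<bullet> wb + T (D (N wb)) \<bullet> D (N wb) = f \<bullet> wb"
  shows "(\<lambda>n. D (N (w n))) \<longlonglongrightarrow> D (N wb)" "w \<longlonglongrightarrow> wb"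
proof -
  interpret T: bounded_linear T by (rule T(1))
  let ?n = "\<lambda>n. D (N (w n))" and ?nb = "D (N wb)"
  let ?r = "\<lambda>n. w n - M (w n)" and ?rb = "wb - M wb"
  have E: "?r n \<bullet> w n + T (?n n) \<bullet> ?n n = f \<bullet> w n" for n
    using eq[OF w, of n] MN(3)[OF w_dom, of n] by simp
  define X where "X n = (w n - wb) \<bullet> (?r n - ?rb) + T (?n n - ?nb) \<bullet> (?n n - ?nb)" for n
  have sym: "?nb \<bullet> T (?n n) = ?n n \<bullet> T ?nb" for n using T(2)[of "?n n" ?nb] by (simp add: inner_commute)
  have X: "X n = w n \<bullet> f - (w n \<bullet> ?rb) - (w n \<bullet> wb - M (w n) \<bullet> wb) + wb \<bullet> ?rb - 2 * (?n n \<bullet> T ?nb) + ?nb \<bullet> T ?nb" for n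
  proof -
    have "X n = (?r n \<bullet> w n + T (?n n) \<bullet> ?n n) - (w n \<bullet> ?rb) - (w n \<bullet> wb - M (w n) \<bullet> wb) + wb \<bullet> ?rb - 2 * (?n n \<bullet> T ?nb) + ?nb \<bullet> T ?nb"
      unfolding X_def by (simp add: T.diff inner_diff_left inner_diff_right T(2) inner_commute[of "T _"])
        (simp add: inner_commute sym)
    then show ?thesis unfolding E by (simp add: inner_commute)
  qed
  have "(\<lambda>n. X n) \<longlonglongrightarrow> wb \<bullet> f - (wb \<bullet> ?rb) - (wb \<bullet> wb - M wb \<bullet> wb) + wb \<bullet> ?rb - 2 * (?nb \<bullet> T ?nb) + ?nb \<bullet> T ?nb"
    unfolding X by (intro tendsto_add tendsto_diff tendsto_mult tendsto_const wconvD galerkin_limits tendsto_inner)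
  moreover have "wb \<bullet> f - (wb \<bullet> ?rb) - (wb \<bullet> wb - M wb \<bullet> wb) + wb \<bullet> ?rb - 2 * (?nb \<bullet> T ?nb) + ?nb \<bullet> T ?nb = 0"
    using energy inner_commute[of wb f] inner_commute[of wb "M wb"]
    by (simp add: inner_diff_left inner_diff_right T(2))
  ultimately have X0: "X \<longlonglongrightarrow> 0" by simp
  have 1: "lo * (norm (?n n - ?nb))\<^sup>2 \<le> X n" "(norm (?r n - ?rb))\<^sup>2 \<le> X n" for n
    using T(3)[of "?n n - ?nb"] R_firm[of "w n" wb] zero_le_power2[of "norm (?r n - ?rb)"]
      mult_nonneg_nonneg[OF less_imp_le[OF pos(4)] zero_le_power2[of "norm (?n n - ?nb)"]]
    unfolding X_def by linarith+
  show "(\<lambda>n. ?n n) \<longlonglongrightarrow> ?nb"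
    by (rule tendsto_if_sq_norm_le[OF _ tendsto_mult_right_zero[OF X0, of "1 / lo"]])
      (use 1(1) pos(4) in \<open>simp add: field_simps\<close>)
  have "(\<lambda>n. ?r n) \<longlonglongrightarrow> ?rb" by (rule tendsto_if_sq_norm_le[OF 1(2) X0])
  from tendsto_add[OF this galerkin_limits(2)] show "w \<longlonglongrightarrow> wb" by simp
qed

end

end


subsection \<open>The Hilbert space of square integrable functions\<close>

text \<open>Taken over the whole space, so that one type of classes serves every domain and
  translations act on it.\<close>

definition sq_int :: "('a::euclidean_space \<Rightarrow> 'b::euclidean_space) \<Rightarrow> bool" where
  "sq_int f \<longleftrightarrow> f \<in> borel_measurable lebesgue \<and> integrable lebesgue (\<lambda>x. (norm (f x))\<^sup>2)"

lemma sq_int_measurable[measurable_dest]: "sq_int f \<Longrightarrow> f \<in> borel_measurable lebesgue"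
  by (simp add: sq_int_def)

lemma sq_intD: "sq_int f \<Longrightarrow> integrable lebesgue (\<lambda>x. (norm (f x))\<^sup>2)"
  by (simp add: sq_int_def)

lemma sq_int_bound:
  assumes "f \<in> borel_measurable lebesgue" "integrable lebesgue g"
    "AE x in lebesgue. (norm (f x))\<^sup>2 \<le> g x"
  shows "sq_int f"
  unfolding sq_int_def using assms
  by (auto intro!: Bochner_Integration.integrable_bound[OF assms(2)] elim!: eventually_mono)

lemma norm_add_sq_le: "(norm (a + b))\<^sup>2 \<le> 2 * (norm a)\<^sup>2 + 2 * (norm (b::'a::real_inner))\<^sup>2"
proof -
  have "(norm (a + b))\<^sup>2 + (norm (a - b))\<^sup>2 = 2 * (norm a)\<^sup>2 + 2 * (norm b)\<^sup>2"
    unfolding power2_norm_eq_inner by (simp add: inner_simps inner_commute)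
  then show ?thesis using zero_le_power2[of "norm (a - b)"] by linarith
qed

lemma abs_inner_le_sq: "\<bar>a \<bullet> b\<bar> \<le> (norm a)\<^sup>2 + (norm (b::'a::real_inner))\<^sup>2"
proof -
  have "2 * (norm a * norm b) \<le> (norm a)\<^sup>2 + (norm b)\<^sup>2"
    using sum_squares_bound[of "norm a" "norm b"] by (simp add: mult.assoc)
  moreover have "0 \<le> norm a * norm b" by simp
  ultimately show ?thesis using Cauchy_Schwarz_ineq2[of a b] by linarith
qed

lemma sq_int_add: assumes "sq_int f" "sq_int g" shows "sq_int (\<lambda>x. f x + g x)"
  by (rule sq_int_bound[of _ "\<lambda>x. 2 * (norm (f x))\<^sup>2 + 2 * (norm (g x))\<^sup>2"])
    (use assms in \<open>auto simp: sq_int_def intro: norm_add_sq_le\<close>)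

lemma sq_int_scaleR: "sq_int f \<Longrightarrow> sq_int (\<lambda>x. c *\<^sub>R f x)"
  by (auto simp: sq_int_def power_mult_distrib)

lemma sq_int_uminus: "sq_int f \<Longrightarrow> sq_int (\<lambda>x. - f x)"
  by (auto simp: sq_int_def)

lemma sq_int_diff: "sq_int f \<Longrightarrow> sq_int g \<Longrightarrow> sq_int (\<lambda>x. f x - g x)"
  using sq_int_add[OF _ sq_int_uminus, of f g] by simp

lemma sq_int_zero: "sq_int (\<lambda>x. 0)" by (auto simp: sq_int_def)

lemma integrable_inner: assumes "sq_int f" "sq_int g" shows "integrable lebesgue (\<lambda>x. f x \<bullet> g x)"
proof (rule Bochner_Integration.integrable_bound)
  show "integrable lebesgue (\<lambda>x. (norm (f x))\<^sup>2 + (norm (g x))\<^sup>2)" using assms by (auto simp: sq_int_def)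
qed (use assms abs_inner_le_sq in \<open>auto simp: sq_int_def\<close>)

\<comment> \<open>The relation is reflexive exactly on square integrable functions, so computations
  with \<open>cls u\<close> carry \<open>sq_int u\<close> as a hypothesis.\<close>
quotient_type (overloaded) ('a, 'b) l2 = "'a::euclidean_space \<Rightarrow> 'b::euclidean_space" /
  partial: "\<lambda>f g. sq_int f \<and> sq_int g \<and> (AE x in lebesgue. f x = g x)"
  morphisms rep_l2 cls
proof (rule part_equivpI)
  show "\<exists>x. sq_int x \<and> sq_int x \<and> (AE xa in lebesgue. x xa = x xa)" using sq_int_zero by blast
  show "symp (\<lambda>f g. sq_int f \<and> sq_int g \<and> (AE x in lebesgue. f x = g x))"
    by (auto simp: symp_def elim: eventually_mono)
  show "transp (\<lambda>f g. sq_int f \<and> sq_int g \<and> (AE x in lebesgue. f x = g x))"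
    by (auto simp: transp_def elim: eventually_elim2)
qed

instantiation l2 :: (euclidean_space, euclidean_space) real_vector
begin

lift_definition zero_l2 :: "('a, 'b) l2" is "\<lambda>x. 0" by (auto intro: sq_int_zero)

lift_definition plus_l2 :: "('a, 'b) l2 \<Rightarrow> ('a, 'b) l2 \<Rightarrow> ('a, 'b) l2" is "\<lambda>f g x. f x + g x"
  by (auto intro: sq_int_add elim: eventually_elim2)

lift_definition minus_l2 :: "('a, 'b) l2 \<Rightarrow> ('a, 'b) l2 \<Rightarrow> ('a, 'b) l2" is "\<lambda>f g x. f x - g x"
  by (auto intro: sq_int_diff elim: eventually_elim2)

lift_definition uminus_l2 :: "('a, 'b) l2 \<Rightarrow> ('a, 'b) l2" is "\<lambda>f x. - f x"
  by (auto intro: sq_int_uminus elim: eventually_mono)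

lift_definition scaleR_l2 :: "real \<Rightarrow> ('a, 'b) l2 \<Rightarrow> ('a, 'b) l2" is "\<lambda>c f x. c *\<^sub>R f x"
  by (auto intro: sq_int_scaleR elim: eventually_mono)

instance
proof
  fix a b c :: "('a, 'b) l2" and r s :: real
  show "a + b + c = a + (b + c)"
    by transfer (auto intro!: sq_int_add simp: algebra_simps)
  show "a + b = b + a" by transfer (auto intro!: sq_int_add simp: algebra_simps)
  show "0 + a = a" by transfer auto
  show "- a + a = 0" by transfer (auto intro: sq_int_zero)
  show "a - b = a + - b" by transfer (auto intro!: sq_int_add sq_int_diff sq_int_uminus)
  show "r *\<^sub>R (a + b) = r *\<^sub>R a + r *\<^sub>R b"
    by transfer (auto intro!: sq_int_add sq_int_scaleR simp: algebra_simps)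
  show "(r + s) *\<^sub>R a = r *\<^sub>R a + s *\<^sub>R a"
    by transfer (auto intro!: sq_int_add sq_int_scaleR[of _ "_ + _"] sq_int_scaleR simp: scaleR_add_left)
  show "r *\<^sub>R s *\<^sub>R a = (r * s) *\<^sub>R a"
    by transfer (auto intro!: sq_int_scaleR)
  show "1 *\<^sub>R a = a" by transfer auto
qed

end

instantiation l2 :: (euclidean_space, euclidean_space) real_inner
begin

lift_definition inner_l2 :: "('a, 'b) l2 \<Rightarrow> ('a, 'b) l2 \<Rightarrow> real" is "\<lambda>f g. LINT x|lebesgue. f x \<bullet> g x"
  by (intro integral_cong_AE) (auto intro: borel_measurable_inner sq_int_measurable elim: eventually_elim2)

definition norm_l2 :: "('a, 'b) l2 \<Rightarrow> real" where "norm_l2 u = sqrt (u \<bullet> u)"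
definition dist_l2 :: "('a, 'b) l2 \<Rightarrow> ('a, 'b) l2 \<Rightarrow> real" where "dist_l2 u v = norm (u - v)"
definition sgn_l2 :: "('a, 'b) l2 \<Rightarrow> ('a, 'b) l2" where "sgn_l2 u = inverse (norm u) *\<^sub>R u"
definition uniformity_l2 :: "(('a, 'b) l2 \<times> ('a, 'b) l2) filter" where
  "uniformity_l2 = (INF e\<in>{0<..}. principal {(x, y). dist x y < e})"
definition open_l2 :: "('a, 'b) l2 set \<Rightarrow> bool" where
  "open_l2 U \<longleftrightarrow> (\<forall>x\<in>U. eventually (\<lambda>(x', y). x' = x \<longrightarrow> y \<in> U) uniformity)"

instance
proof
  fix a b c :: "('a, 'b) l2" and r s :: real
  show "sgn a = a /\<^sub>R norm a" by (simp add: sgn_l2_def)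
  show "a \<bullet> b = b \<bullet> a" by transfer (simp add: inner_commute)
  show "(a + b) \<bullet> c = a \<bullet> c + b \<bullet> c"
    by transfer (simp add: inner_add_left integrable_inner)
  show "(r *\<^sub>R a) \<bullet> b = r * (a \<bullet> b)" by transfer simp
  show "0 \<le> a \<bullet> a" by transfer simp
  show "(a \<bullet> a = 0) = (a = 0)"
  proof transfer
    fix f :: "'a \<Rightarrow> 'b" assume "sq_int f \<and> sq_int f \<and> (AE x in lebesgue. f x = f x)"
    then have f: "sq_int f" by simp
    have "(LINT x|lebesgue. f x \<bullet> f x) = 0 \<longleftrightarrow> (AE x in lebesgue. f x \<bullet> f x = 0)"
      by (rule integral_nonneg_eq_0_iff_AE) (auto intro: integrable_inner f)
    then show "((LINT x|lebesgue. f x \<bullet> f x) = 0) = (sq_int f \<and> sq_int (\<lambda>x. 0) \<and> (AE x in lebesgue. f x = (0::'b)))"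
      using f sq_int_zero by auto
  qed
  show "norm a = sqrt (a \<bullet> a)" by (simp add: norm_l2_def)
  show "dist a b = norm (a - b)" by (simp add: dist_l2_def)
  show "(uniformity :: (('a, 'b) l2 \<times> ('a, 'b) l2) filter) = (INF e\<in>{0<..}. principal {(x, y). dist x y < e})"
    by (simp add: uniformity_l2_def)
  show "open U = (\<forall>x\<in>U. \<forall>\<^sub>F (x', y) in uniformity. x' = x \<longrightarrow> y \<in> U)" for U :: "('a, 'b) l2 set"
    by (simp add: open_l2_def)
qed

end

lemma cls_eq_iff: "sq_int f \<Longrightarrow> sq_int g \<Longrightarrow> cls f = cls g \<longleftrightarrow> (AE x in lebesgue. f x = g x)"
  using Quotient3_rel[OF Quotient3_l2, of f g] by auto

lemma cls_surj: "\<exists>f. sq_int f \<and> u = cls f"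
  using Quotient3_rep_reflp[OF Quotient3_l2, of u] Quotient3_abs_rep[OF Quotient3_l2, of u]
  by (intro exI[of _ "rep_l2 u"]) simp

lemma cls_add: "sq_int f \<Longrightarrow> sq_int g \<Longrightarrow> cls f + cls g = cls (\<lambda>x. f x + g x)"
  by (simp add: plus_l2.abs_eq eq_onp_def)
lemma cls_diff: "sq_int f \<Longrightarrow> sq_int g \<Longrightarrow> cls f - cls g = cls (\<lambda>x. f x - g x)"
  by (simp add: minus_l2.abs_eq)
lemma cls_scaleR: "sq_int f \<Longrightarrow> c *\<^sub>R cls f = cls (\<lambda>x. c *\<^sub>R f x)"
  by (simp add: scaleR_l2.abs_eq)
lemma cls_zero: "0 = cls (\<lambda>x. 0)"
  by (simp add: zero_l2_def)
lemma cls_inner: "sq_int f \<Longrightarrow> sq_int g \<Longrightarrow> cls f \<bullet> cls g = (LINT x|lebesgue. f x \<bullet> g x)"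
  by (simp add: inner_l2.abs_eq)
lemma cls_norm: "sq_int f \<Longrightarrow> (norm (cls f))\<^sup>2 = (LINT x|lebesgue. (norm (f x))\<^sup>2)"
  by (simp add: power2_norm_eq_inner cls_inner)
lemma cls_dist: "sq_int f \<Longrightarrow> sq_int g \<Longrightarrow> (norm (cls f - cls g))\<^sup>2 = (LINT x|lebesgue. (norm (f x - g x))\<^sup>2)"
  by (simp add: cls_diff cls_norm sq_int_diff)

lemma cls_tendsto_iff:
  assumes "\<And>n. sq_int (f n)" "sq_int g"
  shows "(\<lambda>n. cls (f n)) \<longlonglongrightarrow> cls g \<longleftrightarrow> (\<lambda>n. LINT x|lebesgue. (norm (f n x - g x))\<^sup>2) \<longlonglongrightarrow> 0"
proof -
  have "(\<lambda>n. cls (f n)) \<longlonglongrightarrow> cls g \<longleftrightarrow> (\<lambda>n. norm (cls (f n) - cls g)) \<longlonglongrightarrow> 0"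
    by (rule trans[OF LIM_zero_iff[symmetric] tendsto_norm_zero_iff[symmetric]])
  also have "\<dots> \<longleftrightarrow> (\<lambda>n. (norm (cls (f n) - cls g))\<^sup>2) \<longlonglongrightarrow> 0"
    by simp
  finally show ?thesis by (simp add: cls_dist assms)
qed

lemma nn_integral_sq: "sq_int f \<Longrightarrow> (\<integral>\<^sup>+x. ennreal ((norm (f x))\<^sup>2) \<partial>lebesgue) = ennreal ((norm (cls f))\<^sup>2)"
  by (subst nn_integral_eq_integral) (auto simp: cls_norm sq_int_def)

text \<open>Yields square integrability and the norm bound of a pointwise limit at once;
  completeness applies it to the tails of a Cauchy sequence.\<close>

lemma sq_int_Fatou:
  assumes f: "\<And>n. sq_int (f n)" "\<And>n. norm (cls (f n)) \<le> B"
    and g: "g \<in> borel_measurable lebesgue" "AE x in lebesgue. (\<lambda>n. f n x) \<longlonglongrightarrow> g x"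
  shows "sq_int g" "norm (cls g) \<le> B"
proof -
  have B: "B \<ge> 0" using f(2)[of 0] norm_ge_zero order_trans by blast
  have [measurable]: "\<And>n. f n \<in> borel_measurable lebesgue" "g \<in> borel_measurable lebesgue"
    using f g by (auto simp: sq_int_def)
  have "(\<integral>\<^sup>+x. ennreal ((norm (g x))\<^sup>2) \<partial>lebesgue) = (\<integral>\<^sup>+x. liminf (\<lambda>n. ennreal ((norm (f n x))\<^sup>2)) \<partial>lebesgue)"
  proof (rule nn_integral_cong_AE, use g(2) in eventually_elim)
    case (elim x)
    then have "(\<lambda>n. ennreal ((norm (f n x))\<^sup>2)) \<longlonglongrightarrow> ennreal ((norm (g x))\<^sup>2)"
      by (intro tendsto_intros)
    then show ?case using lim_imp_Liminf[of sequentially] by (metis trivial_limit_sequentially)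
  qed
  also have "\<dots> \<le> liminf (\<lambda>n. \<integral>\<^sup>+x. ennreal ((norm (f n x))\<^sup>2) \<partial>lebesgue)"
    by (rule nn_integral_liminf) auto
  also have "\<dots> \<le> liminf (\<lambda>n::nat. ennreal (B\<^sup>2))"
    by (intro Liminf_mono always_eventually allI)
      (use f in \<open>auto simp: nn_integral_sq intro!: ennreal_leI power_mono\<close>)
  also have "\<dots> = ennreal (B\<^sup>2)" by (simp add: Liminf_const)
  finally have le: "(\<integral>\<^sup>+x. ennreal ((norm (g x))\<^sup>2) \<partial>lebesgue) \<le> ennreal (B\<^sup>2)" .
  have "integrable lebesgue (\<lambda>x. (norm (g x))\<^sup>2)"
    by (rule integrableI_bounded) (use le in \<open>auto simp: order_le_less_trans[OF _ ennreal_less_top]\<close>)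
  then show sq: "sq_int g" using g by (simp add: sq_int_def)
  show "norm (cls g) \<le> B"
    by (rule power2_le_imp_le) (use le B in \<open>auto simp: nn_integral_sq[OF sq]\<close>)
qed

text \<open>The Riesz-Fischer theorem. Along a fast subsequence a weighted series of squared
  increments is integrable, hence finite almost everywhere, which forces pointwise convergence;
  Fatou then turns the pointwise limit into a limit in norm.\<close>

instance l2 :: (euclidean_space, euclidean_space) complete_space
proof
  fix X :: "nat \<Rightarrow> ('a, 'b) l2" assume X: "Cauchy X"
  have "\<exists>M. \<forall>m\<ge>M. \<forall>n\<ge>M. norm (X m - X n) < (1/8) ^ k" for k :: nat
    using CauchyD[OF X, of "(1/8)^k"] by simp
  then obtain M where M: "\<And>k m n. m \<ge> M k \<Longrightarrow> n \<ge> M k \<Longrightarrow> norm (X m - X n) < (1/8) ^ k" by metis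
  \<comment> \<open>The sum dominates every \<open>M k\<close>, and the added \<open>k\<close> makes
    \<open>r\<close> strictly increasing.\<close>
  define r where "r k = (\<Sum>j\<le>k. M j) + k" for k
  have rM: "M k \<le> r k" "r k \<le> r (Suc k)" for k
    unfolding r_def using member_le_sum[of k "{..k}" M] by auto
  have r: "strict_mono r" unfolding strict_mono_Suc_iff r_def by simp
  obtain F where F: "\<And>n. sq_int (F n)" "\<And>n. X (r n) = cls (F n)" proof -
    have "\<forall>n. \<exists>f. sq_int f \<and> X (r n) = cls f" using cls_surj by blast
    from choice[OF this] show ?thesis using that by blast
  qed
  have [measurable]: "\<And>n. F n \<in> borel_measurable lebesgue" using F(1) by (auto simp: sq_int_def)
  have d: "norm (cls (\<lambda>x. F (Suc n) x - F n x)) \<le> (1/8)^n" for n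
    using M[of n "r (Suc n)" "r n"] rM[of n] F by (simp add: cls_diff)
  \<comment> \<open>Increments of norm at most \<open>(1/8)^n\<close> leave the summable
    \<open>(1/16)^n\<close> after weighting with \<open>4^n\<close>. Where \<open>S\<close> is
    finite, the same weight bounds the \<open>n\<close>-th increment by a multiple of
    \<open>(1/2)^n\<close>.\<close>
  define S where "S x = (\<Sum>n. ennreal (4 ^ n * (norm (F (Suc n) x - F n x))\<^sup>2))" for x
  have "(\<integral>\<^sup>+x. S x \<partial>lebesgue) = (\<Sum>n. \<integral>\<^sup>+x. ennreal (4 ^ n * (norm (F (Suc n) x - F n x))\<^sup>2) \<partial>lebesgue)"
    unfolding S_def by (rule nn_integral_suminf) measurable
  also have "\<dots> \<le> (\<Sum>n. ennreal ((1/2)^n))"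
  proof (rule suminf_le)
    fix n
    have "(\<integral>\<^sup>+x. ennreal (4 ^ n * (norm (F (Suc n) x - F n x))\<^sup>2) \<partial>lebesgue)
       = ennreal (4^n) * ennreal ((norm (cls (\<lambda>x. F (Suc n) x - F n x)))\<^sup>2)"
      by (subst nn_integral_sq[symmetric])
        (auto simp: ennreal_mult nn_integral_cmult F intro: sq_int_diff)
    also have "\<dots> = ennreal (4^n * (norm (cls (\<lambda>x. F (Suc n) x - F n x)))\<^sup>2)"
      by (simp add: ennreal_mult)
    also have "\<dots> \<le> ennreal (4^n * ((1/8)^n)\<^sup>2)"
      by (intro ennreal_leI mult_left_mono power_mono d) auto
    also have "4^n * ((1/8)^n)\<^sup>2 = ((1/16)::real)^n"
      by (simp add: power2_eq_square flip: power_mult_distrib)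
    also have "ennreal ((1/16)^n) \<le> ennreal ((1/2)^n)" by (intro ennreal_leI power_mono) auto
    finally show "(\<integral>\<^sup>+x. ennreal (4 ^ n * (norm (F (Suc n) x - F n x))\<^sup>2) \<partial>lebesgue) \<le> ennreal ((1/2)^n)" .
  qed auto
  also have "(\<Sum>n. ennreal ((1/2)^n)) = ennreal (\<Sum>n. (1/2)^n)"
    by (rule suminf_ennreal2) (auto simp: summable_geometric)
  finally have "(\<integral>\<^sup>+x. S x \<partial>lebesgue) < top" by (simp add: order_le_less_trans[OF _ ennreal_less_top])
  then have fin: "AE x in lebesgue. S x \<noteq> \<infinity>"
    by (intro nn_integral_noteq_infinite) (auto simp: S_def)
  have conv: "AE x in lebesgue. convergent (\<lambda>n. F n x)"
    using fin
  proof eventually_elim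
    case (elim x)
    define C where "C = enn2real (S x)"
    have "S x < top" using elim by (simp add: top.not_eq_extremum)
    then have C: "S x = ennreal C" unfolding C_def by (rule ennreal_enn2real[symmetric])
    have le: "norm (F (Suc n) x - F n x) \<le> sqrt C * (1/2)^n" for n
    proof (rule power2_le_imp_le)
      have "ennreal (4 ^ n * (norm (F (Suc n) x - F n x))\<^sup>2) \<le> S x"
      proof -
        have "(\<Sum>k\<in>{n}. ennreal (4 ^ k * (norm (F (Suc k) x - F k x))\<^sup>2)) \<le> S x"
          unfolding S_def by (rule sum_le_suminf) auto
        then show ?thesis by (simp only: sum.insert sum.empty finite.emptyI empty_iff add_0_right not_False_eq_True)
      qed
      then have "4 ^ n * (norm (F (Suc n) x - F n x))\<^sup>2 \<le> C"
        unfolding C by (rule ennreal_le_iff[THEN iffD1, rotated]) (simp add: C_def)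
      then have "(norm (F (Suc n) x - F n x))\<^sup>2 \<le> C * (1/4)^n" by (simp add: field_simps)
      also have "C * (1/4)^n = (sqrt C * (1/2)^n)\<^sup>2"
      proof -
        have "((1/2::real)^n)\<^sup>2 = (1/4)^n" by (simp add: power2_eq_square flip: power_mult_distrib)
        then show ?thesis by (simp add: power_mult_distrib C_def)
      qed
      finally show "(norm (F (Suc n) x - F n x))\<^sup>2 \<le> (sqrt C * (1/2)^n)\<^sup>2" .
    qed (simp add: C_def)
    have "summable (\<lambda>n. F (Suc n) x - F n x)"
      by (rule summable_comparison_test'[of "\<lambda>n. sqrt C * (1/2)^n" 0]) (use le in \<open>auto intro: summable_mult summable_geometric\<close>)
    then have "convergent (\<lambda>n. \<Sum>k<n. F (Suc k) x - F k x)" by (simp add: summable_iff_convergent)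
    then have "convergent (\<lambda>n. F n x - F 0 x)" by (simp add: sum_lessThan_telescope[of "\<lambda>n. F n x"])
    from convergent_add[OF this convergent_const[of "F 0 x"]] show ?case by simp
  qed
  define g where "g x = lim (\<lambda>n. F n x)" for x
  have g: "g \<in> borel_measurable lebesgue" unfolding g_def by (rule borel_measurable_lim_metric) simp
  have lim: "AE x in lebesgue. (\<lambda>n. F n x) \<longlonglongrightarrow> g x"
    using conv by eventually_elim (simp add: g_def convergent_LIMSEQ_iff)
  have est: "sq_int (\<lambda>x. F n x - g x)" "norm (cls (\<lambda>x. F n x - g x)) \<le> (1/8)^n" for n
  proof -
    have 1: "sq_int (\<lambda>x. F n x - F (m + n) x)" for m using F(1) sq_int_diff by blast
    have mono: "r n \<le> r (m + n)" for m using r by (simp add: strict_mono_less_eq)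
    have 2: "norm (cls (\<lambda>x. F n x - F (m + n) x)) \<le> (1/8)^n" for m
      using M[of n "r n" "r (m + n)"] rM[of n] mono[of m] F by (simp add: cls_diff)
    have 3: "AE x in lebesgue. (\<lambda>m. F n x - F (m + n) x) \<longlonglongrightarrow> F n x - g x"
      using lim by eventually_elim (intro tendsto_intros LIMSEQ_ignore_initial_segment)
    show "sq_int (\<lambda>x. F n x - g x)" "norm (cls (\<lambda>x. F n x - g x)) \<le> (1/8)^n"
      by (rule sq_int_Fatou[OF 1 2 _ 3], use g in measurable)+
  qed
  have sqg: "sq_int g" using sq_int_diff[OF F(1)[of 0] est(1)[of 0]] by simp
  have "(\<lambda>n. X (r n)) \<longlonglongrightarrow> cls g"
  proof (rule LIM_zero_cancel, rule Lim_null_comparison)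
    show "\<forall>\<^sub>F n in sequentially. norm (X (r n) - cls g) \<le> (1/8)^n"
      using est F sqg by (simp add: cls_diff)
    show "(\<lambda>n. (1/8::real)^n) \<longlonglongrightarrow> 0" by (rule LIMSEQ_power_zero) simp
  qed
  then show "convergent X"
    using X r Cauchy_converges_subseq unfolding convergent_def comp_def by blast
qed

lemma cls_tendsto_AE_subseq:
  assumes "\<And>n. sq_int (f n)" "sq_int g" "(\<lambda>n. cls (f n)) \<longlonglongrightarrow> cls g"
  shows "\<exists>r. strict_mono (r :: nat \<Rightarrow> nat) \<and> (AE x in lebesgue. (\<lambda>n. f (r n) x) \<longlonglongrightarrow> g x)"
proof -
  have lim: "(\<lambda>n. LINT x|lebesgue. (norm (f n x - g x))\<^sup>2) \<longlonglongrightarrow> 0"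
    using cls_tendsto_iff[of f g] assms by blast
  obtain r where r: "strict_mono (r :: nat \<Rightarrow> nat)" "AE x in lebesgue. (\<lambda>n. (norm (f (r n) x - g x))\<^sup>2) \<longlonglongrightarrow> 0"
  proof -
    have "integrable lebesgue (\<lambda>x. (norm (f n x - g x))\<^sup>2)" for n
      by (rule sq_intD[OF sq_int_diff[OF assms(1,2)]])
    moreover have "(\<lambda>n. LINT x|lebesgue. norm ((norm (f n x - g x))\<^sup>2)) \<longlonglongrightarrow> 0" using lim by simp
    ultimately show ?thesis using that tendsto_L1_AE_subseq[of "lebesgue" "\<lambda>n x. (norm (f n x - g x))\<^sup>2"] by blast
  qed
  have "AE x in lebesgue. (\<lambda>n. f (r n) x) \<longlonglongrightarrow> g x"
    using r(2)
  proof eventually_elim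
    case (elim x)
    then have "(\<lambda>n. norm (f (r n) x - g x)) \<longlonglongrightarrow> 0" by simp
    then show ?case by (rule LIM_zero_cancel[OF tendsto_norm_zero_cancel])
  qed
  then show ?thesis using r(1) by blast
qed


subsection \<open>Smooth functions\<close>

lemma partial_eq: "(f has_derivative f') (at x) \<Longrightarrow> partial i f x = f' (axis i 1)"
  unfolding partial_def using frechet_derivative_at by metis

text \<open>Smoothness asks for all iterated partial derivatives; a class stable under
  \<open>partial\<close> settles them together, without computing any of them.\<close>

lemma smooth_coinduct:
  assumes "\<phi> \<in> S" "\<And>\<phi> x. \<phi> \<in> S \<Longrightarrow> \<phi> differentiable (at x)" "\<And>\<phi> i. \<phi> \<in> S \<Longrightarrow> partial i \<phi> \<in> S"
  shows "smooth \<phi>"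
proof -
  have "foldr partial is \<phi> \<in> S" for "is" by (induction "is") (use assms in auto)
  then show ?thesis unfolding smooth_def using assms(2) by blast
qed

lemma smooth_differentiable: "smooth \<phi> \<Longrightarrow> \<phi> differentiable (at x)"
  unfolding smooth_def by (metis foldr.simps(1) id_apply)

lemma smooth_partial: assumes "smooth \<phi>" shows "smooth (partial i \<phi>)"
  unfolding smooth_def
proof (intro allI)
  fix "is" x
  have "foldr partial (is @ [i]) \<phi> differentiable (at x)" using assms unfolding smooth_def by blast
  then show "foldr partial is (partial i \<phi>) differentiable (at x)" by simp
qed

lemma smooth_continuous: "smooth \<phi> \<Longrightarrow> continuous_on S \<phi>"
  by (meson continuous_at_imp_continuous_on differentiable_imp_continuous_within smooth_differentiable)

text \<open>The classical flat function is the case \<open>p = 1\<close>. Carrying a polynomial in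
  \<open>1 / t\<close> makes the family closed under differentiation.\<close>

definition flat :: "real poly \<Rightarrow> real \<Rightarrow> real" where
  "flat p t = (if t > 0 then poly p (1 / t) * exp (- (1 / t)) else 0)"

lemma poly_div_exp_tendsto_0: "((\<lambda>x::real. poly p x / exp x) \<longlongrightarrow> 0) at_top"
proof -
  have "((\<lambda>x. \<Sum>i\<le>degree p. coeff p i * (x ^ i / exp x)) \<longlongrightarrow> (\<Sum>i\<le>degree p. coeff p i * 0)) at_top"
    by (intro tendsto_intros tendsto_power_div_exp_0)
  then show ?thesis by (simp add: poly_altdef sum_divide_distrib)
qed

text \<open>With \<open>s = 1 / t\<close> the derivative in \<open>t\<close> is minus
  \<open>s\<close> squared times that in \<open>s\<close>; applied to
  \<open>poly p s * exp (- s)\<close> it gives the stated polynomial, \<open>[:0,0,1:]\<close> being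
  \<open>s\<close> squared. At 0 the exponential beats every polynomial.\<close>

lemma flat_deriv: "(flat p has_real_derivative flat ([:0,0,1:] * (p - pderiv p)) t) (at t)"
proof -
  consider "t > 0" | "t < 0" | "t = 0" by linarith
  then show ?thesis
  proof cases
    case 1
    have "((\<lambda>t. poly p (1 / t) * exp (- (1 / t))) has_real_derivative
        flat ([:0,0,1:] * (p - pderiv p)) t) (at t)"
      using 1 by (auto intro!: derivative_eq_intros poly_DERIV[THEN DERIV_chain2]
          simp: flat_def field_simps power2_eq_square)
    then show ?thesis
      by (rule has_field_derivative_transform_within_open[of _ _ _ "{0<..}"]) (use 1 in \<open>auto simp: flat_def\<close>)
  next
    case 2
    have "((\<lambda>t. 0) has_real_derivative flat ([:0,0,1:] * (p - pderiv p)) t) (at t)"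
      using 2 by (simp add: flat_def)
    then show ?thesis
      by (rule has_field_derivative_transform_within_open[of _ _ _ "{..<0}"]) (use 2 in \<open>auto simp: flat_def\<close>)
  next
    case 3
    have "((\<lambda>h. flat p h / h) \<longlongrightarrow> 0) (at_left 0)"
      by (rule tendsto_eventually) (auto simp: eventually_at_filter flat_def)
    moreover have "((\<lambda>h. flat p h / h) \<longlongrightarrow> 0) (at_right 0)"
    proof -
      \<comment> \<open>\<open>pCons 0 p\<close> is \<open>p\<close> times its variable
        \<open>inverse h\<close>; it absorbs the division by \<open>h\<close>.\<close>
      have "((\<lambda>h. poly (pCons 0 p) (inverse h) / exp (inverse h)) \<longlongrightarrow> 0) (at_right (0::real))"
        by (rule filterlim_compose[OF poly_div_exp_tendsto_0 filterlim_inverse_at_top_right])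
      then show ?thesis
        by (rule Lim_transform_eventually)
          (auto simp: eventually_at_filter flat_def exp_minus field_simps)
    qed
    ultimately have "((\<lambda>h. flat p h / h) \<longlongrightarrow> 0) (at 0)" by (simp add: filterlim_split_at)
    then show ?thesis using 3 by (simp add: DERIV_def flat_def)
  qed
qed

text \<open>A class stable under \<open>partial\<close> that contains the building blocks of bump
  functions. Admitting all smooth functions as a base case also yields closure of smoothness under
  sums and products.\<close>

inductive smooth_alg :: "(real^'n::finite \<Rightarrow> real) \<Rightarrow> bool" where
  base: "smooth f \<Longrightarrow> smooth_alg f"
| const: "smooth_alg (\<lambda>x. c)"
| coord: "smooth_alg (\<lambda>x. x $ i)"
| flat: "smooth_alg (\<lambda>x. flat p (c * x $ i + d))"
| add: "smooth_alg f \<Longrightarrow> smooth_alg g \<Longrightarrow> smooth_alg (\<lambda>x. f x + g x)"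
| mult: "smooth_alg f \<Longrightarrow> smooth_alg g \<Longrightarrow> smooth_alg (\<lambda>x. f x * g x)"

lemma flat_has_derivative:
  "((\<lambda>x. flat p (c * x $ i + d)) has_derivative
     (\<lambda>h. flat ([:0,0,1:] * (p - pderiv p)) (c * x $ i + d) * (c * h $ i))) (at (x :: real^'n::finite))"
proof -
  have "((\<lambda>x. c * x $ i + d) has_derivative (\<lambda>h. c * h $ i)) (at x)"
    by (auto intro!: derivative_eq_intros bounded_linear.has_derivative[OF bounded_linear_vec_nth])
  from has_derivative_compose[OF this flat_deriv[THEN has_field_derivative_imp_has_derivative]]
  show ?thesis .
qed

lemma partial_add:
  assumes "f differentiable (at x)" "g differentiable (at x)"
  shows "partial i (\<lambda>x. f x + g x) x = partial i f x + partial i g x"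
proof -
  have "((\<lambda>x. f x + g x) has_derivative (\<lambda>h. frechet_derivative f (at x) h + frechet_derivative g (at x) h)) (at x)"
    using assms by (intro has_derivative_add) (auto simp: frechet_derivative_works)
  from partial_eq[OF this] show ?thesis by (simp add: partial_def)
qed

lemma partial_mult:
  assumes "f differentiable (at x)" "g differentiable (at x)"
  shows "partial i (\<lambda>x. f x * g x) x = partial i f x * g x + f x * partial i g x"
proof -
  have "((\<lambda>x. f x * g x) has_derivative (\<lambda>h. f x * frechet_derivative g (at x) h + frechet_derivative f (at x) h * g x)) (at x)"
    using assms by (intro has_derivative_mult) (auto simp: frechet_derivative_works)
  from partial_eq[OF this] show ?thesis by (simp add: partial_def)
qed

lemma smooth_alg_smooth:
  assumes "smooth_alg f" shows "smooth f"
proof (rule smooth_coinduct)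
  show "f \<in> Collect smooth_alg" using assms by simp
  show diff: "\<phi> differentiable (at x)" if "\<phi> \<in> Collect smooth_alg" for \<phi> :: "real^'n \<Rightarrow> real" and x
  proof -
    from that have "smooth_alg \<phi>" by simp
    then show ?thesis
    proof (induction \<phi>)
      case (base f) then show ?case by (rule smooth_differentiable)
    next
      case (coord i) show ?case
        using bounded_linear.has_derivative[OF bounded_linear_vec_nth has_derivative_ident] differentiable_def by blast
    next
      case (flat p c i d) show ?case using flat_has_derivative differentiable_def by blast
    qed (auto intro: differentiable_add differentiable_mult)
  qed
  show "partial i \<phi> \<in> Collect smooth_alg" if "\<phi> \<in> Collect smooth_alg" for \<phi> :: "real^'n \<Rightarrow> real" and i
  proof -
    from that have "smooth_alg \<phi>" by simp
    then have "smooth_alg (partial i \<phi>)"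
    proof (induction \<phi>)
      case (base f) then show ?case by (intro smooth_alg.base smooth_partial)
    next
      case (const c)
      have "partial i (\<lambda>x::real^'n. c) = (\<lambda>x. 0)" by (auto simp: partial_def)
      then show ?case using smooth_alg.const by metis
    next
      case (coord j)
      have "partial i (\<lambda>x::real^'n. x $ j) = (\<lambda>x. axis i 1 $ j)"
        by (rule ext, rule partial_eq[OF bounded_linear.has_derivative[OF bounded_linear_vec_nth has_derivative_ident]])
      then show ?case by (simp add: smooth_alg.const)
    next
      case (flat p c j d)
      have "partial i (\<lambda>x::real^'n. flat p (c * x $ j + d)) =
         (\<lambda>x. (c * axis i 1 $ j) * flat ([:0,0,1:] * (p - pderiv p)) (c * x $ j + d))"
        by (rule ext, subst partial_eq[OF flat_has_derivative]) (simp only: mult_ac)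
      then show ?case by (simp only:) (intro smooth_alg.mult smooth_alg.const smooth_alg.flat)
    next
      case (add f g)
      have "partial i (\<lambda>x. f x + g x) = (\<lambda>x. partial i f x + partial i g x)"
        using diff add by (intro ext partial_add) auto
      then show ?case using add by (simp add: smooth_alg.add)
    next
      case (mult f g)
      have "partial i (\<lambda>x. f x * g x) = (\<lambda>x. partial i f x * g x + f x * partial i g x)"
        using diff mult by (intro ext partial_mult) auto
      then show ?case using mult by (simp add: smooth_alg.add smooth_alg.mult)
    qed
    then show ?thesis by simp
  qed
qed

lemma smooth_add: "smooth f \<Longrightarrow> smooth g \<Longrightarrow> smooth (\<lambda>x. f x + g x)"
  and smooth_mult: "smooth f \<Longrightarrow> smooth g \<Longrightarrow> smooth (\<lambda>x. f x * g x)"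
  by (auto intro: smooth_alg_smooth smooth_alg.intros)

lemma smooth_const: "smooth (\<lambda>x. c)"
  and smooth_coord: "smooth (\<lambda>x. x $ i)"
  and smooth_flat: "smooth (\<lambda>x. flat p (c * x $ i + d))"
  by (auto intro: smooth_alg_smooth smooth_alg.intros)

lemma smooth_prod: "finite I \<Longrightarrow> (\<And>i. i \<in> I \<Longrightarrow> smooth (f i)) \<Longrightarrow> smooth (\<lambda>x. \<Prod>i\<in>I. f i x)"
  by (induction I rule: finite_induct) (auto intro: smooth_const smooth_mult)

lemma smooth_poly: "smooth f \<Longrightarrow> smooth (\<lambda>x. poly p (f x))"
  by (induction p) (auto intro: smooth_const smooth_mult smooth_add)

lemma partial_poly:
  assumes "f differentiable (at x)"
  shows "partial i (\<lambda>x. poly p (f x)) x = poly (pderiv p) (f x) * partial i f x"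
proof -
  have "((\<lambda>x. poly p (f x)) has_derivative (\<lambda>h. poly (pderiv p) (f x) * frechet_derivative f (at x) h)) (at x)"
    using assms
    by (intro has_derivative_compose[OF _ poly_DERIV[THEN has_field_derivative_imp_has_derivative]])
      (auto simp: frechet_derivative_works)
  from partial_eq[OF this] show ?thesis by (simp add: partial_def)
qed

lemma cgrad_inner:
  assumes "f differentiable (at x)" shows "frechet_derivative f (at x) h = cgrad f x \<bullet> h"
proof -
  have lin: "linear (frechet_derivative f (at x))" by (rule linear_frechet_derivative[OF assms])
  have "frechet_derivative f (at x) h = frechet_derivative f (at x) (\<Sum>i\<in>UNIV. h $ i *\<^sub>R axis i 1)"
    using basis_expansion[of h] by (simp add: scalar_mult_eq_scaleR)
  also have "\<dots> = (\<Sum>i\<in>UNIV. h $ i * frechet_derivative f (at x) (axis i 1))"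
    by (simp add: linear_sum[OF lin] linear_cmul[OF lin])
  also have "\<dots> = cgrad f x \<bullet> h" by (simp add: cgrad_def partial_def inner_vec_def mult.commute)
  finally show ?thesis .
qed

lemma smooth_continuous_cgrad: "smooth \<phi> \<Longrightarrow> continuous_on S (cgrad \<phi>)"
  unfolding cgrad_def by (intro continuous_on_vec_lambda smooth_continuous smooth_partial)

subsection \<open>Test functions\<close>

lemma test_funE:
  assumes "test_fun \<Omega> \<phi>" obtains K where "compact K" "K \<subseteq> \<Omega>" "\<And>x. x \<notin> K \<Longrightarrow> \<phi> x = 0"
  using assms unfolding test_fun_def by blast

lemma test_fun_smooth: "test_fun \<Omega> \<phi> \<Longrightarrow> smooth \<phi>"
  by (simp add: test_fun_def)

lemma test_fun_zero: "test_fun \<Omega> (\<lambda>x. 0)"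
  unfolding test_fun_def by (auto intro!: smooth_const exI[of _ "{}"])

lemma test_fun_add:
  assumes "test_fun \<Omega> \<phi>" "test_fun \<Omega> \<psi>" shows "test_fun \<Omega> (\<lambda>x. \<phi> x + \<psi> x)"
proof -
  obtain K L where "compact K" "K \<subseteq> \<Omega>" "\<And>x. x \<notin> K \<Longrightarrow> \<phi> x = 0" "compact L" "L \<subseteq> \<Omega>" "\<And>x. x \<notin> L \<Longrightarrow> \<psi> x = 0"
    using assms by (metis test_funE)
  then show ?thesis unfolding test_fun_def
    by (intro conjI smooth_add test_fun_smooth[OF assms(1)] test_fun_smooth[OF assms(2)] exI[of _ "K \<union> L"]) auto
qed

lemma test_fun_smooth_mult:
  assumes "test_fun \<Omega> \<phi>" "smooth \<psi>" shows "test_fun \<Omega> (\<lambda>x. \<psi> x * \<phi> x)"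
proof -
  obtain K where "compact K" "K \<subseteq> \<Omega>" "\<And>x. x \<notin> K \<Longrightarrow> \<phi> x = 0" using assms by (metis test_funE)
  then show ?thesis unfolding test_fun_def
    by (intro conjI smooth_mult test_fun_smooth[OF assms(1)] assms(2) exI[of _ K]) auto
qed

lemma test_fun_cmult: "test_fun \<Omega> \<phi> \<Longrightarrow> test_fun \<Omega> (\<lambda>x. c * \<phi> x)"
  by (rule test_fun_smooth_mult[OF _ smooth_const])

lemma partial_zero_outside:
  assumes "closed K" "\<And>x. x \<notin> K \<Longrightarrow> \<phi> x = 0" "x \<notin> K"
  shows "partial i \<phi> x = 0"
proof (rule partial_eq)
  show "(\<phi> has_derivative (\<lambda>h. 0)) (at x)"
    by (rule has_derivative_transform_within_open[of "\<lambda>x. 0" _ _ _ "- K"]) (use assms in auto)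
qed

lemma test_fun_partial:
  assumes "test_fun \<Omega> \<phi>" shows "test_fun \<Omega> (partial i \<phi>)"
proof -
  obtain K where K: "compact K" "K \<subseteq> \<Omega>" "\<And>x. x \<notin> K \<Longrightarrow> \<phi> x = 0" using assms by (metis test_funE)
  then show ?thesis unfolding test_fun_def
    using partial_zero_outside[of K \<phi>] by (auto intro!: smooth_partial test_fun_smooth[OF assms] exI[of _ K] simp: compact_imp_closed)
qed

lemma test_fun_poly:
  assumes "test_fun \<Omega> \<phi>" "poly p 0 = 0" shows "test_fun \<Omega> (\<lambda>x. poly p (\<phi> x))"
proof -
  obtain K where K: "compact K" "K \<subseteq> \<Omega>" "\<And>x. x \<notin> K \<Longrightarrow> \<phi> x = 0" using assms by (metis test_funE)
  then show ?thesis unfolding test_fun_def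
    using assms(2) by (auto intro!: smooth_poly test_fun_smooth[OF assms(1)] exI[of _ K])
qed

lemma test_fun_bounded:
  assumes "test_fun \<Omega> \<phi>" shows "\<exists>B. \<forall>x. \<bar>\<phi> x\<bar> \<le> B"
proof -
  obtain K where K: "compact K" "K \<subseteq> \<Omega>" "\<And>x. x \<notin> K \<Longrightarrow> \<phi> x = 0" using assms by (metis test_funE)
  have "compact (\<phi> ` K)" by (rule compact_continuous_image[OF smooth_continuous[OF test_fun_smooth[OF assms]] K(1)])
  then obtain B where "\<forall>y\<in>\<phi> ` K. norm y \<le> B" using compact_imp_bounded bounded_iff by metis
  then have "\<bar>\<phi> x\<bar> \<le> \<bar>B\<bar>" for x using K(3)[of x] by (cases "x \<in> K") force+
  then show ?thesis by blast
qed


subsection \<open>Integration of test functions\<close>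

lemma sq_intI_bounded:
  assumes "f \<in> borel_measurable lebesgue" "S \<in> lmeasurable" "\<And>x. norm (f x) \<le> B * indicator S x"
  shows "sq_int f"
proof (rule sq_int_bound[OF assms(1)])
  show "integrable lebesgue (\<lambda>x. B\<^sup>2 * indicator S x :: real)"
    using assms(2) by (intro integrable_mult_right integrable_real_indicator) (auto simp: fmeasurable_def)
  show "AE x in lebesgue. (norm (f x))\<^sup>2 \<le> B\<^sup>2 * indicator S x"
  proof (rule AE_I2)
    fix x
    show "(norm (f x))\<^sup>2 \<le> B\<^sup>2 * indicator S x"
      using power_mono[OF assms(3)[of x] norm_ge_zero, of 2] by (auto simp: power_mult_distrib split: split_indicator_asm)
  qed
qed

lemma borel_lebesgueI: "f \<in> borel_measurable borel \<Longrightarrow> f \<in> borel_measurable lebesgue"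
  by (rule measurable_completion) simp

lemma continuous_compact_support_integrable:
  fixes f :: "'a::euclidean_space \<Rightarrow> 'b::euclidean_space"
  assumes "continuous_on UNIV f" "compact K" "\<And>x. x \<notin> K \<Longrightarrow> f x = 0"
  shows "integrable lborel f" "integrable lebesgue f" "f \<in> borel_measurable borel"
proof -
  have "f = (\<lambda>x. indicator K x *\<^sub>R f x)" using assms(3) by (auto simp: indicator_def fun_eq_iff)
  then show 1: "integrable lborel f"
    using borel_integrable_compact[OF assms(2) continuous_on_subset[OF assms(1)]] by simp
  show 2: "f \<in> borel_measurable borel" using assms(1) by (rule borel_measurable_continuous_onI)
  show "integrable lebesgue f" using 1 2 by (subst integrable_completion) auto
qed

lemma continuous_compact_support_sq_int:
  fixes f :: "'a::euclidean_space \<Rightarrow> 'b::euclidean_space"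
  assumes "continuous_on UNIV f" "compact K" "\<And>x. x \<notin> K \<Longrightarrow> f x = 0"
  shows "sq_int f"
  unfolding sq_int_def
proof
  show "f \<in> borel_measurable lebesgue"
    by (rule borel_lebesgueI[OF continuous_compact_support_integrable(3)[OF assms]])
  show "integrable lebesgue (\<lambda>x. (norm (f x))\<^sup>2)"
    by (rule continuous_compact_support_integrable(2)[OF _ assms(2)])
      (use assms in \<open>auto intro!: continuous_intros\<close>)
qed

lemma LINT_lebesgue_lborel:
  fixes f :: "'a::euclidean_space \<Rightarrow> 'b::euclidean_space"
  shows "f \<in> borel_measurable borel \<Longrightarrow> (LINT x|lebesgue. f x) = (LINT x|lborel. f x)"
  by (rule integral_completion) simp

lemma test_fun_sq_int: assumes "test_fun \<Omega> \<phi>" shows "sq_int \<phi>" "sq_int (cgrad \<phi>)"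
proof -
  obtain K where K: "compact K" "K \<subseteq> \<Omega>" "\<And>x. x \<notin> K \<Longrightarrow> \<phi> x = 0" using assms by (metis test_funE)
  show "sq_int \<phi>"
    by (rule continuous_compact_support_sq_int[OF smooth_continuous[OF test_fun_smooth[OF assms]] K(1,3)])
  have "cgrad \<phi> x = 0" if "x \<notin> K" for x
    using partial_zero_outside[of K \<phi> x] K that by (simp add: cgrad_def vec_eq_iff compact_imp_closed)
  then show "sq_int (cgrad \<phi>)"
    by (rule continuous_compact_support_sq_int[OF smooth_continuous_cgrad[OF test_fun_smooth[OF assms]] K(1)])
qed

lemma test_fun_axis_sq_int:
  assumes "test_fun \<Omega> \<phi>" shows "sq_int (\<lambda>x. \<phi> x *\<^sub>R axis i 1 :: real^'n::finite)"
  by (rule sq_int_bound[of _ "\<lambda>x. (norm (\<phi> x))\<^sup>2"])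
    (use test_fun_sq_int(1)[OF assms] in \<open>auto simp: sq_int_def\<close>)

lemma LINT_lborel_translate:
  fixes f :: "'a::euclidean_space \<Rightarrow> 'b::euclidean_space"
  assumes "f \<in> borel_measurable borel"
  shows "(LINT x|lborel. f (x + a)) = (LINT x|lborel. f x)"
proof -
  have "(LINT x|lborel. f x) = (LINT x|distr lborel borel ((+) a). f x)" by (simp add: lborel_distr_plus)
  also have "\<dots> = (LINT x|lborel. f (a + x))" by (rule integral_distr) (use assms in auto)
  finally show ?thesis by (simp add: add.commute)
qed

text \<open>The gradient is bounded and increments have length at most \<open>norm h\<close>, so all
  quotients share one bound and one ball as support: this is the domination behind the two limits
  under the integral that follow.\<close>

lemma test_fun_difference_quotient:
  fixes \<psi> :: "real^'n::finite \<Rightarrow> real" and h :: "real^'n"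
  assumes "test_fun \<Omega> \<psi>"
  defines "q \<equiv> \<lambda>n x. real (Suc n) * (\<psi> (x + (1 / real (Suc n)) *\<^sub>R h) - \<psi> x)"
  shows "(\<lambda>n. q n x) \<longlonglongrightarrow> cgrad \<psi> x \<bullet> h"
    and "\<exists>B R. \<forall>n x. \<bar>q n x\<bar> \<le> B * indicator (cball 0 R) x"
    and "q n \<in> borel_measurable borel"
proof -
  have sm: "smooth \<psi>" using assms(1) by (rule test_fun_smooth)
  have der: "(\<psi> has_derivative (\<lambda>h. cgrad \<psi> x \<bullet> h)) (at x)" for x
  proof -
    have "frechet_derivative \<psi> (at x) = (\<lambda>h. cgrad \<psi> x \<bullet> h)"
      by (rule ext, rule cgrad_inner[OF smooth_differentiable[OF sm]])
    then show ?thesis using smooth_differentiable[OF sm, of x] by (simp add: frechet_derivative_works)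
  qed
  show "q n \<in> borel_measurable borel" unfolding q_def
    by (intro borel_measurable_continuous_onI continuous_intros
        continuous_on_compose2[OF smooth_continuous[OF sm, of UNIV]]) auto
  have "((\<lambda>t. \<psi> (x + t *\<^sub>R h)) has_derivative (\<lambda>t. cgrad \<psi> x \<bullet> (t *\<^sub>R h))) (at 0)"
    by (rule has_derivative_compose[of "\<lambda>t. x + t *\<^sub>R h" "\<lambda>t. t *\<^sub>R h" 0 UNIV \<psi>])
      (use der[of x] in \<open>auto intro!: derivative_eq_intros\<close>)
  then have "((\<lambda>t. \<psi> (x + t *\<^sub>R h)) has_field_derivative (cgrad \<psi> x \<bullet> h)) (at 0)"
    by (simp add: has_field_derivative_def mult.commute[of _ "cgrad \<psi> x \<bullet> h"])
  then have D: "((\<lambda>t. (\<psi> (x + t *\<^sub>R h) - \<psi> x) / t) \<longlongrightarrow> cgrad \<psi> x \<bullet> h) (at 0)"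
    by (simp add: DERIV_def)
  from filterlim_compose[OF D inverse_Suc_at_0] show "(\<lambda>n. q n x) \<longlonglongrightarrow> cgrad \<psi> x \<bullet> h"
    unfolding q_def by (simp add: mult.commute)
  obtain K where K: "compact K" "K \<subseteq> \<Omega>" "\<And>x. x \<notin> K \<Longrightarrow> \<psi> x = 0" using assms by (metis test_funE)
  obtain R where R: "K \<subseteq> cball 0 R" "R > 0"
    using bounded_subset_ballD[OF compact_imp_bounded[OF K(1)], of 0] ball_subset_cball by blast
  have "compact (cgrad \<psi> ` K)" by (rule compact_continuous_image[OF smooth_continuous_cgrad[OF sm] K(1)])
  then obtain B where B: "\<forall>y\<in>cgrad \<psi> ` K. norm y \<le> B" using compact_imp_bounded bounded_iff by metis
  have gB: "norm (cgrad \<psi> x) \<le> \<bar>B\<bar>" for x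
  proof (cases "x \<in> K")
    case True then show ?thesis using B by force
  next
    case False
    then have "cgrad \<psi> x = 0"
      using partial_zero_outside[of K \<psi> x] K by (simp add: cgrad_def vec_eq_iff compact_imp_closed)
    then show ?thesis by simp
  qed
  have lip: "\<bar>\<psi> y - \<psi> x\<bar> \<le> \<bar>B\<bar> * norm (y - x)" for x y
  proof -
    have "norm (\<psi> y - \<psi> x) \<le> \<bar>B\<bar> * norm (y - x)"
    proof (rule differentiable_bound[of UNIV])
      show "(\<psi> has_derivative (\<lambda>h. cgrad \<psi> x \<bullet> h)) (at x within UNIV)" for x using der by simp
      show "onorm (\<lambda>h. cgrad \<psi> x \<bullet> h) \<le> \<bar>B\<bar>" for x
      proof (rule onorm_bound)
        fix h
        show "norm (cgrad \<psi> x \<bullet> h) \<le> \<bar>B\<bar> * norm h"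
          using Cauchy_Schwarz_ineq2[of "cgrad \<psi> x" h] mult_right_mono[OF gB[of x] norm_ge_zero[of h]] by simp
      qed simp
    qed auto
    then show ?thesis by simp
  qed
  have "\<bar>q n x\<bar> \<le> (\<bar>B\<bar> * norm h) * indicator (cball 0 (R + norm h)) x" for n x
  proof (cases "x \<in> cball 0 (R + norm h)")
    case True
    have "\<bar>q n x\<bar> = real (Suc n) * \<bar>\<psi> (x + (1 / real (Suc n)) *\<^sub>R h) - \<psi> x\<bar>"
      unfolding q_def by (simp add: abs_mult)
    also have "\<dots> \<le> real (Suc n) * (\<bar>B\<bar> * norm ((1 / real (Suc n)) *\<^sub>R h))"
      using lip[of "x + (1 / real (Suc n)) *\<^sub>R h" x] by (intro mult_left_mono) auto
    also have "\<dots> = \<bar>B\<bar> * norm h" by simp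
    finally show ?thesis using True by simp
  next
    case False
    have "norm ((1 / real (Suc n)) *\<^sub>R h) \<le> norm h" by (simp add: field_simps)
    then have "norm (x + (1 / real (Suc n)) *\<^sub>R h) > R" "norm x > R"
      using False norm_diff_ineq[of x "(1 / real (Suc n)) *\<^sub>R h"] norm_ge_zero[of h]
      unfolding mem_cball dist_0_norm by linarith+
    then have "x \<notin> K" "x + (1 / real (Suc n)) *\<^sub>R h \<notin> K" using R(1) by (auto simp: subset_iff dist_norm)
    then show ?thesis using K(3) False unfolding q_def by simp
  qed
  then show "\<exists>B R. \<forall>n x. \<bar>q n x\<bar> \<le> B * indicator (cball 0 R) x" by blast
qed

text \<open>Lebesgue measure is translation invariant, so every difference quotient has integral 0,
  and so has their dominated limit.\<close>

lemma LINT_cgrad_eq_0: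
  assumes "test_fun \<Omega> \<psi>"
  shows "(LINT x|lebesgue. cgrad \<psi> x \<bullet> h) = 0"
proof -
  define q where "q n x = real (Suc n) * (\<psi> (x + (1 / real (Suc n)) *\<^sub>R h) - \<psi> x)" for n x
  note dq = test_fun_difference_quotient[OF assms, where h=h, folded q_def]
  obtain B R where BR: "\<And>n x. \<bar>q n x\<bar> \<le> B * indicator (cball 0 R) x" using dq(2) by blast
  have [measurable]: "\<psi> \<in> borel_measurable borel"
    using smooth_continuous[OF test_fun_smooth[OF assms]] by (rule borel_measurable_continuous_onI)
  have int: "integrable lborel \<psi>"
    using sq_int_measurable assms by (metis test_funE continuous_compact_support_integrable(1) smooth_continuous test_fun_smooth)
  have int2: "integrable lborel (\<lambda>x. \<psi> (x + a))" for a
  proof -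
    have "integrable (distr lborel borel ((+) a)) \<psi>" using int by (simp add: lborel_distr_plus)
    then show ?thesis by (subst (asm) integrable_distr_eq) (auto simp: add.commute)
  qed
  have "(LINT x|lborel. q n x) = 0" for n
    unfolding q_def using int int2 LINT_lborel_translate[of \<psi>] by simp
  moreover have "(\<lambda>n. LINT x|lborel. q n x) \<longlonglongrightarrow> (LINT x|lborel. cgrad \<psi> x \<bullet> h)"
  proof (rule integral_dominated_convergence[where w="\<lambda>x. B * indicator (cball 0 R) x"])
    show "integrable lborel (\<lambda>x. B * indicator (cball 0 R) x)"
      by (intro integrable_mult_right integrable_real_indicator) (auto simp: emeasure_bounded_finite[OF bounded_cball, unfolded infinity_ennreal_def])
    show "q n \<in> borel_measurable lborel" for n using dq(3) by simp
    show "(\<lambda>x. cgrad \<psi> x \<bullet> h) \<in> borel_measurable lborel"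
      using borel_measurable_continuous_onI[OF smooth_continuous_cgrad[OF test_fun_smooth[OF assms]]] by simp
  qed (use dq(1) BR in auto)
  ultimately have "(LINT x|lborel. cgrad \<psi> x \<bullet> h) = 0" by (simp add: LIMSEQ_const_iff)
  moreover have "(\<lambda>x. cgrad \<psi> x \<bullet> h) \<in> borel_measurable borel"
      using borel_measurable_continuous_onI[OF smooth_continuous_cgrad[OF test_fun_smooth[OF assms]]] by simp
  ultimately show ?thesis by (simp add: LINT_lebesgue_lborel)
qed

lemma LINT_partial_eq_0: "test_fun \<Omega> \<psi> \<Longrightarrow> (LINT x|lebesgue. partial i \<psi> x) = 0"
  using LINT_cgrad_eq_0[of \<Omega> \<psi> "axis i 1"] by (simp add: cgrad_def inner_axis)

lemma test_fun_integration_by_parts: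
  assumes "test_fun \<Omega> \<phi>" "test_fun \<Omega>' \<psi>"
  shows "(LINT x|lebesgue. \<phi> x * partial i \<psi> x) = - (LINT x|lebesgue. partial i \<phi> x * \<psi> x)"
proof -
  have eq: "partial i (\<lambda>x. \<psi> x * \<phi> x) x = partial i \<phi> x * \<psi> x + \<phi> x * partial i \<psi> x" for x
    by (subst partial_mult) (auto intro: smooth_differentiable test_fun_smooth assms)
  have "(LINT x|lebesgue. partial i (\<lambda>x. \<psi> x * \<phi> x) x) = 0"
    by (rule LINT_partial_eq_0[OF test_fun_smooth_mult[OF assms(1) test_fun_smooth[OF assms(2)]]])
  moreover have "integrable lebesgue (\<lambda>x. partial i \<phi> x * \<psi> x)" "integrable lebesgue (\<lambda>x. \<phi> x * partial i \<psi> x)"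
    using integrable_inner[of "partial i \<phi>" \<psi>] integrable_inner[of \<phi> "partial i \<psi>"]
      test_fun_sq_int(1)[OF assms(1)] test_fun_sq_int(1)[OF assms(2)]
      test_fun_sq_int(1)[OF test_fun_partial[OF assms(1)]] test_fun_sq_int(1)[OF test_fun_partial[OF assms(2)]]
    by auto
  ultimately show ?thesis unfolding eq by simp
qed

subsection \<open>The fundamental lemma of the calculus of variations\<close>

text \<open>Since \<open>exp (-1/t) ^ (1/n) = exp (-1/(n t))\<close>, these are the \<open>n\<close>-th roots of one bump function, so they increase to the
  indicator of the box.\<close>

definition box_bump :: "real^'n::finite \<Rightarrow> real^'n \<Rightarrow> nat \<Rightarrow> real^'n \<Rightarrow> real" where
  "box_bump c d n x = (\<Prod>i\<in>UNIV. flat 1 (real n * x $ i + - real n * c $ i) * flat 1 (- real n * x $ i + real n * d $ i))"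

lemma flat_1: "0 \<le> flat 1 t" "flat 1 t \<le> 1" "t \<le> 0 \<Longrightarrow> flat 1 t = 0"
  by (auto simp: flat_def)

lemma flat_1_tendsto: assumes "t > 0" shows "(\<lambda>n. flat 1 (real n * t)) \<longlonglongrightarrow> 1"
proof -
  have "(\<lambda>n. exp (- ((1 / real n) * (1 / t)))) \<longlonglongrightarrow> exp (- (0 * (1 / t)))"
    by (intro tendsto_intros lim_1_over_n)
  then have "(\<lambda>n. exp (- (1 / (real n * t)))) \<longlonglongrightarrow> 1" by simp
  then show ?thesis
    by (rule Lim_transform_eventually)
      (use assms in \<open>auto simp: flat_def eventually_sequentially intro!: exI[of _ 1]\<close>)
qed

lemma box_bump:
  shows "0 \<le> box_bump c d n x" "box_bump c d n x \<le> 1"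
    "x \<notin> box c d \<Longrightarrow> box_bump c d n x = 0"
    "(\<lambda>n. box_bump c d n x) \<longlonglongrightarrow> indicator (box c d) x" "smooth (box_bump c d n)"
proof -
  show "0 \<le> box_bump c d n x" unfolding box_bump_def by (intro prod_nonneg ballI mult_nonneg_nonneg flat_1)
  show "box_bump c d n x \<le> 1" unfolding box_bump_def
    by (intro prod_le_1 conjI mult_nonneg_nonneg mult_le_one flat_1)
  show 0: "box_bump c d n x = 0" if out: "x \<notin> box c d" for n
  proof -
    obtain i where "x $ i \<le> c $ i \<or> d $ i \<le> x $ i" using out by (auto simp: mem_box_cart not_less)
    then have "flat 1 (real n * x $ i + - real n * c $ i) * flat 1 (- real n * x $ i + real n * d $ i) = 0"
      using mult_left_mono[of "x $ i" "c $ i" "real n"] mult_left_mono[of "d $ i" "x $ i" "real n"]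
      by (auto intro!: flat_1(3))
    then show ?thesis unfolding box_bump_def by (intro prod_zero) auto
  qed
  show "(\<lambda>n. box_bump c d n x) \<longlonglongrightarrow> indicator (box c d) x"
  proof (cases "x \<in> box c d")
    case True
    have "(\<lambda>n. box_bump c d n x) \<longlonglongrightarrow> (\<Prod>i\<in>(UNIV::'a set). 1 * 1)"
      unfolding box_bump_def
    proof (intro tendsto_prod tendsto_mult)
      fix i :: 'a
      have "x $ i - c $ i > 0" "d $ i - x $ i > 0" using True by (auto simp: mem_box_cart)
      from this[THEN flat_1_tendsto]
      show "(\<lambda>n. flat 1 (real n * x $ i + - real n * c $ i)) \<longlonglongrightarrow> 1"
        "(\<lambda>n. flat 1 (- real n * x $ i + real n * d $ i)) \<longlonglongrightarrow> 1"
        by (simp_all add: algebra_simps)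
    qed
    then show ?thesis using True by simp
  qed (simp add: 0)
  show "smooth (box_bump c d n)"
    unfolding box_bump_def by (intro smooth_prod smooth_mult smooth_flat) auto
qed

lemma test_fun_box_bump:
  assumes "box c d \<subseteq> C" "closed C" "C \<subseteq> \<Omega>" shows "test_fun \<Omega> (box_bump c d n)"
  unfolding test_fun_def
proof (intro conjI exI[of _ "closure (box c d)"] allI impI)
  show "compact (closure (box c d))" using bounded_box by (simp add: compact_closure)
  show "closure (box c d) \<subseteq> \<Omega>" using closure_minimal[OF assms(1,2)] assms(3) by blast
  show "box_bump c d n x = 0" if "x \<notin> closure (box c d)" for x
    by (rule box_bump(3)) (use that closure_subset in blast)
qed (rule box_bump)

lemma sq_int_indicator: "S \<in> lmeasurable \<Longrightarrow> sq_int (indicator S :: 'a::euclidean_space \<Rightarrow> real)"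
  by (rule sq_intI_bounded[of _ S 1]) (auto simp: fmeasurable_def)

lemma sq_int_indicator_mult:
  assumes "sq_int u" "S \<in> sets lebesgue" shows "sq_int (\<lambda>x. indicator S x *\<^sub>R u x)"
  by (rule sq_int_bound[of _ "\<lambda>x. (norm (u x))\<^sup>2"])
    (use assms in \<open>auto simp: sq_int_def indicator_def\<close>)

text \<open>Open boxes form an intersection-stable generator of the Borel sets, so Dynkin's theorem
  spreads the vanishing to Borel sets, and completion adds null sets. The integral over the whole
  space is a separate hypothesis because it starts the complement step and the space is not a
  box.\<close>

lemma LINT_boxes_eq_0_imp_AE_0:
  fixes v :: "real^'n::finite \<Rightarrow> real"
  assumes v: "integrable lebesgue v" and 0: "\<And>c d. (LINT x|lebesgue. indicator (box c d) x * v x) = 0"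
    and UN: "(LINT x|lebesgue. v x) = 0"
  shows "AE x in lebesgue. v x = 0"
proof -
  have int: "set_integrable lebesgue A v" if "A \<in> sets lebesgue" for A
    unfolding set_integrable_def using that v integrable_mult_indicator by blast
  have borel: "(LINT x:A|lebesgue. v x) = 0" if "A \<in> sets borel" for A
  proof -
    have A: "A \<in> sigma_sets UNIV (range (\<lambda>(a, b). box a b :: (real^'n) set))"
      using that unfolding borel_eq_box by (simp add: sets_measure_of)
    have IS: "Int_stable (range (\<lambda>(a, b). box a b :: (real^'n) set))"
    proof (rule Int_stableI)
      fix X Y :: "(real^'n) set"
      assume "X \<in> range (\<lambda>(a, b). box a b)" "Y \<in> range (\<lambda>(a, b). box a b)"
      then obtain a b c d where XY: "X = box a b" "Y = box c d" by auto
      have "X \<inter> Y = (\<lambda>(a, b). box a b) (\<Sum>i\<in>Basis. max (a\<bullet>i) (c\<bullet>i) *\<^sub>R i, \<Sum>i\<in>Basis. min (b\<bullet>i) (d\<bullet>i) *\<^sub>R i)"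
        unfolding XY by (simp add: box_Int_box)
      then show "X \<inter> Y \<in> range (\<lambda>(a, b). box a b)" by (rule range_eqI)
    qed
    have sub: "X \<in> sets lebesgue" if "X \<in> sigma_sets UNIV (range (\<lambda>(a, b). box a b :: (real^'n) set))" for X
    proof -
      have "X \<in> sets borel" using that unfolding borel_eq_box by (simp add: sets_measure_of)
      then show ?thesis by simp
    qed
    have pow: "range (\<lambda>(a, b). box a b :: (real^'n) set) \<subseteq> Pow UNIV" by auto
    show ?thesis
      using A
    proof (induction A rule: sigma_sets_induct_disjoint[OF IS pow, consumes 1, case_names basic empty compl union])
      case (basic A)
      then show ?case using 0 by (auto simp: set_lebesgue_integral_def)
    next
      case empty show ?case by (simp add: set_lebesgue_integral_def)
    next
      case (compl A)
      have "(LINT x:A \<union> (UNIV - A)|lebesgue. v x) = (LINT x:A|lebesgue. v x) + (LINT x:UNIV - A|lebesgue. v x)"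
        using sub[OF compl(1)] by (intro set_integral_Un int) auto
      then show ?case using compl(2) UN by (simp add: set_lebesgue_integral_def)
    next
      case (union A)
      have sA: "A i \<in> sets lebesgue" for i using union(2) sub by blast
      have "(LINT x:(\<Union>i. A i)|lebesgue. v x) = (\<Sum>i. (LINT x:(A i)|lebesgue. v x))"
        using union(1) sA by (intro lebesgue_integral_countable_add int sets.countable_UN) (auto simp: disjoint_family_on_def)
      then show ?case using union by simp
    qed
  qed
  interpret sigma_finite_measure "lebesgue :: (real^'n) measure"
  proof
    define A where "A = range (\<lambda>n::nat. cball (0::real^'n) (real n))"
    have "countable A" "A \<subseteq> sets lebesgue" unfolding A_def by auto
    moreover have "\<Union>A = space lebesgue" unfolding A_def using real_arch_simple by auto
    moreover have "emeasure lebesgue a \<noteq> (\<infinity>::ennreal)" if "a \<in> A" for a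
      using emeasure_bounded_finite[OF bounded_cball, of "0::real^'n"] that by (auto simp: A_def less_top)
    ultimately show "\<exists>A :: (real^'n) set set. countable A \<and> A \<subseteq> sets lebesgue \<and> \<Union>A = space lebesgue \<and> (\<forall>a\<in>A. emeasure lebesgue a \<noteq> (\<infinity>::ennreal))"
      by (intro exI[of _ A] conjI ballI)
  qed
  show ?thesis
  proof (rule density_zero[OF v])
    fix A :: "(real^'n) set" assume "A \<in> sets lebesgue"
    then obtain S N N' where A: "A = S \<union> N" "N \<subseteq> N'" "N' \<in> null_sets lborel" "S \<in> sets lborel"
      by (rule sets_completionE)
    have N': "N' \<in> null_sets lebesgue" using A(3) by (rule null_sets_completionI)
    have "(LINT x:A|lebesgue. v x) = (LINT x:S|lebesgue. v x)"
      unfolding set_lebesgue_integral_def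
    proof (rule integral_cong_AE)
      show "AE x in lebesgue. indicator A x *\<^sub>R v x = indicator S x *\<^sub>R v x"
        using AE_not_in[OF N'] by eventually_elim (use A in \<open>auto simp: indicator_def\<close>)
      have vm: "v \<in> borel_measurable lebesgue" using v by (rule borel_measurable_integrable)
      have S: "S \<in> sets lebesgue" using A(4) by simp
      show "(\<lambda>x. indicator A x *\<^sub>R v x) \<in> borel_measurable lebesgue"
        by (rule borel_measurable_scaleR[OF borel_measurable_indicator[OF \<open>A \<in> sets lebesgue\<close>] vm])
      show "(\<lambda>x. indicator S x *\<^sub>R v x) \<in> borel_measurable lebesgue"
        by (rule borel_measurable_scaleR[OF borel_measurable_indicator[OF S] vm])
    qed
    then show "(LINT x:A|lebesgue. v x) = 0" using borel[of S] A(4) by simp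
  qed
qed

text \<open>Bump functions approximate indicators of boxes, so integrals of \<open>u\<close> over
  boxes inside closed boxes in \<Omega> vanish. Cutting \<open>u\<close> off to one such box gives a
  function on the whole space with vanishing box integrals, and countably many closed boxes fill
  \<Omega>.\<close>

lemma fundamental_lemma:
  fixes u :: "real^'n::finite \<Rightarrow> real"
  assumes "open \<Omega>" "sq_int u" and 0: "\<And>\<phi>. test_fun \<Omega> \<phi> \<Longrightarrow> (LINT x|lebesgue. u x * \<phi> x) = 0"
  shows "AE x in lebesgue. x \<in> \<Omega> \<longrightarrow> u x = 0"
proof -
  have [measurable]: "u \<in> borel_measurable lebesgue" using assms by (simp add: sq_int_def)
  have box0: "(LINT x|lebesgue. indicator (box c d) x * u x) = 0" if "box c d \<subseteq> cbox a b" "cbox a b \<subseteq> \<Omega>" for a b c d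
  proof -
    \<comment> \<open>The dominating function lives on a compact box, where the square integrable
      \<open>u\<close> is integrable.\<close>
    have "(\<lambda>n. LINT x|lebesgue. u x * box_bump c d n x) \<longlonglongrightarrow> (LINT x|lebesgue. u x * indicator (box c d) x)"
    proof (rule integral_dominated_convergence[where w="\<lambda>x. indicator (cbox a b) x * \<bar>u x\<bar>"])
      have "integrable lebesgue (\<lambda>x. indicator (cbox a b) x \<bullet> u x)"
        by (rule integrable_inner[OF sq_int_indicator assms(2)]) simp
      then have "integrable lebesgue (\<lambda>x. \<bar>indicator (cbox a b) x * u x\<bar>)" by (intro integrable_abs) simp
      then show "integrable lebesgue (\<lambda>x. indicator (cbox a b) x * \<bar>u x\<bar>)" by (simp add: abs_mult)
      show "(\<lambda>x. u x * box_bump c d n x) \<in> borel_measurable lebesgue" for n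
        using borel_lebesgueI[OF borel_measurable_continuous_onI[OF smooth_continuous[OF box_bump(5)]]] by measurable
      show "AE x in lebesgue. norm (u x * box_bump c d n x) \<le> indicator (cbox a b) x * \<bar>u x\<bar>" for n
      proof (rule AE_I2)
        fix x
        show "norm (u x * box_bump c d n x) \<le> indicator (cbox a b) x * \<bar>u x\<bar>"
          using box_bump(1,2)[of c d n x] box_bump(3)[of x c d n] that(1) mult_left_le[of "box_bump c d n x" "\<bar>u x\<bar>"]
          by (cases "x \<in> box c d") (auto simp: abs_mult indicator_def)
      qed
      show "AE x in lebesgue. (\<lambda>n. u x * box_bump c d n x) \<longlonglongrightarrow> u x * indicator (box c d) x"
        by (intro AE_I2 tendsto_intros box_bump(4))
      show "(\<lambda>x. u x * indicator (box c d) x) \<in> borel_measurable lebesgue"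
        by (intro borel_measurable_times borel_measurable_indicator) auto
    qed
    moreover have "(LINT x|lebesgue. u x * box_bump c d n x) = 0" for n
      by (rule 0[OF test_fun_box_bump[OF that(1) closed_cbox that(2)]])
    ultimately show ?thesis by (simp add: LIMSEQ_const_iff mult.commute)
  qed
  have AEbox: "AE x in lebesgue. x \<in> cbox a b \<longrightarrow> u x = 0" if ab: "cbox a b \<subseteq> \<Omega>" for a b
  proof -
    have "AE x in lebesgue. indicator (box a b) x * u x = 0"
    proof (rule LINT_boxes_eq_0_imp_AE_0)
      have "integrable lebesgue (\<lambda>x. indicator (box a b) x \<bullet> u x)"
        by (rule integrable_inner[OF sq_int_indicator assms(2)]) simp
      then show "integrable lebesgue (\<lambda>x. indicator (box a b) x * u x)" by simp
      have sub: "box a b \<subseteq> cbox a b" by (rule box_subset_cbox)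
      then show "(LINT x|lebesgue. indicator (box a b) x * u x) = 0" using box0 ab by blast
      fix c d :: "real^'n"
      obtain c' d' where cd: "box c d \<inter> box a b = box c' d'" using box_Int_box by blast
      have "(\<lambda>x. indicator (box c d) x * (indicator (box a b) x * u x)) = (\<lambda>x. indicator (box c' d') x * u x)"
        unfolding cd[symmetric] by (simp add: indicator_inter_arith fun_eq_iff)
      moreover have "box c' d' \<subseteq> cbox a b" using cd sub by blast
      ultimately show "(LINT x|lebesgue. indicator (box c d) x * (indicator (box a b) x * u x)) = 0"
        using box0[OF _ ab] by simp
    qed
    moreover have "AE x in lebesgue. x \<notin> cbox a b - box a b"
      by (rule AE_not_in) (metis negligible_frontier_interval negligible_iff_null_sets)
    ultimately show ?thesis by eventually_elim (auto simp: indicator_def)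
  qed
  obtain \<D> where \<D>: "countable \<D>" "\<D> \<subseteq> Pow \<Omega>" "\<And>X. X \<in> \<D> \<Longrightarrow> \<exists>a b. X = cbox a b" "\<Union>\<D> = \<Omega>"
    using open_countable_Union_open_cbox[OF assms(1)] by metis
  have "AE x in lebesgue. \<forall>X\<in>\<D>. x \<in> X \<longrightarrow> u x = 0"
  proof (rule AE_ball_countable[THEN iffD2, OF \<D>(1)], rule ballI)
    fix X assume X: "X \<in> \<D>"
    then obtain a b where "X = cbox a b" using \<D>(3) by blast
    moreover have "X \<subseteq> \<Omega>" using X \<D>(2) by blast
    ultimately show "AE x in lebesgue. x \<in> X \<longrightarrow> u x = 0" using AEbox by blast
  qed
  then show ?thesis by eventually_elim (use \<D>(4) in blast)
qed


subsection \<open>The inequality of Poincare and the theorem of Rellich\<close>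

text \<open>The integral of the \<open>i\<close>-th partial derivative of
  \<open>x $ i * (\<phi> x * \<phi> x)\<close> is 0, which expresses the integral of the square of
  \<phi> by that of \<open>- 2 * (x $ i * \<phi> x * partial i \<phi> x)\<close>. There
  \<open>x $ i\<close> is at most \<open>R\<close>, and Young's inequality absorbs one half.\<close>

lemma test_fun_poincare:
  fixes \<phi> :: "real^'n::finite \<Rightarrow> real"
  assumes \<phi>: "test_fun \<Omega> \<phi>" and R: "\<Omega> \<subseteq> cball 0 R" "R > 0"
  shows "norm (cls \<phi>) \<le> 2 * R * norm (cls (cgrad \<phi>))"
proof (rule power2_le_imp_le)
  obtain i :: 'n where True by simp
  have p: "test_fun \<Omega> (\<lambda>x. x $ i * (\<phi> x * \<phi> x))"
    by (intro test_fun_smooth_mult \<phi> test_fun_smooth[OF \<phi>] smooth_coord)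
  have smx: "(\<lambda>x::real^'n. x $ i) differentiable (at x)" for x by (rule smooth_differentiable[OF smooth_coord])
  have sm: "\<phi> differentiable (at x)" for x by (rule smooth_differentiable[OF test_fun_smooth[OF \<phi>]])
  have px: "partial i (\<lambda>x::real^'n. x $ i) x = 1" for x
    by (subst partial_eq[OF bounded_linear.has_derivative[OF bounded_linear_vec_nth has_derivative_ident]]) (simp add: axis_def)
  have eq: "partial i (\<lambda>x. x $ i * (\<phi> x * \<phi> x)) x = (\<phi> x)\<^sup>2 + 2 * (x $ i * \<phi> x * partial i \<phi> x)" for x
    by (subst partial_mult[OF smx differentiable_mult[OF sm sm]], subst partial_mult[OF sm sm])
      (simp add: px power2_eq_square algebra_simps)
  have i1: "integrable lebesgue (\<lambda>x. (\<phi> x)\<^sup>2)" using sq_intD[OF test_fun_sq_int(1)[OF \<phi>]] by simp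
  have i2: "integrable lebesgue (\<lambda>x. (norm (cgrad \<phi> x))\<^sup>2)" using sq_intD[OF test_fun_sq_int(2)[OF \<phi>]] .
  have i3: "integrable lebesgue (\<lambda>x. x $ i * \<phi> x * partial i \<phi> x)"
    using integrable_inner[OF test_fun_sq_int(1)[OF test_fun_smooth_mult[OF \<phi> smooth_coord[of i]]]
        test_fun_sq_int(1)[OF test_fun_partial[OF \<phi>, of i]]] by simp
  have "0 = (LINT x|lebesgue. (\<phi> x)\<^sup>2) + 2 * (LINT x|lebesgue. x $ i * \<phi> x * partial i \<phi> x)"
    using LINT_partial_eq_0[OF p, of i] i1 i3 unfolding eq by simp
  moreover have "(LINT x|lebesgue. - 2 * (x $ i * \<phi> x * partial i \<phi> x)) \<le>
      (LINT x|lebesgue. (\<phi> x)\<^sup>2 / 2 + 2 * R\<^sup>2 * (norm (cgrad \<phi> x))\<^sup>2)"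
  proof (rule integral_mono)
    show "integrable lebesgue (\<lambda>x. - 2 * (x $ i * \<phi> x * partial i \<phi> x))" using i3 by simp
    show "integrable lebesgue (\<lambda>x. (\<phi> x)\<^sup>2 / 2 + 2 * R\<^sup>2 * (norm (cgrad \<phi> x))\<^sup>2)" using i1 i2 by simp
    fix x
    show "- 2 * (x $ i * \<phi> x * partial i \<phi> x) \<le> (\<phi> x)\<^sup>2 / 2 + 2 * R\<^sup>2 * (norm (cgrad \<phi> x))\<^sup>2"
    proof (cases "\<phi> x = 0")
      case False
      then have "x \<in> cball 0 R" using \<phi> R(1) unfolding test_fun_def by blast
      then have "\<bar>x $ i\<bar> \<le> R" using component_le_norm_cart[of x i] by simp
      moreover have "\<bar>partial i \<phi> x\<bar> \<le> norm (cgrad \<phi> x)"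
        using component_le_norm_cart[of "cgrad \<phi> x" i] by (simp add: cgrad_def)
      ultimately have "\<bar>x $ i * partial i \<phi> x\<bar> \<le> R * norm (cgrad \<phi> x)"
        using R(2) by (simp add: abs_mult mult_mono)
      then have "\<bar>x $ i * partial i \<phi> x\<bar>\<^sup>2 \<le> (R * norm (cgrad \<phi> x))\<^sup>2" by (rule power_mono) simp
      then have 1: "(x $ i * partial i \<phi> x)\<^sup>2 \<le> R\<^sup>2 * (norm (cgrad \<phi> x))\<^sup>2" by (simp add: power_mult_distrib)
      have "0 \<le> (\<phi> x + 2 * (x $ i * partial i \<phi> x))\<^sup>2" by simp
      then have "- 4 * (\<phi> x * (x $ i * partial i \<phi> x)) \<le> (\<phi> x)\<^sup>2 + 4 * (x $ i * partial i \<phi> x)\<^sup>2"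
        by (simp add: power2_sum power_mult_distrib algebra_simps)
      moreover have "x $ i * \<phi> x * partial i \<phi> x = \<phi> x * (x $ i * partial i \<phi> x)" by simp
      ultimately show ?thesis using 1 by linarith
    qed simp
  qed
  ultimately have "(LINT x|lebesgue. (\<phi> x)\<^sup>2) \<le> (LINT x|lebesgue. (\<phi> x)\<^sup>2) / 2 + 2 * R\<^sup>2 * (LINT x|lebesgue. (norm (cgrad \<phi> x))\<^sup>2)"
    using i1 i2 i3 by simp
  then show "(norm (cls \<phi>))\<^sup>2 \<le> (2 * R * norm (cls (cgrad \<phi>)))\<^sup>2"
    by (simp add: power_mult_distrib cls_norm[OF test_fun_sq_int(1)[OF \<phi>]] cls_norm[OF test_fun_sq_int(2)[OF \<phi>]])
qed (use R in simp)

lemma integrable_lborel_translate: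
  fixes f :: "'a::euclidean_space \<Rightarrow> real"
  assumes "integrable lborel f" shows "integrable lborel (\<lambda>x. f (x + a))"
proof -
  have "integrable (distr lborel borel ((+) a)) f" using assms by (simp add: lborel_distr_plus)
  then show ?thesis using assms by (subst (asm) integrable_distr_eq) (auto simp: add.commute)
qed

text \<open>The increment along \<open>h\<close> is compared with the difference quotients of step
  \<open>h / Suc n\<close>, for every \<open>n\<close>; their limit is the derivative along
  \<open>h\<close>, which Cauchy-Schwarz bounds by the gradient.\<close>

lemma translation_estimate:
  fixes \<phi> :: "real^'n::finite \<Rightarrow> real"
  assumes \<phi>: "test_fun \<Omega> \<phi>"
  shows "integrable lborel (\<lambda>x. (\<phi> (x + h) - \<phi> x)\<^sup>2)"
    "(LINT x|lborel. (\<phi> (x + h) - \<phi> x)\<^sup>2) \<le> (norm h)\<^sup>2 * (norm (cls (cgrad \<phi>)))\<^sup>2"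
proof -
  define q where "q n x = real (Suc n) * (\<phi> (x + (1 / real (Suc n)) *\<^sub>R h) - \<phi> x)" for n x
  note dq = test_fun_difference_quotient[OF \<phi>, where h=h, folded q_def]
  obtain B R where BR: "\<And>n x. \<bar>q n x\<bar> \<le> B * indicator (cball 0 R) x" using dq(2) by blast
  have [measurable]: "\<And>n. q n \<in> borel_measurable borel" by (rule dq)
  have ib: "integrable lborel (\<lambda>x::real^'n. B\<^sup>2 * indicator (cball 0 R) x)"
    by (intro integrable_mult_right integrable_real_indicator) (auto simp: emeasure_bounded_finite[OF bounded_cball, unfolded infinity_ennreal_def])
  have q2: "(q n x)\<^sup>2 \<le> B\<^sup>2 * indicator (cball 0 R) x" for n x
    using power_mono[OF BR[of n x] abs_ge_zero, of 2] by (auto simp: power_mult_distrib split: split_indicator_asm)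
  have iq: "integrable lborel (\<lambda>x. (q n x)\<^sup>2)" for n
    by (rule Bochner_Integration.integrable_bound[OF ib]) (use q2 in \<open>auto intro: order_trans[OF q2 abs_ge_self]\<close>)
  from iq[of 0] show i0: "integrable lborel (\<lambda>x. (\<phi> (x + h) - \<phi> x)\<^sup>2)" by (simp add: q_def)
  have le: "(LINT x|lborel. (\<phi> (x + h) - \<phi> x)\<^sup>2) \<le> (LINT x|lborel. (q n x)\<^sup>2)" for n
  proof -
    define N where "N = real (Suc n)"
    have N: "N > 0" unfolding N_def by simp
    define g where "g x = \<phi> (x + (1 / N) *\<^sub>R h) - \<phi> x" for x
    have gq: "(q n x)\<^sup>2 = N\<^sup>2 * (g x)\<^sup>2" for x unfolding q_def g_def N_def by (simp add: power_mult_distrib)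
    have ig: "integrable lborel (\<lambda>x. (g x)\<^sup>2)"
      using iq[of n] N unfolding gq by simp
    have ig': "integrable lborel (\<lambda>x. (g (x + a))\<^sup>2)" for a by (rule integrable_lborel_translate[OF ig])
    have tr: "(LINT x|lborel. (g (x + a))\<^sup>2) = (LINT x|lborel. (g x)\<^sup>2)" for a
      using ig by (intro LINT_lborel_translate[of "\<lambda>x. (g x)\<^sup>2"]) simp
    \<comment> \<open>Telescope over \<open>N\<close> equal steps and apply Cauchy-Schwarz to the
      \<open>N\<close> terms. All translates have the same integral, so a factor
      \<open>N * N\<close> arises, exactly the square of the factor in \<open>q n\<close>.\<close>
    have "(\<phi> (x + h) - \<phi> x)\<^sup>2 \<le> N * (\<Sum>k<Suc n. (g (x + (real k / N) *\<^sub>R h))\<^sup>2)" for x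
    proof -
      have "(\<Sum>k<Suc n. g (x + (real k / N) *\<^sub>R h)) =
          (\<Sum>k<Suc n. \<phi> (x + (real (Suc k) / N) *\<^sub>R h) - \<phi> (x + (real k / N) *\<^sub>R h))"
        unfolding g_def
        by (intro sum.cong refl arg_cong2[where f="(-)"] arg_cong[where f=\<phi>])
          (simp add: add_divide_distrib scaleR_left_distrib algebra_simps)
      also have "\<dots> = \<phi> (x + (real (Suc n) / N) *\<^sub>R h) - \<phi> (x + (real 0 / N) *\<^sub>R h)"
        by (rule sum_lessThan_telescope)
      finally have "\<phi> (x + h) - \<phi> x = (\<Sum>k<Suc n. g (x + (real k / N) *\<^sub>R h))" using N unfolding N_def by simp
      then show ?thesis
        using sum_squared_le_sum_of_squares[of "\<lambda>k. g (x + (real k / N) *\<^sub>R h)" "{..<Suc n}"]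
        by (simp add: N_def mult.commute del: sum.lessThan_Suc)
    qed
    then have "(LINT x|lborel. (\<phi> (x + h) - \<phi> x)\<^sup>2) \<le> (LINT x|lborel. N * (\<Sum>k<Suc n. (g (x + (real k / N) *\<^sub>R h))\<^sup>2))"
      by (intro integral_mono i0 integrable_mult_right Bochner_Integration.integrable_sum ig')
    also have "\<dots> = N * (\<Sum>k<Suc n. (LINT x|lborel. (g (x + (real k / N) *\<^sub>R h))\<^sup>2))"
      using ig' by (subst integral_mult_right_zero, subst Bochner_Integration.integral_sum) auto
    also have "\<dots> = (LINT x|lborel. (q n x)\<^sup>2)"
      unfolding tr gq by (simp add: N_def power2_eq_square del: sum.lessThan_Suc of_nat_Suc)
    finally show ?thesis .
  qed
  have [measurable]: "cgrad \<phi> \<in> borel_measurable borel"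
    by (rule borel_measurable_continuous_onI[OF smooth_continuous_cgrad[OF test_fun_smooth[OF \<phi>]]])
  have "(\<lambda>n. LINT x|lborel. (q n x)\<^sup>2) \<longlonglongrightarrow> (LINT x|lborel. (cgrad \<phi> x \<bullet> h)\<^sup>2)"
  proof (rule integral_dominated_convergence[OF _ _ ib])
    show "AE x in lborel. (\<lambda>n. (q n x)\<^sup>2) \<longlonglongrightarrow> (cgrad \<phi> x \<bullet> h)\<^sup>2" using dq(1) by (intro AE_I2 tendsto_power)
  qed (use q2 in auto)
  then have "(LINT x|lborel. (\<phi> (x + h) - \<phi> x)\<^sup>2) \<le> (LINT x|lborel. (cgrad \<phi> x \<bullet> h)\<^sup>2)"
    by (rule tendsto_lowerbound) (use le in auto)
  also have "\<dots> \<le> (LINT x|lborel. (norm h)\<^sup>2 * (norm (cgrad \<phi> x))\<^sup>2)"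
  proof (rule integral_mono_AE')
    have "integrable lborel (\<lambda>x. (norm (cgrad \<phi> x))\<^sup>2)"
      using sq_intD[OF test_fun_sq_int(2)[OF \<phi>]] by (subst (asm) integrable_completion) auto
    then show "integrable lborel (\<lambda>x. (norm h)\<^sup>2 * (norm (cgrad \<phi> x))\<^sup>2)" by simp
    show "AE x in lborel. (cgrad \<phi> x \<bullet> h)\<^sup>2 \<le> (norm h)\<^sup>2 * (norm (cgrad \<phi> x))\<^sup>2"
    proof (rule AE_I2)
      fix x show "(cgrad \<phi> x \<bullet> h)\<^sup>2 \<le> (norm h)\<^sup>2 * (norm (cgrad \<phi> x))\<^sup>2"
        using Cauchy_Schwarz_ineq[of "cgrad \<phi> x" h] by (simp add: power2_norm_eq_inner mult.commute)
    qed
  qed simp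
  also have "\<dots> = (norm h)\<^sup>2 * (norm (cls (cgrad \<phi>)))\<^sup>2"
    by (simp add: cls_norm[OF test_fun_sq_int(2)[OF \<phi>]] LINT_lebesgue_lborel)
  finally show "(LINT x|lborel. (\<phi> (x + h) - \<phi> x)\<^sup>2) \<le> (norm h)\<^sup>2 * (norm (cls (cgrad \<phi>)))\<^sup>2" .
qed

section \<open>Compactness through averages over balls\<close>

definition ball_avg :: "real \<Rightarrow> ('a::euclidean_space \<Rightarrow> real) \<Rightarrow> 'a \<Rightarrow> real" where
  "ball_avg \<delta> \<phi> x = (LINT z|lborel. indicator (ball x \<delta>) z * \<phi> z) / measure lborel (ball (0::'a) \<delta>)"

lemma ball_translate:
  fixes x :: "'a::euclidean_space"
  shows "emeasure lborel (ball x \<delta>) = emeasure lborel (ball (0::'a) \<delta>)"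
    "(indicator (ball x \<delta>) (x + y) :: real) = indicator (ball 0 \<delta>) y"
proof -
  have "emeasure lborel (ball x \<delta>) = emeasure (distr lborel borel ((+) x)) (ball x \<delta>)"
    by (simp add: lborel_distr_plus)
  also have "\<dots> = emeasure lborel ((+) x -` ball x \<delta>)" by (subst emeasure_distr) auto
  also have "(+) x -` ball x \<delta> = ball 0 \<delta>" by (auto simp: dist_norm)
  finally show "emeasure lborel (ball x \<delta>) = emeasure lborel (ball (0::'a) \<delta>)" .
  show "(indicator (ball x \<delta>) (x + y) :: real) = indicator (ball 0 \<delta>) y"
    by (auto simp: indicator_def dist_norm)
qed

context
  fixes \<delta> :: real and \<phi> :: "real^'n::finite \<Rightarrow> real" and \<Omega>
  assumes \<delta>: "\<delta> > 0" and \<phi>: "test_fun \<Omega> \<phi>"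
begin

lemma ball_sq_int: "sq_int (indicator (ball (x::real^'n) \<delta>) :: real^'n \<Rightarrow> real)"
  by (rule sq_int_indicator) (rule lmeasurable_ball)

lemma measure_ball_pos: "measure lborel (ball (0::real^'n) \<delta>) > 0"
  using content_ball_pos[OF \<delta>, of "0 :: real^'n"] by (simp add: measure_completion)

lemma norm_cls_ball: "(norm (cls (indicator (ball (x::real^'n) \<delta>) :: real^'n \<Rightarrow> real)))\<^sup>2 = measure lborel (ball (0::real^'n) \<delta>)"
proof -
  have sq: "(norm (indicator (ball x \<delta>) z :: real))\<^sup>2 = indicator (ball x \<delta>) z" for z
    by (simp split: split_indicator)
  have "(norm (cls (indicator (ball x \<delta>) :: real^'n \<Rightarrow> real)))\<^sup>2 = (LINT z|lebesgue. indicator (ball x \<delta>) z)"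
    unfolding cls_norm[OF ball_sq_int] sq ..
  also have "\<dots> = measure lebesgue (ball x \<delta>)" by (simp only: Bochner_Integration.integral_indicator space_completion space_lborel space_borel Int_UNIV_right)
  also have "\<dots> = measure lborel (ball x \<delta>)" by (rule measure_completion) simp
  also have "\<dots> = measure lborel (ball (0::real^'n) \<delta>)"
    by (simp only: measure_def ball_translate(1)[of x])
  finally show ?thesis .
qed

lemma \<phi>_borel[measurable]: "\<phi> \<in> borel_measurable borel"
  by (rule borel_measurable_continuous_onI[OF smooth_continuous[OF test_fun_smooth[OF \<phi>]]])

lemma ball_borel[measurable]: "ball (x::real^'n) \<delta> \<in> sets borel" by simp

text \<open>As a pairing with a fixed class, the average at each point converges along weakly
  convergent sequences.\<close>

lemma ball_avg_inner: "ball_avg \<delta> \<phi> x = (cls \<phi> \<bullet> cls (indicator (ball x \<delta>))) / measure lborel (ball (0::real^'n) \<delta>)"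
proof -
  have "cls \<phi> \<bullet> cls (indicator (ball x \<delta>)) = (LINT z|lebesgue. indicator (ball x \<delta>) z * \<phi> z)"
    by (simp only: cls_inner[OF test_fun_sq_int(1)[OF \<phi>] ball_sq_int] inner_real_def mult.commute)
  also have "\<dots> = (LINT z|lborel. indicator (ball x \<delta>) z * \<phi> z)"
    by (rule LINT_lebesgue_lborel) measurable
  finally show ?thesis unfolding ball_avg_def by simp
qed

lemma ball_avg_bound: "\<bar>ball_avg \<delta> \<phi> x\<bar> \<le> norm (cls \<phi>) / sqrt (measure lborel (ball (0::real^'n) \<delta>))"
proof -
  let ?m = "measure lborel (ball (0::real^'n) \<delta>)"
  have "norm (cls (indicator (ball x \<delta>) :: real^'n \<Rightarrow> real)) = sqrt ?m"
    using norm_cls_ball[of x] by (metis abs_norm_cancel real_sqrt_abs)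
  then have "\<bar>ball_avg \<delta> \<phi> x\<bar> \<le> norm (cls \<phi>) * sqrt ?m / ?m"
    unfolding ball_avg_inner using measure_ball_pos Cauchy_Schwarz_ineq2[of "cls \<phi>" "cls (indicator (ball x \<delta>))"]
    by (simp add: abs_divide divide_right_mono)
  also have "norm (cls \<phi>) * sqrt ?m / ?m = norm (cls \<phi>) / sqrt ?m"
    using measure_ball_pos by (simp add: field_simps)
  finally show ?thesis .
qed

lemma ball_avg_zero: assumes "\<Omega> \<subseteq> cball 0 R" "x \<notin> cball 0 (R + \<delta>)" shows "ball_avg \<delta> \<phi> x = 0"
proof -
  have "indicator (ball x \<delta>) z * \<phi> z = 0" for z
  proof (cases "\<phi> z = 0")
    case False
    then have "norm z \<le> R" using \<phi> assms(1) unfolding test_fun_def by (auto simp: subset_iff)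
    then have "z \<notin> ball x \<delta>" using assms(2) norm_triangle_ineq2[of x z] by (auto simp: dist_norm)
    then show ?thesis by simp
  qed simp
  then have "(\<lambda>z. indicator (ball x \<delta>) z * \<phi> z) = (\<lambda>z. 0)" by (rule ext)
  then show ?thesis unfolding ball_avg_def by (simp only: integral_zero div_0)
qed

lemma ball_avg_measurable: "ball_avg \<delta> \<phi> \<in> borel_measurable borel"
proof -
  have "(\<lambda>x. LINT z|lborel. (if dist x z < \<delta> then \<phi> z else 0)) \<in> borel_measurable borel"
    by measurable
  moreover have "indicator (ball x \<delta>) z * \<phi> z = (if dist x z < \<delta> then \<phi> z else 0)" for x z
    by (simp add: indicator_def)
  ultimately show ?thesis unfolding ball_avg_def[abs_def] by simp
qed

lemma ball_avg_sq_int: assumes "\<Omega> \<subseteq> cball 0 R" shows "sq_int (ball_avg \<delta> \<phi>)"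
  by (rule sq_intI_bounded[of _ "cball 0 (R + \<delta>)" "norm (cls \<phi>) / sqrt (measure lborel (ball (0::real^'n) \<delta>))"])
    (use ball_avg_measurable ball_avg_bound ball_avg_zero[OF assms] in
      \<open>auto intro: borel_lebesgueI simp: indicator_def split: if_splits\<close>)

text \<open>Jensen's inequality and Fubini reduce the estimate to the translates of \<open>\<phi>\<close>.\<close>

lemma ball_avg_close:
  assumes "\<Omega> \<subseteq> cball 0 R"
  shows "norm (cls (ball_avg \<delta> \<phi>) - cls \<phi>) \<le> \<delta> * norm (cls (cgrad \<phi>))"
proof -
  define m where "m = measure lborel (ball (0::real^'n) \<delta>)"
  define Gr where "Gr = (norm (cls (cgrad \<phi>)))\<^sup>2"
  have m: "m > 0" unfolding m_def by (rule measure_ball_pos)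
  have fin: "emeasure lborel (ball (0::real^'n) \<delta>) = ennreal m"
    unfolding m_def by (rule emeasure_eq_ennreal_measure) (use emeasure_bounded_finite[of "ball (0::real^'n) \<delta>"] in auto)
  obtain B where B: "\<And>x. \<bar>\<phi> x\<bar> \<le> B" using test_fun_bounded[OF \<phi>] by blast
  define J where "J x y = indicator (ball 0 \<delta>) y * (\<phi> (x + y) - \<phi> x)" for x y
  have Jsq: "sq_int (J x)" for x
  proof (rule sq_intI_bounded[of _ "ball 0 \<delta>" "2 * B"])
    show "J x \<in> borel_measurable lebesgue" unfolding J_def by (rule borel_lebesgueI) measurable
    show "ball (0::real^'n) \<delta> \<in> lmeasurable" by (rule lmeasurable_ball)
    show "norm (J x y) \<le> 2 * B * indicator (ball 0 \<delta>) y" for y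
      unfolding J_def using B[of "x + y"] B[of x] by (auto simp: indicator_def)
  qed
  have pt: "(ball_avg \<delta> \<phi> x - \<phi> x)\<^sup>2 \<le> (norm (cls (J x)))\<^sup>2 / m" for x
  proof -
    have ii: "integrable lborel (\<lambda>y. indicator (ball 0 \<delta>) y * \<phi> (x + y))"
    proof (rule Bochner_Integration.integrable_bound)
      show "integrable lborel (\<lambda>y::real^'n. B * indicator (ball 0 \<delta>) y)"
        by (intro integrable_mult_right integrable_real_indicator) (auto simp: fin)
      show "AE y in lborel. norm (indicator (ball 0 \<delta>) y * \<phi> (x + y)) \<le> norm (B * indicator (ball 0 \<delta>) y)"
        using B by (intro AE_I2) (auto simp: indicator_def intro: order_trans[OF B abs_ge_self])
    qed measurable
    have "(LINT z|lborel. indicator (ball x \<delta>) z * \<phi> z) = (LINT y|lborel. indicator (ball x \<delta>) (y + x) * \<phi> (y + x))"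
      by (rule LINT_lborel_translate[symmetric]) measurable
    also have "\<dots> = (LINT y|lborel. indicator (ball 0 \<delta>) y * \<phi> (x + y))"
      using ball_translate(2)[of x \<delta>] by (simp add: add.commute)
    finally have "ball_avg \<delta> \<phi> x - \<phi> x = (LINT y|lborel. indicator (ball 0 \<delta>) y * \<phi> (x + y)) / m - \<phi> x"
      unfolding ball_avg_def m_def by simp
    also have "\<dots> = ((LINT y|lborel. indicator (ball 0 \<delta>) y * \<phi> (x + y)) - (LINT y|lborel. indicator (ball (0::real^'n) \<delta>) y * \<phi> x)) / m"
      using m by (simp add: m_def diff_divide_distrib)
    also have "\<dots> = (LINT y|lborel. J x y) / m"
      unfolding J_def right_diff_distrib
      by (subst Bochner_Integration.integral_diff[OF ii]) (auto intro!: integrable_mult_left integrable_real_indicator simp: fin)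
    also have "(LINT y|lborel. J x y) = (LINT y|lebesgue. J x y)"
      by (rule LINT_lebesgue_lborel[symmetric]) (simp add: J_def)
    also have "\<dots> = cls (J x) \<bullet> cls (indicator (ball 0 \<delta>))"
      by (subst cls_inner[OF Jsq ball_sq_int]) (auto intro!: Bochner_Integration.integral_cong simp: J_def indicator_def)
    finally have "ball_avg \<delta> \<phi> x - \<phi> x = (cls (J x) \<bullet> cls (indicator (ball 0 \<delta>))) / m" .
    then have "(ball_avg \<delta> \<phi> x - \<phi> x)\<^sup>2 = (cls (J x) \<bullet> cls (indicator (ball 0 \<delta>)))\<^sup>2 / m\<^sup>2"
      by (simp add: power_divide)
    also have "\<dots> \<le> ((norm (cls (J x)))\<^sup>2 * m) / m\<^sup>2"
      using Cauchy_Schwarz_ineq[of "cls (J x)" "cls (indicator (ball 0 \<delta>))"] norm_cls_ball[of 0]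
      by (intro divide_right_mono) (auto simp: power2_norm_eq_inner m_def)
    finally show ?thesis using m by (simp add: power2_eq_square)
  qed
  have "ennreal ((norm (cls (ball_avg \<delta> \<phi>) - cls \<phi>))\<^sup>2) = (\<integral>\<^sup>+x. ennreal ((ball_avg \<delta> \<phi> x - \<phi> x)\<^sup>2) \<partial>lborel)"
  proof -
    have "ennreal ((norm (cls (ball_avg \<delta> \<phi>) - cls \<phi>))\<^sup>2) = (\<integral>\<^sup>+x. ennreal ((norm (ball_avg \<delta> \<phi> x - \<phi> x))\<^sup>2) \<partial>lebesgue)"
      using nn_integral_sq[OF sq_int_diff[OF ball_avg_sq_int[OF assms] test_fun_sq_int(1)[OF \<phi>]]]
      by (simp add: cls_diff ball_avg_sq_int[OF assms] test_fun_sq_int(1)[OF \<phi>])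
    also have "\<dots> = (\<integral>\<^sup>+x. ennreal ((ball_avg \<delta> \<phi> x - \<phi> x)\<^sup>2) \<partial>lborel)"
      using ball_avg_measurable by (subst nn_integral_completion) auto
    finally show ?thesis .
  qed
  also have "\<dots> \<le> (\<integral>\<^sup>+x. ennreal (1 / m) * (\<integral>\<^sup>+y. ennreal ((J x y)\<^sup>2) \<partial>lborel) \<partial>lborel)"
  proof (rule nn_integral_mono)
    fix x
    have "(\<integral>\<^sup>+y. ennreal ((norm (J x y))\<^sup>2) \<partial>lebesgue) = (\<integral>\<^sup>+y. ennreal ((norm (J x y))\<^sup>2) \<partial>lborel)"
      unfolding J_def by (subst nn_integral_completion) auto
    then have "ennreal (1 / m) * (\<integral>\<^sup>+y. ennreal ((J x y)\<^sup>2) \<partial>lborel) = ennreal ((norm (cls (J x)))\<^sup>2 / m)"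
      using nn_integral_sq[OF Jsq[of x]] m by (simp add: ennreal_mult[symmetric])
    then show "ennreal ((ball_avg \<delta> \<phi> x - \<phi> x)\<^sup>2) \<le> ennreal (1 / m) * (\<integral>\<^sup>+y. ennreal ((J x y)\<^sup>2) \<partial>lborel)"
      using ennreal_leI[OF pt[of x]] by simp
  qed
  also have "\<dots> = ennreal (1 / m) * (\<integral>\<^sup>+x. (\<integral>\<^sup>+y. ennreal ((J x y)\<^sup>2) \<partial>lborel) \<partial>lborel)"
    unfolding J_def by (rule nn_integral_cmult) measurable
  also have "(\<integral>\<^sup>+x. (\<integral>\<^sup>+y. ennreal ((J x y)\<^sup>2) \<partial>lborel) \<partial>lborel) = (\<integral>\<^sup>+y. (\<integral>\<^sup>+x. ennreal ((J x y)\<^sup>2) \<partial>lborel) \<partial>lborel)"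
    unfolding J_def by (rule lborel_pair.Fubini') measurable
  also have "\<dots> \<le> (\<integral>\<^sup>+y. ennreal (\<delta>\<^sup>2 * Gr) * indicator (ball (0::real^'n) \<delta>) y \<partial>lborel)"
  proof (rule nn_integral_mono)
    fix y :: "real^'n"
    show "(\<integral>\<^sup>+x. ennreal ((J x y)\<^sup>2) \<partial>lborel) \<le> ennreal (\<delta>\<^sup>2 * Gr) * indicator (ball 0 \<delta>) y"
    proof (cases "y \<in> ball 0 \<delta>")
      case True
      then have "(\<integral>\<^sup>+x. ennreal ((J x y)\<^sup>2) \<partial>lborel) = ennreal (LINT x|lborel. (\<phi> (x + y) - \<phi> x)\<^sup>2)"
        unfolding J_def using translation_estimate(1)[OF \<phi>, of y] by (simp add: nn_integral_eq_integral)
      also have "\<dots> \<le> ennreal (\<delta>\<^sup>2 * Gr)"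
        by (intro ennreal_leI order_trans[OF translation_estimate(2)[OF \<phi>]])
          (use True in \<open>auto simp: Gr_def intro!: mult_right_mono power_mono\<close>)
      finally show ?thesis using True by simp
    qed (simp add: J_def)
  qed
  also have "\<dots> = ennreal (\<delta>\<^sup>2 * Gr) * ennreal m" by (simp add: nn_integral_cmult_indicator fin)
  finally have "ennreal ((norm (cls (ball_avg \<delta> \<phi>) - cls \<phi>))\<^sup>2) \<le> ennreal (1 / m) * (ennreal (\<delta>\<^sup>2 * Gr) * ennreal m)"
    by (simp add: mult_left_mono)
  also have "\<dots> = ennreal (\<delta>\<^sup>2 * Gr)"
    using m by (simp add: ennreal_mult[symmetric] Gr_def)
  finally have "(norm (cls (ball_avg \<delta> \<phi>) - cls \<phi>))\<^sup>2 \<le> (\<delta> * norm (cls (cgrad \<phi>)))\<^sup>2"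
    unfolding Gr_def by (subst (asm) ennreal_le_iff) (auto simp: power_mult_distrib)
  then show ?thesis by (rule power2_le_imp_le) (use \<delta> in auto)
qed

end

text \<open>For fixed radius the averages converge pointwise by weak convergence and are bounded
  with common support, so they converge in norm. They stay within radius times \<open>B\<close> of
  the functions, uniformly in \<open>n\<close>, which makes the functions themselves a Cauchy
  sequence.\<close>

lemma test_fun_rellich:
  fixes \<phi> :: "nat \<Rightarrow> real^'n::finite \<Rightarrow> real"
  assumes \<phi>: "\<And>n. test_fun \<Omega> (\<phi> n)" and R: "\<Omega> \<subseteq> cball 0 R" "R > 0"
    and B: "\<And>n. norm (cls (cgrad (\<phi> n))) \<le> B" and w: "wconv (\<lambda>n. cls (\<phi> n)) v"
  shows "(\<lambda>n. cls (\<phi> n)) \<longlonglongrightarrow> v"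
proof -
  have B0: "B \<ge> 0" using B[of 0] norm_ge_zero order_trans by blast
  have nb: "norm (cls (\<phi> n)) \<le> 2 * R * B" for n
    by (rule order_trans[OF test_fun_poincare[OF \<phi> R]]) (use B R in \<open>simp add: mult_left_mono\<close>)
  have conv: "convergent (\<lambda>n. cls (ball_avg \<delta> (\<phi> n)))" if \<delta>: "\<delta> > 0" for \<delta>
  proof -
    define m where "m = measure lborel (ball (0::real^'n) \<delta>)"
    define C where "C = 2 * R * B / sqrt m"
    have m: "m > 0" unfolding m_def by (rule measure_ball_pos[OF \<delta> \<phi>[of 0]])
    define a where "a x = (v \<bullet> cls (indicator (ball x \<delta>))) / m" for x
    have lim: "(\<lambda>n. ball_avg \<delta> (\<phi> n) x) \<longlonglongrightarrow> a x" for x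
      unfolding a_def ball_avg_inner[OF \<delta> \<phi>] m_def[symmetric] by (intro tendsto_intros wconvD[OF w]) (use m in simp)
    have bnd: "\<bar>ball_avg \<delta> (\<phi> n) x\<bar> \<le> C * indicator (cball 0 (R + \<delta>)) x" for n x
    proof (cases "x \<in> cball 0 (R + \<delta>)")
      case True
      have "\<bar>ball_avg \<delta> (\<phi> n) x\<bar> \<le> C" unfolding C_def m_def
        by (rule order_trans[OF ball_avg_bound[OF \<delta> \<phi>]]) (use nb in \<open>simp add: divide_right_mono\<close>)
      then show ?thesis using True by simp
    next
      case False
      then show ?thesis using ball_avg_zero[OF \<delta> \<phi> R(1) False] by simp
    qed
    have meas: "ball_avg \<delta> (\<phi> n) \<in> borel_measurable lebesgue" for n
      by (rule borel_lebesgueI[OF ball_avg_measurable[OF \<delta> \<phi>]])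
    have ma: "a \<in> borel_measurable lebesgue" by (rule borel_measurable_LIMSEQ_real[OF lim meas])
    have ba: "\<bar>a x\<bar> \<le> C * indicator (cball 0 (R + \<delta>)) x" for x
      by (rule tendsto_upperbound[OF tendsto_rabs[OF lim]]) (use bnd in auto)
    have sq: "sq_int (ball_avg \<delta> (\<phi> n))" for n by (rule ball_avg_sq_int[OF \<delta> \<phi> R(1)])
    have sqa: "sq_int a" by (rule sq_intI_bounded[OF ma _ ba[folded real_norm_def]]) simp
    have "(\<lambda>n. LINT x|lebesgue. (norm (ball_avg \<delta> (\<phi> n) x - a x))\<^sup>2) \<longlonglongrightarrow> (LINT x|(lebesgue :: (real^'n) measure). 0)"
    proof (rule integral_dominated_convergence[where w="\<lambda>x. (2 * C)\<^sup>2 * indicator (cball 0 (R + \<delta>)) x"])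
      show "integrable lebesgue (\<lambda>x. (2 * C)\<^sup>2 * indicator (cball (0::real^'n) (R + \<delta>)) x)"
        by (intro integrable_mult_right integrable_real_indicator) (auto simp: emeasure_bounded_finite[OF bounded_cball, unfolded infinity_ennreal_def])
      show "AE x in lebesgue. (\<lambda>n. (norm (ball_avg \<delta> (\<phi> n) x - a x))\<^sup>2) \<longlonglongrightarrow> 0"
      proof (rule AE_I2)
        fix x
        show "(\<lambda>n. (norm (ball_avg \<delta> (\<phi> n) x - a x))\<^sup>2) \<longlonglongrightarrow> 0"
          using tendsto_power[OF tendsto_norm[OF LIM_zero[OF lim[of x]]], of 2] by simp
      qed
      show "AE x in lebesgue. norm ((norm (ball_avg \<delta> (\<phi> n) x - a x))\<^sup>2) \<le> (2 * C)\<^sup>2 * indicator (cball 0 (R + \<delta>)) x" for n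
      proof (rule AE_I2)
        fix x
        have "\<bar>ball_avg \<delta> (\<phi> n) x - a x\<bar> \<le> 2 * C * indicator (cball 0 (R + \<delta>)) x"
          using bnd[of n x] ba[of x] by linarith
        from power_mono[OF this abs_ge_zero, of 2]
        show "norm ((norm (ball_avg \<delta> (\<phi> n) x - a x))\<^sup>2) \<le> (2 * C)\<^sup>2 * indicator (cball 0 (R + \<delta>)) x"
          by (auto simp: power_mult_distrib split: split_indicator_asm)
      qed
    qed (use meas ma in auto)
    then have "(\<lambda>n. cls (ball_avg \<delta> (\<phi> n))) \<longlonglongrightarrow> cls a" using cls_tendsto_iff[OF sq sqa] by simp
    then show ?thesis by (rule convergentI)
  qed
  have "Cauchy (\<lambda>n. cls (\<phi> n))"
  proof (rule CauchyI)
    fix e :: real assume e: "e > 0"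
    \<comment> \<open>Each of the two approximation errors is then at most \<open>e / 4\<close>; the
      added 1 covers \<open>B = 0\<close>.\<close>
    define \<delta> where "\<delta> = e / (4 * (B + 1))"
    have \<delta>: "\<delta> > 0" "\<delta> * B \<le> e / 4" unfolding \<delta>_def using e B0 by (auto simp: field_simps)
    obtain N where N: "\<And>m n. m \<ge> N \<Longrightarrow> n \<ge> N \<Longrightarrow> norm (cls (ball_avg \<delta> (\<phi> m)) - cls (ball_avg \<delta> (\<phi> n))) < e / 2"
      using CauchyD[OF convergent_Cauchy[OF conv[OF \<delta>(1)]], of "e / 2"] e by auto
    have cl: "norm (cls (ball_avg \<delta> (\<phi> n)) - cls (\<phi> n)) \<le> e / 4" for n
      using ball_avg_close[OF \<delta>(1) \<phi> R(1), of n] mult_left_mono[OF B[of n], of \<delta>] \<delta> by linarith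
    have "norm (cls (\<phi> m) - cls (\<phi> n)) < e" if "m \<ge> N" "n \<ge> N" for m n
    proof -
      let ?a = "\<lambda>n. cls (ball_avg \<delta> (\<phi> n))"
      have eq: "cls (\<phi> m) - cls (\<phi> n) = (?a m - ?a n) - (?a m - cls (\<phi> m)) + (?a n - cls (\<phi> n))" by simp
      have "norm (cls (\<phi> m) - cls (\<phi> n)) \<le> norm (?a m - ?a n) + norm (?a m - cls (\<phi> m)) + norm (?a n - cls (\<phi> n))"
        unfolding eq by (intro order_trans[OF norm_triangle_ineq] add_right_mono norm_triangle_ineq4)
      then show ?thesis using N[OF that] cl[of m] cl[of n] by linarith
    qed
    then show "\<exists>M. \<forall>m\<ge>M. \<forall>n\<ge>M. norm (cls (\<phi> m) - cls (\<phi> n)) < e" by blast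
  qed
  then obtain u where u: "(\<lambda>n. cls (\<phi> n)) \<longlonglongrightarrow> u" using Cauchy_convergent convergent_def by blast
  then have "u = v" by (intro wconv_unique[OF wconv_if_tendsto w])
  then show ?thesis using u by simp
qed


subsection \<open>Monotone Lipschitz functions of one variable\<close>

lemma emeasure_disjoint_balls_mono:
  fixes a :: "'i \<Rightarrow> real"
  assumes C: "countable C" "pairwise (\<lambda>i j. disjnt (ball (a i) (r i)) (ball (a j) (r j))) C"
    and sets: "sets M1 = sets borel" "sets M2 = sets borel"
    and le: "\<And>i. i \<in> C \<Longrightarrow> c * emeasure M1 (ball (a i) (r i)) \<le> d * emeasure M2 (ball (a i) (r i))"
  shows "c * emeasure M1 (\<Union>i\<in>C. ball (a i) (r i)) \<le> d * emeasure M2 (\<Union>i\<in>C. ball (a i) (r i))"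
proof -
  have dj: "disjoint_family_on (\<lambda>i. ball (a i) (r i)) C"
    using C(2) unfolding disjoint_family_on_def pairwise_def disjnt_def by blast
  have "c * emeasure M1 (\<Union>i\<in>C. ball (a i) (r i)) = (\<integral>\<^sup>+i. c * emeasure M1 (ball (a i) (r i)) \<partial>count_space C)"
    by (subst emeasure_UN_countable) (use C dj sets in \<open>auto simp: nn_integral_cmult\<close>)
  also have "\<dots> \<le> (\<integral>\<^sup>+i. d * emeasure M2 (ball (a i) (r i)) \<partial>count_space C)"
    by (rule nn_integral_mono) (use le in auto)
  also have "\<dots> = d * emeasure M2 (\<Union>i\<in>C. ball (a i) (r i))"
    by (subst emeasure_UN_countable) (use C dj sets in \<open>auto simp: nn_integral_cmult\<close>)
  finally show ?thesis .
qed

locale mono_lipschitz =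
  fixes F :: "real \<Rightarrow> real"
  assumes mono: "\<And>x y. x \<le> y \<Longrightarrow> F x \<le> F y"
    and lip: "\<And>x y. x \<le> y \<Longrightarrow> F y - F x \<le> y - x"
begin

lemma abs_lip: "\<bar>F y - F x\<bar> \<le> \<bar>y - x\<bar>"
  using mono[of x y] lip[of x y] mono[of y x] lip[of y x] by (cases "x \<le> y") auto

lemma cont: "continuous_on S F"
proof (rule continuous_onI)
  fix x e :: real assume "e > 0"
  then show "\<exists>d>0. \<forall>y\<in>S. dist y x < d \<longrightarrow> dist (F y) (F x) \<le> e"
    using abs_lip[of _ x] by (intro exI[of _ e]) (auto simp: dist_real_def intro: order_trans less_imp_le)
qed

lemma tendsto_F: "(x \<longlongrightarrow> a) G \<Longrightarrow> ((\<lambda>n. F (x n)) \<longlongrightarrow> F a) G"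
  using cont[of UNIV] continuous_on_tendsto_compose[of UNIV F x a G] by auto

abbreviation MF where "MF \<equiv> interval_measure F"

lemma emeasure_MF_ball:
  assumes "s > 0" shows "emeasure MF (ball c s) = ennreal (F (c + s) - F (c - s))"
proof -
  have Icc: "emeasure MF {a..b} = ennreal (F b - F a)" if "a \<le> b" for a b
    using emeasure_interval_measure_Icc[OF that, of F] mono cont by auto
  have "ball c s \<union> {c - s, c + s} = {c - s..c + s}" using assms by (auto simp: ball_eq_greaterThanLessThan)
  moreover have "emeasure MF (ball c s \<union> {c - s, c + s}) = emeasure MF (ball c s)"
  proof (rule emeasure_Un_null_set)
    have "{c - s} \<in> null_sets MF" "{c + s} \<in> null_sets MF"
      using Icc[of "c - s" "c - s"] Icc[of "c + s" "c + s"] by (auto simp: null_sets_def)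
    from null_sets.Un[OF this] show "{c - s, c + s} \<in> null_sets MF" by (simp add: insert_commute)
  qed simp
  ultimately show ?thesis using Icc[of "c - s" "c + s"] assms by simp
qed

text \<open>The points where the upper derivative exceeds \<open>q\<close>, and those where the lower derivative is below \<open>p\<close>. Using
  intervals around \<open>x\<close> that need not be centred at \<open>x\<close> makes them \<open>G\<^sub>\<delta>\<close> sets.\<close>

definition up :: "real \<Rightarrow> real set" where
  "up q = (\<Inter>n. \<Union>(c, s)\<in>{(c, s). 0 < s \<and> s < 1 / real (Suc n) \<and> F (c + s) - F (c - s) > q * (2 * s)}. ball c s)"

definition low :: "real \<Rightarrow> real set" where
  "low p = (\<Inter>n. \<Union>(c, s)\<in>{(c, s). 0 < s \<and> s < 1 / real (Suc n) \<and> F (c + s) - F (c - s) < p * (2 * s)}. ball c s)"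

lemma up_low_borel: "up q \<in> sets borel" "low p \<in> sets borel"
  unfolding up_def low_def
  by (rule sets.countable_INT', simp, simp, rule image_subsetI, rule borel_open, rule open_UN, auto)+

lemma upI:
  assumes "\<And>d. d > 0 \<Longrightarrow> \<exists>c s. 0 < s \<and> s < d \<and> F (c + s) - F (c - s) > q * (2 * s) \<and> x \<in> ball c s"
  shows "x \<in> up q"
  unfolding up_def
proof
  fix n
  show "x \<in> (\<Union>(c, s)\<in>{(c, s). 0 < s \<and> s < 1 / real (Suc n) \<and> F (c + s) - F (c - s) > q * (2 * s)}. ball c s)"
    using assms[of "1 / real (Suc n)"] by auto
qed

lemma upD:
  assumes "x \<in> up q" "d > 0"
  shows "\<exists>c s. 0 < s \<and> s < d \<and> F (c + s) - F (c - s) > q * (2 * s) \<and> x \<in> ball c s"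
proof -
  obtain n where n: "1 / real (Suc n) < d" using nat_approx_posE[OF assms(2)] by blast
  have "x \<in> (\<Union>(c, s)\<in>{(c, s). 0 < s \<and> s < 1 / real (Suc n) \<and> F (c + s) - F (c - s) > q * (2 * s)}. ball c s)"
    using assms(1) unfolding up_def by blast
  then show ?thesis using n by (auto intro: less_trans)
qed

lemma lowI:
  assumes "\<And>d. d > 0 \<Longrightarrow> \<exists>c s. 0 < s \<and> s < d \<and> F (c + s) - F (c - s) < p * (2 * s) \<and> x \<in> ball c s"
  shows "x \<in> low p"
  unfolding low_def
proof
  fix n
  show "x \<in> (\<Union>(c, s)\<in>{(c, s). 0 < s \<and> s < 1 / real (Suc n) \<and> F (c + s) - F (c - s) < p * (2 * s)}. ball c s)"
    using assms[of "1 / real (Suc n)"] by auto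
qed

lemma lowD:
  assumes "x \<in> low p" "d > 0"
  shows "\<exists>c s. 0 < s \<and> s < d \<and> F (c + s) - F (c - s) < p * (2 * s) \<and> x \<in> ball c s"
proof -
  obtain n where n: "1 / real (Suc n) < d" using nat_approx_posE[OF assms(2)] by blast
  have "x \<in> (\<Union>(c, s)\<in>{(c, s). 0 < s \<and> s < 1 / real (Suc n) \<and> F (c + s) - F (c - s) < p * (2 * s)}. ball c s)"
    using assms(1) unfolding low_def by blast
  then show ?thesis using n by (auto intro: less_trans)
qed

lemma emeasure_lborel_interval_ball: "s > 0 \<Longrightarrow> emeasure lborel (ball (c::real) s) = ennreal (2 * s)"
  by (simp add: ball_eq_greaterThanLessThan)

lemma ball_fits:
  assumes "open (U :: real set)" "x \<in> U" "d > 0"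
  shows "\<exists>d'>0. d' \<le> d \<and> (\<forall>c s. 0 < s \<longrightarrow> s < d' \<longrightarrow> x \<in> ball c s \<longrightarrow> ball c s \<subseteq> U)"
proof -
  obtain e where e: "e > 0" "ball x e \<subseteq> U" using assms open_contains_ball by blast
  show ?thesis
  proof (intro exI[of _ "min d (e / 2)"] conjI allI impI)
    fix c s :: real assume s: "0 < s" "s < min d (e / 2)" "x \<in> ball c s"
    have "ball c s \<subseteq> ball x e"
    proof
      fix y assume "y \<in> ball c s"
      then show "y \<in> ball x e" using s dist_triangle[of x y c] by (auto simp: dist_commute)
    qed
    then show "ball c s \<subseteq> U" using e by blast
  qed (use assms e in auto)
qed

text \<open>Two Vitali coverings compare Lebesgue measure with the Stieltjes measure of \<open>F\<close>: cover by intervals of slope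
  below \<open>p\<close>, then cover again inside these by intervals of slope above \<open>q\<close>.\<close>

lemma up_low_null:
  assumes pq: "p < q" and E: "E = up q \<inter> low p \<inter> ball 0 (real N)"
  shows "emeasure lborel E = 0"
proof (cases "p > 0")
  case False
  have "low p = {}"
  proof (rule equals0I)
    fix x assume "x \<in> low p"
    then obtain c s where "0 < s" "F (c + s) - F (c - s) < p * (2 * s)" using lowD[of x p 1] by auto
    moreover have "p * (2 * s) \<le> 0" using False \<open>0 < s\<close> by (simp add: mult_nonpos_nonneg)
    ultimately show False using mono[of "c - s" "c + s"] by auto
  qed
  then show ?thesis using E by simp
next
  case True
  have Eb: "E \<in> sets borel" unfolding E using up_low_borel by auto
  have "emeasure lborel E \<le> emeasure lborel (ball (0::real) (real N))" unfolding E by (rule emeasure_mono) auto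
  also have "\<dots> < \<infinity>" by (rule emeasure_lborel_ball_finite)
  finally have fin: "emeasure lborel E = ennreal (measure lborel E)" by (intro emeasure_eq_ennreal_measure) auto
  define m where "m = measure lborel E"
  \<comment> \<open>As \<open>e\<close> tends to 0 this becomes \<open>q * m \<le> p * m\<close>,
    which for \<open>p < q\<close> leaves only \<open>m = 0\<close>.\<close>
  have main: "q * m \<le> p * (m + e)" if e: "e > 0" for e
  proof -
    obtain V where V: "open V" "E \<subseteq> V" "(V - E) \<in> lmeasurable" "emeasure lebesgue (V - E) < ennreal e"
      using sets_lebesgue_outer_open[of E e] Eb e by auto
    have "emeasure lborel V = emeasure lborel (V - E) + emeasure lborel E"
      using V Eb by (subst plus_emeasure) (auto simp: Un_absorb2 intro!: arg_cong[where f="emeasure lborel"])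
    also have "\<dots> \<le> ennreal e + ennreal m"
      using V(1,4) Eb fin unfolding m_def by (intro add_mono) (auto simp: less_imp_le)
    also have "\<dots> = ennreal (m + e)" using e by (simp add: m_def ennreal_plus[symmetric] add.commute del: ennreal_plus)
    finally have Vm: "emeasure lborel V \<le> ennreal (m + e)" .
    define K1 where "K1 = {(c, s). 0 < s \<and> F (c + s) - F (c - s) < p * (2 * s) \<and> ball c s \<subseteq> V}"
    obtain C1 where C1: "countable C1" "C1 \<subseteq> K1"
      "pairwise (\<lambda>i j. disjnt (ball (fst i) (snd i)) (ball (fst j) (snd j))) C1"
      "negligible (E - (\<Union>i\<in>C1. ball (fst i) (snd i)))"
    proof (rule Vitali_covering_theorem_balls[of E K1 fst snd])
      fix x d :: real assume x: "x \<in> E" "0 < d"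
      obtain d' where d': "d' > 0" "d' \<le> d" "\<And>c s. 0 < s \<Longrightarrow> s < d' \<Longrightarrow> x \<in> ball c s \<Longrightarrow> ball c s \<subseteq> V"
        using ball_fits[OF V(1) _ x(2), of x] x(1) V(2) by blast
      obtain c s where "0 < s" "s < d'" "F (c + s) - F (c - s) < p * (2 * s)" "x \<in> ball c s"
        using lowD[of x p d'] x(1) d'(1) unfolding E by blast
      then show "\<exists>i. i \<in> K1 \<and> x \<in> ball (fst i) (snd i) \<and> snd i < d"
        using d' by (intro exI[of _ "(c, s)"]) (auto simp: K1_def)
    qed blast
    define W where "W = (\<Union>i\<in>C1. ball (fst i) (snd i))"
    have "ball (fst i) (snd i) \<subseteq> V" if "i \<in> C1" for i using subsetD[OF C1(2) that] by (simp add: K1_def split_beta)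
    then have W: "open W" "W \<subseteq> V" unfolding W_def by (simp_all add: UN_least open_UN)
    \<comment> \<open>Requiring balls inside \<open>W\<close> makes the Stieltjes measure of the
      second covering at most that of the first, which links the two slope estimates.\<close>
    define K2 where "K2 = {(c, s). 0 < s \<and> F (c + s) - F (c - s) > q * (2 * s) \<and> ball c s \<subseteq> W}"
    obtain C2 where C2: "countable C2" "C2 \<subseteq> K2"
      "pairwise (\<lambda>i j. disjnt (ball (fst i) (snd i)) (ball (fst j) (snd j))) C2"
      "negligible (E \<inter> W - (\<Union>i\<in>C2. ball (fst i) (snd i)))"
    proof (rule Vitali_covering_theorem_balls[of "E \<inter> W" K2 fst snd])
      fix x d :: real assume x: "x \<in> E \<inter> W" "0 < d"
      obtain d' where d': "d' > 0" "d' \<le> d" "\<And>c s. 0 < s \<Longrightarrow> s < d' \<Longrightarrow> x \<in> ball c s \<Longrightarrow> ball c s \<subseteq> W"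
        using ball_fits[OF W(1) _ x(2), of x] x(1) by blast
      obtain c s where "0 < s" "s < d'" "F (c + s) - F (c - s) > q * (2 * s)" "x \<in> ball c s"
        using upD[of x q d'] x(1) d'(1) unfolding E by blast
      then show "\<exists>i. i \<in> K2 \<and> x \<in> ball (fst i) (snd i) \<and> snd i < d"
        using d' by (intro exI[of _ "(c, s)"]) (auto simp: K2_def)
    qed blast
    define Z where "Z = (\<Union>i\<in>C2. ball (fst i) (snd i))"
    have "ball (fst i) (snd i) \<subseteq> W" if "i \<in> C2" for i using subsetD[OF C2(2) that] by (simp add: K2_def split_beta)
    then have Z: "open Z" "Z \<subseteq> W" unfolding Z_def by (simp_all add: UN_least open_UN)
    have "negligible ((E - W) \<union> (E \<inter> W - Z))"
      using C1(4) C2(4) unfolding W_def[symmetric] Z_def[symmetric] by (rule negligible_Un)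
    then have "negligible (E - Z)" by (rule negligible_subset) (use Z in blast)
    then have "E - Z \<in> null_sets lborel"
      using Eb Z(1) by (simp add: negligible_iff_null_sets null_sets_completion_iff)
    then have "emeasure lborel (E - Z) = 0" by auto
    then have "emeasure lborel E \<le> emeasure lborel Z"
      using emeasure_mono[of E "Z \<union> (E - Z)" lborel] emeasure_subadditive[of Z lborel "E - Z"] Eb Z(1)
      by (auto intro: order_trans)
    then have "ennreal q * ennreal m \<le> ennreal q * emeasure lborel Z"
      unfolding m_def fin[symmetric] by (rule mult_left_mono) simp
    also have "\<dots> \<le> 1 * emeasure MF Z"
      unfolding Z_def
    proof (rule emeasure_disjoint_balls_mono[OF C2(1,3)])
      fix i assume "i \<in> C2"
      then have i: "snd i > 0" "F (fst i + snd i) - F (fst i - snd i) > q * (2 * snd i)"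
        using C2(2) by (auto simp: K2_def)
      then show "ennreal q * emeasure lborel (ball (fst i) (snd i)) \<le> 1 * emeasure MF (ball (fst i) (snd i))"
        using True pq by (simp add: emeasure_lborel_interval_ball emeasure_MF_ball ennreal_mult[symmetric] ennreal_leI)
    qed auto
    also have "\<dots> \<le> 1 * emeasure MF W"
      using Z W by (auto intro!: emeasure_mono)
    also have "\<dots> \<le> ennreal p * emeasure lborel W"
      unfolding W_def
    proof (rule emeasure_disjoint_balls_mono[OF C1(1,3)])
      fix i assume "i \<in> C1"
      then have i: "snd i > 0" "F (fst i + snd i) - F (fst i - snd i) < p * (2 * snd i)"
        using C1(2) by (auto simp: K1_def)
      then show "1 * emeasure MF (ball (fst i) (snd i)) \<le> ennreal p * emeasure lborel (ball (fst i) (snd i))"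
        using True by (simp add: emeasure_lborel_interval_ball emeasure_MF_ball ennreal_mult[symmetric] ennreal_leI)
    qed auto
    also have "\<dots> \<le> ennreal p * ennreal (m + e)"
      using W V by (intro mult_left_mono order_trans[OF _ Vm] emeasure_mono) auto
    finally have "ennreal (q * m) \<le> ennreal (p * (m + e))"
      using True pq e by (simp add: ennreal_mult m_def)
    then show ?thesis using True e by (subst (asm) ennreal_le_iff) (auto simp: m_def)
  qed
  have "(q - p) * m \<le> 0"
  proof (rule field_le_epsilon)
    fix e :: real assume "e > 0"
    then have "q * m \<le> p * (m + e / p)" using main[of "e / p"] True by simp
    then show "(q - p) * m \<le> 0 + e" using True by (simp add: algebra_simps)
  qed
  then have "m \<le> 0" using pq by (simp add: mult_le_0_iff)
  then have "m = 0" by (simp add: m_def antisym)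
  then show ?thesis using fin by (simp add: m_def)
qed

section \<open>Lebesgue's theorem on the differentiability of monotone functions\<close>

definition nd :: "real set" where
  "nd = (\<Union>p\<in>\<rat>. \<Union>q\<in>\<rat> \<inter> {p<..}. up q \<inter> low p)"

lemma nd_borel: "nd \<in> sets borel"
  unfolding nd_def
  by (rule sets.countable_UN'[OF countable_rat], rule image_subsetI,
      rule sets.countable_UN'[OF countable_Int1[OF countable_rat]], rule image_subsetI, intro sets.Int up_low_borel)

lemma nd_null: "nd \<in> null_sets lborel"
proof -
  have "up q \<inter> low p \<in> null_sets lborel" if "p < q" for p q
  proof -
    have "up q \<inter> low p \<inter> ball 0 (real N) \<in> null_sets lborel" for N
      using up_low_null[OF that refl, of N] up_low_borel by (auto simp: null_sets_def)
    then have "(\<Union>N. up q \<inter> low p \<inter> ball 0 (real N)) \<in> null_sets lborel" by (rule null_sets_UN)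
    moreover have "(\<Union>N. up q \<inter> low p \<inter> ball 0 (real N)) = up q \<inter> low p"
      using reals_Archimedean2 by (auto simp: dist_real_def)
    ultimately show ?thesis by simp
  qed
  then show ?thesis unfolding nd_def using countable_rat
    by (intro null_sets_UN' countable_Int1) auto
qed

text \<open>The derivative is the supremum of the rational slopes \<open>q\<close> with
  \<open>x\<close> in \<open>up q\<close>. Off \<open>nd\<close> no rational gap separates the upper
  from the lower slopes, so all short intervals around \<open>x\<close> have slope close to this
  supremum.\<close>

lemma differentiable_if_not_nd:
  assumes x: "x \<notin> nd" shows "\<exists>D. (F has_real_derivative D) (at x)"
proof -
  define S where "S = {q \<in> \<rat>. x \<in> up q}"
  \<comment> \<open>Slopes lie between 0 and 1, so \<open>S\<close> contains -1 and is bounded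
    above; its supremum is meaningful.\<close>
  have m1: "-1 \<in> S"
  proof -
    have "x \<in> up (-1)"
    proof (rule upI)
      fix d :: real assume "d > 0"
      then show "\<exists>c s. 0 < s \<and> s < d \<and> F (c + s) - F (c - s) > -1 * (2 * s) \<and> x \<in> ball c s"
        using mono[of "x - d/2" "x + d/2"] by (intro exI[of _ x] exI[of _ "d/2"]) auto
    qed
    then show ?thesis unfolding S_def by auto
  qed
  have S1: "q \<le> 1" if "q \<in> S" for q
  proof (rule ccontr)
    assume q: "\<not> q \<le> 1"
    obtain c s where s: "0 < s" "F (c + s) - F (c - s) > q * (2 * s)" using upD[of x q 1] \<open>q \<in> S\<close> unfolding S_def by auto
    have "F (c + s) - F (c - s) \<le> 2 * s" using lip[of "c - s" "c + s"] s(1) by simp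
    then show False using q s mult_right_mono[of 1 q "2 * s"] by linarith
  qed
  have bdd: "bdd_above S" using S1 by (auto simp: bdd_above_def)
  define D where "D = Sup S"
  have key: "\<exists>d>0. \<forall>c s. 0 < s \<longrightarrow> s < d \<longrightarrow> x \<in> ball c s \<longrightarrow> \<bar>F (c + s) - F (c - s) - D * (2 * s)\<bar> \<le> e * (2 * s)"
    if e: "e > 0" for e
  proof -
    obtain q where q: "q \<in> \<rat>" "D < q" "q < D + e" using Rats_dense_in_real[of D "D + e"] e by auto
    have "q \<notin> S" using cSup_upper[OF _ bdd, of q] q(2) unfolding D_def by auto
    then have "x \<notin> up q" using q(1) unfolding S_def by simp
    then obtain d1 where d1: "d1 > 0" "\<And>c s. 0 < s \<Longrightarrow> s < d1 \<Longrightarrow> x \<in> ball c s \<Longrightarrow> F (c + s) - F (c - s) \<le> q * (2 * s)"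
      using upI[of q x] not_less by metis
    obtain q' where q': "q' \<in> S" "D - e < q'" using less_cSup_iff[OF _ bdd, of "D - e"] m1 e unfolding D_def by auto
    obtain p where p: "p \<in> \<rat>" "D - e < p" "p < q'" using Rats_dense_in_real[OF q'(2)] by auto
    \<comment> \<open>\<open>x\<close> lies in \<open>up q'\<close>, so membership in
      \<open>low p\<close> for the rational \<open>p < q'\<close> would put it in
      \<open>nd\<close>.\<close>
    have "x \<notin> low p" using x p q'(1) unfolding nd_def S_def by auto
    then obtain d2 where d2: "d2 > 0" "\<And>c s. 0 < s \<Longrightarrow> s < d2 \<Longrightarrow> x \<in> ball c s \<Longrightarrow> F (c + s) - F (c - s) \<ge> p * (2 * s)"
      using lowI[of p x] not_less by metis
    show ?thesis
    proof (intro exI[of _ "min d1 d2"] conjI allI impI)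
      fix c s assume s: "0 < s" "s < min d1 d2" "x \<in> ball c s"
      have "q * (2 * s) \<le> (D + e) * (2 * s)" "(D - e) * (2 * s) \<le> p * (2 * s)"
        using q(3) p(2) s(1) by (auto intro!: mult_right_mono)
      then show "\<bar>F (c + s) - F (c - s) - D * (2 * s)\<bar> \<le> e * (2 * s)"
        using d1(2)[of s c] d2(2)[of s c] s by (simp add: abs_le_iff algebra_simps)
    qed (use d1 d2 in auto)
  qed
  \<comment> \<open>Difference quotients at \<open>x\<close> use intervals with \<open>x\<close> as
    an endpoint, while \<open>key\<close> wants \<open>x\<close> in the interior. Widening by
    \<open>\<eta> n\<close> and the continuity of \<open>F\<close> close the gap.\<close>
  have key2: "\<exists>d>0. \<forall>a b. a \<le> x \<longrightarrow> x \<le> b \<longrightarrow> a < b \<longrightarrow> b - a < d \<longrightarrow> \<bar>F b - F a - D * (b - a)\<bar> \<le> e * (b - a)"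
    if e: "e > 0" for e
  proof -
    obtain d where d: "d > 0" "\<And>c s. 0 < s \<Longrightarrow> s < d \<Longrightarrow> x \<in> ball c s \<Longrightarrow> \<bar>F (c + s) - F (c - s) - D * (2 * s)\<bar> \<le> e * (2 * s)"
      using key[OF e] by blast
    show ?thesis
    proof (intro exI[of _ d] conjI allI impI d(1))
      fix a b assume ab: "a \<le> x" "x \<le> b" "a < b" "b - a < d"
      define \<eta> where "\<eta> n = (d - (b - a)) / 2 / real (Suc n)" for n
      have \<eta>: "\<eta> n > 0" "2 * \<eta> n \<le> d - (b - a)" for n
      proof -
        define t where "t = d - (b - a)"
        have t: "t > 0" using ab(4) by (simp add: t_def)
        then show "\<eta> n > 0" unfolding \<eta>_def t_def[symmetric] by simp
        have "t / real (Suc n) \<le> t / 1" using t by (intro divide_left_mono) auto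
        moreover have "2 * (t / 2 / real (Suc n)) = t / real (Suc n)" by (simp del: of_nat_Suc)
        ultimately show "2 * \<eta> n \<le> d - (b - a)" unfolding \<eta>_def t_def[symmetric] by linarith
      qed
      have "(\<lambda>n. (d - (b - a)) / 2 * (1 / real (Suc n))) \<longlonglongrightarrow> (d - (b - a)) / 2 * 0"
        by (intro tendsto_intros LIMSEQ_Suc[OF lim_1_over_n])
      then have \<eta>0: "\<eta> \<longlonglongrightarrow> 0" unfolding \<eta>_def[abs_def] by simp
      have le: "\<bar>F (b + \<eta> n) - F (a - \<eta> n) - D * (b - a + 2 * \<eta> n)\<bar> \<le> e * (b - a + 2 * \<eta> n)" for n
      proof -
        define c s where "c = (a + b) / 2" and "s = (b - a) / 2 + \<eta> n"
        have eq: "c + s = b + \<eta> n" "c - s = a - \<eta> n" "2 * s = b - a + 2 * \<eta> n" unfolding c_def s_def by (auto simp: field_simps)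
        have "x \<in> ball c s" using ab \<eta>(1)[of n] unfolding c_def s_def by (auto simp: dist_real_def abs_less_iff field_simps)
        moreover have "2 * s = (b - a) + 2 * \<eta> n" by (rule trans[OF eq(3)]) simp
        then have "0 < s" "s < d" using ab(3) \<eta>(1)[of n] \<eta>(2)[of n] d(1) by auto
        ultimately show ?thesis using d(2)[of s c] unfolding eq by blast
      qed
      have l1: "(\<lambda>n. \<bar>F (b + \<eta> n) - F (a - \<eta> n) - D * (b - a + 2 * \<eta> n)\<bar>) \<longlonglongrightarrow> \<bar>F (b + 0) - F (a - 0) - D * (b - a + 2 * 0)\<bar>"
        by (intro tendsto_intros tendsto_F \<eta>0)
      have l2: "(\<lambda>n. e * (b - a + 2 * \<eta> n)) \<longlonglongrightarrow> e * (b - a + 2 * 0)" by (intro tendsto_intros \<eta>0)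
      show "\<bar>F b - F a - D * (b - a)\<bar> \<le> e * (b - a)"
        using LIMSEQ_le[OF l1 l2] le by simp
    qed
  qed
  have "(F has_derivative (\<lambda>h. D * h)) (at x)"
    unfolding has_derivative_at_alt
  proof (intro conjI allI impI)
    show "bounded_linear (\<lambda>h. D * h)" by (rule bounded_linear_mult_right)
    fix e :: real assume "0 < e"
    then obtain d where d: "d > 0" "\<And>a b. a \<le> x \<Longrightarrow> x \<le> b \<Longrightarrow> a < b \<Longrightarrow> b - a < d \<Longrightarrow> \<bar>F b - F a - D * (b - a)\<bar> \<le> e * (b - a)"
      using key2 by blast
    show "\<exists>d>0. \<forall>y. norm (y - x) < d \<longrightarrow> norm (F y - F x - D * (y - x)) \<le> e * norm (y - x)"
    proof (intro exI[of _ d] conjI allI impI d(1))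
      fix y assume y: "norm (y - x) < d"
      consider "y = x" | "x < y" | "y < x" by linarith
      then show "norm (F y - F x - D * (y - x)) \<le> e * norm (y - x)"
      proof cases
        case 2 then show ?thesis using d(2)[of x y] y by simp
      next
        case 3 then show ?thesis using d(2)[of y x] y by (simp add: abs_le_iff algebra_simps)
      qed simp
    qed
  qed
  then show ?thesis by (auto simp: has_field_derivative_def)
qed

text \<open>This converse shows that \<open>deriv\<close> is unspecified on all of
  \<open>nd\<close>. An interval around \<open>x\<close> splits at \<open>x\<close> into two
  difference quotients, so its slope is within \<open>e\<close> of the derivative; half the gap
  between \<open>p\<close> and \<open>q\<close> leaves no room for both intervals.\<close>

lemma not_nd_if_differentiable:
  assumes D: "(F has_real_derivative D) (at x)" shows "x \<notin> nd"
proof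
  assume "x \<in> nd"
  then obtain p q where pq: "p < q" "x \<in> up q" "x \<in> low p" unfolding nd_def by auto
  define e where "e = (q - p) / 2"
  have e: "e > 0" using pq by (simp add: e_def)
  have "(F has_derivative (\<lambda>h. D * h)) (at x)" using D by (simp add: has_field_derivative_def)
  then obtain d where d: "d > 0" "\<And>y. \<bar>y - x\<bar> < d \<Longrightarrow> \<bar>F y - F x - D * (y - x)\<bar> \<le> e * \<bar>y - x\<bar>"
    unfolding has_derivative_at_alt using e by (auto simp only: real_norm_def) 
  have est: "\<bar>F (c + s) - F (c - s) - D * (2 * s)\<bar> \<le> e * (2 * s)" if s: "0 < s" "s < d / 2" "x \<in> ball c s" for c s
  proof -
    have xs: "c - s < x" "x < c + s" using s(3) by (auto simp: dist_real_def abs_less_iff)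
    have "\<bar>F (c + s) - F x - D * (c + s - x)\<bar> \<le> e * (c + s - x)" using d(2)[of "c + s"] xs s by simp
    moreover have "\<bar>F (c - s) - F x - D * (c - s - x)\<bar> \<le> e * (x - (c - s))" using d(2)[of "c - s"] xs s by simp
    ultimately show ?thesis unfolding abs_le_iff by (simp add: algebra_simps)
  qed
  obtain c s where 1: "0 < s" "s < d / 2" "F (c + s) - F (c - s) > q * (2 * s)" "x \<in> ball c s"
    using upD[OF pq(2), of "d / 2"] d(1) by auto
  obtain c' s' where 2: "0 < s'" "s' < d / 2" "F (c' + s') - F (c' - s') < p * (2 * s')" "x \<in> ball c' s'"
    using lowD[OF pq(3), of "d / 2"] d(1) by auto
  have "q * (2 * s) < (D + e) * (2 * s)" using est[OF 1(1,2,4)] 1(3) by (simp add: abs_le_iff algebra_simps)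
  then have "q < D + e" using 1(1) by simp
  have "(D - e) * (2 * s') < p * (2 * s')" using est[OF 2(1,2,4)] 2(3) by (simp add: abs_le_iff algebra_simps)
  then have "D - e < p" using 2(1) by simp
  then show False using \<open>q < D + e\<close> unfolding e_def by (simp add: field_simps)
qed

text \<open>The junk value of \<open>deriv\<close> is one constant, so \<open>deriv F\<close> is Borel measurable on the whole line.\<close>

lemma deriv_nd: "x \<in> nd \<Longrightarrow> deriv F x = (SOME D. False)"
  unfolding deriv_def using not_nd_if_differentiable by (metis (no_types, lifting))

lemma has_deriv: "x \<notin> nd \<Longrightarrow> (F has_real_derivative deriv F x) (at x)"
  using differentiable_if_not_nd DERIV_imp_deriv by metis

text \<open>Continuous approximations of the derivative with values between 0 and 1: the chain rule
  for continuous derivatives and dominated convergence both apply to them and to their square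
  roots.\<close>

definition quot :: "nat \<Rightarrow> real \<Rightarrow> real" where
  "quot n x = real (Suc n) * (F (x + 1 / real (Suc n)) - F x)"

lemma quot_bounds: "0 \<le> quot n x" "quot n x \<le> 1"
proof -
  show "0 \<le> quot n x" unfolding quot_def by (intro mult_nonneg_nonneg) (auto intro: mono)
  have "F (x + 1 / real (Suc n)) - F x \<le> 1 / real (Suc n)" using lip[of x "x + 1 / real (Suc n)"] by simp
  then show "quot n x \<le> 1" unfolding quot_def by (simp add: field_simps)
qed

lemma quot_cont: "continuous_on S (quot n)"
  unfolding quot_def by (intro continuous_intros continuous_on_compose2[OF cont[of UNIV]]) auto

lemma quot_tendsto: assumes "x \<notin> nd" shows "(\<lambda>n. quot n x) \<longlonglongrightarrow> deriv F x"
proof -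
  have "((\<lambda>h. (F (x + h) - F x) / h) \<longlongrightarrow> deriv F x) (at 0)"
    using has_deriv[OF assms] by (simp add: DERIV_def)
  from filterlim_compose[OF this inverse_Suc_at_0]
  have "(\<lambda>n. (F (x + 1 / real (Suc n)) - F x) / (1 / real (Suc n))) \<longlonglongrightarrow> deriv F x"
    .
  then show ?thesis unfolding quot_def by (simp add: mult.commute)
qed

lemma deriv_bounds: assumes "x \<notin> nd" shows "0 \<le> deriv F x" "deriv F x \<le> 1"
  using LIMSEQ_le_const[OF quot_tendsto[OF assms], of 0] LIMSEQ_le_const2[OF quot_tendsto[OF assms], of 1] quot_bounds by auto

lemma deriv_borel: "deriv F \<in> borel_measurable borel"
proof -
  have "(\<lambda>x. lim (\<lambda>n. quot n x)) \<in> borel_measurable borel"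
    by (rule borel_measurable_lim_metric) (rule borel_measurable_continuous_onI[OF quot_cont])
  then have "(\<lambda>x. if x \<in> nd then (SOME D. False) else lim (\<lambda>n. quot n x)) \<in> borel_measurable borel"
    using nd_borel by (intro measurable_If_set) auto
  moreover have "deriv F = (\<lambda>x. if x \<in> nd then (SOME D. False) else lim (\<lambda>n. quot n x))"
    using deriv_nd limI[OF quot_tendsto] by auto
  ultimately show ?thesis by simp
qed

end


subsection \<open>The graph of the gradient on the Sobolev space\<close>

definition zext :: "'a set \<Rightarrow> ('a \<Rightarrow> 'b::real_vector) \<Rightarrow> 'a \<Rightarrow> 'b" where
  "zext \<Omega> u = (\<lambda>x. indicator \<Omega> x *\<^sub>R u x)"

lemma cls_tendsto_dominated:
  fixes f :: "nat \<Rightarrow> 'a::euclidean_space \<Rightarrow> 'b::euclidean_space"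
  assumes "\<And>n. f n \<in> borel_measurable lebesgue" "g \<in> borel_measurable lebesgue" "sq_int (w :: 'a \<Rightarrow> real)"
    and "AE x in lebesgue. (\<lambda>n. f n x) \<longlonglongrightarrow> g x"
    and "\<And>n. AE x in lebesgue. norm (f n x) \<le> w x"
  shows "sq_int g" "\<And>n. sq_int (f n)" "(\<lambda>n. cls (f n)) \<longlonglongrightarrow> cls g"
proof -
  have w2: "integrable lebesgue (\<lambda>x. (w x)\<^sup>2)" using sq_intD[OF assms(3)] by simp
  have gw: "AE x in lebesgue. norm (g x) \<le> w x"
  proof -
    have "AE x in lebesgue. \<forall>n. norm (f n x) \<le> w x" unfolding AE_all_countable using assms(5) by blast
    with assms(4) show ?thesis
    proof eventually_elim
      case (elim x)
      show ?case by (rule LIMSEQ_le_const2[OF tendsto_norm[OF elim(1)]]) (use elim(2) in auto)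
    qed
  qed
  show sg: "sq_int g"
    by (rule sq_int_bound[OF assms(2) w2]) (use gw in eventually_elim, auto intro: power_mono)
  show sf: "sq_int (f n)" for n
    by (rule sq_int_bound[OF assms(1) w2]) (use assms(5)[of n] in eventually_elim, auto intro: power_mono)
  have "(\<lambda>n. LINT x|lebesgue. (norm (f n x - g x))\<^sup>2) \<longlonglongrightarrow> (LINT x|(lebesgue::'a measure). 0)"
  proof (rule integral_dominated_convergence[where w="\<lambda>x. 4 * (w x)\<^sup>2"])
    show "AE x in lebesgue. norm ((norm (f n x - g x))\<^sup>2) \<le> 4 * (w x)\<^sup>2" for n
      using gw assms(5)[of n]
    proof eventually_elim
      case (elim x)
      have "norm (f n x - g x) \<le> 2 * w x" using norm_triangle_ineq4[of "f n x" "g x"] elim by linarith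
      from power_mono[OF this norm_ge_zero, of 2] show ?case by (simp add: power_mult_distrib)
    qed
    show "AE x in lebesgue. (\<lambda>n. (norm (f n x - g x))\<^sup>2) \<longlonglongrightarrow> 0"
      using assms(4)
    proof eventually_elim
      case (elim x)
      from tendsto_power[OF tendsto_norm[OF LIM_zero[OF elim]], of 2] show ?case by simp
    qed
  qed (use assms w2 in auto)
  then show "(\<lambda>n. cls (f n)) \<longlonglongrightarrow> cls g" using cls_tendsto_iff[OF sf sg] by simp
qed

lemma sq_int_compose_mult:
  fixes u :: "'a::euclidean_space \<Rightarrow> real" and h :: "'a \<Rightarrow> 'b::euclidean_space"
  assumes "sq_int u" "sq_int h" "g \<in> borel_measurable borel" "\<And>s. \<bar>g s\<bar> \<le> C"
  shows "sq_int (\<lambda>x. g (u x) *\<^sub>R h x)"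
proof (rule sq_int_bound[of _ "\<lambda>x. C\<^sup>2 * (norm (h x))\<^sup>2"])
  show "(\<lambda>x. g (u x) *\<^sub>R h x) \<in> borel_measurable lebesgue"
    using assms(1-3) by (auto intro!: borel_measurable_scaleR measurable_compose[OF sq_int_measurable] sq_int_measurable)
  show "AE x in lebesgue. (norm (g (u x) *\<^sub>R h x))\<^sup>2 \<le> C\<^sup>2 * (norm (h x))\<^sup>2"
  proof (rule AE_I2)
    fix x show "(norm (g (u x) *\<^sub>R h x))\<^sup>2 \<le> C\<^sup>2 * (norm (h x))\<^sup>2"
      using power_mono[OF assms(4)[of "u x"] abs_ge_zero, of 2] by (simp add: power_mult_distrib mult_right_mono)
  qed
qed (use assms(2) in \<open>auto simp: sq_int_def\<close>)

lemma sq_int_compose: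
  fixes u :: "'a::euclidean_space \<Rightarrow> real" and f :: "real \<Rightarrow> real"
  assumes "sq_int u" "f \<in> borel_measurable borel" "\<And>s. \<bar>f s\<bar> \<le> C * \<bar>s\<bar>"
  shows "sq_int (\<lambda>x. f (u x))"
proof (rule sq_int_bound[of _ "\<lambda>x. C\<^sup>2 * (norm (u x))\<^sup>2"])
  show "(\<lambda>x. f (u x)) \<in> borel_measurable lebesgue"
    using assms(1,2) by (auto intro!: measurable_compose[OF sq_int_measurable])
  show "AE x in lebesgue. (norm (f (u x)))\<^sup>2 \<le> C\<^sup>2 * (norm (u x))\<^sup>2"
  proof (rule AE_I2)
    fix x show "(norm (f (u x)))\<^sup>2 \<le> C\<^sup>2 * (norm (u x))\<^sup>2"
      using power_mono[OF assms(3)[of "u x"] abs_ge_zero, of 2] by (simp add: power_mult_distrib)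
  qed
qed (use assms(1) in \<open>auto simp: sq_int_def\<close>)

text \<open>The classes that vanish almost everywhere outside \<open>\<Omega>\<close>; orthogonality makes the set visibly closed.\<close>

definition supp_in :: "'a::euclidean_space set \<Rightarrow> ('a, 'b::euclidean_space) l2 set" where
  "supp_in \<Omega> = {v. \<forall>w. sq_int w \<longrightarrow> (\<forall>x\<in>\<Omega>. w x = 0) \<longrightarrow> v \<bullet> cls w = 0}"

lemma supp_in_closed: "closed (supp_in \<Omega>)" "subspace (supp_in \<Omega>)"
proof -
  have eq: "supp_in \<Omega> = (\<Inter>w\<in>{w. sq_int w \<and> (\<forall>x\<in>\<Omega>. w x = 0)}. (\<lambda>v. v \<bullet> cls w) -` {0})" by (auto simp: supp_in_def)
  show "closed (supp_in \<Omega>)" unfolding eq by (intro closed_INT ballI closed_vimage continuous_intros)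
  show "subspace (supp_in \<Omega>)" by (auto simp: supp_in_def subspace_def inner_simps)
qed

lemma supp_in_zext:
  assumes "cls u \<in> supp_in \<Omega>" "sq_int u" "\<Omega> \<in> sets lebesgue"
  shows "AE x in lebesgue. x \<notin> \<Omega> \<longrightarrow> u x = 0"
proof -
  define w where "w x = indicator (- \<Omega>) x *\<^sub>R u x" for x
  have w: "sq_int w" unfolding w_def
    using assms by (intro sq_int_indicator_mult) (auto simp: Compl_in_sets_lebesgue)
  have "(LINT x|lebesgue. (norm (w x))\<^sup>2) = cls u \<bullet> cls w"
    by (subst cls_inner[OF assms(2) w])
      (auto intro!: Bochner_Integration.integral_cong simp: w_def indicator_def power2_norm_eq_inner)
  also have "\<dots> = 0" using assms(1) w unfolding supp_in_def by (auto simp: w_def)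
  finally have "AE x in lebesgue. (norm (w x))\<^sup>2 = 0"
    by (subst (asm) integral_nonneg_eq_0_iff_AE) (use sq_intD[OF w] in auto)
  then show ?thesis by eventually_elim (auto simp: w_def)
qed

lemma cls_mem_supp_in: "sq_int u \<Longrightarrow> (\<And>x. x \<notin> \<Omega> \<Longrightarrow> u x = 0) \<Longrightarrow> cls u \<in> supp_in \<Omega>"
proof -
  assume u: "sq_int u" "\<And>x. x \<notin> \<Omega> \<Longrightarrow> u x = 0"
  have "cls u \<bullet> cls w = 0" if w: "sq_int w" "\<forall>x\<in>\<Omega>. w x = 0" for w
  proof -
    have "(\<lambda>x. u x \<bullet> w x) = (\<lambda>x. 0)" using u(2) w(2) by (metis inner_zero_left inner_zero_right)
    then show ?thesis using cls_inner[OF u(1) w(1)] by simp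
  qed
  then show "cls u \<in> supp_in \<Omega>" by (auto simp: supp_in_def)
qed

locale bounded_open =
  fixes \<Omega> :: "(real^'n::finite) set" and R :: real
  assumes op: "open \<Omega>" and sub: "\<Omega> \<subseteq> cball 0 R" and R: "R > 0"
begin

lemma \<Omega>_sets: "\<Omega> \<in> sets lebesgue" using op by simp

definition G0 :: "((real^'n, real) l2 \<times> (real^'n, real^'n) l2) set" where
  "G0 = {(cls \<phi>, cls (cgrad \<phi>)) | \<phi>. test_fun \<Omega> \<phi>}"

text \<open>Completing the test functions jointly with their gradients yields the graph of the weak
  gradient on the Sobolev space; its properties are proved on \<open>G0\<close> and pass to
  limits.\<close>

definition Gr :: "((real^'n, real) l2 \<times> (real^'n, real^'n) l2) set" where "Gr = closure G0"

lemma G0_I: "test_fun \<Omega> \<phi> \<Longrightarrow> (cls \<phi>, cls (cgrad \<phi>)) \<in> G0" unfolding G0_def by blast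

lemma G0_subspace: "subspace G0"
  unfolding subspace_def
proof (intro conjI ballI allI)
  have "cgrad (\<lambda>x::real^'n. 0) = (\<lambda>x. 0)" by (auto simp: cgrad_def partial_def vec_eq_iff)
  then show "0 \<in> G0" using G0_I[OF test_fun_zero] by (simp add: zero_prod_def cls_zero)
next
  fix a b assume "a \<in> G0" "b \<in> G0"
  then obtain \<phi> \<psi> where ab: "a = (cls \<phi>, cls (cgrad \<phi>))" "b = (cls \<psi>, cls (cgrad \<psi>))" and t: "test_fun \<Omega> \<phi>" "test_fun \<Omega> \<psi>"
    unfolding G0_def by blast
  have "cgrad (\<lambda>x. \<phi> x + \<psi> x) = (\<lambda>x. cgrad \<phi> x + cgrad \<psi> x)"
    using t by (auto simp: cgrad_def vec_eq_iff intro!: partial_add smooth_differentiable test_fun_smooth)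
  then show "a + b \<in> G0" using G0_I[OF test_fun_add[OF t]] t unfolding ab
    by (simp add: cls_add test_fun_sq_int)
next
  fix c a assume "a \<in> G0"
  then obtain \<phi> where a: "a = (cls \<phi>, cls (cgrad \<phi>))" and t: "test_fun \<Omega> \<phi>" unfolding G0_def by blast
  have sd: "\<phi> differentiable (at x)" for x using t by (intro smooth_differentiable test_fun_smooth)
  have pc: "partial i (\<lambda>x. c * \<phi> x) x = c * partial i \<phi> x" for i x
    by (subst partial_mult) (auto simp: sd partial_def)
  have "cgrad (\<lambda>x. c * \<phi> x) = (\<lambda>x. c *\<^sub>R cgrad \<phi> x)"
    by (auto simp: cgrad_def vec_eq_iff pc)
  then show "c *\<^sub>R a \<in> G0" using G0_I[OF test_fun_cmult[OF t, of c]] t unfolding a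
    by (simp add: cls_scaleR test_fun_sq_int)
qed

lemma Gr_subspace: "subspace Gr" "closed Gr"
  unfolding Gr_def by (auto intro: subspace_closure G0_subspace)

lemma Gr_approx:
  assumes "(v, h) \<in> Gr" "e > 0"
  shows "\<exists>\<phi>. test_fun \<Omega> \<phi> \<and> norm (cls \<phi> - v) < e \<and> norm (cls (cgrad \<phi>) - h) < e"
proof -
  obtain p where p: "p \<in> G0" "dist p (v, h) < e" using assms unfolding Gr_def closure_approachable by blast
  then obtain \<phi> where \<phi>: "test_fun \<Omega> \<phi>" "p = (cls \<phi>, cls (cgrad \<phi>))" unfolding G0_def by blast
  have "norm (cls \<phi> - v) \<le> dist p (v, h)" "norm (cls (cgrad \<phi>) - h) \<le> dist p (v, h)"
    using norm_fst_le[of "cls \<phi> - v" "cls (cgrad \<phi>) - h"] norm_snd_le[of "cls (cgrad \<phi>) - h" "cls \<phi> - v"] \<phi>(2)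
    by (auto simp: dist_norm)
  then show ?thesis using \<phi>(1) p(2) by force
qed

lemma Gr_seq:
  assumes "(v, h) \<in> Gr"
  shows "\<exists>\<phi>. (\<forall>n. test_fun \<Omega> (\<phi> n)) \<and> (\<lambda>n. cls (\<phi> n)) \<longlonglongrightarrow> v \<and> (\<lambda>n. cls (cgrad (\<phi> n))) \<longlonglongrightarrow> h"
proof -
  obtain p where p: "\<And>n. p n \<in> G0" "p \<longlonglongrightarrow> (v, h)" using assms unfolding Gr_def closure_sequential by blast
  have "\<forall>n. \<exists>\<phi>. test_fun \<Omega> \<phi> \<and> p n = (cls \<phi>, cls (cgrad \<phi>))" using p(1) unfolding G0_def by blast
  from choice[OF this] obtain \<phi> where \<phi>: "\<And>n. test_fun \<Omega> (\<phi> n)" "\<And>n. p n = (cls (\<phi> n), cls (cgrad (\<phi> n)))" by blast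
  show ?thesis
    using tendsto_fst[OF p(2)] tendsto_snd[OF p(2)] \<phi> by (intro exI[of _ \<phi>]) simp
qed

lemma GrI:
  assumes "\<And>n. (a n, b n) \<in> Gr" "a \<longlonglongrightarrow> v" "b \<longlonglongrightarrow> h" shows "(v, h) \<in> Gr"
  using closed_sequentially[OF Gr_subspace(2), of "\<lambda>n. (a n, b n)" "(v, h)"] assms tendsto_Pair by blast

lemma G0_Gr: "test_fun \<Omega> \<phi> \<Longrightarrow> (cls \<phi>, cls (cgrad \<phi>)) \<in> Gr"
  using G0_I closure_subset unfolding Gr_def by blast

lemma Gr_weak:
  assumes "(v, h) \<in> Gr" "test_fun \<Omega>' \<psi>"
  shows "v \<bullet> cls (partial i \<psi>) = - (h \<bullet> cls (\<lambda>x. \<psi> x *\<^sub>R axis i 1))"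
proof -
  note sqp = test_fun_axis_sq_int[OF assms(2), of i]
  obtain \<phi> where \<phi>: "\<And>n. test_fun \<Omega> (\<phi> n)" "(\<lambda>n. cls (\<phi> n)) \<longlonglongrightarrow> v" "(\<lambda>n. cls (cgrad (\<phi> n))) \<longlonglongrightarrow> h"
    using Gr_seq[OF assms(1)] by blast
  have "cls (\<phi> n) \<bullet> cls (partial i \<psi>) = - (cls (cgrad (\<phi> n)) \<bullet> cls (\<lambda>x. \<psi> x *\<^sub>R axis i 1))" for n
    unfolding cls_inner[OF test_fun_sq_int(1)[OF \<phi>(1)] test_fun_sq_int(1)[OF test_fun_partial[OF assms(2)]]]
      cls_inner[OF test_fun_sq_int(2)[OF \<phi>(1)] sqp]
    using test_fun_integration_by_parts[OF \<phi>(1)[of n] assms(2), of i]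
    by (simp add: inner_axis cgrad_def mult.commute)
  moreover have "(\<lambda>n. cls (\<phi> n) \<bullet> cls (partial i \<psi>)) \<longlonglongrightarrow> v \<bullet> cls (partial i \<psi>)" by (intro tendsto_intros \<phi>)
  moreover have "(\<lambda>n. - (cls (cgrad (\<phi> n)) \<bullet> cls (\<lambda>x. \<psi> x *\<^sub>R axis i 1))) \<longlonglongrightarrow> - (h \<bullet> cls (\<lambda>x. \<psi> x *\<^sub>R axis i 1))"
    by (intro tendsto_intros \<phi>)
  ultimately show ?thesis using LIMSEQ_unique by simp
qed

lemma test_fun_supp:
  assumes "test_fun \<Omega> \<phi>" "x \<notin> \<Omega>" shows "\<phi> x = 0" "cgrad \<phi> x = 0"
proof -
  obtain K where K: "compact K" "K \<subseteq> \<Omega>" "\<And>x. x \<notin> K \<Longrightarrow> \<phi> x = 0" using assms by (metis test_funE)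
  then show "\<phi> x = 0" using assms(2) by blast
  have "x \<notin> K" using K assms(2) by blast
  then show "cgrad \<phi> x = 0"
    using partial_zero_outside[of K \<phi> x] K by (simp add: cgrad_def vec_eq_iff compact_imp_closed)
qed

lemma Gr_supp: assumes "(v, h) \<in> Gr" shows "v \<in> supp_in \<Omega>" "h \<in> supp_in \<Omega>"
proof -
  obtain \<phi> where \<phi>: "\<And>n. test_fun \<Omega> (\<phi> n)" "(\<lambda>n. cls (\<phi> n)) \<longlonglongrightarrow> v" "(\<lambda>n. cls (cgrad (\<phi> n))) \<longlonglongrightarrow> h"
    using Gr_seq[OF assms(1)] by blast
  have 1: "cls (\<phi> n) \<in> supp_in \<Omega>" for n by (rule cls_mem_supp_in[OF test_fun_sq_int(1)[OF \<phi>(1)] test_fun_supp(1)[OF \<phi>(1)]])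
  have 2: "cls (cgrad (\<phi> n)) \<in> supp_in \<Omega>" for n by (rule cls_mem_supp_in[OF test_fun_sq_int(2)[OF \<phi>(1)] test_fun_supp(2)[OF \<phi>(1)]])
  show "v \<in> supp_in \<Omega>" "h \<in> supp_in \<Omega>"
    using closed_sequentially[OF supp_in_closed(1) 1 \<phi>(2)] closed_sequentially[OF supp_in_closed(1) 2 \<phi>(3)] by auto
qed

lemma supp_in_zero:
  assumes "v \<in> supp_in \<Omega>" and "\<And>\<phi>. test_fun \<Omega> \<phi> \<Longrightarrow> v \<bullet> cls \<phi> = 0"
  shows "v = 0"
proof -
  obtain u where u: "sq_int u" "v = cls u" using cls_surj by blast
  have "AE x in lebesgue. x \<in> \<Omega> \<longrightarrow> u x = 0"
  proof (rule fundamental_lemma[OF op u(1)])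
    fix \<phi> assume "test_fun \<Omega> \<phi>"
    then show "(LINT x|lebesgue. u x * \<phi> x) = 0"
      using assms(2)[of \<phi>] unfolding u(2) by (simp add: cls_inner[OF u(1)] test_fun_sq_int)
  qed
  moreover have "AE x in lebesgue. x \<notin> \<Omega> \<longrightarrow> u x = 0"
    by (rule supp_in_zext[OF _ u(1) \<Omega>_sets]) (use assms u in simp)
  ultimately have "AE x in lebesgue. u x = 0" by eventually_elim auto
  then show ?thesis unfolding u(2) cls_zero using cls_eq_iff[OF u(1) sq_int_zero] by simp
qed

lemma sq_int_component: assumes "sq_int (g :: real^'n \<Rightarrow> real^'n)" shows "sq_int (\<lambda>x. g x $ i)"
proof (rule sq_int_bound[of _ "\<lambda>x. (norm (g x))\<^sup>2"])
  show "(\<lambda>x. g x $ i) \<in> borel_measurable lebesgue"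
    by (rule measurable_compose[OF sq_int_measurable[OF assms]])
      (auto intro!: borel_measurable_continuous_onI continuous_intros)
  show "AE x in lebesgue. (norm (g x $ i))\<^sup>2 \<le> (norm (g x))\<^sup>2"
    by (intro AE_I2 power_mono) (auto intro: component_le_norm_cart)
qed (use assms in \<open>auto simp: sq_int_def\<close>)

lemma vec_supp_in_zero:
  assumes "v \<in> supp_in \<Omega>" and 0: "\<And>\<phi> i. test_fun \<Omega> \<phi> \<Longrightarrow> v \<bullet> cls (\<lambda>x. \<phi> x *\<^sub>R axis i 1 :: real^'n) = 0"
  shows "v = 0"
proof -
  obtain u where u: "sq_int u" "v = cls u" using cls_surj by blast
  have "AE x in lebesgue. x \<in> \<Omega> \<longrightarrow> u x $ i = 0" for i
  proof (rule fundamental_lemma[OF op sq_int_component[OF u(1)]])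
    fix \<phi> assume \<phi>: "test_fun \<Omega> \<phi>"
    note sqp = test_fun_axis_sq_int[OF \<phi>, of i]
    show "(LINT x|lebesgue. u x $ i * \<phi> x) = 0"
      using 0[OF \<phi>, of i] unfolding u(2) by (simp add: cls_inner[OF u(1) sqp] inner_axis mult.commute)
  qed
  then have "AE x in lebesgue. \<forall>i. x \<in> \<Omega> \<longrightarrow> u x $ i = 0" by (intro AE_all_countable[THEN iffD2] allI)
  moreover have "AE x in lebesgue. x \<notin> \<Omega> \<longrightarrow> u x = 0"
    by (rule supp_in_zext[OF _ u(1) \<Omega>_sets]) (use assms u in simp)
  ultimately have "AE x in lebesgue. u x = 0" by eventually_elim (auto simp: vec_eq_iff)
  then show ?thesis unfolding u(2) cls_zero using cls_eq_iff[OF u(1) sq_int_zero] by simp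
qed

text \<open>Closability of the gradient: integration by parts survives the closure, so a limit of
  gradients over 0 is orthogonal to all test fields, and it vanishes off \<Omega>.\<close>

lemma Gr_unique: assumes "(0, h) \<in> Gr" shows "h = 0"
proof (rule vec_supp_in_zero[OF Gr_supp(2)[OF assms]])
  fix \<phi> i assume "test_fun \<Omega> \<phi>"
  then show "h \<bullet> cls (\<lambda>x. \<phi> x *\<^sub>R axis i 1 :: real^'n) = 0" using Gr_weak[OF assms, of \<Omega> \<phi> i] by simp
qed

lemma Gr_poincare: assumes "(v, h) \<in> Gr" shows "norm v \<le> 2 * R * norm h"
proof -
  obtain \<phi> where \<phi>: "\<And>n. test_fun \<Omega> (\<phi> n)" "(\<lambda>n. cls (\<phi> n)) \<longlonglongrightarrow> v" "(\<lambda>n. cls (cgrad (\<phi> n))) \<longlonglongrightarrow> h"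
    using Gr_seq[OF assms(1)] by blast
  have 1: "(\<lambda>n. norm (cls (\<phi> n))) \<longlonglongrightarrow> norm v" by (intro tendsto_intros \<phi>)
  have 2: "(\<lambda>n. 2 * R * norm (cls (cgrad (\<phi> n)))) \<longlonglongrightarrow> 2 * R * norm h" by (intro tendsto_intros \<phi>)
  show ?thesis by (rule LIMSEQ_le[OF 1 2]) (use test_fun_poincare[OF \<phi>(1) sub R] in auto)
qed

text \<open>Test functions within \<open>1 / Suc n\<close> of the given elements inherit the weak
  limit and the gradient bound \<open>B + 1\<close>.\<close>

lemma Gr_rellich:
  assumes G: "\<And>n. (u n, g n) \<in> Gr" and B: "\<And>n. norm (g n) \<le> B" and w: "wconv u v"
  shows "u \<longlonglongrightarrow> v"
proof -
  have "\<forall>n. \<exists>\<phi>. test_fun \<Omega> \<phi> \<and> norm (cls \<phi> - u n) < 1 / real (Suc n) \<and> norm (cls (cgrad \<phi>) - g n) < 1 / real (Suc n)"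
    using Gr_approx[OF G] by simp
  from choice[OF this] obtain \<phi> where \<phi>: "\<And>n. test_fun \<Omega> (\<phi> n)" "\<And>n. norm (cls (\<phi> n) - u n) < 1 / real (Suc n)"
    "\<And>n. norm (cls (cgrad (\<phi> n)) - g n) < 1 / real (Suc n)" by blast
  have d0: "(\<lambda>n. cls (\<phi> n) - u n) \<longlonglongrightarrow> 0"
    by (rule Lim_null_comparison[OF _ LIMSEQ_Suc[OF lim_1_over_n]]) (intro always_eventually allI less_imp_le \<phi>(2))
  have "wconv (\<lambda>n. cls (\<phi> n)) v"
    unfolding wconv_def
  proof
    fix z
    have "(\<lambda>n. u n \<bullet> z + (cls (\<phi> n) - u n) \<bullet> z) \<longlonglongrightarrow> v \<bullet> z + 0 \<bullet> z"
      by (intro tendsto_add wconvD[OF w] tendsto_inner d0 tendsto_const)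
    then show "(\<lambda>n. cls (\<phi> n) \<bullet> z) \<longlonglongrightarrow> v \<bullet> z" by (simp add: inner_diff_left)
  qed
  moreover have "norm (cls (cgrad (\<phi> n))) \<le> B + 1" for n
  proof -
    have "1 / real (Suc n) \<le> 1" by simp
    then show ?thesis using \<phi>(3)[of n] B[of n] norm_triangle_ineq2[of "cls (cgrad (\<phi> n))" "g n"] by linarith
  qed
  ultimately have "(\<lambda>n. cls (\<phi> n)) \<longlonglongrightarrow> v" by (intro test_fun_rellich[OF \<phi>(1) sub R])
  from tendsto_diff[OF this d0] show ?thesis by simp
qed

subsection \<open>The chain rule\<close>

text \<open>\<open>g\<close> plays the role of the derivative of \<open>f\<close>. The class of such pairs is closed under bounded pointwise limits.\<close>

definition chain_pair :: "(real \<Rightarrow> real) \<Rightarrow> (real \<Rightarrow> real) \<Rightarrow> bool" where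
  "chain_pair f g \<longleftrightarrow> f \<in> borel_measurable borel \<and> g \<in> borel_measurable borel \<and>
     (\<forall>u h. sq_int u \<longrightarrow> sq_int h \<longrightarrow> (cls u, cls h) \<in> Gr \<longrightarrow>
        (cls (\<lambda>x. f (u x)), cls (\<lambda>x. g (u x) *\<^sub>R h x)) \<in> Gr)"

text \<open>Convergence of \<open>gn\<close> is asked only along \<open>u\<close> and after
  multiplication by \<open>h\<close>. This form tolerates exceptional arguments, provided that
  \<open>h\<close> vanishes where \<open>u\<close> takes them.\<close>

lemma chain_pair_limit_AE:
  assumes c: "\<And>n. chain_pair (fn n) (gn n)" and bf: "\<And>n s. \<bar>fn n s\<bar> \<le> C * \<bar>s\<bar>" and bg: "\<And>n s. \<bar>gn n s\<bar> \<le> C"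
    and u: "sq_int u" and h: "sq_int h" and uh: "(cls u, cls h) \<in> Gr"
    and lf: "\<And>s. (\<lambda>n. fn n s) \<longlonglongrightarrow> f s" and f: "f \<in> borel_measurable borel"
    and g: "g \<in> borel_measurable borel" and lg: "AE x in lebesgue. (\<lambda>n. gn n (u x) *\<^sub>R h x) \<longlonglongrightarrow> g (u x) *\<^sub>R h x"
  shows "(cls (\<lambda>x. f (u x)), cls (\<lambda>x. g (u x) *\<^sub>R h x)) \<in> Gr" "sq_int (\<lambda>x. g (u x) *\<^sub>R h x)"
proof -
  have mu: "u \<in> borel_measurable lebesgue" and mh: "h \<in> borel_measurable lebesgue" using u h by (auto simp: sq_int_def)
  have mf: "fn n \<in> borel_measurable borel" "gn n \<in> borel_measurable borel" for n using c unfolding chain_pair_def by auto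
  have 1: "(\<lambda>n. cls (\<lambda>x. fn n (u x))) \<longlonglongrightarrow> cls (\<lambda>x. f (u x))"
  proof (rule cls_tendsto_dominated(3)[where w="\<lambda>x. C *\<^sub>R \<bar>u x\<bar>"])
    have "sq_int (\<lambda>x. \<bar>u x\<bar>)" using u by (auto simp: sq_int_def)
    then show "sq_int (\<lambda>x. C *\<^sub>R \<bar>u x\<bar>)" by (rule sq_int_scaleR)
  qed (use bf lf mf f mu in \<open>auto intro!: measurable_compose[OF mu]\<close>)
  have "sq_int (\<lambda>x. C *\<^sub>R norm (h x))" using h by (intro sq_int_scaleR) (auto simp: sq_int_def)
  moreover have "AE x in lebesgue. norm (gn n (u x) *\<^sub>R h x) \<le> C *\<^sub>R norm (h x)" for n
    using bg by (auto intro!: AE_I2 mult_right_mono)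
  moreover have "(\<lambda>x. gn n (u x) *\<^sub>R h x) \<in> borel_measurable lebesgue" "(\<lambda>x. g (u x) *\<^sub>R h x) \<in> borel_measurable lebesgue" for n
    by (intro borel_measurable_scaleR mh measurable_compose[OF mu] mf g)+
  ultimately have 2: "(\<lambda>n. cls (\<lambda>x. gn n (u x) *\<^sub>R h x)) \<longlonglongrightarrow> cls (\<lambda>x. g (u x) *\<^sub>R h x)" "sq_int (\<lambda>x. g (u x) *\<^sub>R h x)"
    using cls_tendsto_dominated[of "\<lambda>n x. gn n (u x) *\<^sub>R h x" "\<lambda>x. g (u x) *\<^sub>R h x" "\<lambda>x. C *\<^sub>R norm (h x)"] lg by blast+
  show "sq_int (\<lambda>x. g (u x) *\<^sub>R h x)" by (rule 2)
  have "(cls (\<lambda>x. fn n (u x)), cls (\<lambda>x. gn n (u x) *\<^sub>R h x)) \<in> Gr" for n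
    using c[of n] u h uh unfolding chain_pair_def by blast
  then show "(cls (\<lambda>x. f (u x)), cls (\<lambda>x. g (u x) *\<^sub>R h x)) \<in> Gr" by (rule GrI[OF _ 1 2(1)])
qed

lemma chain_pair_limit:
  assumes c: "\<And>n. chain_pair (fn n) (gn n)" and bf: "\<And>n s. \<bar>fn n s\<bar> \<le> C * \<bar>s\<bar>" and bg: "\<And>n s. \<bar>gn n s\<bar> \<le> C"
    and lf: "\<And>s. (\<lambda>n. fn n s) \<longlonglongrightarrow> f s" and lg: "\<And>s. (\<lambda>n. gn n s) \<longlonglongrightarrow> g s"
  shows "chain_pair f g"
proof -
  have mf: "fn n \<in> borel_measurable borel" "gn n \<in> borel_measurable borel" for n using c unfolding chain_pair_def by auto
  have m: "f \<in> borel_measurable borel" "g \<in> borel_measurable borel"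
    by (rule borel_measurable_LIMSEQ_real[OF lf mf(1)], rule borel_measurable_LIMSEQ_real[OF lg mf(2)])
  show ?thesis unfolding chain_pair_def
    by (intro conjI allI impI m chain_pair_limit_AE(1)[OF c bf bg _ _ _ lf m] AE_I2 tendsto_scaleR lg tendsto_const)
qed

end


section \<open>Primitives from zero and the function \<nu>\<close>

definition I0 :: "(real \<Rightarrow> real) \<Rightarrow> real \<Rightarrow> real" where
  "I0 g s = (LBINT x=ereal 0..ereal s. g x)"

text \<open>A fixed compact interval for either sign of \<open>s\<close> puts the primitive into the
  form of a plain integral, ready for bounds and dominated convergence.\<close>

lemma I0_eq: "I0 g s = (if 0 \<le> s then 1 else -1) * (LINT x|lborel. indicator {min 0 s..max 0 s} x * g x)"
proof (cases "0 \<le> s")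
  case True
  then show ?thesis unfolding I0_def
    by (subst interval_integral_Icc) (auto simp: set_lebesgue_integral_def)
next
  case False
  have "(LBINT x=ereal 0..ereal s. g x) = - (LBINT x=ereal s..ereal 0. g x)"
    by (rule interval_integral_endpoints_reverse)
  also have "(LBINT x=ereal s..ereal 0. g x) = (LBINT x:{s..0}. g x)"
    by (rule interval_integral_Icc) (use False in simp)
  finally show ?thesis unfolding I0_def using False by (simp add: set_lebesgue_integral_def min_def max_def)
qed

lemma integrable_Icc_mult:
  fixes g :: "real \<Rightarrow> real"
  assumes "g \<in> borel_measurable borel" "AE x in lborel. \<bar>g x\<bar> \<le> C"
  shows "integrable lborel (\<lambda>x. indicator {a..b} x * g x)"
proof (rule Bochner_Integration.integrable_bound)
  show "integrable lborel (\<lambda>x. C * indicator {a..b} x :: real)"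
    by (intro integrable_mult_right integrable_real_indicator) (auto simp: emeasure_lborel_Icc_eq)
  show "AE x in lborel. norm (indicator {a..b} x * g x) \<le> norm (C * indicator {a..b} x)"
    using assms(2) by eventually_elim (auto simp: indicator_def)
qed (use assms(1) in simp)

lemma I0_0: "I0 g 0 = 0"
  unfolding I0_def by (simp add: zero_ereal_def)

lemma I0_abs_le:
  assumes "g \<in> borel_measurable borel" "\<And>x. \<bar>g x\<bar> \<le> C"
  shows "\<bar>I0 g s\<bar> \<le> C * \<bar>s\<bar>"
proof -
  let ?i = "indicator {min 0 s..max 0 s} :: real \<Rightarrow> real"
  have "\<bar>I0 g s\<bar> = \<bar>LINT x|lborel. ?i x * g x\<bar>" unfolding I0_eq by simp
  also have "\<dots> \<le> (LINT x|lborel. C * ?i x)"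
  proof (rule order_trans[OF integral_abs_bound integral_mono])
    show "integrable lborel (\<lambda>x. \<bar>?i x * g x\<bar>)"
      by (intro integrable_abs integrable_Icc_mult[where C=C]) (use assms in auto)
    show "integrable lborel (\<lambda>x. C * ?i x)"
      by (intro integrable_mult_right integrable_real_indicator) (auto simp: emeasure_lborel_Icc_eq)
    show "\<bar>?i x * g x\<bar> \<le> C * ?i x" for x using assms(2) by (auto simp: indicator_def)
  qed
  also have "\<dots> = C * \<bar>s\<bar>" by (simp add: measure_lborel_Icc min_def max_def)
  finally show ?thesis .
qed

lemma I0_limit:
  assumes "\<And>n. gn n \<in> borel_measurable borel" "g \<in> borel_measurable borel" "\<And>n x. \<bar>gn n x\<bar> \<le> C"
    "AE x in lborel. (\<lambda>n. gn n x) \<longlonglongrightarrow> g x"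
  shows "(\<lambda>n. I0 (gn n) s) \<longlonglongrightarrow> I0 g s"
  unfolding I0_eq
proof (intro tendsto_mult tendsto_const integral_dominated_convergence[where w="\<lambda>x. C * indicator {min 0 s..max 0 s} x"])
  show "integrable lborel (\<lambda>x. C * indicator {min 0 s..max 0 s} x)"
    by (intro integrable_mult_right integrable_real_indicator) (auto simp: emeasure_lborel_Icc_eq)
  show "AE x in lborel. (\<lambda>n. indicator {min 0 s..max 0 s} x * gn n x) \<longlonglongrightarrow> indicator {min 0 s..max 0 s} x * g x"
    using assms(4) by eventually_elim (intro tendsto_intros)
  show "AE x in lborel. norm (indicator {min 0 s..max 0 s} x * gn n x) \<le> C * indicator {min 0 s..max 0 s} x" for n
    using assms(3) by (auto simp: indicator_def)
qed (use assms(1,2) in auto)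

lemma I0_deriv:
  assumes "continuous_on UNIV g" shows "(I0 g has_real_derivative g s) (at s)"
proof -
  let ?a = "- \<bar>s\<bar> - 1" and ?b = "\<bar>s\<bar> + 1"
  have "((\<lambda>u. LBINT y=ereal 0..ereal u. g y) has_vector_derivative g s) (at s within {?a..?b})"
    by (rule interval_integral_FTC2) (auto intro: continuous_on_subset[OF assms])
  then have "((\<lambda>u. LBINT y=ereal 0..ereal u. g y) has_vector_derivative g s) (at s)"
    by (subst (asm) at_within_interior) auto
  then show ?thesis unfolding I0_def[abs_def] by (simp add: has_real_derivative_iff_has_vector_derivative)
qed

lemma I0_diff:
  assumes g: "g \<in> borel_measurable borel" "AE x in lborel. \<bar>g x\<bar> \<le> C" and ab: "a \<le> b"
  shows "I0 g b - I0 g a = (LINT x|lborel. indicator {a..b} x * g x)"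
proof -
  have il: "interval_lebesgue_integrable lborel (ereal p) (ereal q) g" if "p \<le> q" for p q
  proof -
    have "set_integrable lborel {p..q} g"
      unfolding set_integrable_def using integrable_Icc_mult[OF g, of p q] by simp
    then have "set_integrable lborel {p<..<q} g" by (rule set_integrable_subset) auto
    moreover have "einterval (ereal p) (ereal q) = {p<..<q}" by (auto simp: einterval_iff)
    ultimately show ?thesis unfolding interval_lebesgue_integrable_def using that by simp
  qed
  have e: "min (ereal 0) (min (ereal a) (ereal b)) = ereal (min 0 (min a b))"
    "max (ereal 0) (max (ereal a) (ereal b)) = ereal (max 0 (max a b))"
    unfolding ereal_min ereal_max by (rule refl)+
  have "(LBINT x=ereal 0..ereal a. g x) + (LBINT x=ereal a..ereal b. g x) = (LBINT x=ereal 0..ereal b. g x)"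
    by (rule interval_integral_sum) (simp only: e, rule il, simp)
  moreover have "(LBINT x=ereal a..ereal b. g x) = (LINT x|lborel. indicator {a..b} x * g x)"
    using ab by (subst interval_integral_Icc) (auto simp: set_lebesgue_integral_def)
  ultimately show ?thesis unfolding I0_def by simp
qed

context mono_lipschitz
begin

lemma quot_borel: "quot n \<in> borel_measurable borel"
  by (rule borel_measurable_continuous_onI[OF quot_cont])

lemma AE_nd: "AE x in lborel. x \<notin> nd"
  by (rule AE_not_in[OF nd_null])

text \<open>If \<open>P\<close> is the primitive of \<open>F\<close>, difference quotients of
  \<open>P\<close> are a primitive of \<open>quot n\<close>; they tend to \<open>F\<close>, since
  \<open>F\<close> is continuous.\<close>

lemma I0_quot_tendsto: "(\<lambda>n. I0 (quot n) s) \<longlonglongrightarrow> F s - F 0"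
proof -
  let ?P = "I0 F"
  have P: "(?P has_real_derivative F x) (at x)" for x by (rule I0_deriv[OF cont])
  have eq: "I0 (quot n) s = real (Suc n) * (?P (s + 1 / real (Suc n)) - ?P s) - real (Suc n) * (?P (0 + 1 / real (Suc n)) - ?P 0)" for n
    unfolding I0_def[of "quot n"]
  proof (rule interval_integral_FTC_finite[OF quot_cont])
    fix x
    have "((\<lambda>x. real (Suc n) * (?P (x + 1 / real (Suc n)) - ?P x)) has_real_derivative
        real (Suc n) * (F (x + 1 / real (Suc n)) - F x)) (at x)"
      by (auto intro!: derivative_eq_intros DERIV_chain2[OF P] P)
    then show "((\<lambda>x. real (Suc n) * (?P (x + 1 / real (Suc n)) - ?P x)) has_vector_derivative quot n x)
        (at x within {min 0 s..max 0 s})"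
      unfolding quot_def has_real_derivative_iff_has_vector_derivative by (rule has_vector_derivative_at_within)
  qed
  have lim: "(\<lambda>n. real (Suc n) * (?P (x + 1 / real (Suc n)) - ?P x)) \<longlonglongrightarrow> F x" for x
  proof -
    have "((\<lambda>h. (?P (x + h) - ?P x) / h) \<longlongrightarrow> F x) (at 0)"
      using P[of x] by (simp add: DERIV_def)
    from filterlim_compose[OF this inverse_Suc_at_0]
    have "(\<lambda>n. (?P (x + 1 / real (Suc n)) - ?P x) / (1 / real (Suc n))) \<longlonglongrightarrow> F x"
      .
    then show ?thesis by (simp add: mult.commute)
  qed
  show ?thesis unfolding eq by (intro tendsto_diff lim)
qed

text \<open>The Lipschitz bound excludes a singular part: it keeps the quotients at most 1, so their
  almost everywhere convergence passes to the integrals.\<close>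

lemma I0_deriv_F: "I0 (deriv F) s = F s - F 0"
proof (rule LIMSEQ_unique)
  show "(\<lambda>n. I0 (quot n) s) \<longlonglongrightarrow> I0 (deriv F) s"
    by (rule I0_limit[where C=1])
      (use quot_borel deriv_borel quot_bounds AE_nd in \<open>auto elim!: eventually_mono intro: quot_tendsto\<close>)
qed (rule I0_quot_tendsto)

text \<open>The function \<nu> of the problem when \<open>F\<close> is \<mu>.\<close>

definition N :: "real \<Rightarrow> real" where "N s = I0 (\<lambda>r. sqrt (deriv F r)) s"

lemma sqrt_deriv: "(\<lambda>r. sqrt (deriv F r)) \<in> borel_measurable borel" "AE x in lborel. \<bar>sqrt (deriv F x)\<bar> \<le> 1"
  "AE x in lborel. \<bar>deriv F x\<bar> \<le> 1"
  using deriv_borel AE_nd deriv_bounds by (auto elim!: eventually_mono)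

lemma I0_sqrt_quot_tendsto: "(\<lambda>n. I0 (\<lambda>x. sqrt (quot n x)) s) \<longlonglongrightarrow> N s"
  unfolding N_def
proof (rule I0_limit[where C=1])
  show "AE x in lborel. (\<lambda>n. sqrt (quot n x)) \<longlonglongrightarrow> sqrt (deriv F x)"
    using AE_nd by eventually_elim (intro tendsto_real_sqrt quot_tendsto)
qed (use quot_borel quot_bounds sqrt_deriv in auto)

lemma N_diff: "a \<le> b \<Longrightarrow> N b - N a = (LINT x|lborel. indicator {a..b} x * sqrt (deriv F x))"
  unfolding N_def by (rule I0_diff[OF sqrt_deriv(1,2)])

lemma F_diff: "a \<le> b \<Longrightarrow> F b - F a = (LINT x|lborel. indicator {a..b} x * deriv F x)"
  using I0_diff[OF deriv_borel sqrt_deriv(3), of a b] by (simp add: I0_deriv_F)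

text \<open>A derivative between 0 and 1 is at most its square root. Through
  \<open>norm (M a) \<le> norm (N a)\<close> this lets the energy control \<open>w\<close>.\<close>

lemma F_diff_le_N_diff: assumes "a \<le> b" shows "F b - F a \<le> N b - N a"
  unfolding N_diff[OF assms] F_diff[OF assms]
proof (rule integral_mono_AE)
  show "AE x in lborel. indicator {a..b} x * deriv F x \<le> indicator {a..b} x * sqrt (deriv F x)"
    using AE_nd
  proof eventually_elim
    case (elim x)
    have "deriv F x = sqrt (deriv F x) * sqrt (deriv F x)" using deriv_bounds[OF elim] by simp
    also have "\<dots> \<le> 1 * sqrt (deriv F x)" using deriv_bounds[OF elim] by (intro mult_right_mono) auto
    finally show ?case by (simp add: indicator_def)
  qed
qed (rule integrable_Icc_mult[OF deriv_borel sqrt_deriv(3)] integrable_Icc_mult[OF sqrt_deriv(1,2)])+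

lemma N_0: "N 0 = 0" unfolding N_def by (rule I0_0)

lemma F_le_N: "\<bar>F s - F 0\<bar> \<le> \<bar>N s\<bar>"
proof (cases "0 \<le> s")
  case True
  then show ?thesis using F_diff_le_N_diff[of 0 s] mono[of 0 s] N_0 by auto
next
  case False
  then show ?thesis using F_diff_le_N_diff[of s 0] mono[of s 0] N_0 by auto
qed

text \<open>Cauchy-Schwarz for the constant 1 and the root of the derivative on
  \<open>{a..b}\<close>, carried out for their classes in \<open>l2\<close>; the three pairings are
  the increments of \<open>N\<close>, of the identity and of \<open>F\<close>.\<close>

lemma N_sq_le_aux: assumes ab: "a \<le> b" shows "(N b - N a)\<^sup>2 \<le> (b - a) * (F b - F a)"
proof -
  define i where "i = (indicator {a..b} :: real \<Rightarrow> real)"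
  define w where "w x = i x * sqrt (deriv F x)" for x
  have Icc: "{a..b} \<in> lmeasurable" by (rule lmeasurable_cbox[of a b, unfolded cbox_interval])
  have i: "sq_int i" unfolding i_def by (rule sq_int_indicator[OF Icc])
  have bw: "w \<in> borel_measurable borel" unfolding w_def i_def using sqrt_deriv(1) by measurable
  have w: "sq_int w"
  proof (rule sq_int_bound[OF borel_lebesgueI[OF bw] sq_intD[OF i]])
    have "AE x in lborel. (norm (w x))\<^sup>2 \<le> (norm (i x))\<^sup>2" using AE_nd
    proof eventually_elim
      case (elim x)
      show ?case using deriv_bounds[OF elim] by (auto simp: w_def i_def power_mult_distrib indicator_def)
    qed
    then show "AE x in lebesgue. (norm (w x))\<^sup>2 \<le> (norm (i x))\<^sup>2" by (rule AE_completion)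
  qed
  have "cls i \<bullet> cls w = (LINT x|lborel. i x * w x)"
    using cls_inner[OF i w] LINT_lebesgue_lborel[of "\<lambda>x. i x * w x"] bw by (simp add: i_def)
  also have "\<dots> = N b - N a" unfolding N_diff[OF ab]
    by (rule Bochner_Integration.integral_cong) (auto simp: w_def i_def indicator_def)
  finally have 1: "cls i \<bullet> cls w = N b - N a" .
  have "(norm (cls i))\<^sup>2 = (LINT x|lborel. (norm (i x))\<^sup>2)"
    using cls_norm[OF i] LINT_lebesgue_lborel[of "\<lambda>x. (norm (i x))\<^sup>2"] by (simp add: i_def)
  also have "\<dots> = (LINT x|lborel. i x)"
    by (rule Bochner_Integration.integral_cong) (auto simp: i_def indicator_def)
  also have "\<dots> = b - a" unfolding i_def using ab by simp
  finally have 2: "(norm (cls i))\<^sup>2 = b - a" .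
  have "(norm (cls w))\<^sup>2 = (LINT x|lborel. (norm (w x))\<^sup>2)"
    using cls_norm[OF w] LINT_lebesgue_lborel[of "\<lambda>x. (norm (w x))\<^sup>2"] bw by simp
  also have "\<dots> = (LINT x|lborel. indicator {a..b} x * deriv F x)"
  proof (rule integral_cong_AE)
    show "AE x in lborel. (norm (w x))\<^sup>2 = indicator {a..b} x * deriv F x" using AE_nd
    proof eventually_elim
      case (elim x)
      show ?case using deriv_bounds[OF elim] by (auto simp: w_def i_def power_mult_distrib indicator_def)
    qed
  qed (use bw deriv_borel in auto)
  also have "\<dots> = F b - F a" by (rule F_diff[OF ab, symmetric])
  finally have 3: "(norm (cls w))\<^sup>2 = F b - F a" .
  show ?thesis using Cauchy_Schwarz_ineq[of "cls i" "cls w"] unfolding 1 by (simp add: power2_norm_eq_inner[symmetric] 2 3)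
qed

lemma N_sq_le: "(N b - N a)\<^sup>2 \<le> (b - a) * (F b - F a)"
proof (cases "a \<le> b")
  case False
  then have "(N a - N b)\<^sup>2 \<le> (a - b) * (F a - F b)" by (intro N_sq_le_aux) simp
  then show ?thesis by (simp add: power2_commute algebra_simps)
qed (rule N_sq_le_aux)

lemma F_sq_le: "(F b - F a)\<^sup>2 \<le> (b - a) * (F b - F a)"
proof -
  have *: "(F y - F x)\<^sup>2 \<le> (y - x) * (F y - F x)" if "x \<le> y" for x y
    unfolding power2_eq_square using mono[OF that] lip[OF that] by (intro mult_right_mono) auto
  show ?thesis using *[of a b] *[of b a] by (cases "a \<le> b") (auto simp: power2_commute algebra_simps)
qed

lemma N_lip: "\<bar>N b - N a\<bar> \<le> \<bar>b - a\<bar>"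
proof (rule power2_le_imp_le)
  have "(N b - N a)\<^sup>2 \<le> (b - a) * (F b - F a)" by (rule N_sq_le)
  also have "\<dots> \<le> \<bar>b - a\<bar> * \<bar>F b - F a\<bar>" by (metis abs_ge_self abs_mult)
  also have "\<dots> \<le> \<bar>b - a\<bar> * \<bar>b - a\<bar>" by (intro mult_left_mono abs_lip) simp
  finally show "\<bar>N b - N a\<bar>\<^sup>2 \<le> \<bar>b - a\<bar>\<^sup>2" by (simp add: power2_eq_square)
qed simp

lemma N_borel: "N \<in> borel_measurable borel"
proof (rule borel_measurable_continuous_onI, rule continuous_onI)
  fix x e :: real assume "e > 0"
  then show "\<exists>d>0. \<forall>y\<in>UNIV. dist y x < d \<longrightarrow> dist (N y) (N x) \<le> e"
    using N_lip[of _ x] by (intro exI[of _ e]) (auto simp: dist_real_def intro: order_trans less_imp_le)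
qed

end

section \<open>The chain rule for Lipschitz functions\<close>

context bounded_open
begin

lemma antiderivative_bound:
  fixes f :: "real \<Rightarrow> real"
  assumes "\<And>s. (f has_real_derivative g s) (at s)" "\<And>s. \<bar>g s\<bar> \<le> C"
  shows "\<bar>f b - f a\<bar> \<le> C * \<bar>b - a\<bar>"
proof -
  have "norm (f b - f a) \<le> C * norm (b - a)"
    by (rule field_differentiable_bound[of UNIV f g]) (use assms in auto)
  then show ?thesis by simp
qed

lemma pderiv_sum: "finite I \<Longrightarrow> pderiv (\<Sum>i\<in>I. p i) = (\<Sum>i\<in>I. pderiv (p i))"
  by (induction I rule: finite_induct) (auto simp: pderiv_add)

text \<open>Weierstrass approximates the derivative, and integrating the polynomial controls
  function and derivative together. Vanishing at 0 keeps compact supports.\<close>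

lemma polynomial_antiderivative_approx:
  assumes "continuous_on UNIV g" "e > 0"
  shows "\<exists>P :: real poly. poly P 0 = 0 \<and> (\<forall>s. \<bar>s\<bar> \<le> M \<longrightarrow> \<bar>poly (pderiv P) s - g s\<bar> < e)"
proof -
  obtain q where q: "real_polynomial_function q" "\<And>s. s \<in> {-M..M} \<Longrightarrow> \<bar>g s - q s\<bar> < e"
    using Stone_Weierstrass_real_polynomial_function[of "{-M..M}" g e] assms continuous_on_subset[OF assms(1)] by auto
  obtain a n where an: "q = (\<lambda>x. \<Sum>i\<le>n. a i * x ^ i)"
    using q(1) unfolding real_polynomial_function_iff_sum by blast
  define P where "P = (\<Sum>i\<le>n. monom (a i / real (Suc i)) (Suc i))"
  have "pderiv P = (\<Sum>i\<le>n. monom (a i) i)"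
    unfolding P_def by (simp add: pderiv_sum pderiv_monom)
  then have "poly (pderiv P) s = q s" for s by (simp add: an poly_sum poly_monom)
  moreover have "poly P 0 = 0" unfolding P_def by (simp add: poly_sum poly_monom)
  ultimately show ?thesis using q(2) by (intro exI[of _ P]) (auto simp: abs_minus_commute abs_le_iff)
qed

text \<open>The composition of \<open>f\<close> with \<phi> need not be smooth, so it is reached
  through polynomials in \<phi>, which are again test functions. The values of \<phi> stay in a
  compact interval, where the approximation is uniform.\<close>

lemma chain_test_fun:
  assumes g: "continuous_on UNIV g" "\<And>s. \<bar>g s\<bar> \<le> C"
    and f: "\<And>s. (f has_real_derivative g s) (at s)" "f 0 = 0" and \<phi>: "test_fun \<Omega> \<phi>"
  shows "(cls (\<lambda>x. f (\<phi> x)), cls (\<lambda>x. g (\<phi> x) *\<^sub>R cgrad \<phi> x)) \<in> Gr"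
proof -
  obtain M where M: "\<And>x. \<bar>\<phi> x\<bar> \<le> M" using test_fun_bounded[OF \<phi>] by blast
  have "\<forall>k. \<exists>P :: real poly. poly P 0 = 0 \<and> (\<forall>s. \<bar>s\<bar> \<le> M \<longrightarrow> \<bar>poly (pderiv P) s - g s\<bar> < 1 / real (Suc k))"
    using polynomial_antiderivative_approx[OF g(1)] by simp
  from choice[OF this] obtain P :: "nat \<Rightarrow> real poly" where P: "\<And>k. poly (P k) 0 = 0"
    "\<And>k s. \<bar>s\<bar> \<le> M \<Longrightarrow> \<bar>poly (pderiv (P k)) s - g s\<bar> < 1 / real (Suc k)" by blast
  have tf: "test_fun \<Omega> (\<lambda>x. poly (P k) (\<phi> x))" for k by (rule test_fun_poly[OF \<phi> P(1)])
  have cg: "cgrad (\<lambda>x. poly (P k) (\<phi> x)) = (\<lambda>x. poly (pderiv (P k)) (\<phi> x) *\<^sub>R cgrad \<phi> x)" for k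
    by (auto simp: cgrad_def vec_eq_iff partial_poly[OF smooth_differentiable[OF test_fun_smooth[OF \<phi>]]])
  have mem: "(cls (\<lambda>x. poly (P k) (\<phi> x)), cls (\<lambda>x. poly (pderiv (P k)) (\<phi> x) *\<^sub>R cgrad \<phi> x)) \<in> Gr" for k
    using G0_Gr[OF tf] unfolding cg .
  have diffb: "\<bar>poly (P k) s - f s\<bar> \<le> 1 / real (Suc k) * \<bar>s\<bar>" if s: "\<bar>s\<bar> \<le> M" for k s
  proof -
    have "norm ((poly (P k) s - f s) - (poly (P k) 0 - f 0)) \<le> 1 / real (Suc k) * norm (s - 0)"
    proof (rule field_differentiable_bound[of "{-M..M}" "\<lambda>s. poly (P k) s - f s" "\<lambda>s. poly (pderiv (P k)) s - g s"])
      fix z assume "z \<in> {-M..M}"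
      show "((\<lambda>s. poly (P k) s - f s) has_field_derivative poly (pderiv (P k)) z - g z) (at z within {- M..M})"
        by (intro DERIV_diff DERIV_subset[OF poly_DERIV] DERIV_subset[OF f(1)]) auto
      show "norm (poly (pderiv (P k)) z - g z) \<le> 1 / real (Suc k)"
        using P(2)[of z k] \<open>z \<in> {-M..M}\<close> by (auto simp: abs_le_iff intro: less_imp_le)
    qed (use s in auto)
    then show ?thesis using P(1) f(2) by simp
  qed
  have mphi: "\<phi> \<in> borel_measurable borel" by (rule borel_measurable_continuous_onI[OF smooth_continuous[OF test_fun_smooth[OF \<phi>]]])
  have mcg: "cgrad \<phi> \<in> borel_measurable borel" by (rule borel_measurable_continuous_onI[OF smooth_continuous_cgrad[OF test_fun_smooth[OF \<phi>]]])
  have mg: "g \<in> borel_measurable borel" by (rule borel_measurable_continuous_onI[OF g(1)])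
  have mf: "f \<in> borel_measurable borel"
    by (intro borel_measurable_continuous_onI continuous_at_imp_continuous_on ballI DERIV_isCont[OF f(1)])
  have mp: "poly (p :: real poly) \<in> borel_measurable borel" for p
    by (intro borel_measurable_continuous_onI continuous_intros)
  have inv0: "(\<lambda>k. 1 / real (Suc k)) \<longlonglongrightarrow> 0" by (rule LIMSEQ_Suc[OF lim_1_over_n])
  have C0: "C \<ge> 0" using g(2)[of 0] by linarith
  have l1: "(\<lambda>k. cls (\<lambda>x. poly (P k) (\<phi> x))) \<longlonglongrightarrow> cls (\<lambda>x. f (\<phi> x))"
  proof (rule cls_tendsto_dominated(3)[where w="\<lambda>x. (C + 1) *\<^sub>R \<bar>\<phi> x\<bar>"])
    show "sq_int (\<lambda>x. (C + 1) *\<^sub>R \<bar>\<phi> x\<bar>)" by (intro sq_int_scaleR) (use test_fun_sq_int(1)[OF \<phi>] in \<open>auto simp: sq_int_def\<close>)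
    show "AE x in lebesgue. (\<lambda>k. poly (P k) (\<phi> x)) \<longlonglongrightarrow> f (\<phi> x)"
    proof (rule AE_I2)
      fix x
      have "(\<lambda>k. poly (P k) (\<phi> x) - f (\<phi> x)) \<longlonglongrightarrow> 0"
        by (rule Lim_null_comparison[OF _ tendsto_mult_left_zero[OF inv0, of "\<bar>\<phi> x\<bar>"]]) (use diffb[OF M] in auto)
      then show "(\<lambda>k. poly (P k) (\<phi> x)) \<longlonglongrightarrow> f (\<phi> x)" by (rule LIM_zero_cancel)
    qed
    show "AE x in lebesgue. norm (poly (P k) (\<phi> x)) \<le> (C + 1) *\<^sub>R \<bar>\<phi> x\<bar>" for k
    proof (rule AE_I2)
      fix x
      have "1 / real (Suc k) * \<bar>\<phi> x\<bar> \<le> 1 * \<bar>\<phi> x\<bar>" by (rule mult_right_mono) auto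
      moreover have "\<bar>f (\<phi> x)\<bar> \<le> C * \<bar>\<phi> x\<bar>" using antiderivative_bound[OF f(1) g(2), of "\<phi> x" 0] f(2) by simp
      ultimately show "norm (poly (P k) (\<phi> x)) \<le> (C + 1) *\<^sub>R \<bar>\<phi> x\<bar>"
        using diffb[OF M[of x], of k] by (simp add: algebra_simps abs_le_iff)
    qed
  qed (auto intro!: borel_lebesgueI measurable_compose[OF mphi] mp mf)
  have l2: "(\<lambda>k. cls (\<lambda>x. poly (pderiv (P k)) (\<phi> x) *\<^sub>R cgrad \<phi> x)) \<longlonglongrightarrow> cls (\<lambda>x. g (\<phi> x) *\<^sub>R cgrad \<phi> x)"
  proof (rule cls_tendsto_dominated(3)[where w="\<lambda>x. (C + 1) *\<^sub>R norm (cgrad \<phi> x)"])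
    show "sq_int (\<lambda>x. (C + 1) *\<^sub>R norm (cgrad \<phi> x))" by (intro sq_int_scaleR) (use test_fun_sq_int(2)[OF \<phi>] in \<open>auto simp: sq_int_def\<close>)
    show "AE x in lebesgue. (\<lambda>k. poly (pderiv (P k)) (\<phi> x) *\<^sub>R cgrad \<phi> x) \<longlonglongrightarrow> g (\<phi> x) *\<^sub>R cgrad \<phi> x"
    proof (rule AE_I2)
      fix x
      have "(\<lambda>k. poly (pderiv (P k)) (\<phi> x) - g (\<phi> x)) \<longlonglongrightarrow> 0"
        by (rule Lim_null_comparison[OF _ inv0]) (intro always_eventually allI, use P(2)[OF M] in \<open>auto intro: less_imp_le\<close>)
      from tendsto_scaleR[OF LIM_zero_cancel[OF this] tendsto_const]
      show "(\<lambda>k. poly (pderiv (P k)) (\<phi> x) *\<^sub>R cgrad \<phi> x) \<longlonglongrightarrow> g (\<phi> x) *\<^sub>R cgrad \<phi> x" .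
    qed
    show "AE x in lebesgue. norm (poly (pderiv (P k)) (\<phi> x) *\<^sub>R cgrad \<phi> x) \<le> (C + 1) *\<^sub>R norm (cgrad \<phi> x)" for k
    proof (rule AE_I2)
      fix x
      have "1 / real (Suc k) \<le> 1" by simp
      then have "\<bar>poly (pderiv (P k)) (\<phi> x)\<bar> \<le> C + 1" using P(2)[OF M[of x], of k] g(2)[of "\<phi> x"] by linarith
      then show "norm (poly (pderiv (P k)) (\<phi> x) *\<^sub>R cgrad \<phi> x) \<le> (C + 1) *\<^sub>R norm (cgrad \<phi> x)"
        by (simp add: mult_right_mono)
    qed
  qed (intro borel_lebesgueI borel_measurable_scaleR mcg measurable_compose[OF mphi] mp mg)+
  show ?thesis by (rule GrI[OF mem l1 l2])
qed

text \<open>Approximate \<open>u\<close> by test functions that also converge almost everywhere. The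
  gradient error splits into \<open>g\<close> times the difference of the gradients, small by the
  bound on \<open>g\<close>, and the change of \<open>g\<close> times \<open>h\<close>, small by
  dominated convergence.\<close>

lemma chain_pair_C1:
  assumes g: "continuous_on UNIV g" "\<And>s. \<bar>g s\<bar> \<le> C"
    and f: "\<And>s. (f has_real_derivative g s) (at s)" "f 0 = 0"
  shows "chain_pair f g"
  unfolding chain_pair_def
proof (intro conjI allI impI)
  show mg: "g \<in> borel_measurable borel" by (rule borel_measurable_continuous_onI[OF g(1)])
  show mf: "f \<in> borel_measurable borel"
    by (intro borel_measurable_continuous_onI continuous_at_imp_continuous_on ballI DERIV_isCont[OF f(1)])
  fix u :: "real^'n \<Rightarrow> real" and h :: "real^'n \<Rightarrow> real^'n"
  assume u: "sq_int u" and h: "sq_int h" and uh: "(cls u, cls h) \<in> Gr"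
  have mu: "u \<in> borel_measurable lebesgue" and mh: "h \<in> borel_measurable lebesgue" using u h by (auto simp: sq_int_def)
  have C0: "C \<ge> 0" using g(2)[of 0] by linarith
  obtain \<phi>' where \<phi>': "\<And>n. test_fun \<Omega> (\<phi>' n)" "(\<lambda>n. cls (\<phi>' n)) \<longlonglongrightarrow> cls u" "(\<lambda>n. cls (cgrad (\<phi>' n))) \<longlonglongrightarrow> cls h"
    using Gr_seq[OF uh] by blast
  obtain r where r: "strict_mono r" "AE x in lebesgue. (\<lambda>n. \<phi>' (r n) x) \<longlonglongrightarrow> u x"
    using cls_tendsto_AE_subseq[OF test_fun_sq_int(1)[OF \<phi>'(1)] u \<phi>'(2)] by blast
  define \<phi> where "\<phi> n = \<phi>' (r n)" for n
  have \<phi>: "test_fun \<Omega> (\<phi> n)" "(\<lambda>n. cls (\<phi> n)) \<longlonglongrightarrow> cls u" "(\<lambda>n. cls (cgrad (\<phi> n))) \<longlonglongrightarrow> cls h"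
    "AE x in lebesgue. (\<lambda>n. \<phi> n x) \<longlonglongrightarrow> u x" for n
    using \<phi>'(1) LIMSEQ_subseq_LIMSEQ[OF \<phi>'(2) r(1)] LIMSEQ_subseq_LIMSEQ[OF \<phi>'(3) r(1)] r(2)
    by (auto simp: \<phi>_def comp_def)
  note sq = test_fun_sq_int[OF \<phi>(1)]
  have fC: "\<bar>f s\<bar> \<le> C * \<bar>s\<bar>" for s using antiderivative_bound[OF f(1) g(2), of s 0] f(2) by simp
  have sf: "sq_int (\<lambda>x. f (v x))" if "sq_int v" for v :: "real^'n \<Rightarrow> real" by (rule sq_int_compose[OF that mf fC])
  have l1: "(\<lambda>n. cls (\<lambda>x. f (\<phi> n x))) \<longlonglongrightarrow> cls (\<lambda>x. f (u x))"
  proof (rule LIM_zero_cancel, rule Lim_null_comparison)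
    show "(\<lambda>n. C * norm (cls (\<phi> n) - cls u)) \<longlonglongrightarrow> 0"
      using tendsto_mult_right_zero[OF tendsto_norm_zero[OF LIM_zero[OF \<phi>(2)]], of C] .
    have "norm (cls (\<lambda>x. f (\<phi> n x)) - cls (\<lambda>x. f (u x))) \<le> C * norm (cls (\<phi> n) - cls u)" for n
    proof (rule power2_le_imp_le)
      have "(norm (cls (\<lambda>x. f (\<phi> n x)) - cls (\<lambda>x. f (u x))))\<^sup>2 = (LINT x|lebesgue. (norm (f (\<phi> n x) - f (u x)))\<^sup>2)"
        by (rule cls_dist[OF sf[OF sq(1)] sf[OF u]])
      also have "\<dots> \<le> (LINT x|lebesgue. C\<^sup>2 * (norm (\<phi> n x - u x))\<^sup>2)"
      proof (rule integral_mono)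
        show "integrable lebesgue (\<lambda>x. (norm (f (\<phi> n x) - f (u x)))\<^sup>2)" by (rule sq_intD[OF sq_int_diff[OF sf[OF sq(1)] sf[OF u]]])
        show "integrable lebesgue (\<lambda>x. C\<^sup>2 * (norm (\<phi> n x - u x))\<^sup>2)"
          by (rule integrable_mult_right[OF sq_intD[OF sq_int_diff[OF sq(1) u]]])
        show "(norm (f (\<phi> n x) - f (u x)))\<^sup>2 \<le> C\<^sup>2 * (norm (\<phi> n x - u x))\<^sup>2" for x
          using power_mono[OF antiderivative_bound[OF f(1) g(2), of "\<phi> n x" "u x"] abs_ge_zero, of 2]
          by (simp add: power_mult_distrib)
      qed
      also have "\<dots> = (C * norm (cls (\<phi> n) - cls u))\<^sup>2"
        by (simp add: power_mult_distrib cls_dist[OF sq(1) u])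
      finally show "(norm (cls (\<lambda>x. f (\<phi> n x)) - cls (\<lambda>x. f (u x))))\<^sup>2 \<le> (C * norm (cls (\<phi> n) - cls u))\<^sup>2" .
    qed (use C0 in simp)
    then show "\<forall>\<^sub>F n in sequentially. norm (cls (\<lambda>x. f (\<phi> n x)) - cls (\<lambda>x. f (u x))) \<le> C * norm (cls (\<phi> n) - cls u)" by simp
  qed
  have sgh: "sq_int (\<lambda>x. g (\<phi> n x) *\<^sub>R h x)" for n by (rule sq_int_compose_mult[OF sq(1) h mg g(2)])
  have sgc: "sq_int (\<lambda>x. g (\<phi> n x) *\<^sub>R cgrad (\<phi> n) x)" for n by (rule sq_int_compose_mult[OF sq(1) sq(2) mg g(2)])
  have l2a: "(\<lambda>n. cls (\<lambda>x. g (\<phi> n x) *\<^sub>R h x)) \<longlonglongrightarrow> cls (\<lambda>x. g (u x) *\<^sub>R h x)"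
  proof (rule cls_tendsto_dominated(3)[where w="\<lambda>x. C *\<^sub>R norm (h x)"])
    show "sq_int (\<lambda>x. C *\<^sub>R norm (h x))" by (intro sq_int_scaleR) (use h in \<open>auto simp: sq_int_def\<close>)
    show "(\<lambda>x. g (\<phi> n x) *\<^sub>R h x) \<in> borel_measurable lebesgue" for n by (rule sq_int_measurable[OF sgh])
    show "(\<lambda>x. g (u x) *\<^sub>R h x) \<in> borel_measurable lebesgue"
      by (intro borel_measurable_scaleR mh measurable_compose[OF mu mg])
    show "AE x in lebesgue. (\<lambda>n. g (\<phi> n x) *\<^sub>R h x) \<longlonglongrightarrow> g (u x) *\<^sub>R h x"
      using \<phi>(4)
    proof eventually_elim
      case (elim x)
      have "(\<lambda>n. g (\<phi> n x)) \<longlonglongrightarrow> g (u x)"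
        using continuous_on_tendsto_compose[OF g(1) elim] by simp
      then show ?case by (intro tendsto_scaleR tendsto_const)
    qed
    show "AE x in lebesgue. norm (g (\<phi> n x) *\<^sub>R h x) \<le> C *\<^sub>R norm (h x)" for n
      using g(2) by (auto intro!: AE_I2 mult_right_mono)
  qed
  have l2b: "(\<lambda>n. cls (\<lambda>x. g (\<phi> n x) *\<^sub>R cgrad (\<phi> n) x) - cls (\<lambda>x. g (\<phi> n x) *\<^sub>R h x)) \<longlonglongrightarrow> 0"
  proof (rule Lim_null_comparison)
    show "(\<lambda>n. C * norm (cls (cgrad (\<phi> n)) - cls h)) \<longlonglongrightarrow> 0"
      using tendsto_mult_right_zero[OF tendsto_norm_zero[OF LIM_zero[OF \<phi>(3)]], of C] .
    have "norm (cls (\<lambda>x. g (\<phi> n x) *\<^sub>R cgrad (\<phi> n) x) - cls (\<lambda>x. g (\<phi> n x) *\<^sub>R h x)) \<le> C * norm (cls (cgrad (\<phi> n)) - cls h)" for n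
    proof (rule power2_le_imp_le)
      have "(norm (cls (\<lambda>x. g (\<phi> n x) *\<^sub>R cgrad (\<phi> n) x) - cls (\<lambda>x. g (\<phi> n x) *\<^sub>R h x)))\<^sup>2 =
          (LINT x|lebesgue. (norm (g (\<phi> n x) *\<^sub>R cgrad (\<phi> n) x - g (\<phi> n x) *\<^sub>R h x))\<^sup>2)"
        by (rule cls_dist[OF sgc sgh])
      also have "\<dots> \<le> (LINT x|lebesgue. C\<^sup>2 * (norm (cgrad (\<phi> n) x - h x))\<^sup>2)"
      proof (rule integral_mono)
        show "integrable lebesgue (\<lambda>x. (norm (g (\<phi> n x) *\<^sub>R cgrad (\<phi> n) x - g (\<phi> n x) *\<^sub>R h x))\<^sup>2)"
          by (rule sq_intD[OF sq_int_diff[OF sgc sgh]])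
        show "integrable lebesgue (\<lambda>x. C\<^sup>2 * (norm (cgrad (\<phi> n) x - h x))\<^sup>2)"
          by (rule integrable_mult_right[OF sq_intD[OF sq_int_diff[OF sq(2) h]]])
        show "(norm (g (\<phi> n x) *\<^sub>R cgrad (\<phi> n) x - g (\<phi> n x) *\<^sub>R h x))\<^sup>2 \<le> C\<^sup>2 * (norm (cgrad (\<phi> n) x - h x))\<^sup>2" for x
          using power_mono[OF g(2)[of "\<phi> n x"] abs_ge_zero, of 2]
          by (simp add: scaleR_diff_right[symmetric] power_mult_distrib mult_right_mono)
      qed
      also have "\<dots> = (C * norm (cls (cgrad (\<phi> n)) - cls h))\<^sup>2"
        by (simp add: power_mult_distrib cls_dist[OF sq(2) h])
      finally show "(norm (cls (\<lambda>x. g (\<phi> n x) *\<^sub>R cgrad (\<phi> n) x) - cls (\<lambda>x. g (\<phi> n x) *\<^sub>R h x)))\<^sup>2 \<le> (C * norm (cls (cgrad (\<phi> n)) - cls h))\<^sup>2" .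
    qed (use C0 in simp)
    then show "\<forall>\<^sub>F n in sequentially. norm (cls (\<lambda>x. g (\<phi> n x) *\<^sub>R cgrad (\<phi> n) x) - cls (\<lambda>x. g (\<phi> n x) *\<^sub>R h x)) \<le> C * norm (cls (cgrad (\<phi> n)) - cls h)" by simp
  qed
  have l2: "(\<lambda>n. cls (\<lambda>x. g (\<phi> n x) *\<^sub>R cgrad (\<phi> n) x)) \<longlonglongrightarrow> cls (\<lambda>x. g (u x) *\<^sub>R h x)"
    using tendsto_add[OF l2b l2a] by simp
  show "(cls (\<lambda>x. f (u x)), cls (\<lambda>x. g (u x) *\<^sub>R h x)) \<in> Gr"
    by (rule GrI[OF chain_test_fun[OF g f \<phi>(1)] l1 l2])
qed

text \<open>The indicator is the limit of truncated multiples of the distance to the complement. The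
  whole line is excluded because \<open>infdist\<close> to the empty set is 0.\<close>

lemma chain_pair_open:
  assumes U: "open U" "U \<noteq> UNIV" shows "chain_pair (I0 (indicator U)) (indicator U)"
proof -
  define k where "k n x = min 1 (real n * infdist x (- U))" for n x
  have k: "continuous_on UNIV (k n)" "\<bar>k n x\<bar> \<le> 1" for n x
    unfolding k_def by (auto intro!: continuous_intros simp: infdist_nonneg)
  have lim: "(\<lambda>n. k n x) \<longlonglongrightarrow> indicator U x" for x
  proof (cases "x \<in> U")
    case True
    have pos: "infdist x (- U) > 0"
      using infdist_pos_not_in_closed[of "- U" x] U True by auto
    then obtain m where m: "1 / infdist x (- U) < real m" using reals_Archimedean2 by blast
    have "k n x = 1" if "n \<ge> m" for n
    proof -
      have "1 \<le> real m * infdist x (- U)" using m pos by (simp add: field_simps)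
      also have "\<dots> \<le> real n * infdist x (- U)" using that pos by (intro mult_right_mono) auto
      finally show ?thesis unfolding k_def by simp
    qed
    then have "\<forall>\<^sub>F n in sequentially. k n x = 1" by (auto simp: eventually_sequentially)
    then show ?thesis using True by (simp add: tendsto_eventually)
  qed (simp add: k_def)
  have bk: "k n \<in> borel_measurable borel" for n by (rule borel_measurable_continuous_onI[OF k(1)])
  show ?thesis
  proof (rule chain_pair_limit[where C=1, OF chain_pair_C1[OF k I0_deriv[OF k(1)] I0_0]])
    show "\<bar>I0 (k n) s\<bar> \<le> 1 * \<bar>s\<bar>" for n s by (rule I0_abs_le[OF bk k(2)])
    show "(\<lambda>n. I0 (k n) s) \<longlonglongrightarrow> I0 (indicator U) s" for s
      by (rule I0_limit[OF bk _ k(2)]) (use lim U(1) in auto)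
  qed (use k(2) lim in auto)
qed

text \<open>Apply the chain rule to the primitives of the indicators of open sets that shrink to \<open>N\<close>; these primitives tend to 0.\<close>

lemma grad_zero_on_null:
  assumes N: "N \<in> null_sets lborel" and u: "sq_int u" and h: "sq_int h" and uh: "(cls u, cls h) \<in> Gr"
  shows "AE x in lebesgue. u x \<in> N \<longrightarrow> h x = 0"
proof -
  have "\<exists>T. open T \<and> N \<subseteq> T \<and> emeasure lborel T < ennreal (1 / real (Suc j))" for j
  proof -
    have NL: "N \<in> sets lebesgue" using N by (auto simp: null_sets_def)
    obtain T where T: "open T" "N \<subseteq> T" "emeasure lebesgue (T - N) < ennreal (1 / real (Suc j))"
      using sets_lebesgue_outer_open[OF NL, of "1 / real (Suc j)"] by (metis of_nat_0_less_iff zero_less_Suc zero_less_divide_1_iff)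
    have "emeasure lebesgue (T - N) = emeasure lborel (T - N)"
    proof -
      have "T - N \<in> sets lborel" using T(1) N by (auto simp: null_sets_def)
      then show ?thesis by simp
    qed
    also have "\<dots> = emeasure lborel T" by (rule emeasure_Diff_null_set[OF N]) (use T in auto)
    finally show ?thesis using T by auto
  qed
  then obtain T where T: "\<And>j. open (T j)" "\<And>j. N \<subseteq> T j" "\<And>j. emeasure lborel (T j) < ennreal (1 / real (Suc j))" by metis
  \<comment> \<open>Finite intersections make the sets decrease, so that their indicators converge
    at every point.\<close>
  define U where "U j = (\<Inter>i\<le>j. T i)" for j
  have U: "open (U j)" "N \<subseteq> U j" "U j \<subseteq> T j" for j unfolding U_def using T by auto
  have Um: "emeasure lborel (U j) < ennreal (1 / real (Suc j))" for j
    using emeasure_mono[OF U(3)[of j], of lborel] T(1,3)[of j] by (auto intro: le_less_trans)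
  have UU: "U j \<noteq> UNIV" for j
    using Um[of j] by (metis emeasure_lborel_UNIV ennreal_less_top infinity_ennreal_def less_asym)
  have bI: "\<bar>I0 (indicator (U j)) s\<bar> \<le> 1 / real (Suc j)" for j s
  proof -
    let ?i = "indicator {min 0 s..max 0 s} :: real \<Rightarrow> real"
    have iU: "integrable lborel (indicator (U j) :: real \<Rightarrow> real)"
      by (rule integrable_real_indicator) (use U(1) Um[of j] in \<open>auto intro: less_trans[OF _ ennreal_less_top]\<close>)
    have "\<bar>I0 (indicator (U j)) s\<bar> = \<bar>LINT x|lborel. ?i x * indicator (U j) x\<bar>" unfolding I0_eq by simp
    also have "\<dots> \<le> (LINT x|lborel. indicator (U j) x)"
    proof (rule order_trans[OF integral_abs_bound integral_mono[OF _ iU]])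
      show "integrable lborel (\<lambda>x. \<bar>?i x * indicator (U j) x :: real\<bar>)"
        by (intro integrable_abs integrable_Icc_mult[where C=1]) (use U(1) in auto)
      show "\<bar>?i x * indicator (U j) x\<bar> \<le> indicator (U j) x" for x by (simp add: indicator_def)
    qed
    also have "\<dots> = measure lborel (U j)" by simp
    also have "\<dots> \<le> 1 / real (Suc j)"
      unfolding measure_def using enn2real_mono[OF less_imp_le[OF Um[of j]]] by simp
    finally show ?thesis .
  qed
  define N' where "N' = (\<Inter>j. U j)"
  have bN': "N' \<in> sets borel" unfolding N'_def using U(1) by (intro sets.countable_INT') auto
  have limU: "(\<lambda>j. indicator (U j) s :: real) \<longlonglongrightarrow> indicator N' s" for s
  proof -
    have "\<forall>\<^sub>F j in sequentially. (indicator (U j) s :: real) = indicator N' s"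
    proof (cases "s \<in> N'")
      case True
      then show ?thesis unfolding N'_def by auto
    next
      case False
      then obtain m where "s \<notin> U m" unfolding N'_def by blast
      then have "s \<notin> U j" if "j \<ge> m" for j using that unfolding U_def by auto
      then show ?thesis using False by (auto simp: eventually_sequentially indicator_def intro!: exI[of _ m])
    qed
    then show ?thesis by (rule tendsto_eventually)
  qed
  \<comment> \<open>In the limit the zero function acquires the gradient
    \<open>indicator N' (u x) *\<^sub>R h x\<close>. Since \<open>Gr\<close> is single-valued, this
    gradient is 0.\<close>
  have "chain_pair (\<lambda>s. 0) (indicator N')"
  proof (rule chain_pair_limit[where C=1, OF chain_pair_open[OF U(1) UU]])
    show "\<bar>I0 (indicator (U j)) s\<bar> \<le> 1 * \<bar>s\<bar>" for j s
      by (rule I0_abs_le) (use U(1) in \<open>auto simp: indicator_def\<close>)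
    show "\<bar>indicator (U j) s\<bar> \<le> (1::real)" for j s by (simp add: indicator_def)
    show "(\<lambda>j. I0 (indicator (U j)) s) \<longlonglongrightarrow> 0" for s
      by (rule Lim_null_comparison[OF _ LIMSEQ_Suc[OF lim_1_over_n]]) (use bI in auto)
  qed (rule limU)
  then have "(cls (\<lambda>x. 0), cls (\<lambda>x. indicator N' (u x) *\<^sub>R h x)) \<in> Gr"
    using u h uh unfolding chain_pair_def by blast
  then have "cls (\<lambda>x. indicator N' (u x) *\<^sub>R h x) = cls (\<lambda>x. 0)" using Gr_unique by (simp add: cls_zero)
  moreover have "sq_int (\<lambda>x. indicator N' (u x) *\<^sub>R h x)"
    by (rule sq_int_compose_mult[OF u h, where C=1]) (use bN' in \<open>auto simp: indicator_def\<close>)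
  ultimately have "AE x in lebesgue. indicator N' (u x) *\<^sub>R h x = 0"
    using cls_eq_iff[OF _ sq_int_zero] by blast
  then show ?thesis
  proof eventually_elim
    case (elim x)
    show ?case using elim U(2) unfolding N'_def by (auto simp: indicator_def split: if_splits)
  qed
qed

text \<open>The gradient \<open>h\<close> vanishes where \<open>u\<close> takes values in the null
  set \<open>N\<close>, so convergence off \<open>N\<close> suffices. Applied to the quotients it
  yields \<mu>, applied to their roots it yields \<nu>.\<close>

lemma chain_rule_AE:
  assumes gn: "\<And>n. continuous_on UNIV (gn n)" "\<And>n s. \<bar>gn n s\<bar> \<le> 1"
    and lim: "\<And>s. s \<notin> N \<Longrightarrow> (\<lambda>n. gn n s) \<longlonglongrightarrow> g s" and N: "N \<in> null_sets lborel"
    and f: "\<And>s. (\<lambda>n. I0 (gn n) s) \<longlonglongrightarrow> f s" "f \<in> borel_measurable borel" and g: "g \<in> borel_measurable borel"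
    and u: "sq_int u" and h: "sq_int h" and uh: "(cls u, cls h) \<in> Gr"
  shows "(cls (\<lambda>x. f (u x)), cls (\<lambda>x. g (u x) *\<^sub>R h x)) \<in> Gr" "sq_int (\<lambda>x. g (u x) *\<^sub>R h x)"
proof -
  have c: "chain_pair (I0 (gn n)) (gn n)" for n by (rule chain_pair_C1[OF gn I0_deriv[OF gn(1)] I0_0])
  have b: "\<bar>I0 (gn n) s\<bar> \<le> 1 * \<bar>s\<bar>" for n s
    by (rule I0_abs_le[OF borel_measurable_continuous_onI[OF gn(1)] gn(2)])
  have l: "AE x in lebesgue. (\<lambda>n. gn n (u x) *\<^sub>R h x) \<longlonglongrightarrow> g (u x) *\<^sub>R h x"
    using grad_zero_on_null[OF N u h uh]
  proof eventually_elim
    case (elim x)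
    show ?case
    proof (cases "u x \<in> N")
      case False
      then show ?thesis by (intro tendsto_scaleR lim tendsto_const)
    qed (use elim in simp)
  qed
  show "(cls (\<lambda>x. f (u x)), cls (\<lambda>x. g (u x) *\<^sub>R h x)) \<in> Gr" "sq_int (\<lambda>x. g (u x) *\<^sub>R h x)"
    by (rule chain_pair_limit_AE[where gn=gn and C=1, OF c b gn(2) u h uh f g l])+
qed

end


subsection \<open>Symmetric matrices\<close>

lemma psd_Cauchy_Schwarz:
  fixes L :: "'a::real_inner \<Rightarrow> 'a"
  assumes L: "linear L" "\<And>x y. L x \<bullet> y = x \<bullet> L y" "\<And>x. 0 \<le> L x \<bullet> x"
  shows "(L x \<bullet> y)\<^sup>2 \<le> (L x \<bullet> x) * (L y \<bullet> y)"
proof -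
  have ex: "0 \<le> L x \<bullet> x + 2 * t * (L x \<bullet> y) + t\<^sup>2 * (L y \<bullet> y)" for t
  proof -
    have "L y \<bullet> x = L x \<bullet> y" using L(2)[of y x] by (simp add: inner_commute)
    then have "L (x + t *\<^sub>R y) \<bullet> (x + t *\<^sub>R y) = L x \<bullet> x + 2 * t * (L x \<bullet> y) + t\<^sup>2 * (L y \<bullet> y)"
      by (simp add: linear_add[OF L(1)] linear_scale[OF L(1)] inner_simps power2_eq_square algebra_simps)
    then show ?thesis using L(3)[of "x + t *\<^sub>R y"] by simp
  qed
  show ?thesis
  proof (cases "L y \<bullet> y = 0")
    case True
    have "L x \<bullet> y = 0"
    proof (rule ccontr)
      assume ne: "L x \<bullet> y \<noteq> 0"
      \<comment> \<open>With \<open>L y \<bullet> y = 0\<close> the quadratic in \<open>ex\<close>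
        is affine in \<open>t\<close>; this \<open>t\<close> gives it the value -1.\<close>
      define t where "t = - (L x \<bullet> x + 1) / (2 * (L x \<bullet> y))"
      have "2 * t * (L x \<bullet> y) = - (L x \<bullet> x + 1)" unfolding t_def using ne by simp
      then show False using ex[of t] True by simp
    qed
    then show ?thesis using True by simp
  next
    case False
    then have pos: "L y \<bullet> y > 0" using L(3)[of y] by simp
    define t where "t = - (L x \<bullet> y) / (L y \<bullet> y)"
    have "2 * t * (L x \<bullet> y) = - 2 * (L x \<bullet> y)\<^sup>2 / (L y \<bullet> y)" unfolding t_def by (simp add: power2_eq_square)
    moreover have "t\<^sup>2 * (L y \<bullet> y) = (L x \<bullet> y)\<^sup>2 / (L y \<bullet> y)" unfolding t_def using pos by (simp add: power2_eq_square)
    ultimately have "0 \<le> L x \<bullet> x - (L x \<bullet> y)\<^sup>2 / (L y \<bullet> y)" using ex[of t] by simp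
    then show ?thesis using pos by (simp add: field_simps)
  qed
qed

text \<open>Minimize the quadratic form on the unit sphere. Subtracting the minimum gives a
  nonnegative \<open>B\<close> with \<open>B \<xi> \<bullet> \<xi> = 0\<close> at the minimizer, and
  Cauchy-Schwarz for the form of \<open>B\<close> forces \<open>B \<xi> = 0\<close>.\<close>

lemma min_eigenvalue:
  fixes L :: "'a::euclidean_space \<Rightarrow> 'a"
  assumes L: "linear L" "\<And>x y. L x \<bullet> y = x \<bullet> L y"
  shows "\<exists>m \<xi>. \<xi> \<noteq> 0 \<and> L \<xi> = m *\<^sub>R \<xi> \<and> (\<forall>x. m * (norm x)\<^sup>2 \<le> L x \<bullet> x)"
proof -
  have cont: "continuous_on (sphere 0 1) (\<lambda>x. L x \<bullet> x)"
    by (intro continuous_intros linear_continuous_on linear_conv_bounded_linear[THEN iffD1] L(1))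
  obtain b :: 'a where "b \<in> Basis" using nonempty_Basis by blast
  then have "sphere (0::'a) 1 \<noteq> {}" by (auto intro!: exI[of _ b])
  then obtain \<xi> where \<xi>: "\<xi> \<in> sphere 0 1" "\<And>x. x \<in> sphere 0 1 \<Longrightarrow> L \<xi> \<bullet> \<xi> \<le> L x \<bullet> x"
    using continuous_attains_inf[OF compact_sphere _ cont] by blast
  define m where "m = L \<xi> \<bullet> \<xi>"
  have lower: "m * (norm x)\<^sup>2 \<le> L x \<bullet> x" for x
  proof (cases "x = 0")
    case False
    have "m \<le> L ((1 / norm x) *\<^sub>R x) \<bullet> ((1 / norm x) *\<^sub>R x)"
      unfolding m_def by (rule \<xi>(2)) (use False in simp)
    also have "\<dots> = (L x \<bullet> x) / (norm x)\<^sup>2" by (simp add: linear_scale[OF L(1)] power2_eq_square)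
    finally show ?thesis using False by (simp add: field_simps)
  qed (simp add: linear_0[OF L(1)])
  define B where "B x = L x - m *\<^sub>R x" for x
  have "linear B" unfolding B_def by (intro linear_compose_sub L(1) linear_compose_scale_right linear_id[unfolded id_def])
  moreover have sym: "B x \<bullet> y = x \<bullet> B y" for x y unfolding B_def by (simp add: inner_simps L(2))
  moreover have "0 \<le> B x \<bullet> x" for x
    using lower[of x] unfolding B_def by (simp add: inner_simps power2_norm_eq_inner)
  ultimately have "(B \<xi> \<bullet> B \<xi>)\<^sup>2 \<le> (B \<xi> \<bullet> \<xi>) * (B (B \<xi>) \<bullet> B \<xi>)" by (rule psd_Cauchy_Schwarz)
  moreover have "B \<xi> \<bullet> \<xi> = 0"
    using \<xi>(1) unfolding B_def m_def by (simp add: inner_simps power2_norm_eq_inner[symmetric])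
  ultimately have "B \<xi> = 0" by simp
  then have "L \<xi> = m *\<^sub>R \<xi>" by (simp add: B_def)
  moreover have "\<xi> \<noteq> 0" using \<xi>(1) by auto
  ultimately show ?thesis using lower by blast
qed

lemma symmetric_matrix_inner:
  fixes A :: "real^'n^'n"
  assumes "transpose A = A" shows "(A *v x) \<bullet> y = x \<bullet> (A *v y)"
  using dot_lmul_matrix[of x A y] transpose_matrix_vector[of A x] assms by simp

text \<open>The extreme values of the quadratic form on the sphere are eigenvalues, the largest one
  by passing to the negative of \<open>A\<close>. Cauchy-Schwarz for the form, at \<open>x\<close>
  and \<open>A *v x\<close>, turns the upper bound into a bound on the operator.\<close>

lemma eigenvalues_in_bounds:
  fixes A :: "real^'n::finite^'n"
  assumes A: "transpose A = A" "eigenvalues_in A lo hi" and lo: "lo > 0"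
  shows "lo * (norm x)\<^sup>2 \<le> (A *v x) \<bullet> x" "norm (A *v x) \<le> hi * norm x"
proof -
  note sym = symmetric_matrix_inner[OF A(1)]
  obtain m \<xi> where m: "\<xi> \<noteq> 0" "A *v \<xi> = m *\<^sub>R \<xi>" "\<And>x. m * (norm x)\<^sup>2 \<le> (A *v x) \<bullet> x"
    using min_eigenvalue[OF matrix_vector_mul_linear sym] by blast
  have "lo \<le> m" using A(2) m(1,2) unfolding eigenvalues_in_def by blast
  then have low: "lo * (norm x)\<^sup>2 \<le> (A *v x) \<bullet> x" for x
    using m(3)[of x] mult_right_mono[of lo m "(norm x)\<^sup>2"] by simp
  show "lo * (norm x)\<^sup>2 \<le> (A *v x) \<bullet> x" by (rule low)
  have lin: "linear (\<lambda>x. - (A *v x))" by (intro linear_compose_neg matrix_vector_mul_linear)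
  obtain m' \<xi>' where m': "\<xi>' \<noteq> 0" "- (A *v \<xi>') = m' *\<^sub>R \<xi>'" "\<And>x. m' * (norm x)\<^sup>2 \<le> - (A *v x) \<bullet> x"
    using min_eigenvalue[OF lin] sym by (auto simp: inner_minus_left inner_minus_right)
  have "A *v \<xi>' = (- m') *\<^sub>R \<xi>'" using m'(2) by (metis minus_minus scaleR_minus_left)
  then have "- m' \<le> hi" using A(2) m'(1) unfolding eigenvalues_in_def by blast
  then have up: "(A *v x) \<bullet> x \<le> hi * (norm x)\<^sup>2" for x
    using m'(3)[of x] mult_right_mono[of "- m'" hi "(norm x)\<^sup>2"] by simp
  have psd: "0 \<le> (A *v x) \<bullet> x" for x using low[of x] lo by (meson less_imp_le mult_nonneg_nonneg order_trans zero_le_power2)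
  have hi0: "hi \<ge> 0"
  proof -
    have "0 \<le> hi * (norm \<xi>)\<^sup>2" using psd[of \<xi>] up[of \<xi>] by linarith
    then show ?thesis using m(1) by (simp add: zero_le_mult_iff)
  qed
  show "norm (A *v x) \<le> hi * norm x"
  proof (cases "A *v x = 0")
    case False
    let ?y = "A *v x"
    have "((A *v x) \<bullet> ?y)\<^sup>2 \<le> ((A *v x) \<bullet> x) * ((A *v ?y) \<bullet> ?y)"
      by (rule psd_Cauchy_Schwarz[OF matrix_vector_mul_linear sym psd])
    also have "\<dots> \<le> (hi * (norm x)\<^sup>2) * (hi * (norm ?y)\<^sup>2)"
      by (intro mult_mono up psd mult_nonneg_nonneg hi0) auto
    also have "\<dots> = (hi * norm x)\<^sup>2 * (norm ?y)\<^sup>2" by (simp add: power2_eq_square mult_ac)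
    also have "((A *v x) \<bullet> ?y)\<^sup>2 = (norm ?y)\<^sup>2 * (norm ?y)\<^sup>2"
      unfolding power2_norm_eq_inner by (simp add: power2_eq_square)
    finally have "(norm ?y)\<^sup>2 * (norm ?y)\<^sup>2 \<le> (hi * norm x)\<^sup>2 * (norm ?y)\<^sup>2" .
    then have "(norm ?y)\<^sup>2 \<le> (hi * norm x)\<^sup>2" by (rule mult_right_le_imp_le) (use False in simp)
    then show ?thesis by (rule power2_le_imp_le) (use hi0 in simp)
  qed (use hi0 in simp)
qed

subsection \<open>Functions on the domain as elements of Hilbert spaces\<close>

lemma sq_int_rep: "sq_int (rep_l2 v)" "cls (rep_l2 v) = v"
  using Quotient3_rep_reflp[OF Quotient3_l2, of v] Quotient3_abs_rep[OF Quotient3_l2, of v] by auto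

lemma rep_cls: "sq_int u \<Longrightarrow> AE x in lebesgue. rep_l2 (cls u) x = u x"
  using cls_eq_iff[OF sq_int_rep(1)[of "cls u"]] sq_int_rep(2) by blast

definition comp_l2 :: "(real \<Rightarrow> real) \<Rightarrow> ('a::euclidean_space, real) l2 \<Rightarrow> ('a, real) l2" where
  "comp_l2 f v = cls (\<lambda>x. f (rep_l2 v x))"

lemma comp_l2_cls:
  assumes "sq_int u" "f \<in> borel_measurable borel" "\<And>s. \<bar>f s\<bar> \<le> C * \<bar>s\<bar>"
  shows "comp_l2 f (cls u) = cls (\<lambda>x. f (u x))"
  unfolding comp_l2_def
  by (subst cls_eq_iff) (auto intro: sq_int_compose[OF _ assms(2,3)] assms sq_int_rep eventually_mono[OF rep_cls[OF assms(1)]])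

lemma norm_cls_mono:
  assumes "sq_int f" "sq_int g" "AE x in lebesgue. norm (f x) \<le> norm (g x)"
  shows "norm (cls f) \<le> norm (cls g)"
proof (rule power2_le_imp_le)
  show "(norm (cls f))\<^sup>2 \<le> (norm (cls g))\<^sup>2"
    unfolding cls_norm[OF assms(1)] cls_norm[OF assms(2)]
    by (rule integral_mono_AE[OF sq_intD[OF assms(1)] sq_intD[OF assms(2)]])
      (use assms(3) in eventually_elim, auto intro: power_mono)
qed simp

context bounded_open
begin

abbreviation cl where "cl u \<equiv> cls (zext \<Omega> u)"

lemma L2_iff: "L2 \<Omega> u \<longleftrightarrow> sq_int (zext \<Omega> u)"
proof -
  have "(\<lambda>x. (norm (zext \<Omega> u x))\<^sup>2) = (\<lambda>x. indicator \<Omega> x *\<^sub>R (u x)\<^sup>2)"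
    by (auto simp: zext_def indicator_def)
  then show ?thesis unfolding L2_def sq_int_def
    using \<Omega>_sets by (simp add: borel_measurable_restrict_space_iff integrable_restrict_space zext_def)
qed

lemma L2vec_iff: "L2vec \<Omega> g \<longleftrightarrow> sq_int (zext \<Omega> g)"
proof
  assume "sq_int (zext \<Omega> g)"
  then have "sq_int (\<lambda>x. zext \<Omega> g x $ i)" for i by (rule sq_int_component)
  moreover have "(\<lambda>x. zext \<Omega> g x $ i) = zext \<Omega> (\<lambda>x. g x $ i)" for i by (auto simp: zext_def)
  ultimately show "L2vec \<Omega> g" unfolding L2vec_def L2_iff by simp
next
  assume "L2vec \<Omega> g"
  then have c: "sq_int (zext \<Omega> (\<lambda>x. g x $ i))" for i unfolding L2vec_def L2_iff by blast
  have e: "zext \<Omega> g = (\<lambda>x. \<chi> i. zext \<Omega> (\<lambda>x. g x $ i) x)" by (auto simp: zext_def vec_eq_iff)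
  show "sq_int (zext \<Omega> g)"
  proof (rule sq_int_bound[of _ "\<lambda>x. \<Sum>i\<in>UNIV. (norm (zext \<Omega> (\<lambda>x. g x $ i) x))\<^sup>2"])
    show "zext \<Omega> g \<in> borel_measurable lebesgue"
      unfolding borel_measurable_euclidean_space[of "zext \<Omega> g"]
    proof
      fix b :: "real^'n" assume "b \<in> Basis"
      then obtain i where b: "b = axis i 1" by (auto simp: Basis_vec_def)
      have "(\<lambda>x. zext \<Omega> g x \<bullet> b) = zext \<Omega> (\<lambda>x. g x $ i)" unfolding b by (auto simp: zext_def inner_axis)
      then show "(\<lambda>x. zext \<Omega> g x \<bullet> b) \<in> borel_measurable lebesgue" using c[of i] by (simp add: sq_int_def)
    qed
    show "integrable lebesgue (\<lambda>x. \<Sum>i\<in>UNIV. (norm (zext \<Omega> (\<lambda>x. g x $ i) x))\<^sup>2)"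
      using sq_intD[OF c] by (intro Bochner_Integration.integrable_sum) auto
    show "AE x in lebesgue. (norm (zext \<Omega> g x))\<^sup>2 \<le> (\<Sum>i\<in>UNIV. (norm (zext \<Omega> (\<lambda>x. g x $ i) x))\<^sup>2)"
    proof (rule AE_I2)
      fix x
      have "(norm (zext \<Omega> g x))\<^sup>2 = (\<Sum>i\<in>UNIV. (norm (zext \<Omega> (\<lambda>x. g x $ i) x))\<^sup>2)"
        unfolding power2_norm_eq_inner inner_vec_def by (simp add: zext_def)
      then show "(norm (zext \<Omega> g x))\<^sup>2 \<le> (\<Sum>i\<in>UNIV. (norm (zext \<Omega> (\<lambda>x. g x $ i) x))\<^sup>2)" by simp
    qed
  qed
qed

lemma LINT_on: 
  fixes f :: "real^'n \<Rightarrow> real"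
  shows "(LINT x|lebesgue_on \<Omega>. f x) = (LINT x|lebesgue. indicator \<Omega> x *\<^sub>R f x)"
  using \<Omega>_sets by (simp add: integral_restrict_space)

lemma LINT_on_mult: "sq_int (zext \<Omega> u) \<Longrightarrow> sq_int (zext \<Omega> v) \<Longrightarrow> (LINT x|lebesgue_on \<Omega>. u x * v x) = cl u \<bullet> cl v"
  unfolding LINT_on by (subst cls_inner) (auto intro!: Bochner_Integration.integral_cong simp: zext_def indicator_def)

lemma LINT_on_inner:
  fixes g h :: "real^'n \<Rightarrow> real^'n"
  shows "sq_int (zext \<Omega> g) \<Longrightarrow> sq_int (zext \<Omega> h) \<Longrightarrow> (LINT x|lebesgue_on \<Omega>. g x \<bullet> h x) = cl g \<bullet> cl h"
  unfolding LINT_on by (subst cls_inner) (auto intro!: Bochner_Integration.integral_cong simp: zext_def indicator_def)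

lemma zext_diff: "zext \<Omega> (\<lambda>x. u x - v x) = (\<lambda>x. zext \<Omega> u x - zext \<Omega> v x)"
  by (auto simp: zext_def scaleR_diff_right)

lemma cl_diff: "sq_int (zext \<Omega> u) \<Longrightarrow> sq_int (zext \<Omega> v) \<Longrightarrow> cl (\<lambda>x. u x - v x) = cl u - cl v"
  unfolding zext_diff by (simp add: cls_diff)

lemma LINT_on_norm_diff:
  fixes g h :: "real^'n \<Rightarrow> 'b::euclidean_space"
  assumes "sq_int (zext \<Omega> g)" "sq_int (zext \<Omega> h)"
  shows "(LINT x|lebesgue_on \<Omega>. (norm (g x - h x))\<^sup>2) = (norm (cl g - cl h))\<^sup>2"
  unfolding LINT_on cls_dist[OF assms]
  by (rule Bochner_Integration.integral_cong) (auto simp: zext_def indicator_def)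

lemma zext_test_fun: assumes "test_fun \<Omega> \<phi>" shows "zext \<Omega> \<phi> = \<phi>" "zext \<Omega> (cgrad \<phi>) = cgrad \<phi>"
  using test_fun_supp[OF assms] by (auto simp: zext_def indicator_def fun_eq_iff)

lemma cl_supp: "sq_int (zext \<Omega> u) \<Longrightarrow> cl u \<in> supp_in \<Omega>"
  by (rule cls_mem_supp_in) (auto simp: zext_def)

lemma zext_cls_supp:
  assumes "sq_int u" "cls u \<in> supp_in \<Omega>" shows "cl u = cls u" "sq_int (zext \<Omega> u)"
proof -
  show s: "sq_int (zext \<Omega> u)" unfolding zext_def by (rule sq_int_indicator_mult[OF assms(1) \<Omega>_sets])
  show "cl u = cls u"
    unfolding cls_eq_iff[OF s assms(1)]
    using supp_in_zext[OF assms(2,1) \<Omega>_sets] by eventually_elim (auto simp: zext_def indicator_def)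
qed

lemma cl_inner_test:
  assumes \<phi>: "test_fun \<Omega> \<phi>"
  shows "sq_int (zext \<Omega> u) \<Longrightarrow> cl u \<bullet> cls (partial i \<phi>) = (LINT x|lebesgue_on \<Omega>. u x * partial i \<phi> x)"
    and "sq_int (zext \<Omega> g) \<Longrightarrow> cl g \<bullet> cls (\<lambda>x. \<phi> x *\<^sub>R axis i 1) = (LINT x|lebesgue_on \<Omega>. g x $ i * \<phi> x)"
proof -
  assume u: "sq_int (zext \<Omega> u)"
  show "cl u \<bullet> cls (partial i \<phi>) = (LINT x|lebesgue_on \<Omega>. u x * partial i \<phi> x)"
    unfolding LINT_on cls_inner[OF u test_fun_sq_int(1)[OF test_fun_partial[OF \<phi>]]]
    by (rule Bochner_Integration.integral_cong) (auto simp: zext_def)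
next
  assume g: "sq_int (zext \<Omega> g)"
  show "cl g \<bullet> cls (\<lambda>x. \<phi> x *\<^sub>R axis i 1) = (LINT x|lebesgue_on \<Omega>. g x $ i * \<phi> x)"
    unfolding LINT_on cls_inner[OF g test_fun_axis_sq_int[OF \<phi>]]
    by (rule Bochner_Integration.integral_cong) (auto simp: zext_def inner_axis)
qed

lemma weak_gradD:
  assumes "weak_grad \<Omega> u g"
  shows "sq_int (zext \<Omega> u)" "sq_int (zext \<Omega> g)"
    "test_fun \<Omega> \<phi> \<Longrightarrow> cl u \<bullet> cls (partial i \<phi>) = - (cl g \<bullet> cls (\<lambda>x. \<phi> x *\<^sub>R axis i 1))"
proof -
  show u: "sq_int (zext \<Omega> u)" and g: "sq_int (zext \<Omega> g)"
    using assms unfolding weak_grad_def L2_iff L2vec_iff by auto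
  assume \<phi>: "test_fun \<Omega> \<phi>"
  have "(LINT x|lebesgue_on \<Omega>. u x * partial i \<phi> x) = - (LINT x|lebesgue_on \<Omega>. g x $ i * \<phi> x)"
    using assms \<phi> unfolding weak_grad_def by blast
  then show "cl u \<bullet> cls (partial i \<phi>) = - (cl g \<bullet> cls (\<lambda>x. \<phi> x *\<^sub>R axis i 1))"
    using cl_inner_test[OF \<phi>] u g by simp
qed

lemma weak_grad_unique:
  assumes "weak_grad \<Omega> u g" "weak_grad \<Omega> u g'" shows "cl g = cl g'"
proof -
  have "cl g - cl g' = 0"
  proof (rule vec_supp_in_zero)
    show "cl g - cl g' \<in> supp_in \<Omega>"
      by (intro subspace_diff supp_in_closed cl_supp weak_gradD(2)[OF assms(1)] weak_gradD(2)[OF assms(2)])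
    fix \<phi> i assume "test_fun \<Omega> \<phi>"
    then show "(cl g - cl g') \<bullet> cls (\<lambda>x. \<phi> x *\<^sub>R axis i 1) = 0"
      using weak_gradD(3)[OF assms(1), of \<phi> i] weak_gradD(3)[OF assms(2), of \<phi> i] by (simp add: inner_diff_left)
  qed
  then show ?thesis by simp
qed

text \<open>\<open>H1grad\<close> chooses some weak gradient, possibly another function than the
  \<open>g\<close> in the definition of \<open>H10\<close>; by the fundamental lemma both have the
  same class.\<close>

lemma H10D:
  assumes "u \<in> H10 \<Omega>"
  shows "sq_int (zext \<Omega> u)" "sq_int (zext \<Omega> (H1grad \<Omega> u))" "(cl u, cl (H1grad \<Omega> u)) \<in> Gr"
proof -
  obtain g \<phi> where g: "weak_grad \<Omega> u g" and \<phi>: "\<And>k. test_fun \<Omega> (\<phi> k)"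
    and lim: "(\<lambda>k. (LINT x|lebesgue_on \<Omega>. (\<phi> k x - u x)\<^sup>2)
            + (LINT x|lebesgue_on \<Omega>. (norm (cgrad (\<phi> k) x - g x))\<^sup>2)) \<longlonglongrightarrow> 0"
    using assms unfolding H10_def by blast
  have g': "weak_grad \<Omega> u (H1grad \<Omega> u)" unfolding H1grad_def using g by (rule someI[of "weak_grad \<Omega> u"])
  show "sq_int (zext \<Omega> u)" "sq_int (zext \<Omega> (H1grad \<Omega> u))" using weak_gradD[OF g'] by auto
  note gD = weak_gradD(1,2)[OF g]
  have s: "sq_int (zext \<Omega> (\<phi> k))" "sq_int (zext \<Omega> (cgrad (\<phi> k)))" for k
    using test_fun_sq_int[OF \<phi>] by (simp_all add: zext_test_fun[OF \<phi>])
  have 1: "(LINT x|lebesgue_on \<Omega>. (\<phi> k x - u x)\<^sup>2) = (norm (cls (\<phi> k) - cl u))\<^sup>2" for k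
    using LINT_on_norm_diff[OF s(1) gD(1), of k] by (simp add: zext_test_fun[OF \<phi>])
  have 2: "(LINT x|lebesgue_on \<Omega>. (norm (cgrad (\<phi> k) x - g x))\<^sup>2) = (norm (cls (cgrad (\<phi> k)) - cl g))\<^sup>2" for k
    using LINT_on_norm_diff[OF s(2) gD(2), of k] by (simp add: zext_test_fun[OF \<phi>])
  have "(cl u, cl g) \<in> Gr" 
  proof (rule GrI)
    show "(cls (\<phi> k), cls (cgrad (\<phi> k))) \<in> Gr" for k by (rule G0_Gr[OF \<phi>])
    show "(\<lambda>k. cls (\<phi> k)) \<longlonglongrightarrow> cl u" by (rule tendsto_if_sq_norm_le[OF _ lim[unfolded 1 2]]) simp
    show "(\<lambda>k. cls (cgrad (\<phi> k))) \<longlonglongrightarrow> cl g" by (rule tendsto_if_sq_norm_le[OF _ lim[unfolded 1 2]]) simp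
  qed
  then show "(cl u, cl (H1grad \<Omega> u)) \<in> Gr" using weak_grad_unique[OF g g'] by simp
qed

text \<open>A representative of \<open>h\<close> serves as weak gradient, because integration by
  parts survives the closure; the approximating test functions come with membership in
  \<open>Gr\<close>.\<close>

lemma H10I:
  assumes u: "sq_int (zext \<Omega> u)" and G: "(cl u, h) \<in> Gr" shows "u \<in> H10 \<Omega>"
proof -
  obtain g where g: "sq_int g" "h = cls g" using cls_surj by blast
  have hg: "cl g = h" "sq_int (zext \<Omega> g)" using zext_cls_supp[OF g(1)] Gr_supp(2)[OF G] g(2) by auto
  have wg: "weak_grad \<Omega> u g"
    unfolding weak_grad_def L2_iff L2vec_iff
  proof (intro conjI u hg allI impI)
    fix \<phi> i assume \<phi>: "test_fun \<Omega> \<phi>"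
    show "(LINT x|lebesgue_on \<Omega>. u x * partial i \<phi> x) = - (LINT x|lebesgue_on \<Omega>. g x $ i * \<phi> x)"
      using Gr_weak[OF G \<phi>, of i] hg cl_inner_test(1)[OF \<phi> u] cl_inner_test(2)[OF \<phi> hg(2)] by simp
  qed
  obtain \<phi> where \<phi>: "\<And>n. test_fun \<Omega> (\<phi> n)" "(\<lambda>n. cls (\<phi> n)) \<longlonglongrightarrow> cl u" "(\<lambda>n. cls (cgrad (\<phi> n))) \<longlonglongrightarrow> h"
    using Gr_seq[OF G] by blast
  have s: "sq_int (zext \<Omega> (\<phi> k))" "sq_int (zext \<Omega> (cgrad (\<phi> k)))" for k
    using test_fun_sq_int[OF \<phi>(1)] by (simp_all add: zext_test_fun[OF \<phi>(1)])
  have 1: "(LINT x|lebesgue_on \<Omega>. (\<phi> k x - u x)\<^sup>2) = (norm (cls (\<phi> k) - cl u))\<^sup>2" for k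
    using LINT_on_norm_diff[OF s(1) u, of k] by (simp add: zext_test_fun[OF \<phi>(1)])
  have 2: "(LINT x|lebesgue_on \<Omega>. (norm (cgrad (\<phi> k) x - g x))\<^sup>2) = (norm (cls (cgrad (\<phi> k)) - h))\<^sup>2" for k
    using LINT_on_norm_diff[OF s(2) hg(2), of k] hg(1) by (simp add: zext_test_fun[OF \<phi>(1)])
  have "(\<lambda>k. (norm (cls (\<phi> k) - cl u))\<^sup>2 + (norm (cls (cgrad (\<phi> k)) - h))\<^sup>2) \<longlonglongrightarrow> 0\<^sup>2 + 0\<^sup>2"
    by (intro tendsto_add tendsto_power tendsto_norm_zero LIM_zero \<phi>)
  then have "(\<lambda>k. (LINT x|lebesgue_on \<Omega>. (\<phi> k x - u x)\<^sup>2)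
            + (LINT x|lebesgue_on \<Omega>. (norm (cgrad (\<phi> k) x - g x))\<^sup>2)) \<longlonglongrightarrow> 0"
    unfolding 1 2 by simp
  then show ?thesis unfolding H10_def using wg \<phi>(1) by blast
qed

lemma H1_inner_cl:
  assumes "u \<in> H10 \<Omega>" "v \<in> H10 \<Omega>"
  shows "H1_inner \<Omega> u v = cl u \<bullet> cl v + cl (H1grad \<Omega> u) \<bullet> cl (H1grad \<Omega> v)"
  unfolding H1_inner_def
  by (simp add: LINT_on_mult LINT_on_inner H10D[OF assms(1)] H10D[OF assms(2)])

end


subsection \<open>The degenerate elliptic problem\<close>

locale degenerate_problem = bounded_open \<Omega> R
  for \<Omega> :: "(real^'n::finite) set" and R :: real +
  fixes \<zeta> \<beta> :: "real \<Rightarrow> real" and \<Lambda> :: "real^'n \<Rightarrow> real^'n^'n" and f :: "real^'n \<Rightarrow> real"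
    and M0 M1 K0 K1 lam_lo lam_hi :: real
  assumes \<zeta>: "continuous_on UNIV \<zeta>" "mono \<zeta>" "\<zeta> 0 = 0" "M0 > 0" "M1 > 0"
        "\<forall>s. \<bar>\<zeta> s\<bar> \<ge> M0 * \<bar>s\<bar> - M1"
    and \<beta>: "continuous_on UNIV \<beta>" "mono \<beta>" "\<beta> 0 = 0" "K0 > 0" "K1 > 0"
        "\<forall>s. \<bar>\<beta> s\<bar> \<le> K0 * \<bar>s\<bar> + K1"
    and \<beta>\<zeta>: "strict_mono (\<lambda>s. \<beta> s + \<zeta> s)"
    and \<Lambda>: "\<Lambda> \<in> borel_measurable (lebesgue_on \<Omega>)" "lam_hi \<ge> lam_lo" "lam_lo > 0"
        "AE x in lebesgue_on \<Omega>. transpose (\<Lambda> x) = \<Lambda> x \<and> eigenvalues_in (\<Lambda> x) lam_lo lam_hi"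
    and f: "L2 \<Omega> f"
begin

abbreviation "\<mu> \<equiv> mu_of \<beta> \<zeta>"
abbreviation "\<rho> \<equiv> rho_of \<beta> \<zeta>"
abbreviation "\<nu> \<equiv> nu_of \<beta> \<zeta>"

definition Bz :: "real \<Rightarrow> real" where "Bz s = \<beta> s + \<zeta> s"

lemma inj_Bz: "inj Bz"
  using strict_mono_imp_inj_on[OF \<beta>\<zeta>] unfolding Bz_def[abs_def] .

lemma Bz_0: "Bz 0 = 0" by (simp add: Bz_def \<zeta>(3) \<beta>(3))

lemma surj_Bz: "\<exists>s. Bz s = t"
proof -
  have cont: "continuous_on {a..b} Bz" for a b
    unfolding Bz_def[abs_def]
    by (intro continuous_on_add continuous_on_subset[OF \<zeta>(1)] continuous_on_subset[OF \<beta>(1)]) auto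
  \<comment> \<open>Chosen so that \<open>M0 * a - M1 = \<bar>t\<bar>\<close>. The growth of \<zeta>
    then puts \<open>\<zeta> (- a)\<close> and \<open>\<zeta> a\<close> on either side of
    \<open>t\<close>, and \<beta> only adds values of the same sign.\<close>
  define a where "a = (\<bar>t\<bar> + M1) / M0"
  have a: "a \<ge> 0" "M0 * a = \<bar>t\<bar> + M1" using \<zeta>(4,5) unfolding a_def by auto
  have "0 \<le> \<zeta> a" "0 \<le> \<beta> a" "\<zeta> (- a) \<le> 0" "\<beta> (- a) \<le> 0"
    using monoD[OF \<zeta>(2), of 0 a] monoD[OF \<beta>(2), of 0 a] monoD[OF \<zeta>(2), of "- a" 0] monoD[OF \<beta>(2), of "- a" 0]
      \<zeta>(3) \<beta>(3) a(1) by auto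
  moreover have "\<bar>\<zeta> a\<bar> \<ge> \<bar>t\<bar>" "\<bar>\<zeta> (- a)\<bar> \<ge> \<bar>t\<bar>"
    using \<zeta>(6)[rule_format, of a] \<zeta>(6)[rule_format, of "- a"] a by auto
  ultimately have "Bz (- a) \<le> t" "t \<le> Bz a" unfolding Bz_def by auto
  then show ?thesis using IVT'[of Bz "- a" t a] cont[of "- a" a] a(1) by auto
qed

lemma Bz_inv: "Bz (inv Bz t) = t"
  using surj_Bz[of t] by (metis f_inv_into_f rangeI)

lemma mu_eq: "\<mu> t = \<zeta> (inv Bz t)"
  by (simp add: mu_of_def Bz_def[abs_def])

lemma mu_0: "\<mu> 0 = 0"
  using inv_f_f[OF inj_Bz, of 0] by (simp add: mu_eq Bz_0 \<zeta>(3))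

lemma inv_Bz_mono: assumes "x \<le> y" shows "inv Bz x \<le> inv Bz y"
proof (rule ccontr)
  assume "\<not> inv Bz x \<le> inv Bz y"
  then have "Bz (inv Bz y) < Bz (inv Bz x)" using strict_monoD[OF \<beta>\<zeta>] by (simp add: Bz_def)
  then show False using assms by (simp add: Bz_inv)
qed

text \<open>Along \<open>inv Bz\<close> both \<zeta> and \<beta> increase, and their increments add
  up to \<open>y - x\<close>, so neither exceeds it.\<close>

lemma mono_lipschitz_mu: "mono_lipschitz \<mu>"
proof
  fix x y :: real assume xy: "x \<le> y"
  note le = inv_Bz_mono[OF xy]
  show "\<mu> x \<le> \<mu> y" unfolding mu_eq using monoD[OF \<zeta>(2) le] .
  have "x = \<beta> (inv Bz x) + \<zeta> (inv Bz x)" "y = \<beta> (inv Bz y) + \<zeta> (inv Bz y)"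
    using Bz_inv[of x] Bz_inv[of y] by (simp_all add: Bz_def)
  then show "\<mu> y - \<mu> x \<le> y - x" unfolding mu_eq using monoD[OF \<beta>(2) le] by linarith
qed

sublocale mu: mono_lipschitz \<mu> by (rule mono_lipschitz_mu)

lemma nu_eq: "\<nu> = mu.N"
  by (simp add: fun_eq_iff nu_of_def mu.N_def I0_def)

lemma mu_abs: "\<bar>\<mu> s\<bar> \<le> 1 * \<bar>s\<bar>" using mu.abs_lip[of s 0] mu_0 by simp

lemma nu_abs: "\<bar>\<nu> s\<bar> \<le> 1 * \<bar>s\<bar>" unfolding nu_eq using mu.N_lip[of s 0] mu.N_0 by simp

lemma mu_borel: "\<mu> \<in> borel_measurable borel"
  by (rule borel_measurable_continuous_onI[OF mu.cont])

lemma nu_borel: "\<nu> \<in> borel_measurable borel" unfolding nu_eq by (rule mu.N_borel)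

lemma nu_0: "\<nu> 0 = 0" unfolding nu_eq by (rule mu.N_0)

definition c1 :: real where "c1 = K0 / M0 + 1"
definition c2 :: real where "c2 = K0 * M1 / M0 + K1"

lemma c_pos: "c1 > 0" "c2 > 0"
  unfolding c1_def c2_def using \<zeta>(4,5) \<beta>(4,5) by (auto intro!: add_pos_pos divide_pos_pos add_nonneg_pos)

text \<open>Here \<open>t = \<beta> s + \<zeta> s\<close> and \<open>\<mu> t = \<zeta> s\<close>.
  The lower growth of \<zeta> bounds \<open>s\<close>, then the upper growth of \<beta> bounds
  \<open>t\<close>; substituting one into the other produces \<open>c1\<close> and
  \<open>c2\<close>.\<close>

lemma mu_coercive: "\<bar>t\<bar> \<le> c1 * \<bar>\<mu> t\<bar> + c2"
proof -
  define s where "s = inv Bz t"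
  have t: "t = \<beta> s + \<zeta> s" using Bz_inv[of t] by (simp add: Bz_def s_def)
  have "\<bar>s\<bar> \<le> (\<bar>\<zeta> s\<bar> + M1) / M0" using \<zeta>(6)[rule_format, of s] \<zeta>(4) by (simp add: field_simps)
  then have "K0 * \<bar>s\<bar> \<le> K0 * ((\<bar>\<zeta> s\<bar> + M1) / M0)" using \<beta>(4) by (intro mult_left_mono) auto
  then have "\<bar>\<beta> s\<bar> \<le> K0 * ((\<bar>\<zeta> s\<bar> + M1) / M0) + K1" using \<beta>(6)[rule_format, of s] by linarith
  then have "\<bar>t\<bar> \<le> K0 * ((\<bar>\<zeta> s\<bar> + M1) / M0) + K1 + \<bar>\<zeta> s\<bar>" using t by linarith
  also have "\<dots> = c1 * \<bar>\<mu> t\<bar> + c2" unfolding c1_def c2_def mu_eq s_def[symmetric]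
    by (simp add: algebra_simps add_divide_distrib)
  finally show ?thesis .
qed

section \<open>Composition and diffusion as operators on classes\<close>

abbreviation "MM \<equiv> comp_l2 \<mu> :: (real^'n, real) l2 \<Rightarrow> _"
abbreviation "NN \<equiv> comp_l2 \<nu> :: (real^'n, real) l2 \<Rightarrow> _"

lemma MM_cls: "sq_int u \<Longrightarrow> MM (cls u) = cls (\<lambda>x. \<mu> (u x))" "sq_int u \<Longrightarrow> sq_int (\<lambda>x. \<mu> (u x))"
  for u :: "real^'n \<Rightarrow> real"
  by (rule comp_l2_cls[OF _ mu_borel mu_abs], assumption) (rule sq_int_compose[OF _ mu_borel mu_abs])

lemma NN_cls: "sq_int u \<Longrightarrow> NN (cls u) = cls (\<lambda>x. \<nu> (u x))" "sq_int u \<Longrightarrow> sq_int (\<lambda>x. \<nu> (u x))"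
  for u :: "real^'n \<Rightarrow> real"
  by (rule comp_l2_cls[OF _ nu_borel nu_abs], assumption) (rule sq_int_compose[OF _ nu_borel nu_abs])

lemma zext_comp: "g 0 = (0::real) \<Longrightarrow> zext \<Omega> (\<lambda>x. g (u x)) = (\<lambda>x. g (zext \<Omega> u x))"
  by (auto simp: zext_def indicator_def)

lemma MM_cl: assumes "sq_int (zext \<Omega> u)"
  shows "MM (cl u) = cl (\<lambda>x. \<mu> (u x))" "sq_int (zext \<Omega> (\<lambda>x. \<mu> (u x)))"
  unfolding zext_comp[of \<mu>, OF mu_0] using MM_cls[OF assms] by auto

lemma NN_cl: assumes "sq_int (zext \<Omega> u)"
  shows "NN (cl u) = cl (\<lambda>x. \<nu> (u x))" "sq_int (zext \<Omega> (\<lambda>x. \<nu> (u x)))"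
  unfolding zext_comp[of \<nu>, OF nu_0] using NN_cls[OF assms] by auto

text \<open>Outside \<open>\<Omega>\<close> the matrix is replaced by a multiple of the identity, to keep the operator elliptic on the whole space.\<close>

definition diffusion :: "real^'n \<Rightarrow> real^'n \<Rightarrow> real^'n" where
  "diffusion x \<xi> = (if x \<in> \<Omega> then \<Lambda> x *v \<xi> else lam_lo *\<^sub>R \<xi>)"

lemma diffusion_AE:
  "AE x in lebesgue. (\<forall>\<xi> \<eta>. diffusion x \<xi> \<bullet> \<eta> = \<xi> \<bullet> diffusion x \<eta>) \<and>
     (\<forall>\<xi>. lam_lo * (norm \<xi>)\<^sup>2 \<le> diffusion x \<xi> \<bullet> \<xi>) \<and> (\<forall>\<xi>. norm (diffusion x \<xi>) \<le> lam_hi * norm \<xi>)"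
proof -
  have "AE x in lebesgue. x \<in> \<Omega> \<longrightarrow> transpose (\<Lambda> x) = \<Lambda> x \<and> eigenvalues_in (\<Lambda> x) lam_lo lam_hi"
  proof -
    have sp: "\<Omega> \<inter> space lebesgue \<in> sets lebesgue" using \<Omega>_sets by simp
    show ?thesis by (rule iffD1[OF AE_restrict_space_iff[OF sp] \<Lambda>(4)])
  qed
  then show ?thesis
  proof eventually_elim
    case (elim x)
    show ?case
    proof (cases "x \<in> \<Omega>")
      case True
      then have A: "transpose (\<Lambda> x) = \<Lambda> x" "eigenvalues_in (\<Lambda> x) lam_lo lam_hi" using elim by auto
      show ?thesis using True symmetric_matrix_inner[OF A(1)] eigenvalues_in_bounds[OF A \<Lambda>(3)]
        by (simp add: diffusion_def)
    next
      case False
      then show ?thesis using \<Lambda>(2,3) by (auto simp: diffusion_def power2_norm_eq_inner mult_right_mono)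
    qed
  qed
qed

lemma diffusion_linear: "linear (diffusion x)"
  unfolding diffusion_def[abs_def]
  by (cases "x \<in> \<Omega>") (auto intro: matrix_vector_mul_linear linear_compose_scale_right linear_id[unfolded id_def])

lemma diffusion_measurable:
  assumes "g \<in> borel_measurable lebesgue" shows "(\<lambda>x. diffusion x (g x)) \<in> borel_measurable lebesgue"
proof -
  have L: "(\<lambda>x. indicator \<Omega> x *\<^sub>R \<Lambda> x) \<in> borel_measurable lebesgue"
    using \<Lambda>(1) \<Omega>_sets by (simp add: borel_measurable_restrict_space_iff)
  have "(\<lambda>x. (indicator \<Omega> x *\<^sub>R \<Lambda> x) *v g x) \<in> borel_measurable lebesgue"
    by (rule borel_measurable_continuous_Pair[OF L assms])
      (simp add: matrix_vector_mult_def, intro continuous_on_vec_lambda continuous_intros)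
  then have "(\<lambda>x. if x \<in> \<Omega> then (indicator \<Omega> x *\<^sub>R \<Lambda> x) *v g x else lam_lo *\<^sub>R g x) \<in> borel_measurable lebesgue"
    using \<Omega>_sets assms by (intro measurable_If_set) auto
  moreover have "(\<lambda>x. diffusion x (g x)) = (\<lambda>x. if x \<in> \<Omega> then (indicator \<Omega> x *\<^sub>R \<Lambda> x) *v g x else lam_lo *\<^sub>R g x)"
    by (auto simp: diffusion_def)
  ultimately show ?thesis by simp
qed

lemma diffusion_sq_int:
  assumes "sq_int g" shows "sq_int (\<lambda>x. diffusion x (g x))"
proof (rule sq_int_bound[of _ "\<lambda>x. lam_hi\<^sup>2 * (norm (g x))\<^sup>2"])
  show "AE x in lebesgue. (norm (diffusion x (g x)))\<^sup>2 \<le> lam_hi\<^sup>2 * (norm (g x))\<^sup>2"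
    using diffusion_AE
  proof eventually_elim
    case (elim x)
    then have "norm (diffusion x (g x)) \<le> lam_hi * norm (g x)" by blast
    from power_mono[OF this norm_ge_zero, of 2] show ?case by (simp add: power_mult_distrib)
  qed
qed (use assms in \<open>auto simp: sq_int_def diffusion_measurable\<close>)

definition TT :: "(real^'n, real^'n) l2 \<Rightarrow> (real^'n, real^'n) l2" where
  "TT v = cls (\<lambda>x. diffusion x (rep_l2 v x))"

lemma TT_cls: assumes "sq_int g" shows "TT (cls g) = cls (\<lambda>x. diffusion x (g x))"
  unfolding TT_def
  by (subst cls_eq_iff) (auto intro!: diffusion_sq_int sq_int_rep assms intro: eventually_mono[OF rep_cls[OF assms]])

lemma TT_props: "bounded_linear TT" "TT v \<bullet> w = v \<bullet> TT w" "lam_lo * (norm v)\<^sup>2 \<le> TT v \<bullet> v"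
proof -
  show "TT v \<bullet> w = v \<bullet> TT w" for v w
  proof -
    obtain a b where ab: "sq_int a" "v = cls a" "sq_int b" "w = cls b" using cls_surj by metis
    show ?thesis unfolding ab(2,4) TT_cls[OF ab(1)] TT_cls[OF ab(3)]
      unfolding cls_inner[OF diffusion_sq_int[OF ab(1)] ab(3)] cls_inner[OF ab(1) diffusion_sq_int[OF ab(3)]]
    proof (rule integral_cong_AE)
      show "AE x in lebesgue. diffusion x (a x) \<bullet> b x = a x \<bullet> diffusion x (b x)"
        using diffusion_AE by eventually_elim blast
    qed (use ab diffusion_sq_int in \<open>auto intro!: borel_measurable_inner sq_int_measurable\<close>)
  qed
  show "lam_lo * (norm v)\<^sup>2 \<le> TT v \<bullet> v" for v
  proof -
    obtain a where a: "sq_int a" "v = cls a" using cls_surj by blast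
    have "(LINT x|lebesgue. lam_lo * (norm (a x))\<^sup>2) \<le> (LINT x|lebesgue. diffusion x (a x) \<bullet> a x)"
    proof (rule integral_mono_AE)
      show "AE x in lebesgue. lam_lo * (norm (a x))\<^sup>2 \<le> diffusion x (a x) \<bullet> a x"
        using diffusion_AE by eventually_elim blast
    qed (use sq_intD[OF a(1)] integrable_inner[OF diffusion_sq_int[OF a(1)] a(1)] in auto)
    then show ?thesis unfolding a(2) TT_cls[OF a(1)]
      by (simp add: cls_inner[OF diffusion_sq_int[OF a(1)] a(1)] cls_norm[OF a(1)])
  qed
  show "bounded_linear TT"
  proof (rule bounded_linear_intro[of _ lam_hi])
    fix v w :: "(real^'n, real^'n) l2" and c :: real
    obtain a b where ab: "sq_int a" "v = cls a" "sq_int b" "w = cls b" using cls_surj by metis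
    show "TT (v + w) = TT v + TT w"
      unfolding ab(2,4) by (simp add: cls_add ab TT_cls sq_int_add diffusion_sq_int linear_add[OF diffusion_linear])
    show "TT (c *\<^sub>R v) = c *\<^sub>R TT v"
      unfolding ab(2) by (simp add: cls_scaleR ab TT_cls sq_int_scaleR diffusion_sq_int linear_scale[OF diffusion_linear])
    have hi: "lam_hi > 0" using \<Lambda>(2,3) by linarith
    have "norm (TT v) \<le> norm (lam_hi *\<^sub>R v)"
      unfolding ab(2) TT_cls[OF ab(1)] cls_scaleR[OF ab(1)]
    proof (rule norm_cls_mono[OF diffusion_sq_int[OF ab(1)] sq_int_scaleR[OF ab(1)]])
      show "AE x in lebesgue. norm (diffusion x (a x)) \<le> norm (lam_hi *\<^sub>R a x)"
        using diffusion_AE by eventually_elim (use hi in simp)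
    qed
    then show "norm (TT v) \<le> norm v * lam_hi" using hi by (simp add: mult.commute)
  qed
qed

text \<open>The constant \<open>c2\<close> is square integrable only over the bounded set \<Omega>,
  hence the restriction to classes supported there. The added 1 keeps the constant positive even for
  an empty domain.\<close>

lemma coercive_l2:
  assumes "w \<in> supp_in \<Omega>"
  shows "norm w \<le> c1 * norm (MM w) + (c2 * norm (cls (indicator \<Omega> :: real^'n \<Rightarrow> real)) + 1)"
proof -
  obtain u where u: "sq_int u" "w = cls u" using cls_surj by blast
  have "bounded \<Omega>" using sub bounded_cball bounded_subset by blast
  then have Om: "\<Omega> \<in> lmeasurable" using op by (simp add: lmeasurable_open)
  have i: "sq_int (indicator \<Omega> :: real^'n \<Rightarrow> real)" by (rule sq_int_indicator[OF Om])
  have m: "sq_int (\<lambda>x. \<bar>\<mu> (u x)\<bar>)" using MM_cls(2)[OF u(1)] by (auto simp: sq_int_def)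
  let ?g = "\<lambda>x. c1 *\<^sub>R \<bar>\<mu> (u x)\<bar> + c2 *\<^sub>R indicator \<Omega> x"
  have "norm (cls u) \<le> norm (cls ?g)"
  proof (rule norm_cls_mono[OF u(1)])
    show "sq_int ?g" by (intro sq_int_add sq_int_scaleR m i)
    have "AE x in lebesgue. x \<notin> \<Omega> \<longrightarrow> u x = 0"
      by (rule supp_in_zext[OF _ u(1) \<Omega>_sets]) (use assms u in simp)
    then show "AE x in lebesgue. norm (u x) \<le> norm (?g x)"
    proof eventually_elim
      case (elim x)
      show ?case
      proof (cases "x \<in> \<Omega>")
        case True
        then have "norm (u x) \<le> ?g x" using mu_coercive[of "u x"] by simp
        then show ?thesis by simp
      qed (use elim in simp)
    qed
  qed
  also have "cls ?g = c1 *\<^sub>R cls (\<lambda>x. \<bar>\<mu> (u x)\<bar>) + c2 *\<^sub>R cls (indicator \<Omega>)"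
    by (simp only: cls_scaleR[OF m] cls_scaleR[OF i] cls_add[OF sq_int_scaleR[OF m] sq_int_scaleR[OF i]])
  also have "norm \<dots> \<le> c1 * norm (cls (\<lambda>x. \<bar>\<mu> (u x)\<bar>)) + c2 * norm (cls (indicator \<Omega> :: real^'n \<Rightarrow> real))"
    by (rule order_trans[OF norm_triangle_ineq]) (use c_pos in simp)
  also have "norm (cls (\<lambda>x. \<bar>\<mu> (u x)\<bar>)) \<le> norm (MM w)"
    unfolding u(2) MM_cls(1)[OF u(1)] by (rule norm_cls_mono[OF m MM_cls(2)[OF u(1)]]) simp
  finally show ?thesis using c_pos u(2) by simp
qed

text \<open>Off \<open>mu.nd\<close> the quotients tend to the derivative of \<mu>, their roots to
  its root. The two energies agree because the derivative is the square of its root and the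
  diffusion is linear at each point; both norm bounds reflect that the derivative lies between 0 and
  1.\<close>

lemma chain_l2:
  assumes wg: "(w, h) \<in> Gr"
  shows "\<exists>gM gN. (MM w, gM) \<in> Gr \<and> (NN w, gN) \<in> Gr \<and>
          TT gM \<bullet> h = TT gN \<bullet> gN \<and> norm gM \<le> norm gN \<and> norm gN \<le> norm h"
proof -
  obtain u g where ug: "sq_int u" "w = cls u" "sq_int g" "h = cls g" using cls_surj by metis
  have mem: "(cls u, cls g) \<in> Gr" using wg ug by simp
  let ?d = "deriv \<mu>"
  have q: "\<bar>mu.quot n s\<bar> \<le> 1" "\<bar>sqrt (mu.quot n s)\<bar> \<le> 1" for n s using mu.quot_bounds[of n s] by auto
  have qM: "(\<lambda>n. I0 (mu.quot n) s) \<longlonglongrightarrow> \<mu> s" for s using mu.I0_quot_tendsto[of s] mu_0 by simp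
  have M: "(cls (\<lambda>x. \<mu> (u x)), cls (\<lambda>x. ?d (u x) *\<^sub>R g x)) \<in> Gr" "sq_int (\<lambda>x. ?d (u x) *\<^sub>R g x)"
    by (rule chain_rule_AE[where gn="mu.quot", OF mu.quot_cont q(1) _ mu.nd_null qM mu_borel mu.deriv_borel ug(1,3) mem],
        rule mu.quot_tendsto, assumption)+
  have sc: "continuous_on UNIV (\<lambda>s. sqrt (mu.quot n s))" for n by (intro continuous_intros mu.quot_cont)
  have sl: "(\<lambda>n. sqrt (mu.quot n s)) \<longlonglongrightarrow> sqrt (?d s)" if "s \<notin> mu.nd" for s
    by (intro tendsto_real_sqrt mu.quot_tendsto that)
  have qN: "(\<lambda>n. I0 (\<lambda>s. sqrt (mu.quot n s)) s) \<longlonglongrightarrow> \<nu> s" for s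
    unfolding nu_eq by (rule mu.I0_sqrt_quot_tendsto)
  have N: "(cls (\<lambda>x. \<nu> (u x)), cls (\<lambda>x. sqrt (?d (u x)) *\<^sub>R g x)) \<in> Gr" "sq_int (\<lambda>x. sqrt (?d (u x)) *\<^sub>R g x)"
    by (rule chain_rule_AE[where gn="\<lambda>n s. sqrt (mu.quot n s)" and g="\<lambda>s. sqrt (?d s)",
          OF sc q(2) _ mu.nd_null qN nu_borel mu.sqrt_deriv(1) ug(1,3) mem], rule sl, assumption)+
  \<comment> \<open>At values in \<open>mu.nd\<close> the number \<open>?d (u x)\<close> is
    unspecified and may even be negative; there the gradient is 0 almost everywhere.\<close>
  have AE01: "AE x in lebesgue. g x = 0 \<or> (0 \<le> ?d (u x) \<and> ?d (u x) \<le> 1)"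
    using grad_zero_on_null[OF mu.nd_null ug(1,3) mem]
    by eventually_elim (use mu.deriv_bounds in blast)
  have "TT (cls (\<lambda>x. ?d (u x) *\<^sub>R g x)) \<bullet> h = TT (cls (\<lambda>x. sqrt (?d (u x)) *\<^sub>R g x)) \<bullet> cls (\<lambda>x. sqrt (?d (u x)) *\<^sub>R g x)"
    unfolding ug(4) TT_cls[OF M(2)] TT_cls[OF N(2)] cls_inner[OF diffusion_sq_int[OF M(2)] ug(3)]
      cls_inner[OF diffusion_sq_int[OF N(2)] N(2)]
  proof (rule integral_cong_AE)
    show "AE x in lebesgue. diffusion x (?d (u x) *\<^sub>R g x) \<bullet> g x =
        diffusion x (sqrt (?d (u x)) *\<^sub>R g x) \<bullet> (sqrt (?d (u x)) *\<^sub>R g x)"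
      using AE01
    proof eventually_elim
      case (elim x)
      then show ?case
        by (cases "g x = 0") (auto simp: linear_scale[OF diffusion_linear] linear_0[OF diffusion_linear] mult.assoc[symmetric])
    qed
  qed (rule borel_measurable_inner[OF sq_int_measurable[OF diffusion_sq_int[OF M(2)]] sq_int_measurable[OF ug(3)]]
        borel_measurable_inner[OF sq_int_measurable[OF diffusion_sq_int[OF N(2)]] sq_int_measurable[OF N(2)]])+
  moreover have "norm (cls (\<lambda>x. ?d (u x) *\<^sub>R g x)) \<le> norm (cls (\<lambda>x. sqrt (?d (u x)) *\<^sub>R g x))"
  proof (rule norm_cls_mono[OF M(2) N(2)])
    show "AE x in lebesgue. norm (?d (u x) *\<^sub>R g x) \<le> norm (sqrt (?d (u x)) *\<^sub>R g x)"
      using AE01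
    proof eventually_elim
      case (elim x)
      have "?d (u x) \<le> sqrt (?d (u x))" if d: "0 \<le> ?d (u x)" "?d (u x) \<le> 1"
        by (rule real_le_rsqrt) (use d in \<open>simp add: power2_eq_square mult_left_le\<close>)
      then show ?case using elim by (cases "g x = 0") (auto intro!: mult_right_mono)
    qed
  qed
  moreover have "norm (cls (\<lambda>x. sqrt (?d (u x)) *\<^sub>R g x)) \<le> norm h"
    unfolding ug(4)
  proof (rule norm_cls_mono[OF N(2) ug(3)])
    show "AE x in lebesgue. norm (sqrt (?d (u x)) *\<^sub>R g x) \<le> norm (g x)"
      using AE01
    proof eventually_elim
      case (elim x)
      then show ?case by (cases "g x = 0") (auto intro!: mult_left_le_one_le)
    qed
  qed
  ultimately show ?thesis
    using M(1) N(1) unfolding ug(2) MM_cls(1)[OF ug(1)] NN_cls(1)[OF ug(1)] by blast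
qed

lemma pointwise_l2:
  fixes a b :: "(real^'n, real) l2"
  shows "(MM a - MM b) \<bullet> (MM a - MM b) \<le> (a - b) \<bullet> (MM a - MM b)"
    "(NN a - NN b) \<bullet> (NN a - NN b) \<le> (a - b) \<bullet> (MM a - MM b)"
    "norm (MM a) \<le> norm (NN a)"
proof -
  obtain u v where uv: "sq_int u" "a = cls u" "sq_int v" "b = cls v" using cls_surj by metis
  note s = MM_cls(2)[OF uv(1)] MM_cls(2)[OF uv(3)] NN_cls(2)[OF uv(1)] NN_cls(2)[OF uv(3)]
  have eq: "a - b = cls (\<lambda>x. u x - v x)" "MM a - MM b = cls (\<lambda>x. \<mu> (u x) - \<mu> (v x))"
    "NN a - NN b = cls (\<lambda>x. \<nu> (u x) - \<nu> (v x))"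
    unfolding uv(2,4) MM_cls(1)[OF uv(1)] MM_cls(1)[OF uv(3)] NN_cls(1)[OF uv(1)] NN_cls(1)[OF uv(3)]
    by (rule cls_diff uv s)+
  note sd = sq_int_diff[OF uv(1,3)] sq_int_diff[OF s(1,2)] sq_int_diff[OF s(3,4)]
  show "(MM a - MM b) \<bullet> (MM a - MM b) \<le> (a - b) \<bullet> (MM a - MM b)"
    unfolding eq cls_inner[OF sd(2) sd(2)] cls_inner[OF sd(1) sd(2)]
  proof (rule integral_mono[OF integrable_inner[OF sd(2) sd(2)] integrable_inner[OF sd(1) sd(2)]])
    fix x show "(\<mu> (u x) - \<mu> (v x)) \<bullet> (\<mu> (u x) - \<mu> (v x)) \<le> (u x - v x) \<bullet> (\<mu> (u x) - \<mu> (v x))"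
      using mu.F_sq_le[of "u x" "v x"] by (simp add: power2_eq_square)
  qed
  show "(NN a - NN b) \<bullet> (NN a - NN b) \<le> (a - b) \<bullet> (MM a - MM b)"
    unfolding eq cls_inner[OF sd(3) sd(3)] cls_inner[OF sd(1) sd(2)]
  proof (rule integral_mono[OF integrable_inner[OF sd(3) sd(3)] integrable_inner[OF sd(1) sd(2)]])
    fix x show "(\<nu> (u x) - \<nu> (v x)) \<bullet> (\<nu> (u x) - \<nu> (v x)) \<le> (u x - v x) \<bullet> (\<mu> (u x) - \<mu> (v x))"
      using mu.N_sq_le[of "u x" "v x"] unfolding nu_eq by (simp add: power2_eq_square)
  qed
  show "norm (MM a) \<le> norm (NN a)"
    unfolding uv(2) MM_cls(1)[OF uv(1)] NN_cls(1)[OF uv(1)]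
  proof (rule norm_cls_mono[OF s(1,3)])
    show "AE x in lebesgue. norm (\<mu> (u x)) \<le> norm (\<nu> (u x))"
      using mu.F_le_N mu_0 unfolding nu_eq by (intro AE_I2) simp
  qed
qed

sublocale gal: galerkin Gr "supp_in \<Omega>" MM NN TT "cl f" "2 * R" c1
    "c2 * norm (cls (indicator \<Omega> :: real^'n \<Rightarrow> real)) + 1" lam_lo
proof (rule galerkin.intro)
  show "subspace Gr" "closed Gr" "subspace (supp_in \<Omega>)" "closed (supp_in \<Omega>)"
    using Gr_subspace supp_in_closed by auto
  show "g = 0" if "(0, g) \<in> Gr" for g using Gr_unique that .
  show "norm u \<le> 2 * R * norm g" if "(u, g) \<in> Gr" for u g using Gr_poincare that .
  show "u \<longlonglongrightarrow> v" if "\<And>n. (u n, g n) \<in> Gr" "\<And>n. norm (g n) \<le> B" "wconv u v" for u g v B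
    using Gr_rellich that by blast
  show "fst ` Gr \<subseteq> supp_in \<Omega>" using Gr_supp(1) by auto
  show "h = 0" if "h \<in> supp_in \<Omega>" "\<And>v g. (v, g) \<in> Gr \<Longrightarrow> h \<bullet> v = 0" for h
    using supp_in_zero[OF that(1)] that(2) G0_Gr by blast
  show "(MM a - MM b) \<bullet> (MM a - MM b) \<le> (a - b) \<bullet> (MM a - MM b)" for a b by (rule pointwise_l2)
  show "MM 0 = 0" using MM_cls(1)[OF sq_int_zero] by (simp add: cls_zero mu_0)
  show "(NN a - NN b) \<bullet> (NN a - NN b) \<le> (a - b) \<bullet> (MM a - MM b)" for a b by (rule pointwise_l2)
  show "norm (MM a) \<le> norm (NN a)" for a by (rule pointwise_l2)
  show "norm w \<le> c1 * norm (MM w) + (c2 * norm (cls (indicator \<Omega> :: real^'n \<Rightarrow> real)) + 1)" if "w \<in> supp_in \<Omega>" for w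
    by (rule coercive_l2[OF that])
  show "\<exists>gM gN. (MM w, gM) \<in> Gr \<and> (NN w, gN) \<in> Gr \<and>
          TT gM \<bullet> g = TT gN \<bullet> gN \<and> norm gM \<le> norm gN \<and> norm gN \<le> norm g" if "(w, g) \<in> Gr" for w g
    by (rule chain_l2[OF that])
  show "bounded_linear TT" by (rule TT_props)
  show "TT x \<bullet> y = x \<bullet> TT y" for x y by (rule TT_props)
  show "lam_lo * (norm x)\<^sup>2 \<le> TT x \<bullet> x" for x by (rule TT_props)
  show "0 < 2 * R" "0 < c1" "0 < lam_lo" using R c_pos \<Lambda>(3) by auto
  show "0 < c2 * norm (cls (indicator \<Omega> :: real^'n \<Rightarrow> real)) + 1" using c_pos by (auto intro!: add_nonneg_pos)
qed

section \<open>From classes back to functions on the domain\<close>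

lemma f_sq_int: "sq_int (zext \<Omega> f)" using f by (simp add: L2_iff)

lemma H10_dom: "u \<in> H10 \<Omega> \<Longrightarrow> cl u \<in> gal.dom" "u \<in> H10 \<Omega> \<Longrightarrow> gal.D (cl u) = cl (H1grad \<Omega> u)"
  using H10D(3) gal.domI gal.D_eq by blast+

lemma dom_H10: "sq_int (zext \<Omega> u) \<Longrightarrow> cl u \<in> gal.dom \<Longrightarrow> u \<in> H10 \<Omega>"
  using H10I gal.G_D by blast

lemma dom_rep: assumes "\<phi> \<in> gal.dom" shows "\<exists>u\<in>H10 \<Omega>. \<phi> = cl u"
proof -
  obtain u where u: "sq_int u" "\<phi> = cls u" using cls_surj by blast
  have "\<phi> \<in> supp_in \<Omega>" using assms gal.dom_K by blast
  then have "cl u = cls u" "sq_int (zext \<Omega> u)" using zext_cls_supp[OF u(1)] u(2) by auto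
  then show ?thesis using dom_H10[of u] assms u(2) by (intro bexI[of _ u]) auto
qed

lemma rho_cl:
  assumes w: "sq_int (zext \<Omega> w)"
  shows "cl (\<lambda>x. \<rho> (w x)) = cl w - MM (cl w)" "sq_int (zext \<Omega> (\<lambda>x. \<rho> (w x)))"
proof -
  show "cl (\<lambda>x. \<rho> (w x)) = cl w - MM (cl w)"
    unfolding rho_of_def MM_cl(1)[OF w] by (rule cl_diff[OF w MM_cl(2)[OF w]])
  show "sq_int (zext \<Omega> (\<lambda>x. \<rho> (w x)))"
    unfolding rho_of_def zext_diff by (rule sq_int_diff[OF w MM_cl(2)[OF w]])
qed

text \<open>Zero extension of the gradients hides the values of \<open>diffusion\<close> outside
  \<Omega>, so integrals over the domain become pairings of classes.\<close>

lemma form_eq: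
  assumes w: "sq_int (zext \<Omega> w)" and m: "(\<lambda>x. \<mu> (w x)) \<in> H10 \<Omega>" and v: "v \<in> H10 \<Omega>"
  shows "(LINT x|lebesgue_on \<Omega>. \<rho> (w x) * v x)
      + (LINT x|lebesgue_on \<Omega>. (\<Lambda> x *v H1grad \<Omega> (\<lambda>y. \<mu> (w y)) x) \<bullet> H1grad \<Omega> v x)
     = (cl w - MM (cl w)) \<bullet> cl v + TT (gal.D (MM (cl w))) \<bullet> gal.D (cl v)"
proof -
  note r = rho_cl[OF w]
  have D: "gal.D (MM (cl w)) = cl (H1grad \<Omega> (\<lambda>y. \<mu> (w y)))" unfolding MM_cl(1)[OF w] by (rule H10_dom(2)[OF m])
  have "(LINT x|lebesgue_on \<Omega>. (\<Lambda> x *v H1grad \<Omega> (\<lambda>y. \<mu> (w y)) x) \<bullet> H1grad \<Omega> v x)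
      = TT (cl (H1grad \<Omega> (\<lambda>y. \<mu> (w y)))) \<bullet> cl (H1grad \<Omega> v)"
    unfolding LINT_on TT_cls[OF H10D(2)[OF m]] cls_inner[OF diffusion_sq_int[OF H10D(2)[OF m]] H10D(2)[OF v]]
    by (rule Bochner_Integration.integral_cong) (auto simp: zext_def indicator_def diffusion_def)
  then show ?thesis
    using LINT_on_mult[OF r(2) H10D(1)[OF v]] unfolding r(1) D H10_dom(2)[OF v] by simp
qed

lemma energy_eq:
  assumes w: "sq_int (zext \<Omega> w)" and n: "(\<lambda>x. \<nu> (w x)) \<in> H10 \<Omega>"
  shows "(LINT x|lebesgue_on \<Omega>. \<rho> (w x) * w x)
      + (LINT x|lebesgue_on \<Omega>. (\<Lambda> x *v H1grad \<Omega> (\<lambda>y. \<nu> (w y)) x) \<bullet> H1grad \<Omega> (\<lambda>y. \<nu> (w y)) x)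
     = (cl w - MM (cl w)) \<bullet> cl w + TT (gal.D (NN (cl w))) \<bullet> gal.D (NN (cl w))"
proof -
  note r = rho_cl[OF w]
  have D: "gal.D (NN (cl w)) = cl (H1grad \<Omega> (\<lambda>y. \<nu> (w y)))" unfolding NN_cl(1)[OF w] by (rule H10_dom(2)[OF n])
  have "(LINT x|lebesgue_on \<Omega>. (\<Lambda> x *v H1grad \<Omega> (\<lambda>y. \<nu> (w y)) x) \<bullet> H1grad \<Omega> (\<lambda>y. \<nu> (w y)) x)
      = TT (cl (H1grad \<Omega> (\<lambda>y. \<nu> (w y)))) \<bullet> cl (H1grad \<Omega> (\<lambda>y. \<nu> (w y)))"
    unfolding LINT_on TT_cls[OF H10D(2)[OF n]] cls_inner[OF diffusion_sq_int[OF H10D(2)[OF n]] H10D(2)[OF n]]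
    by (rule Bochner_Integration.integral_cong) (auto simp: zext_def indicator_def diffusion_def)
  then show ?thesis
    using LINT_on_mult[OF r(2) w] unfolding r(1) D by simp
qed

lemma MM_H10: assumes "w \<in> H10 \<Omega>" shows "(\<lambda>x. \<mu> (w x)) \<in> H10 \<Omega>" "(\<lambda>x. \<nu> (w x)) \<in> H10 \<Omega>"
proof -
  note w = H10D(1)[OF assms] H10_dom(1)[OF assms]
  show "(\<lambda>x. \<mu> (w x)) \<in> H10 \<Omega>" using gal.MN(1)[OF w(2)] dom_H10 MM_cl[OF w(1)] by simp
  show "(\<lambda>x. \<nu> (w x)) \<in> H10 \<Omega>" using gal.MN(2)[OF w(2)] dom_H10 NN_cl[OF w(1)] by simp
qed

text \<open>Distinct functions in \<open>B\<close> may have the same class, so linear combinations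
  stay indexed by \<open>B\<close> instead of its image.\<close>

lemma subspace_facts:
  assumes V: "fin_dim_subspace_H10 \<Omega> V"
  shows "V \<subseteq> H10 \<Omega>" "\<exists>B. finite B \<and> B \<subseteq> gal.dom \<and> cl ` V = span B"
    "V \<noteq> {}"
proof -
  obtain B where B: "finite B" "B \<subseteq> H10 \<Omega>" "V = {(\<lambda>x. \<Sum>b\<in>B. c b * b x) | c. True}"
    using V unfolding fin_dim_subspace_H10_def by blast
  have lin: "sq_int (zext \<Omega> (\<lambda>x. \<Sum>b\<in>S. c b * b x)) \<and> cl (\<lambda>x. \<Sum>b\<in>S. c b * b x) = (\<Sum>b\<in>S. c b *\<^sub>R cl b)"
    if "S \<subseteq> B" for S c
    using finite_subset[OF that B(1)] that
  proof (induction S rule: finite_induct)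
    case empty
    have "zext \<Omega> (\<lambda>x. 0::real) = (\<lambda>x. 0)" by (auto simp: zext_def)
    then show ?case by (simp add: sq_int_zero cls_zero)
  next
    case (insert b S)
    have b: "sq_int (zext \<Omega> b)" using insert.prems B(2) H10D(1) by blast
    have "zext \<Omega> (\<lambda>x. \<Sum>b\<in>insert b S. c b * b x) = (\<lambda>x. c b *\<^sub>R zext \<Omega> b x + zext \<Omega> (\<lambda>x. \<Sum>b\<in>S. c b * b x) x)"
      using insert.hyps by (auto simp: zext_def indicator_def)
    note e = this
    have IH: "sq_int (zext \<Omega> (\<lambda>x. \<Sum>b\<in>S. c b * b x))" "cl (\<lambda>x. \<Sum>b\<in>S. c b * b x) = (\<Sum>b\<in>S. c b *\<^sub>R cl b)"
      using insert by auto
    note s = sq_int_scaleR[OF b, of "c b"]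
    show ?case
      unfolding e unfolding cls_add[OF s IH(1), symmetric] cls_scaleR[OF b, symmetric] IH(2)
      by (intro conjI sq_int_add[OF s IH(1)] sum.insert[OF insert.hyps, symmetric])
  qed
  have Bd: "cl ` B \<subseteq> gal.dom" using H10_dom(1) B(2) by blast
  have im: "cl ` V = span (cl ` B)"
  proof
    show "cl ` V \<subseteq> span (cl ` B)"
    proof
      fix w assume "w \<in> cl ` V"
      then obtain c where "w = (\<Sum>b\<in>B. c b *\<^sub>R cl b)" using lin[OF order_refl] unfolding B(3) by blast
      then show "w \<in> span (cl ` B)"
        by (simp only:) (rule span_sum, rule span_scale, rule span_base, rule imageI)
    qed
    show "span (cl ` B) \<subseteq> cl ` V"
    proof
      fix w assume "w \<in> span (cl ` B)"
      moreover have "span (cl ` B) \<subseteq> range (\<lambda>c. \<Sum>b\<in>B. c b *\<^sub>R cl b)"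
      proof (rule span_minimal)
        show "cl ` B \<subseteq> range (\<lambda>c. \<Sum>b\<in>B. c b *\<^sub>R cl b)"
        proof
          fix y assume "y \<in> cl ` B"
          then obtain b0 where b0: "b0 \<in> B" "y = cl b0" by blast
          have "y = (\<Sum>b\<in>B. (if b = b0 then 1 else 0) *\<^sub>R cl b)"
            using b0 B(1) by (simp add: if_distrib[of "\<lambda>c. c *\<^sub>R _"] cong: if_cong)
          then show "y \<in> range (\<lambda>c. \<Sum>b\<in>B. c b *\<^sub>R cl b)"
            by (rule range_eqI[where x="\<lambda>b. if b = b0 then 1 else 0"])
        qed
        show "subspace (range (\<lambda>c. \<Sum>b\<in>B. c b *\<^sub>R cl b))"
          unfolding subspace_def
        proof (intro conjI ballI allI)
          show "0 \<in> range (\<lambda>c. \<Sum>b\<in>B. c b *\<^sub>R cl b)" by (rule range_eqI[of _ _ "\<lambda>_. 0"]) simp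
          fix p q assume "p \<in> range (\<lambda>c. \<Sum>b\<in>B. c b *\<^sub>R cl b)" "q \<in> range (\<lambda>c. \<Sum>b\<in>B. c b *\<^sub>R cl b)"
          then obtain c d where "p = (\<Sum>b\<in>B. c b *\<^sub>R cl b)" "q = (\<Sum>b\<in>B. d b *\<^sub>R cl b)" by blast
          then show "p + q \<in> range (\<lambda>c. \<Sum>b\<in>B. c b *\<^sub>R cl b)"
            by (intro range_eqI[of _ _ "\<lambda>b. c b + d b"]) (simp add: scaleR_left_distrib sum.distrib)
        next
          fix r p assume "p \<in> range (\<lambda>c. \<Sum>b\<in>B. c b *\<^sub>R cl b)"
          then obtain c where "p = (\<Sum>b\<in>B. c b *\<^sub>R cl b)" by blast
          then show "r *\<^sub>R p \<in> range (\<lambda>c. \<Sum>b\<in>B. c b *\<^sub>R cl b)"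
            by (intro range_eqI[of _ _ "\<lambda>b. r * c b"]) (simp add: scaleR_sum_right)
        qed
      qed
      ultimately obtain c where "w = (\<Sum>b\<in>B. c b *\<^sub>R cl b)" by blast
      then have "w = cl (\<lambda>x. \<Sum>b\<in>B. c b * b x)" using lin[OF order_refl] by simp
      then show "w \<in> cl ` V" unfolding B(3) by blast
    qed
  qed
  show "\<exists>B. finite B \<and> B \<subseteq> gal.dom \<and> cl ` V = span B"
    using B(1) Bd im by (intro exI[of _ "cl ` B"]) auto
  show "V \<subseteq> H10 \<Omega>"
  proof
    fix v assume v: "v \<in> V"
    then have "sq_int (zext \<Omega> v)" using lin[OF order_refl] unfolding B(3) by blast
    moreover have "cl v \<in> gal.dom" using v im span_minimal[OF Bd gal.subspace_dom] by blast
    ultimately show "v \<in> H10 \<Omega>" by (rule dom_H10)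
  qed
  show "V \<noteq> {}" unfolding B(3) by blast
qed

lemma exists_discrete_solution:
  assumes V: "fin_dim_subspace_H10 \<Omega> V"
  shows "\<exists>w\<in>V. \<forall>v\<in>V.
        (LINT x|lebesgue_on \<Omega>. \<rho> (w x) * v x)
        + (LINT x|lebesgue_on \<Omega>. (\<Lambda> x *v H1grad \<Omega> (\<lambda>y. \<mu> (w y)) x) \<bullet> H1grad \<Omega> v x)
        = (LINT x|lebesgue_on \<Omega>. f x * v x)"
proof -
  obtain B where B: "finite B" "B \<subseteq> gal.dom" "cl ` V = span B" using subspace_facts(2)[OF V] by blast
  note VH = subspace_facts(1)[OF V]
  obtain w where w: "w \<in> V" "\<forall>v\<in>span B. (cl w - MM (cl w)) \<bullet> v + TT (gal.D (MM (cl w))) \<bullet> gal.D v = cl f \<bullet> v"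
    using gal.exists_galerkin[OF B(1,2)] unfolding B(3)[symmetric] by blast
  show ?thesis
  proof (intro bexI[of _ w] ballI w(1))
    fix v assume v: "v \<in> V"
    have H: "w \<in> H10 \<Omega>" "v \<in> H10 \<Omega>" using w(1) v VH by auto
    have "cl v \<in> span B" unfolding B(3)[symmetric] using v by blast
    then show "(LINT x|lebesgue_on \<Omega>. \<rho> (w x) * v x)
        + (LINT x|lebesgue_on \<Omega>. (\<Lambda> x *v H1grad \<Omega> (\<lambda>y. \<mu> (w y)) x) \<bullet> H1grad \<Omega> v x)
        = (LINT x|lebesgue_on \<Omega>. f x * v x)"
      unfolding form_eq[OF H10D(1)[OF H(1)] MM_H10(1)[OF H(1)] H(2)] LINT_on_mult[OF f_sq_int H10D(1)[OF H(2)]]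
      using w(2) by blast
  qed
qed

section \<open>The convergence statements for functions\<close>

context
  fixes V :: "nat \<Rightarrow> (real^'n \<Rightarrow> real) set" and w :: "nat \<Rightarrow> real^'n \<Rightarrow> real" and wbar :: "real^'n \<Rightarrow> real"
  assumes V: "\<And>m. fin_dim_subspace_H10 \<Omega> (V m)"
        "\<And>\<phi>. \<phi> \<in> H10 \<Omega> \<Longrightarrow> (\<lambda>m. INF v\<in>V m. H1_norm \<Omega> (\<lambda>x. \<phi> x - v x)) \<longlonglongrightarrow> 0"
    and w: "\<And>m. w m \<in> V m"
    and weq: "\<And>m v. v \<in> V m \<Longrightarrow>
           (LINT x|lebesgue_on \<Omega>. \<rho> (w m x) * v x)
           + (LINT x|lebesgue_on \<Omega>. (\<Lambda> x *v H1grad \<Omega> (\<lambda>y. \<mu> (w m y)) x) \<bullet> H1grad \<Omega> v x)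
           = (LINT x|lebesgue_on \<Omega>. f x * v x)"
    and wbar: "L2 \<Omega> wbar" "(\<lambda>x. \<mu> (wbar x)) \<in> H10 \<Omega>"
    and wbeq: "\<And>v. v \<in> H10 \<Omega> \<Longrightarrow>
           (LINT x|lebesgue_on \<Omega>. \<rho> (wbar x) * v x)
           + (LINT x|lebesgue_on \<Omega>. (\<Lambda> x *v H1grad \<Omega> (\<lambda>y. \<mu> (wbar y)) x) \<bullet> H1grad \<Omega> v x)
           = (LINT x|lebesgue_on \<Omega>. f x * v x)"
begin

lemma V_H10: "V m \<subseteq> H10 \<Omega>" using subspace_facts(1)[OF V(1)] .

lemma w_H10: "w m \<in> H10 \<Omega>" using w V_H10 by blast

lemma wb_sq: "sq_int (zext \<Omega> wbar)" using wbar(1) by (simp add: L2_iff)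

lemma H1_norm_diff:
  assumes "u \<in> H10 \<Omega>" "v \<in> H10 \<Omega>"
  shows "(H1_norm \<Omega> (\<lambda>x. u x - v x))\<^sup>2 = (norm (cl u - cl v))\<^sup>2 + (norm (gal.D (cl u) - gal.D (cl v)))\<^sup>2"
proof -
  note d = H10_dom(1)[OF assms(1)] H10_dom(1)[OF assms(2)]
  note cd = cl_diff[OF H10D(1)[OF assms(1)] H10D(1)[OF assms(2)]]
  have H: "(\<lambda>x. u x - v x) \<in> H10 \<Omega>"
  proof (rule dom_H10)
    show "sq_int (zext \<Omega> (\<lambda>x. u x - v x))"
      unfolding zext_diff by (rule sq_int_diff[OF H10D(1)[OF assms(1)] H10D(1)[OF assms(2)]])
    show "cl (\<lambda>x. u x - v x) \<in> gal.dom" unfolding cd by (rule gal.D_linear(3)[OF d])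
  qed
  have "H1_inner \<Omega> (\<lambda>x. u x - v x) (\<lambda>x. u x - v x) = (norm (cl u - cl v))\<^sup>2 + (norm (gal.D (cl u) - gal.D (cl v)))\<^sup>2"
    unfolding H1_inner_cl[OF H H] H10_dom(2)[OF H, symmetric] cd gal.D_linear(4)[OF d] power2_norm_eq_inner by (rule refl)
  then show ?thesis unfolding H1_norm_def by simp
qed

text \<open>Elements within \<open>1 / Suc m\<close> of the infimum give the approximating sequence,
  since the Sobolev norm dominates the norms of the function and of its gradient.\<close>

lemma dense_V:
  assumes "\<phi> \<in> gal.dom"
  shows "\<exists>v. (\<forall>m. v m \<in> cl ` V m) \<and> v \<longlonglongrightarrow> \<phi> \<and> (\<lambda>m. gal.D (v m)) \<longlonglongrightarrow> gal.D \<phi>"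
proof -
  obtain u where u: "u \<in> H10 \<Omega>" "\<phi> = cl u" using dom_rep[OF assms] by blast
  let ?N = "\<lambda>v. H1_norm \<Omega> (\<lambda>x. u x - v x)"
  have N0: "0 \<le> ?N v" if "v \<in> H10 \<Omega>" for v
    using H1_norm_diff[OF u(1) that] unfolding H1_norm_def by (simp add: H1_inner_def add_nonneg_nonneg)
  have bdd: "bdd_below (?N ` V m)" for m
    using N0 V_H10[of m] by (auto intro!: bdd_belowI2[where m=0])
  have "\<exists>v\<in>V m. ?N v < (INF v\<in>V m. ?N v) + 1 / real (Suc m)" for m
    using cINF_less_iff[OF subspace_facts(3)[OF V(1)] bdd, of m "(INF v\<in>V m. ?N v) + 1 / real (Suc m)"] by simp
  then obtain v where v: "\<And>m. v m \<in> V m" "\<And>m. ?N (v m) < (INF v\<in>V m. ?N v) + 1 / real (Suc m)" by metis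
  have "(\<lambda>m. (INF v\<in>V m. ?N v) + 1 / real (Suc m)) \<longlonglongrightarrow> 0 + 0"
    by (intro tendsto_add V(2)[OF u(1)] LIMSEQ_Suc[OF lim_1_over_n])
  then have lim: "(\<lambda>m. (INF v\<in>V m. ?N v) + 1 / real (Suc m)) \<longlonglongrightarrow> 0" by simp
  have vH: "v m \<in> H10 \<Omega>" for m using v(1) V_H10 by blast
  have le: "norm (cl (v m) - cl u) \<le> ?N (v m)" "norm (gal.D (cl (v m)) - gal.D (cl u)) \<le> ?N (v m)" for m
  proof -
    have "norm (cl u - cl (v m)) \<le> ?N (v m)"
      by (rule power2_le_imp_le[OF _ N0[OF vH]]) (simp add: H1_norm_diff[OF u(1) vH])
    then show "norm (cl (v m) - cl u) \<le> ?N (v m)" by (subst norm_minus_commute)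
    have "norm (gal.D (cl u) - gal.D (cl (v m))) \<le> ?N (v m)"
      by (rule power2_le_imp_le[OF _ N0[OF vH]]) (simp add: H1_norm_diff[OF u(1) vH])
    then show "norm (gal.D (cl (v m)) - gal.D (cl u)) \<le> ?N (v m)" by (subst norm_minus_commute)
  qed
  show ?thesis
  proof (intro exI[of _ "\<lambda>m. cl (v m)"] conjI allI)
    show "cl (v m) \<in> cl ` V m" for m using v(1) by blast
    show "(\<lambda>m. cl (v m)) \<longlonglongrightarrow> \<phi>" unfolding u(2)
      by (rule LIM_zero_cancel, rule Lim_null_comparison[OF _ lim])
        (intro always_eventually allI order_trans[OF le(1)] less_imp_le v(2))
    show "(\<lambda>m. gal.D (cl (v m))) \<longlonglongrightarrow> gal.D \<phi>" unfolding u(2)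
      by (rule LIM_zero_cancel, rule Lim_null_comparison[OF _ lim])
        (intro always_eventually allI order_trans[OF le(2)] less_imp_le v(2))
  qed
qed

lemma galerkin_hyps:
  "cl ` V m \<subseteq> gal.dom" "cl (w m) \<in> cl ` V m"
  "z \<in> cl ` V m \<Longrightarrow> (cl (w m) - MM (cl (w m))) \<bullet> z + TT (gal.D (MM (cl (w m)))) \<bullet> gal.D z = cl f \<bullet> z"
  "cl wbar \<in> supp_in \<Omega>" "MM (cl wbar) \<in> gal.dom"
  "z \<in> gal.dom \<Longrightarrow> (cl wbar - MM (cl wbar)) \<bullet> z + TT (gal.D (MM (cl wbar))) \<bullet> gal.D z = cl f \<bullet> z"
proof -
  show "cl ` V m \<subseteq> gal.dom" using V_H10 H10_dom(1) by blast
  show "cl (w m) \<in> cl ` V m" using w by blast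
  show "cl wbar \<in> supp_in \<Omega>" by (rule cl_supp[OF wb_sq])
  show "MM (cl wbar) \<in> gal.dom" unfolding MM_cl(1)[OF wb_sq] by (rule H10_dom(1)[OF wbar(2)])
  show "(cl (w m) - MM (cl (w m))) \<bullet> z + TT (gal.D (MM (cl (w m)))) \<bullet> gal.D z = cl f \<bullet> z" if z: "z \<in> cl ` V m"
  proof -
    obtain v where v: "v \<in> V m" "z = cl v" using z by blast
    have vH: "v \<in> H10 \<Omega>" using v(1) V_H10 by blast
    show ?thesis
      using weq[OF v(1)] unfolding form_eq[OF H10D(1)[OF w_H10] MM_H10(1)[OF w_H10] vH]
        LINT_on_mult[OF f_sq_int H10D(1)[OF vH]] v(2) .
  qed
  show "(cl wbar - MM (cl wbar)) \<bullet> z + TT (gal.D (MM (cl wbar))) \<bullet> gal.D z = cl f \<bullet> z" if z: "z \<in> gal.dom"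
  proof -
    obtain v where v: "v \<in> H10 \<Omega>" "z = cl v" using dom_rep[OF z] by blast
    show ?thesis
      using wbeq[OF v(1)] unfolding form_eq[OF wb_sq wbar(2) v(1)]
        LINT_on_mult[OF f_sq_int H10D(1)[OF v(1)]] v(2) .
  qed
qed

lemma limits:
  "wconv (\<lambda>m. cl (w m)) (cl wbar)" "(\<lambda>m. MM (cl (w m))) \<longlonglongrightarrow> MM (cl wbar)"
  "(\<lambda>m. NN (cl (w m))) \<longlonglongrightarrow> NN (cl wbar)"
  "wconv (\<lambda>m. gal.D (MM (cl (w m)))) (gal.D (MM (cl wbar)))"
  "wconv (\<lambda>m. gal.D (NN (cl (w m)))) (gal.D (NN (cl wbar)))"
  by (rule gal.galerkin_limits[of "\<lambda>m. cl ` V m" "\<lambda>m. cl (w m)" "cl wbar",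
        OF galerkin_hyps(1) dense_V galerkin_hyps(2-6)], assumption+)+

lemma strong_limits:
  assumes "(cl wbar - MM (cl wbar)) \<bullet> cl wbar + TT (gal.D (NN (cl wbar))) \<bullet> gal.D (NN (cl wbar)) = cl f \<bullet> cl wbar"
  shows "(\<lambda>m. gal.D (NN (cl (w m)))) \<longlonglongrightarrow> gal.D (NN (cl wbar))" "(\<lambda>m. cl (w m)) \<longlonglongrightarrow> cl wbar"
  by (rule gal.galerkin_strong_limits[of "\<lambda>m. cl ` V m" "\<lambda>m. cl (w m)" "cl wbar",
        OF galerkin_hyps(1) dense_V galerkin_hyps(2-6) assms], assumption+)+

lemma nu_wbar_H10: "(\<lambda>x. \<nu> (wbar x)) \<in> H10 \<Omega>"
proof (rule dom_H10[OF NN_cl(2)[OF wb_sq]])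
  show "cl (\<lambda>x. \<nu> (wbar x)) \<in> gal.dom"
    unfolding NN_cl(1)[OF wb_sq, symmetric]
    by (rule gal.N_wb_dom[of "\<lambda>m. cl ` V m" "\<lambda>m. cl (w m)" "cl wbar",
          OF galerkin_hyps(1) dense_V galerkin_hyps(2-6)], assumption+)
qed

lemma w_sq: "sq_int (zext \<Omega> (w m))" by (rule H10D(1)[OF w_H10])

lemma weak_conv_H10I:
  assumes u: "\<And>m. us m \<in> H10 \<Omega>" "u \<in> H10 \<Omega>" and "(\<lambda>m. cl (us m)) \<longlonglongrightarrow> cl u"
    "wconv (\<lambda>m. gal.D (cl (us m))) (gal.D (cl u))"
  shows "weak_conv_H10 \<Omega> us u"
  unfolding weak_conv_H10_def
proof (intro conjI allI ballI u)
  fix \<phi> assume \<phi>: "\<phi> \<in> H10 \<Omega>"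
  show "(\<lambda>m. H1_inner \<Omega> (us m) \<phi>) \<longlonglongrightarrow> H1_inner \<Omega> u \<phi>"
    unfolding H1_inner_cl[OF u(1) \<phi>] H1_inner_cl[OF u(2) \<phi>] H10_dom(2)[OF u(1), symmetric] H10_dom(2)[OF u(2), symmetric]
    by (intro tendsto_add tendsto_inner assms(3) tendsto_const wconvD[OF assms(4)])
qed

lemma strong_conv_L2I:
  assumes u: "\<And>m. sq_int (zext \<Omega> (us m))" "sq_int (zext \<Omega> u)" and "(\<lambda>m. cl (us m)) \<longlonglongrightarrow> cl u"
  shows "strong_conv_L2 \<Omega> us u"
  unfolding strong_conv_L2_def L2_iff
proof (intro conjI allI u)
  have "(\<lambda>m. (norm (cl (us m) - cl u))\<^sup>2) \<longlonglongrightarrow> 0\<^sup>2"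
    by (intro tendsto_power tendsto_norm_zero LIM_zero assms(3))
  then show "(\<lambda>m. LINT x|lebesgue_on \<Omega>. (us m x - u x)\<^sup>2) \<longlonglongrightarrow> 0"
    using LINT_on_norm_diff[OF u] by simp
qed

lemma convergence:
  "weak_conv_H10 \<Omega> (\<lambda>m x. \<mu> (w m x)) (\<lambda>x. \<mu> (wbar x))"
  "strong_conv_L2 \<Omega> (\<lambda>m x. \<mu> (w m x)) (\<lambda>x. \<mu> (wbar x))"
  "weak_conv_H10 \<Omega> (\<lambda>m x. \<nu> (w m x)) (\<lambda>x. \<nu> (wbar x))"
  "strong_conv_L2 \<Omega> (\<lambda>m x. \<nu> (w m x)) (\<lambda>x. \<nu> (wbar x))"
  "weak_conv_L2 \<Omega> (\<lambda>m x. \<rho> (w m x)) (\<lambda>x. \<rho> (wbar x))"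
proof -
  note lim = limits[unfolded MM_cl(1)[OF w_sq] MM_cl(1)[OF wb_sq] NN_cl(1)[OF w_sq] NN_cl(1)[OF wb_sq]]
  show "weak_conv_H10 \<Omega> (\<lambda>m x. \<mu> (w m x)) (\<lambda>x. \<mu> (wbar x))"
    by (rule weak_conv_H10I[OF MM_H10(1)[OF w_H10] wbar(2) lim(2) lim(4)])
  show "strong_conv_L2 \<Omega> (\<lambda>m x. \<mu> (w m x)) (\<lambda>x. \<mu> (wbar x))"
    by (rule strong_conv_L2I[OF MM_cl(2)[OF w_sq] MM_cl(2)[OF wb_sq] lim(2)])
  show "weak_conv_H10 \<Omega> (\<lambda>m x. \<nu> (w m x)) (\<lambda>x. \<nu> (wbar x))"
    by (rule weak_conv_H10I[OF MM_H10(2)[OF w_H10] nu_wbar_H10 lim(3) lim(5)])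
  show "strong_conv_L2 \<Omega> (\<lambda>m x. \<nu> (w m x)) (\<lambda>x. \<nu> (wbar x))"
    by (rule strong_conv_L2I[OF NN_cl(2)[OF w_sq] NN_cl(2)[OF wb_sq] lim(3)])
  show "weak_conv_L2 \<Omega> (\<lambda>m x. \<rho> (w m x)) (\<lambda>x. \<rho> (wbar x))"
    unfolding weak_conv_L2_def L2_iff
  proof (intro conjI allI impI rho_cl(2) w_sq wb_sq)
    fix \<phi> :: "real^'n \<Rightarrow> real" assume \<phi>: "sq_int (zext \<Omega> \<phi>)"
    show "(\<lambda>m. LINT x|lebesgue_on \<Omega>. \<rho> (w m x) * \<phi> x) \<longlonglongrightarrow> (LINT x|lebesgue_on \<Omega>. \<rho> (wbar x) * \<phi> x)"
      unfolding LINT_on_mult[OF rho_cl(2)[OF w_sq] \<phi>] LINT_on_mult[OF rho_cl(2)[OF wb_sq] \<phi>]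
        rho_cl(1)[OF w_sq] rho_cl(1)[OF wb_sq] inner_diff_left
      by (intro tendsto_diff wconvD[OF limits(1)] tendsto_inner limits(2) tendsto_const)
  qed
qed

lemma strong_convergence:
  assumes energy: "(LINT x|lebesgue_on \<Omega>. \<rho> (wbar x) * wbar x)
          + (LINT x|lebesgue_on \<Omega>. (\<Lambda> x *v H1grad \<Omega> (\<lambda>y. \<nu> (wbar y)) x) \<bullet> H1grad \<Omega> (\<lambda>y. \<nu> (wbar y)) x)
          = (LINT x|lebesgue_on \<Omega>. f x * wbar x)"
  shows "strong_conv_L2vec \<Omega> (\<lambda>m. H1grad \<Omega> (\<lambda>y. \<nu> (w m y))) (H1grad \<Omega> (\<lambda>y. \<nu> (wbar y)))"
    "strong_conv_L2 \<Omega> w wbar"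
proof -
  note lim = strong_limits[OF energy[unfolded energy_eq[OF wb_sq nu_wbar_H10] LINT_on_mult[OF f_sq_int wb_sq]]]
  show "strong_conv_L2 \<Omega> w wbar" by (rule strong_conv_L2I[OF w_sq wb_sq lim(2)])
  have nw: "(\<lambda>y. \<nu> (w m y)) \<in> H10 \<Omega>" for m by (rule MM_H10(2)[OF w_H10])
  have l: "(\<lambda>m. cl (H1grad \<Omega> (\<lambda>y. \<nu> (w m y)))) \<longlonglongrightarrow> cl (H1grad \<Omega> (\<lambda>y. \<nu> (wbar y)))"
    using lim(1) unfolding NN_cl(1)[OF w_sq] NN_cl(1)[OF wb_sq] H10_dom(2)[OF nw] H10_dom(2)[OF nu_wbar_H10] .
  show "strong_conv_L2vec \<Omega> (\<lambda>m. H1grad \<Omega> (\<lambda>y. \<nu> (w m y))) (H1grad \<Omega> (\<lambda>y. \<nu> (wbar y)))"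
    unfolding strong_conv_L2vec_def L2vec_iff
  proof (intro conjI allI H10D(2) nw nu_wbar_H10)
    have "(\<lambda>m. (norm (cl (H1grad \<Omega> (\<lambda>y. \<nu> (w m y))) - cl (H1grad \<Omega> (\<lambda>y. \<nu> (wbar y)))))\<^sup>2) \<longlonglongrightarrow> 0\<^sup>2"
      by (intro tendsto_power tendsto_norm_zero LIM_zero l)
    then show "(\<lambda>m. LINT x|lebesgue_on \<Omega>. (norm (H1grad \<Omega> (\<lambda>y. \<nu> (w m y)) x - H1grad \<Omega> (\<lambda>y. \<nu> (wbar y)) x))\<^sup>2) \<longlonglongrightarrow> 0"
      using LINT_on_norm_diff[OF H10D(2)[OF nw] H10D(2)[OF nu_wbar_H10]] by simp
  qed
qed

end

end


theorem theoremB1: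
  fixes \<Omega> :: "(real^'n::finite) set"
    and \<zeta> \<beta> :: "real \<Rightarrow> real"
    and \<Lambda> :: "real^'n \<Rightarrow> real^'n^'n"
    and f :: "real^'n \<Rightarrow> real"
    and M0 M1 K0 K1 lam_lo lam_hi :: real
    and V :: "nat \<Rightarrow> (real^'n \<Rightarrow> real) set"
  assumes \<Omega>: "open \<Omega>" "bounded \<Omega>" "connected \<Omega>"
    and \<zeta>: "continuous_on UNIV \<zeta>" "mono \<zeta>" "\<zeta> 0 = 0" "M0 > 0" "M1 > 0"
        "\<forall>s. \<bar>\<zeta> s\<bar> \<ge> M0 * \<bar>s\<bar> - M1"
    and \<beta>: "continuous_on UNIV \<beta>" "mono \<beta>" "\<beta> 0 = 0" "K0 > 0" "K1 > 0"
        "\<forall>s. \<bar>\<beta> s\<bar> \<le> K0 * \<bar>s\<bar> + K1"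
    and \<beta>\<zeta>: "strict_mono (\<lambda>s. \<beta> s + \<zeta> s)"
    and \<Lambda>: "\<Lambda> \<in> borel_measurable (lebesgue_on \<Omega>)" "lam_hi \<ge> lam_lo" "lam_lo > 0"
        "AE x in lebesgue_on \<Omega>. transpose (\<Lambda> x) = \<Lambda> x \<and> eigenvalues_in (\<Lambda> x) lam_lo lam_hi"
    and f: "L2 \<Omega> f"
    and V: "\<forall>m. fin_dim_subspace_H10 \<Omega> (V m)"
        "\<forall>\<phi>\<in>H10 \<Omega>. (\<lambda>m. INF v\<in>V m. H1_norm \<Omega> (\<lambda>x. \<phi> x - v x)) \<longlonglongrightarrow> 0"
  defines "\<mu> \<equiv> mu_of \<beta> \<zeta>" and "\<rho> \<equiv> rho_of \<beta> \<zeta>" and "\<nu> \<equiv> nu_of \<beta> \<zeta>"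
  shows
    "(\<forall>m. \<exists>w\<in>V m. \<forall>v\<in>V m.
        (LINT x|lebesgue_on \<Omega>. \<rho> (w x) * v x)
        + (LINT x|lebesgue_on \<Omega>. (\<Lambda> x *v H1grad \<Omega> (\<lambda>y. \<mu> (w y)) x) \<bullet> H1grad \<Omega> v x)
        = (LINT x|lebesgue_on \<Omega>. f x * v x))
     \<and>
     (\<forall>w wbar.
        (\<forall>m. w m \<in> V m \<and> (\<forall>v\<in>V m.
           (LINT x|lebesgue_on \<Omega>. \<rho> (w m x) * v x)
           + (LINT x|lebesgue_on \<Omega>. (\<Lambda> x *v H1grad \<Omega> (\<lambda>y. \<mu> (w m y)) x) \<bullet> H1grad \<Omega> v x)
           = (LINT x|lebesgue_on \<Omega>. f x * v x)))
      \<longrightarrow> L2 \<Omega> wbar \<and> (\<lambda>x. \<mu> (wbar x)) \<in> H10 \<Omega>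
        \<and> (\<forall>v\<in>H10 \<Omega>.
           (LINT x|lebesgue_on \<Omega>. \<rho> (wbar x) * v x)
           + (LINT x|lebesgue_on \<Omega>. (\<Lambda> x *v H1grad \<Omega> (\<lambda>y. \<mu> (wbar y)) x) \<bullet> H1grad \<Omega> v x)
           = (LINT x|lebesgue_on \<Omega>. f x * v x))
      \<longrightarrow>
        weak_conv_H10 \<Omega> (\<lambda>m x. \<mu> (w m x)) (\<lambda>x. \<mu> (wbar x))
      \<and> strong_conv_L2 \<Omega> (\<lambda>m x. \<mu> (w m x)) (\<lambda>x. \<mu> (wbar x))
      \<and> weak_conv_H10 \<Omega> (\<lambda>m x. \<nu> (w m x)) (\<lambda>x. \<nu> (wbar x))
      \<and> strong_conv_L2 \<Omega> (\<lambda>m x. \<nu> (w m x)) (\<lambda>x. \<nu> (wbar x))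
      \<and> weak_conv_L2 \<Omega> (\<lambda>m x. \<rho> (w m x)) (\<lambda>x. \<rho> (wbar x))
      \<and> ((LINT x|lebesgue_on \<Omega>. \<rho> (wbar x) * wbar x)
          + (LINT x|lebesgue_on \<Omega>. (\<Lambda> x *v H1grad \<Omega> (\<lambda>y. \<nu> (wbar y)) x)
                                      \<bullet> H1grad \<Omega> (\<lambda>y. \<nu> (wbar y)) x)
          = (LINT x|lebesgue_on \<Omega>. f x * wbar x)
        \<longrightarrow> strong_conv_L2vec \<Omega> (\<lambda>m. H1grad \<Omega> (\<lambda>y. \<nu> (w m y))) (H1grad \<Omega> (\<lambda>y. \<nu> (wbar y)))
          \<and> strong_conv_L2 \<Omega> w wbar))"
proof -
  obtain r where r: "\<Omega> \<subseteq> cball 0 r" using \<Omega>(2) by (auto simp: bounded_iff subset_iff)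
  \<comment> \<open>The bound \<open>r\<close> need not be positive, whereas
    \<open>bounded_open\<close> wants a positive radius.\<close>
  define R where "R = max r 1"
  have R: "\<Omega> \<subseteq> cball 0 R" "R > 0" using r unfolding R_def by (auto simp: subset_iff)
  interpret P: degenerate_problem \<Omega> R \<zeta> \<beta> \<Lambda> f M0 M1 K0 K1 lam_lo lam_hi
    by unfold_locales (fact \<Omega>(1) R \<zeta> \<beta> \<beta>\<zeta> \<Lambda> f)+
  show ?thesis
    unfolding \<mu>_def \<rho>_def \<nu>_def
  proof (rule conjI)
    show "\<forall>m. \<exists>w\<in>V m. \<forall>v\<in>V m.
        (LINT x|lebesgue_on \<Omega>. rho_of \<beta> \<zeta> (w x) * v x)
        + (LINT x|lebesgue_on \<Omega>. (\<Lambda> x *v H1grad \<Omega> (\<lambda>y. mu_of \<beta> \<zeta> (w y)) x) \<bullet> H1grad \<Omega> v x)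
        = (LINT x|lebesgue_on \<Omega>. f x * v x)"
      using P.exists_discrete_solution V(1) by blast
  next
    show "\<forall>w wbar.
        (\<forall>m. w m \<in> V m \<and> (\<forall>v\<in>V m.
           (LINT x|lebesgue_on \<Omega>. rho_of \<beta> \<zeta> (w m x) * v x)
           + (LINT x|lebesgue_on \<Omega>. (\<Lambda> x *v H1grad \<Omega> (\<lambda>y. mu_of \<beta> \<zeta> (w m y)) x) \<bullet> H1grad \<Omega> v x)
           = (LINT x|lebesgue_on \<Omega>. f x * v x)))
      \<longrightarrow> L2 \<Omega> wbar \<and> (\<lambda>x. mu_of \<beta> \<zeta> (wbar x)) \<in> H10 \<Omega>
        \<and> (\<forall>v\<in>H10 \<Omega>.
           (LINT x|lebesgue_on \<Omega>. rho_of \<beta> \<zeta> (wbar x) * v x)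
           + (LINT x|lebesgue_on \<Omega>. (\<Lambda> x *v H1grad \<Omega> (\<lambda>y. mu_of \<beta> \<zeta> (wbar y)) x) \<bullet> H1grad \<Omega> v x)
           = (LINT x|lebesgue_on \<Omega>. f x * v x))
      \<longrightarrow>
        weak_conv_H10 \<Omega> (\<lambda>m x. mu_of \<beta> \<zeta> (w m x)) (\<lambda>x. mu_of \<beta> \<zeta> (wbar x))
      \<and> strong_conv_L2 \<Omega> (\<lambda>m x. mu_of \<beta> \<zeta> (w m x)) (\<lambda>x. mu_of \<beta> \<zeta> (wbar x))
      \<and> weak_conv_H10 \<Omega> (\<lambda>m x. nu_of \<beta> \<zeta> (w m x)) (\<lambda>x. nu_of \<beta> \<zeta> (wbar x))
      \<and> strong_conv_L2 \<Omega> (\<lambda>m x. nu_of \<beta> \<zeta> (w m x)) (\<lambda>x. nu_of \<beta> \<zeta> (wbar x))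
      \<and> weak_conv_L2 \<Omega> (\<lambda>m x. rho_of \<beta> \<zeta> (w m x)) (\<lambda>x. rho_of \<beta> \<zeta> (wbar x))
      \<and> ((LINT x|lebesgue_on \<Omega>. rho_of \<beta> \<zeta> (wbar x) * wbar x)
          + (LINT x|lebesgue_on \<Omega>. (\<Lambda> x *v H1grad \<Omega> (\<lambda>y. nu_of \<beta> \<zeta> (wbar y)) x)
                                      \<bullet> H1grad \<Omega> (\<lambda>y. nu_of \<beta> \<zeta> (wbar y)) x)
          = (LINT x|lebesgue_on \<Omega>. f x * wbar x)
        \<longrightarrow> strong_conv_L2vec \<Omega> (\<lambda>m. H1grad \<Omega> (\<lambda>y. nu_of \<beta> \<zeta> (w m y))) (H1grad \<Omega> (\<lambda>y. nu_of \<beta> \<zeta> (wbar y)))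
          \<and> strong_conv_L2 \<Omega> w wbar)"
      (is "\<forall>w wbar. ?d w \<longrightarrow> ?c wbar \<longrightarrow> ?g w wbar")
    proof (intro allI impI)
      fix w wbar
      assume d: "?d w" and c: "?c wbar"
      have dw: "w m \<in> V m" for m using d by blast
      have de: "(LINT x|lebesgue_on \<Omega>. rho_of \<beta> \<zeta> (w m x) * v x)
           + (LINT x|lebesgue_on \<Omega>. (\<Lambda> x *v H1grad \<Omega> (\<lambda>y. mu_of \<beta> \<zeta> (w m y)) x) \<bullet> H1grad \<Omega> v x)
           = (LINT x|lebesgue_on \<Omega>. f x * v x)" if "v \<in> V m" for m v
        using d that by blast
      note c1 = c[THEN conjunct1] and c2 = c[THEN conjunct2, THEN conjunct1] and c3 = c[THEN conjunct2, THEN conjunct2, THEN bspec]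
      note hyps = V(1)[rule_format] V(2)[rule_format] dw de c1 c2 c3
      show "?g w wbar"
        by (intro conjI impI; (rule P.convergence[of V w wbar, OF hyps(1)] P.strong_convergence[of V w wbar, OF hyps(1)]); (rule hyps | assumption)+)
    qed
  qed
qed

end
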